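(* Let $\Omega\subset\mathbb{R}^d$ be a domain with boundary $\Gamma=\bigcup_{j=1}^m\overline{F_j}$, where $F_1,\dots,F_m$ is a finite family of non-empty pairwise disjoint subsets of $\Gamma$ which are open in the relative topology of $\Gamma$ and such that $F_j$ is Ahlfors $s_j$-regular with $s_j\in(0,d)$. Set $\delta_{c,j}=1+(s_j-(d-1))$. Let $h_0(\varphi)=\sum_{k,l=1}^d\int_\Omega c_{kl}\,(\partial_k\varphi)(\partial_l\varphi)\,dx$ on $C_c^\infty(\Omega)$, with coefficient matrix $C=(c_{kl})$. (I) If for each $j$ there are $\delta_j\ge\delta_{c,j}$ and $b_j,r_j>0$ such that for each bounded set $A\subset F_j$ one has $0\le C(x)\le b_j\,d_\Gamma(x)^{\delta_j}I$ for almost all $x\in\Omega$ with $d_A(x)=d_\Gamma(x)<r_j$, then $h_D=h_N$. (II) Further assume that for every $j$ with $s_j\ge d-1$ there are $z_j\in F_j$ and $R_j>0$ such that $\Omega_{z_j,R_j}=\Omega\cap B(z_j;R_j)$ is $\Omega$-uniform. If $h_D=h_N$ and for each $j$ there are $\delta_j\ge0$ and $b_j,r_j>0$ such that for each bounded set $A\subset F_j$ one has $C(x)\ge b_j\,d_\Gamma(x)^{\delta_j}I$ for almost all $x\in\Omega$ with $d_A(x)=d_\Gamma(x)<r_j$, then $\delta_j\ge\delta_{c,j}$ for each $j$.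
   Context: A domain is a non-empty open connected subset of $\mathbb{R}^d$. $d(x;y)$ is Euclidean distance, $B(x;r)$ the open Euclidean ball, $d_A(x)=\inf_{z\in A}d(x;z)$. Matrix inequalities are in the sense of order of symmetric matrices. Coefficients: $c_{kl}=c_{lk}\in L_\infty(\Omega)$ are real, $C(x)=(c_{kl}(x))>0$ for almost all $x\in\Omega$, and for each compact $K\subset\Omega$ there is $c_K>0$ with $C(x)\ge c_K I$ for almost all $x\in K$. The form $h_0$ on (real) $L_2(\Omega)$ with domain $C_c^\infty(\Omega)$ is then closable; $h_D$ denotes its closure. The form $h_N$ is $h_N(\varphi)=\int_\Omega\sum_{k,l}c_{kl}(\partial_k\varphi)(\partial_l\varphi)\,dx$ with domain $D(h_N)=\{\varphi\in W^{1,2}_{\rm loc}(\Omega):\sum_{k,l}c_{kl}(\partial_k\varphi)(\partial_l\varphi)+\varphi^2\in L_1(\Omega)\}$. A set $G\subset\mathbb{R}^d$ is Ahlfors $s$-regular ($s>0$) if there is a regular Borel measure $\mu$ on $G$ such that for each $A=G\cap B(x_0;R_0)$ with $x_0\in G$, $R_0>0$, there is $c>0$ with $c^{-1}r^s\le\mu(A\cap B(x;r))\le c\,r^s$ for all $x\in A$ and $r\in(0,2R_0)$. For $z\in\Gamma$, $R>0$, $\Omega_{z,R}$ is $\Omega$-uniform if there is $\sigma\ge1$ such that for all $x,y\in\Omega_{z,R}$ there is a rectifiable curve $\gamma:[0,1]\to\Omega$ with $\gamma(0)=x$, $\gamma(1)=y$, length at most $\sigma\,d(x;y)$, and $d_\Gamma(w)\ge\sigma^{-1}\min(d(x;w),d(w;y))$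 for all $w\in\gamma([0,1])$. *)

theory Defs
  imports "HOL-Analysis.Analysis"
begin

text \<open>Order of symmetric matrices. The \<open>\<le>\<close> the library provides on \<open>real^'n^'n\<close> is
  componentwise and is not used.\<close>

definition mat_le :: "real^'n^'n \<Rightarrow> real^'n^'n \<Rightarrow> bool" where
  "mat_le A B \<longleftrightarrow> (\<forall>v. v \<bullet> (A *v v) \<le> v \<bullet> (B *v v))"

definition mat_less :: "real^'n^'n \<Rightarrow> real^'n^'n \<Rightarrow> bool" where
  "mat_less A B \<longleftrightarrow> (\<forall>v. v \<noteq> 0 \<longrightarrow> v \<bullet> (A *v v) < v \<bullet> (B *v v))"


text \<open>Elements of function spaces over \<open>\<Omega>\<close> are represented by functions on the whole space
  whose values outside \<open>\<Omega>\<close> are irrelevant; functions are not identified almost everywhere.\<close>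

definition Linfty_on :: "(real^'n) set \<Rightarrow> (real^'n \<Rightarrow> real) set" where
  "Linfty_on S = {f. f \<in> borel_measurable (lebesgue_on S) \<and>
     (\<exists>M. AE x in lebesgue_on S. \<bar>f x\<bar> \<le> M)}"

definition L2_on :: "(real^'n) set \<Rightarrow> (real^'n \<Rightarrow> real) set" where
  "L2_on S = {f. f \<in> borel_measurable (lebesgue_on S) \<and> integrable (lebesgue_on S) (\<lambda>x. (f x)\<^sup>2)}"

definition L2_loc :: "(real^'n) set \<Rightarrow> (real^'n \<Rightarrow> real) set" where
  "L2_loc \<Omega> = {f. \<forall>K. compact K \<and> K \<subseteq> \<Omega> \<longrightarrow> f \<in> L2_on K}"


definition partial_deriv :: "'n::finite \<Rightarrow> (real^'n \<Rightarrow> real) \<Rightarrow> real^'n \<Rightarrow> real" where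
  "partial_deriv k f x = frechet_derivative f (at x) (axis k 1)"

primrec C_order :: "nat \<Rightarrow> (real^'n \<Rightarrow> real) \<Rightarrow> bool" where
  "C_order 0 f \<longleftrightarrow> continuous_on UNIV f"
| "C_order (Suc p) f \<longleftrightarrow> f differentiable_on UNIV \<and> (\<forall>k. C_order p (partial_deriv k f))"

text \<open>\<open>C\<^sub>c\<^sup>\<infinity>(\<Omega>)\<close>, its elements being extended by zero to the whole space.\<close>

definition test_functions :: "(real^'n) set \<Rightarrow> (real^'n \<Rightarrow> real) set" where
  "test_functions \<Omega> = {f. (\<forall>p. C_order p f) \<and>
     compact (closure {x. f x \<noteq> 0}) \<and> closure {x. f x \<noteq> 0} \<subseteq> \<Omega>}"

text \<open>\<open>g\<close> is a weak derivative \<open>\<partial>\<^sub>k f\<close> on \<open>\<Omega>\<close>, for locally square-integrable \<open>f\<close> and \<open>g\<close>.\<close>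

definition is_weak_deriv ::
  "(real^'n) set \<Rightarrow> 'n::finite \<Rightarrow> (real^'n \<Rightarrow> real) \<Rightarrow> (real^'n \<Rightarrow> real) \<Rightarrow> bool" where
  "is_weak_deriv \<Omega> k f g \<longleftrightarrow> f \<in> L2_loc \<Omega> \<and> g \<in> L2_loc \<Omega> \<and>
     (\<forall>\<psi>\<in>test_functions \<Omega>.
        (LINT x|lebesgue_on \<Omega>. f x * partial_deriv k \<psi> x) = - (LINT x|lebesgue_on \<Omega>. g x * \<psi> x))"

definition W12_loc :: "(real^'n) set \<Rightarrow> (real^'n \<Rightarrow> real) set" where
  "W12_loc \<Omega> = {f. f \<in> L2_loc \<Omega> \<and> (\<forall>k. \<exists>g. is_weak_deriv \<Omega> k f g)}"

text \<open>Weak derivatives are unique only up to null sets; one representative is chosen.\<close>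

definition weak_deriv :: "(real^'n) set \<Rightarrow> 'n::finite \<Rightarrow> (real^'n \<Rightarrow> real) \<Rightarrow> real^'n \<Rightarrow> real" where
  "weak_deriv \<Omega> k f = (SOME g. is_weak_deriv \<Omega> k f g)"


text \<open>A quadratic form on real \<open>L\<^sub>2(\<Omega>)\<close> is a partial real-valued function, whose domain of
  definition is the domain of the form. Equality of two forms thus comprises equality of their
  domains.\<close>

type_synonym 'n quad_form = "(real^'n \<Rightarrow> real) \<rightharpoonup> real"

text \<open>\<open>\<Sum>\<^sub>k\<^sub>l c\<^sub>k\<^sub>l g\<^sub>k g\<^sub>l\<close>\<close>

definition energy_density ::
  "(real^'n \<Rightarrow> real^'n^'n) \<Rightarrow> ('n::finite \<Rightarrow> real^'n \<Rightarrow> real) \<Rightarrow> real^'n \<Rightarrow> real" where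
  "energy_density C g x = (\<Sum>k\<in>UNIV. \<Sum>l\<in>UNIV. C x $ k $ l * g k x * g l x)"

definition form_0 :: "(real^'n) set \<Rightarrow> (real^'n \<Rightarrow> real^'n^'n) \<Rightarrow> 'n::finite quad_form" where
  "form_0 \<Omega> C \<phi> =
     (if \<phi> \<in> test_functions \<Omega>
      then Some (LINT x|lebesgue_on \<Omega>. energy_density C (\<lambda>k. partial_deriv k \<phi>) x)
      else None)"

definition form_approx ::
  "(real^'n) set \<Rightarrow> 'n::finite quad_form \<Rightarrow> (nat \<Rightarrow> real^'n \<Rightarrow> real) \<Rightarrow> (real^'n \<Rightarrow> real) \<Rightarrow> bool" where
  "form_approx \<Omega> h u \<phi> \<longleftrightarrow>
     (\<forall>n. u n \<in> dom h) \<and>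
     \<phi> \<in> L2_on \<Omega> \<and> (\<lambda>n. LINT x|lebesgue_on \<Omega>. (u n x - \<phi> x)\<^sup>2) \<longlonglongrightarrow> 0 \<and>
     (\<forall>\<epsilon>>0. \<exists>N. \<forall>n\<ge>N. \<forall>p\<ge>N. the (h (\<lambda>x. u n x - u p x)) < \<epsilon>)"

text \<open>Closure of a closable form; closability is what makes the value independent of the
  approximating sequence \<open>u\<close>.\<close>

definition form_closure :: "(real^'n) set \<Rightarrow> 'n::finite quad_form \<Rightarrow> 'n quad_form" where
  "form_closure \<Omega> h \<phi> =
     (if \<exists>u. form_approx \<Omega> h u \<phi>
      then Some (THE a. \<exists>u. form_approx \<Omega> h u \<phi> \<and> (\<lambda>n. the (h (u n))) \<longlonglongrightarrow> a)
      else None)"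

definition form_D :: "(real^'n) set \<Rightarrow> (real^'n \<Rightarrow> real^'n^'n) \<Rightarrow> 'n::finite quad_form" where
  "form_D \<Omega> C = form_closure \<Omega> (form_0 \<Omega> C)"

definition form_N :: "(real^'n) set \<Rightarrow> (real^'n \<Rightarrow> real^'n^'n) \<Rightarrow> 'n::finite quad_form" where
  "form_N \<Omega> C \<phi> =
     (if \<phi> \<in> W12_loc \<Omega> \<and>
         integrable (lebesgue_on \<Omega>)
           (\<lambda>x. energy_density C (\<lambda>k. weak_deriv \<Omega> k \<phi>) x + (\<phi> x)\<^sup>2)
      then Some (LINT x|lebesgue_on \<Omega>. energy_density C (\<lambda>k. weak_deriv \<Omega> k \<phi>) x)
      else None)"


definition regular_borel_measure_on :: "(real^'n) set \<Rightarrow> (real^'n) measure \<Rightarrow> bool" where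
  "regular_borel_measure_on G \<mu> \<longleftrightarrow>
     sets \<mu> = sets (restrict_space borel G) \<and>
     (\<forall>B\<in>sets \<mu>.
        emeasure \<mu> B = (INF U\<in>{U. openin (top_of_set G) U \<and> B \<subseteq> U}. emeasure \<mu> U) \<and>
        emeasure \<mu> B = (SUP K\<in>{K. compact K \<and> K \<subseteq> B}. emeasure \<mu> K))"

definition ahlfors_regular :: "real \<Rightarrow> (real^'n) set \<Rightarrow> bool" where
  "ahlfors_regular s G \<longleftrightarrow>
     (\<exists>\<mu>. regular_borel_measure_on G \<mu> \<and>
        (\<forall>x0\<in>G. \<forall>R0>0. \<exists>c>0. \<forall>x\<in>G \<inter> ball x0 R0. \<forall>r. 0 < r \<and> r < 2 * R0 \<longrightarrow>
           ennreal (inverse c * r powr s) \<le> emeasure \<mu> ((G \<inter> ball x0 R0) \<inter> ball x r) \<and>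
           emeasure \<mu> ((G \<inter> ball x0 R0) \<inter> ball x r) \<le> ennreal (c * r powr s)))"


definition curve_length :: "(real \<Rightarrow> real^'n) \<Rightarrow> ennreal" where
  "curve_length \<gamma> =
     (SUP ts\<in>{ts. sorted ts \<and> set ts \<subseteq> {0..1}}.
        \<Sum>i<length ts - 1. ennreal (dist (\<gamma> (ts ! i)) (\<gamma> (ts ! Suc i))))"

text \<open>\<open>E\<close> is \<open>\<Omega>\<close>-uniform. The bound on the length also makes \<open>\<gamma>\<close> rectifiable.\<close>

definition uniform_in :: "(real^'n) set \<Rightarrow> (real^'n) set \<Rightarrow> bool" where
  "uniform_in \<Omega> E \<longleftrightarrow>
     (\<exists>\<sigma>\<ge>1. \<forall>x\<in>E. \<forall>y\<in>E. \<exists>\<gamma>.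
        path \<gamma> \<and> path_image \<gamma> \<subseteq> \<Omega> \<and> pathstart \<gamma> = x \<and> pathfinish \<gamma> = y \<and>
        curve_length \<gamma> \<le> ennreal (\<sigma> * dist x y) \<and>
        (\<forall>w\<in>path_image \<gamma>. infdist w (frontier \<Omega>) \<ge> inverse \<sigma> * min (dist x w) (dist w y)))"

text \<open>\<open>1 + (s - (d - 1))\<close> with \<open>d = CARD('n)\<close>\<close>

definition critical_exponent :: "'n::finite itself \<Rightarrow> real \<Rightarrow> real" where
  "critical_exponent _ s = 1 + (s - (real CARD('n) - 1))"

text \<open>The points of \<open>\<Omega>\<close> at which \<open>d\<^sub>A = d\<^sub>\<Gamma> < r\<close>, \<open>\<Gamma>\<close> being the boundary of \<open>\<Omega>\<close>. For empty
  \<open>A\<close>, where mathematically \<open>d\<^sub>A = \<infinity>\<close>, the library has \<open>infdist x {} = 0\<close>; in both readings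
  the set is empty as soon as \<open>\<Omega>\<close> is open and \<open>\<Gamma>\<close> nonempty.\<close>

definition near_part :: "(real^'n) set \<Rightarrow> (real^'n) set \<Rightarrow> real \<Rightarrow> (real^'n) set" where
  "near_part \<Omega> A r =
     {x\<in>\<Omega>. infdist x A = infdist x (frontier \<Omega>) \<and> infdist x (frontier \<Omega>) < r}"

end

theory Submission
  imports Defs
begin

text \<open>
  (I) Let \<open>\<zeta>\<^sub>i\<close> be a smooth step across the level \<open>d\<^sub>\<Gamma> = t\<^sub>i\<close>, where \<open>t\<^sub>i\<close> is proportional to \<open>2\<^sup>-\<^sup>i\<close>. Inside a
  ball, the part of the layer \<open>d\<^sub>\<Gamma> \<approx> t\<^sub>i\<close> close to \<open>F\<^sub>j\<close> has volume \<open>O(t\<^sub>i powr (d - s\<^sub>j))\<close> by Ahlfors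
  regularity, so \<open>\<delta>\<^sub>j \<ge> 1 + (s\<^sub>j - (d - 1))\<close> bounds the energy of \<open>\<zeta>\<^sub>i\<close> independently of \<open>i\<close>. As the layers are
  disjoint, the average of \<open>N\<close> of these steps has energy \<open>O(1 / N)\<close>. Multiplying by one minus this average
  approximates bounded functions of bounded support in the domain of \<open>h\<^sub>N\<close> by functions of compact support
  in \<open>\<Omega>\<close>, which can be mollified; an arctangent truncation and a radial cutoff reduce the general case to
  this one.

  (II) If \<open>h\<^sub>D = h\<^sub>N\<close>, a bump function at \<open>z \<in> F\<^sub>j\<close> is a limit of test functions \<open>u\<^sub>n\<close> with bounded energies. From
  each \<open>x \<in> F\<^sub>j\<close> near \<open>z\<close> take a chain of cubes of side comparable to \<open>R 2\<^sup>-\<^sup>k\<close> at comparable distances from \<open>x\<close>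
  and \<open>\<Gamma>\<close>. The means of \<open>u\<^sub>n\<close> over these cubes fall from a fixed positive value at scale \<open>r\<close> to \<open>0\<close>, so they
  change noticeably at some scale \<open>\<rho>\<close>, and if \<open>\<delta>\<^sub>j\<close> is too small the energy near \<open>x\<close> at this scale is at least
  \<open>c r powr (- 2 \<epsilon>) \<rho> powr s\<^sub>j\<close>. Vitali's covering lemma and Ahlfors regularity turn this into a lower bound
  \<open>c' r powr (- 2 \<epsilon>)\<close> for the total energy, which is absurd for small \<open>r\<close>. The chains are provided by
  uniformity if \<open>s\<^sub>j \<ge> d - 1\<close>; otherwise \<open>\<Gamma>\<close> is too thin near \<open>z\<close> to obstruct all translates of a segment.
\<close>

section \<open>Smooth functions\<close>

text \<open>The critical exponent is the one at which the energy of a step is independent of scale: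
  at height \<open>t\<close> the squared gradient is of order \<open>t powr -2\<close>, the
  coefficients are of order \<open>t powr \<delta>\<close> and the layer has volume of order
  \<open>t powr (d - s)\<close>, so the powers cancel if \<open>\<delta> = s - d + 2\<close>. There
  a single step cannot have small energy, which is why many scales are averaged. Below it, with
  \<open>2 * \<epsilon> = s - d + 2 - \<delta>\<close>, a drop of the means at scale
  \<open>\<rho>\<close> by a multiple of \<open>(\<rho> / r) powr \<epsilon>\<close> costs at least
  a multiple of \<open>\<rho> powr (\<delta> + d - 2) * (\<rho> / r) powr (2 * \<epsilon>) = \<rho>
  powr s * r powr (- 2 * \<epsilon>)\<close>. The power of \<open>\<rho>\<close> is the one that
  Ahlfors regularity can sum, and drops of this size are forced because a geometric series
  converges. The analytic obstacle is the degeneracy at the boundary: energy controls gradients in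
  L2 only on compact subsets of \<open>\<Omega>\<close>. Limits of gradients are therefore taken
  almost everywhere and locally, with Fatou's lemma in place of completeness of a global L2
  space.\<close>

abbreviation grad :: "(real^'n \<Rightarrow> real) \<Rightarrow> 'n::finite \<Rightarrow> real^'n \<Rightarrow> real" where
  "grad f \<equiv> \<lambda>k. partial_deriv k f"

definition smooth_fn :: "(real^'n \<Rightarrow> real) \<Rightarrow> bool" where
  "smooth_fn f \<longleftrightarrow> (\<forall>p. C_order p f)"

lemma C_order_SucD: "C_order (Suc p) f \<Longrightarrow> C_order p f"
proof (induction p arbitrary: f)
  case 0
  then show ?case by (simp add: differentiable_imp_continuous_on)
next
  case (Suc p)
  then show ?case by (metis C_order.simps(2))
qed

lemma smooth_fn_C_order: "smooth_fn f \<Longrightarrow> C_order p f"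
  by (simp add: smooth_fn_def)

lemma smooth_fn_partial: "smooth_fn f \<Longrightarrow> smooth_fn (partial_deriv k f)"
  unfolding smooth_fn_def by (metis C_order.simps(2))

lemma C_order_1_iff:
  "C_order 1 f \<longleftrightarrow> (\<forall>x. f differentiable (at x)) \<and> (\<forall>k. continuous_on UNIV (partial_deriv k f))"
  by (auto simp: differentiable_on_def One_nat_def)

lemma C_order_1_differentiable: "C_order 1 f \<Longrightarrow> f differentiable (at x)"
  by (simp add: C_order_1_iff del: One_nat_def)

lemma C_order_1_continuous: "C_order 1 f \<Longrightarrow> continuous_on UNIV f"
  using C_order_SucD[of 0 f] by simp

lemma C_order_1_continuous_partial: "C_order 1 f \<Longrightarrow> continuous_on UNIV (partial_deriv k f)"
  by (simp add: C_order_1_iff del: One_nat_def)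

lemma partial_deriv_eqI:
  "(f has_derivative f') (at x) \<Longrightarrow> partial_deriv k f x = f' (axis k 1)"
  unfolding partial_deriv_def by (metis frechet_derivative_at)

lemma has_derivative_partial:
  fixes f :: "real^'n \<Rightarrow> real"
  assumes "f differentiable (at x)"
  shows "(f has_derivative (\<lambda>h. \<Sum>k\<in>UNIV. h$k * partial_deriv k f x)) (at x)"
proof -
  let ?D = "frechet_derivative f (at x)"
  have D: "(f has_derivative ?D) (at x)"
    using assms frechet_derivative_works by blast
  have "?D h = (\<Sum>k\<in>UNIV. h$k * partial_deriv k f x)" for h
  proof -
    have "?D h = ?D (\<Sum>k\<in>UNIV. h$k *\<^sub>R axis k 1)"
      by (simp add: basis_expansion scalar_mult_eq_scaleR[symmetric])
    also have "\<dots> = (\<Sum>k\<in>UNIV. h$k * ?D (axis k 1))"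
      using has_derivative_linear[OF D] by (simp add: linear_sum linear_cmul)
    finally show ?thesis by (simp add: partial_deriv_def)
  qed
  then have "?D = (\<lambda>h. \<Sum>k\<in>UNIV. h$k * partial_deriv k f x)" by blast
  then show ?thesis using D by simp
qed

lemma partial_deriv_const [simp]: "partial_deriv k (\<lambda>x. c) x = 0"
  by (rule partial_deriv_eqI) (rule has_derivative_const)

lemma partial_deriv_add:
  assumes "f differentiable (at x)" "g differentiable (at x)"
  shows "partial_deriv k (\<lambda>x. f x + g x) x = partial_deriv k f x + partial_deriv k g x"
  by (rule partial_deriv_eqI[OF has_derivative_add[OF
      assms(1)[unfolded frechet_derivative_works] assms(2)[unfolded frechet_derivative_works]],
      unfolded partial_deriv_def[symmetric]])

lemma partial_deriv_diff:
  assumes "f differentiable (at x)" "g differentiable (at x)"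
  shows "partial_deriv k (\<lambda>x. f x - g x) x = partial_deriv k f x - partial_deriv k g x"
  by (rule partial_deriv_eqI[OF has_derivative_diff[OF
      assms(1)[unfolded frechet_derivative_works] assms(2)[unfolded frechet_derivative_works]],
      unfolded partial_deriv_def[symmetric]])

lemma partial_deriv_mult:
  assumes "f differentiable (at x)" "g differentiable (at x)"
  shows "partial_deriv k (\<lambda>x. f x * g x) x = f x * partial_deriv k g x + partial_deriv k f x * g x"
  by (rule partial_deriv_eqI[OF has_derivative_mult[OF
      assms(1)[unfolded frechet_derivative_works] assms(2)[unfolded frechet_derivative_works]],
      unfolded partial_deriv_def[symmetric]])

lemma partial_deriv_affine:
  fixes f :: "real^'n \<Rightarrow> real"
  assumes "f differentiable (at (a + c *\<^sub>R x))"
  shows "partial_deriv k (\<lambda>x. f (a + c *\<^sub>R x)) x = c * partial_deriv k f (a + c *\<^sub>R x)"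
proof -
  let ?D = "frechet_derivative f (at (a + c *\<^sub>R x))"
  have D: "(f has_derivative ?D) (at (a + c *\<^sub>R x))"
    using assms frechet_derivative_works by blast
  have 1: "((\<lambda>x. a + c *\<^sub>R x) has_derivative (\<lambda>h. c *\<^sub>R h)) (at x)"
    by (auto intro!: derivative_eq_intros)
  have "partial_deriv k (\<lambda>x. f (a + c *\<^sub>R x)) x = ?D (c *\<^sub>R axis k 1)"
    using partial_deriv_eqI[OF has_derivative_compose[OF 1 D]] .
  also have "\<dots> = c * ?D (axis k 1)"
    using has_derivative_linear[OF D] by (simp add: linear_cmul)
  finally show ?thesis by (simp add: partial_deriv_def)
qed

lemma C_order_const: "C_order p (\<lambda>x. c)"
proof (induction p arbitrary: c)
  case (Suc p)
  have "partial_deriv k (\<lambda>x. c) = (\<lambda>x. 0)" for k :: 'a by auto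
  with Suc show ?case by simp
qed simp

lemma C_order_add: "C_order p f \<Longrightarrow> C_order p g \<Longrightarrow> C_order p (\<lambda>x. f x + g x)"
proof (induction p arbitrary: f g)
  case (Suc p)
  have d: "f differentiable (at x)" "g differentiable (at x)" for x
    using Suc.prems by (auto simp: differentiable_on_def)
  have "partial_deriv k (\<lambda>x. f x + g x) = (\<lambda>x. partial_deriv k f x + partial_deriv k g x)" for k
    using d by (auto simp: partial_deriv_add)
  with Suc d show ?case by (auto simp: differentiable_on_def)
qed (auto intro: continuous_intros)

lemma C_order_mult: "C_order p f \<Longrightarrow> C_order p g \<Longrightarrow> C_order p (\<lambda>x. f x * g x)"
proof (induction p arbitrary: f g)
  case (Suc p)
  have d: "f differentiable (at x)" "g differentiable (at x)" for x
    using Suc.prems by (auto simp: differentiable_on_def)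
  have c: "C_order p f" "C_order p g"
    using Suc.prems by (auto dest: C_order_SucD simp del: C_order.simps)
  have "partial_deriv k (\<lambda>x. f x * g x) =
      (\<lambda>x. f x * partial_deriv k g x + partial_deriv k f x * g x)" for k
    using d by (auto simp: partial_deriv_mult)
  with Suc d c show ?case by (auto simp: differentiable_on_def intro!: C_order_add)
qed (auto intro: continuous_intros)

lemma C_order_affine: "C_order p f \<Longrightarrow> C_order p (\<lambda>x. f (a + c *\<^sub>R x))"
proof (induction p arbitrary: f)
  case 0
  then show ?case by (auto intro!: continuous_intros continuous_on_compose2[of UNIV f])
next
  case (Suc p)
  have d: "f differentiable (at x)" for x
    using Suc.prems by (auto simp: differentiable_on_def)
  have "partial_deriv k (\<lambda>x. f (a + c *\<^sub>R x)) = (\<lambda>x. c * partial_deriv k f (a + c *\<^sub>R x))" for k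
    using d by (auto simp: partial_deriv_affine)
  moreover have "(\<lambda>x. f (a + c *\<^sub>R x)) differentiable (at x)" for x
    by (rule differentiable_compose[of f]) (use d in \<open>auto intro!: derivative_intros\<close>)
  ultimately show ?case using Suc
    by (auto simp: differentiable_on_def intro!: C_order_mult C_order_const)
qed

lemma smooth_fn_const: "smooth_fn (\<lambda>x. c)"
  and smooth_fn_add: "smooth_fn f \<Longrightarrow> smooth_fn g \<Longrightarrow> smooth_fn (\<lambda>x. f x + g x)"
  and smooth_fn_mult: "smooth_fn f \<Longrightarrow> smooth_fn g \<Longrightarrow> smooth_fn (\<lambda>x. f x * g x)"
  and smooth_fn_affine: "smooth_fn f \<Longrightarrow> smooth_fn (\<lambda>x. f (a + c *\<^sub>R x))"
  by (auto simp: smooth_fn_def C_order_const C_order_add C_order_mult C_order_affine)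

lemma smooth_fn_diff: "smooth_fn f \<Longrightarrow> smooth_fn g \<Longrightarrow> smooth_fn (\<lambda>x. f x - g x)"
  using smooth_fn_add[of f "\<lambda>x. - 1 * g x"] smooth_fn_mult[OF smooth_fn_const[of "-1"], of g] by simp

lemma smooth_fn_sum: "(\<And>i. i \<in> I \<Longrightarrow> smooth_fn (f i)) \<Longrightarrow> smooth_fn (\<lambda>x. \<Sum>i\<in>I. f i x)"
  by (induction I rule: infinite_finite_induct) (auto intro: smooth_fn_add smooth_fn_const)

text \<open>Each order follows from the previous one for all members of \<open>S\<close> at once.
  This serves for families whose partial derivatives have again the same shape, namely coordinate
  products and convolutions.\<close>

lemma smooth_fn_coinduct:
  assumes "f \<in> S" and S: "\<And>f. f \<in> S \<Longrightarrow> f differentiable_on UNIV \<and> (\<forall>k. partial_deriv k f \<in> S)"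
  shows "smooth_fn f"
proof -
  have "\<forall>f\<in>S. C_order p f" for p
  proof (induction p)
    case 0
    then show ?case using S by (simp add: differentiable_imp_continuous_on)
  next
    case (Suc p)
    then show ?case using S by simp
  qed
  with assms(1) show ?thesis by (simp add: smooth_fn_def)
qed

text \<open>Level 0 may be trivial because smoothness means the predicate at all orders, and a
  derivative at the next order already gives continuity.\<close>

primrec D_order :: "nat \<Rightarrow> (real \<Rightarrow> real) \<Rightarrow> bool" where
  "D_order 0 f \<longleftrightarrow> True"
| "D_order (Suc p) f \<longleftrightarrow> (\<exists>f'. (\<forall>t. (f has_real_derivative f' t) (at t)) \<and> D_order p f')"

lemma D_order_SucD: "D_order (Suc p) f \<Longrightarrow> D_order p f"
  by (induction p arbitrary: f) (simp, metis D_order.simps(2))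

lemma D_order_add: "D_order p f \<Longrightarrow> D_order p g \<Longrightarrow> D_order p (\<lambda>t. f t + g t)"
proof (induction p arbitrary: f g)
  case (Suc p)
  obtain f' g' where "\<forall>t. (f has_real_derivative f' t) (at t)" "D_order p f'"
    "\<forall>t. (g has_real_derivative g' t) (at t)" "D_order p g'" using Suc.prems by auto
  then show ?case using Suc.IH
    by (auto intro!: exI[of _ "\<lambda>t. f' t + g' t"] derivative_eq_intros)
qed simp

lemma D_order_mult: "D_order p f \<Longrightarrow> D_order p g \<Longrightarrow> D_order p (\<lambda>t. f t * g t)"
proof (induction p arbitrary: f g)
  case (Suc p)
  obtain f' g' where *: "\<forall>t. (f has_real_derivative f' t) (at t)" "D_order p f'"
    "\<forall>t. (g has_real_derivative g' t) (at t)" "D_order p g'" using Suc.prems by auto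
  have "D_order p f" "D_order p g" using Suc.prems D_order_SucD by blast+
  then have "D_order p (\<lambda>t. f' t * g t + g' t * f t)"
    using * Suc.IH by (intro D_order_add) auto
  moreover have "\<forall>t. ((\<lambda>t. f t * g t) has_real_derivative f' t * g t + g' t * f t) (at t)"
    using * by (auto intro!: DERIV_mult)
  ultimately show ?case by auto
qed simp

lemma D_order_const: "D_order p (\<lambda>t. c)"
  by (induction p arbitrary: c) (auto intro!: exI[of _ "\<lambda>t. 0"])

lemma D_order_affine: "D_order p f \<Longrightarrow> D_order p (\<lambda>t. f (a + c * t))"
proof (induction p arbitrary: f)
  case (Suc p)
  obtain f' where f': "\<forall>t. (f has_real_derivative f' t) (at t)" "D_order p f'"
    using Suc.prems by auto
  have "((\<lambda>t. f (a + c * t)) has_real_derivative f' (a + c * t) * c) (at t)" for t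
    by (rule DERIV_chain'[of "\<lambda>t. a + c * t" _ _ _ f])
       (use f' in \<open>auto intro!: derivative_eq_intros\<close>)
  then show ?case using Suc.IH[OF f'(2)]
    by (auto intro!: exI[of _ "\<lambda>t. f' (a + c * t) * c"] D_order_mult D_order_const)
qed simp

text \<open>The functions \<open>exp (- 1 / t) / t ^ n\<close>, extended by zero. The parameter
  \<open>n\<close> makes the family stable under differentiation up to linear combinations, which is
  what the induction on the order needs.\<close>

definition exp_inv :: "nat \<Rightarrow> real \<Rightarrow> real" where
  "exp_inv n t = (if t > 0 then exp (- (1 / t)) / t ^ n else 0)"

text \<open>The term of index \<open>n + 2\<close> of the exponential series at \<open>1 / t\<close>
  is enough. The bound is quadratic so that the difference quotients at the origin tend to
  0.\<close>

lemma exp_inv_bound: "\<bar>exp_inv n t\<bar> \<le> fact (n + 2) * t\<^sup>2"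
proof (cases "t > 0")
  case True
  have "exp (1/t) \<ge> (1/t) ^ (n+2) / fact (n+2)"
  proof -
    have "(\<Sum>k\<in>{n+2}. inverse (fact k) * (1/t) ^ k) \<le> exp (1/t)"
      unfolding exp_def
      using sum_le_suminf[OF summable_exp[of "1/t"], of "{n+2}"] True
      by (simp add: scaleR_conv_of_real field_simps)
    then show ?thesis by (simp add: field_simps)
  qed
  then have "inverse (exp (1/t)) \<le> inverse ((1/t) ^ (n+2) / fact (n+2))"
    using True by (intro le_imp_inverse_le) auto
  also have "\<dots> = fact (n+2) * t ^ (n+2)"
    using True by (simp only: power_one_over inverse_eq_divide divide_divide_eq_right divide_divide_eq_left) simp
  finally have "exp (- (1/t)) / t ^ n \<le> fact (n+2) * t ^ (n+2) / t ^ n"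
    using True by (intro divide_right_mono) (auto simp only: exp_minus, auto)
  also have "\<dots> = fact (n+2) * t\<^sup>2"
    using True by (simp only: power_add) simp
  finally have "exp (- (1/t)) / t ^ n \<le> fact (n+2) * t\<^sup>2" .
  then show ?thesis using True by (simp add: exp_inv_def)
next
  case False
  then show ?thesis by (simp add: exp_inv_def)
qed

lemma exp_inv_deriv:
  "(exp_inv n has_real_derivative exp_inv (n+2) t - real n * exp_inv (n+1) t) (at t)"
proof -
  consider "t > 0" | "t < 0" | "t = 0" by linarith
  then show ?thesis
  proof cases
    case 1
    have "((\<lambda>t. exp (- (1 / t)) / t ^ n) has_real_derivative exp_inv (n+2) t - real n * exp_inv (n+1) t) (at t)"
      using 1 by (auto intro!: derivative_eq_intros simp: exp_inv_def field_simps power2_eq_square)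
        (cases n; simp add: field_simps)
    moreover have ev: "\<forall>\<^sub>F x in nhds t. exp (- (1 / x)) / x ^ n = exp_inv n x"
      using eventually_nhds_in_open[of "{0<..}" t] 1 by (auto simp: exp_inv_def elim!: eventually_mono)
    ultimately show ?thesis using DERIV_cong_ev[OF refl ev refl, of "exp_inv (n+2) t - real n * exp_inv (n+1) t"] by metis
  next
    case 2
    have "\<forall>\<^sub>F x in nhds t. 0 = exp_inv n x"
      using eventually_nhds_in_open[of "{..<0}" t] 2 by (auto simp: exp_inv_def elim!: eventually_mono)
    from DERIV_cong_ev[OF refl this refl, of 0, THEN iffD1, OF DERIV_const]
    have "(exp_inv n has_real_derivative 0) (at t)" .
    then show ?thesis using 2 by (simp add: exp_inv_def[of _ t])
  next
    case 3
    have "((\<lambda>h. exp_inv n h / h) \<longlongrightarrow> 0) (at 0)"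
    proof (rule Lim_null_comparison)
      have "norm (exp_inv n h / h) \<le> fact (n+2) * \<bar>h\<bar>" if "h \<noteq> 0" for h
      proof -
        have "\<bar>exp_inv n h\<bar> \<le> (fact (n+2) * \<bar>h\<bar>) * \<bar>h\<bar>"
          using exp_inv_bound[of n h] by (simp only: power2_eq_square mult.assoc abs_mult_self_eq)
        then show ?thesis using that by (simp only: norm_divide real_norm_def) (simp add: pos_divide_le_eq)
      qed
      then show "\<forall>\<^sub>F h in at 0. norm (exp_inv n h / h) \<le> fact (n+2) * \<bar>h\<bar>"
        unfolding eventually_at_filter by (intro always_eventually) auto
      show "((\<lambda>h::real. fact (n+2) * \<bar>h\<bar>) \<longlongrightarrow> 0) (at 0)"
        by (auto intro!: tendsto_eq_intros)
    qed
    then show ?thesis using 3 by (simp add: DERIV_def exp_inv_def)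
  qed
qed

lemma D_order_exp_inv: "D_order p (exp_inv n)"
proof (induction p arbitrary: n)
  case (Suc p)
  have "D_order p (\<lambda>t. exp_inv (n+2) t + (- real n) * exp_inv (n+1) t)"
    by (intro D_order_add D_order_mult D_order_const Suc)
  then show ?case using exp_inv_deriv[of n]
    by (auto intro!: exI[of _ "\<lambda>t. exp_inv (n+2) t + (- real n) * exp_inv (n+1) t"])
qed simp

text \<open>The redundant factor in \<open>1 + 1 * t\<close> gives the argument the form
  \<open>a + c * t\<close> to which \<open>D_order_affine\<close> applies.\<close>

definition bump1 :: "real \<Rightarrow> real" where
  "bump1 t = exp_inv 0 (1 + 1 * t) * exp_inv 0 (1 + (-1) * t)"

lemma D_order_bump1: "D_order p bump1"
  unfolding bump1_def[abs_def] by (intro D_order_mult D_order_affine D_order_exp_inv)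

lemma bump1_nonneg: "bump1 t \<ge> 0" and bump1_pos_iff: "bump1 t > 0 \<longleftrightarrow> \<bar>t\<bar> < 1"
  by (auto simp: bump1_def exp_inv_def zero_less_mult_iff)

lemma deriv_D_order:
  assumes "\<And>p. D_order p f"
  shows "(f has_real_derivative deriv f t) (at t)" "D_order p (deriv f)"
proof -
  have *: "\<exists>f'. (\<forall>t. (f has_real_derivative f' t) (at t)) \<and> D_order p f'" for p
    using assms[of "Suc p"] by simp
  then show "(f has_real_derivative deriv f t) (at t)"
    by (metis DERIV_imp_deriv)
  show "D_order p (deriv f)"
    using *[of p] DERIV_imp_deriv by (metis ext)
qed

lemma D_order_iter_deriv: "(\<And>p. D_order p f) \<Longrightarrow> D_order p ((deriv ^^ i) f)"
  by (induction i arbitrary: p) (auto intro: deriv_D_order)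

text \<open>Differentiating in direction \<open>i\<close> raises the entry \<open>a i\<close> of the
  multi-index by one, so the products over all multi-indices form a set closed under partial
  derivatives. The bump function is the case \<open>a = 0\<close>; the coinduction runs through all
  the others.\<close>

lemma smooth_fn_prod_coords:
  fixes a :: "'n::finite \<Rightarrow> nat"
  assumes f: "\<And>p. D_order p f"
  shows "smooth_fn (\<lambda>x::real^'n. \<Prod>k\<in>UNIV. (deriv ^^ a k) f (x$k))"
proof (rule smooth_fn_coinduct[where S = "range (\<lambda>a (x::real^'n). \<Prod>k\<in>UNIV. (deriv ^^ a k) f (x$k))"])
  fix g assume "g \<in> range (\<lambda>a (x::real^'n). \<Prod>k\<in>UNIV. (deriv ^^ a k) f (x$k))"
  then obtain a where g: "g = (\<lambda>x::real^'n. \<Prod>k\<in>UNIV. (deriv ^^ a k) f (x$k))" by auto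
  have 1: "((\<lambda>x::real^'n. (deriv ^^ a k) f (x$k)) has_derivative
        (\<lambda>h. (deriv ^^ Suc (a k)) f (x$k) * (h$k))) (at x)" for k x
  proof -
    have "((deriv ^^ a k) f has_real_derivative (deriv ^^ Suc (a k)) f (x$k)) (at (x$k))"
      using deriv_D_order(1)[OF D_order_iter_deriv[OF f]] by simp
    then have "((deriv ^^ a k) f has_derivative (*) ((deriv ^^ Suc (a k)) f (x$k))) (at (x$k))"
      by (simp add: has_field_derivative_def)
    from has_derivative_compose[OF bounded_linear.has_derivative[OF bounded_linear_vec_nth has_derivative_ident] this]
    show ?thesis .
  qed
  have 2: "(g has_derivative (\<lambda>h. \<Sum>k\<in>UNIV. ((deriv ^^ Suc (a k)) f (x$k) * (h$k)) *
      (\<Prod>j\<in>UNIV - {k}. (deriv ^^ a j) f (x$j)))) (at x)" for x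
    unfolding g by (rule has_derivative_prod) (rule 1)
  have "partial_deriv i g = (\<lambda>x. \<Prod>k\<in>UNIV. (deriv ^^ (a(i := Suc (a i))) k) f (x$k))" for i
  proof
    fix x
    have "partial_deriv i g x = (\<Sum>k\<in>UNIV. ((deriv ^^ Suc (a k)) f (x$k) * (axis i 1$k)) *
      (\<Prod>j\<in>UNIV - {k}. (deriv ^^ a j) f (x$j)))"
      by (rule partial_deriv_eqI[OF 2])
    also have "\<dots> = (\<Sum>k\<in>UNIV. if k = i then (deriv ^^ Suc (a k)) f (x$k) *
      (\<Prod>j\<in>UNIV - {k}. (deriv ^^ a j) f (x$j)) else 0)"
      by (rule sum.cong) (auto simp: axis_def)
    also have "\<dots> = (deriv ^^ Suc (a i)) f (x$i) * (\<Prod>j\<in>UNIV - {i}. (deriv ^^ a j) f (x$j))"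
      by simp
    also have "\<dots> = (\<Prod>k\<in>UNIV. (deriv ^^ (a(i := Suc (a i))) k) f (x$k))"
      by (subst prod.remove[of UNIV i]) (auto intro!: prod.cong)
    finally show "partial_deriv i g x = (\<Prod>k\<in>UNIV. (deriv ^^ (a(i := Suc (a i))) k) f (x$k))" .
  qed
  moreover have "g differentiable_on UNIV"
    using 2 by (meson differentiableI differentiable_on_def differentiable_at_withinI)
  ultimately show "g differentiable_on UNIV \<and>
      (\<forall>k. partial_deriv k g \<in> range (\<lambda>a (x::real^'n). \<Prod>k\<in>UNIV. (deriv ^^ a k) f (x$k)))"
    by auto
qed auto

lemma smooth_bump_exists:
  fixes z :: "real^'n"
  assumes "\<epsilon> > 0"
  obtains \<eta> where "smooth_fn \<eta>" "\<And>x. \<eta> x \<ge> 0" "\<eta> z > 0" "\<And>x. \<eta> x \<noteq> 0 \<Longrightarrow> dist z x < \<epsilon>"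
proof -
  let ?N = "real CARD('n)"
  \<comment> \<open>With this factor every coordinate of \<open>x - z\<close> is below
    \<open>\<epsilon> / ?N\<close> on the support, so the sum norm, and with it the Euclidean norm,
    is below \<open>\<epsilon>\<close>.\<close>
  let ?c = "?N / \<epsilon>"
  define \<eta> where "\<eta> x = (\<Prod>k\<in>UNIV. bump1 (((- ?c *\<^sub>R z) + ?c *\<^sub>R x)$k))" for x :: "real^'n"
  have "smooth_fn (\<lambda>x::real^'n. \<Prod>k\<in>UNIV. bump1 (x$k))"
    using smooth_fn_prod_coords[OF D_order_bump1, of "\<lambda>_. 0"] by simp
  from smooth_fn_affine[OF this] have "smooth_fn \<eta>" unfolding \<eta>_def .
  moreover have "\<eta> x \<ge> 0" for x by (auto simp: \<eta>_def bump1_nonneg intro: prod_nonneg)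
  moreover have "\<eta> z > 0" by (auto simp: \<eta>_def bump1_pos_iff intro!: prod_pos)
  moreover have "dist z x < \<epsilon>" if "\<eta> x \<noteq> 0" for x
  proof -
    have "\<bar>(x - z)$k\<bar> < \<epsilon> / ?N" for k
    proof -
      have "bump1 (((- ?c *\<^sub>R z) + ?c *\<^sub>R x)$k) \<noteq> 0" using that by (auto simp: \<eta>_def)
      then have "bump1 (((- ?c *\<^sub>R z) + ?c *\<^sub>R x)$k) > 0"
        using bump1_nonneg by (metis order_less_le)
      then have "\<bar>?c * (x - z)$k\<bar> < 1" by (simp add: bump1_pos_iff algebra_simps)
      then have "?c * \<bar>(x - z)$k\<bar> < 1" using assms by (simp add: abs_mult)
      then show ?thesis using assms by (simp add: field_simps)
    qed
    then have "(\<Sum>k\<in>UNIV. \<bar>(x - z)$k\<bar>) < (\<Sum>k\<in>(UNIV::'n set). \<epsilon> / ?N)"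
      by (intro sum_strict_mono) auto
    also have "\<dots> = \<epsilon>" by simp
    finally show ?thesis using norm_le_l1_cart[of "x - z"] by (simp add: dist_norm norm_minus_commute)
  qed
  ultimately show ?thesis using that by blast
qed

section \<open>Square-integrable functions\<close>

definition sq_int :: "'a measure \<Rightarrow> ('a \<Rightarrow> real) \<Rightarrow> bool" where
  "sq_int M f \<longleftrightarrow> f \<in> borel_measurable M \<and> integrable M (\<lambda>x. (f x)\<^sup>2)"

lemma L2_on_iff: "f \<in> L2_on S \<longleftrightarrow> sq_int (lebesgue_on S) f"
  by (simp add: L2_on_def sq_int_def)

lemma sq_int_measurable [measurable_dest]: "sq_int M f \<Longrightarrow> f \<in> borel_measurable M"
  by (simp add: sq_int_def)

lemma sq_int_integrable: "sq_int M f \<Longrightarrow> integrable M (\<lambda>x. (f x)\<^sup>2)"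
  by (simp add: sq_int_def)

lemma sq_int_bound:
  assumes "sq_int M g" "f \<in> borel_measurable M" "AE x in M. \<bar>f x\<bar> \<le> B * \<bar>g x\<bar>"
  shows "sq_int M f"
proof -
  have "integrable M (\<lambda>x. B\<^sup>2 * (g x)\<^sup>2)" using assms(1) by (simp add: sq_int_def)
  moreover have "AE x in M. norm ((f x)\<^sup>2) \<le> norm (B\<^sup>2 * (g x)\<^sup>2)"
    using assms(3)
  proof eventually_elim
    case (elim x)
    then have "\<bar>f x\<bar>\<^sup>2 \<le> (B * \<bar>g x\<bar>)\<^sup>2" by (intro power_mono) auto
    then show ?case by (simp add: power_mult_distrib)
  qed
  moreover have "(\<lambda>x. (f x)\<^sup>2) \<in> borel_measurable M" using assms(2) by measurable
  ultimately have "integrable M (\<lambda>x. (f x)\<^sup>2)"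
    using Bochner_Integration.integrable_bound by blast
  then show ?thesis using assms(2) by (simp add: sq_int_def)
qed

lemma sq_int_mult_integrable:
  assumes f: "sq_int M f" and g: "sq_int M g"
  shows "integrable M (\<lambda>x. f x * g x)"
proof (rule Bochner_Integration.integrable_bound)
  show "integrable M (\<lambda>x. (f x)\<^sup>2 + (g x)\<^sup>2)" using assms by (simp add: sq_int_def)
  show "AE x in M. norm (f x * g x) \<le> norm ((f x)\<^sup>2 + (g x)\<^sup>2)"
  proof (intro AE_I2)
    fix x
    have "2 * (\<bar>f x\<bar> * \<bar>g x\<bar>) \<le> (f x)\<^sup>2 + (g x)\<^sup>2"
      using sum_squares_bound[of "\<bar>f x\<bar>" "\<bar>g x\<bar>"] by (simp add: mult.assoc)
    moreover have "0 \<le> \<bar>f x\<bar> * \<bar>g x\<bar>" by simp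
    ultimately have "\<bar>f x\<bar> * \<bar>g x\<bar> \<le> (f x)\<^sup>2 + (g x)\<^sup>2" by linarith
    then show "norm (f x * g x) \<le> norm ((f x)\<^sup>2 + (g x)\<^sup>2)" by (simp add: abs_mult)
  qed
  show "(\<lambda>x. f x * g x) \<in> borel_measurable M" using assms by measurable
qed

lemma sq_int_add:
  assumes f: "sq_int M f" and g: "sq_int M g"
  shows "sq_int M (\<lambda>x. f x + g x)"
proof -
  have "integrable M (\<lambda>x. (f x)\<^sup>2 + 2 * (f x * g x) + (g x)\<^sup>2)"
    using sq_int_mult_integrable[OF f g] assms by (auto simp: sq_int_def)
  then have "integrable M (\<lambda>x. (f x + g x)\<^sup>2)" by (simp add: power2_sum algebra_simps)
  then show ?thesis using assms unfolding sq_int_def by (auto intro: borel_measurable_add)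
qed

lemma sq_int_bounded_mult:
  assumes "sq_int M g" "h \<in> borel_measurable M" "AE x in M. \<bar>h x\<bar> \<le> B"
  shows "sq_int M (\<lambda>x. h x * g x)"
proof (rule sq_int_bound[OF assms(1)])
  show "AE x in M. \<bar>h x * g x\<bar> \<le> B * \<bar>g x\<bar>"
    using assms(3) by eventually_elim (auto simp: abs_mult intro: mult_right_mono)
qed (use assms in measurable)

lemma sq_int_cmult: "sq_int M f \<Longrightarrow> sq_int M (\<lambda>x. c * f x)"
  by (rule sq_int_bounded_mult[where B="\<bar>c\<bar>"]) auto

lemma sq_int_diff:
  assumes "sq_int M f" "sq_int M g" shows "sq_int M (\<lambda>x. f x - g x)"
  using sq_int_add[OF assms(1) sq_int_cmult[OF assms(2), of "-1"]] by simp

lemma sq_int_zero [simp]: "sq_int M (\<lambda>x. 0)" by (simp add: sq_int_def)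

text \<open>The integral of \<open>(t * f x + u * g x)\<^sup>2\<close> is a nonnegative quadratic
  form in \<open>t\<close> and \<open>u\<close>; unless \<open>?C = 0\<close>, the inequality is
  read off at \<open>t = ?C\<close>, \<open>u = - ?B\<close>.\<close>

lemma Cauchy_Schwarz_integral:
  assumes f: "sq_int M f" and g: "sq_int M g"
  shows "(\<integral>x. f x * g x \<partial>M)\<^sup>2 \<le> (\<integral>x. (f x)\<^sup>2 \<partial>M) * (\<integral>x. (g x)\<^sup>2 \<partial>M)"
proof -
  let ?A = "\<integral>x. (f x)\<^sup>2 \<partial>M" and ?B = "\<integral>x. f x * g x \<partial>M" and ?C = "\<integral>x. (g x)\<^sup>2 \<partial>M"
  note i = sq_int_mult_integrable[OF f g] sq_int_integrable[OF f] sq_int_integrable[OF g]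
  have q: "0 \<le> ?A * t\<^sup>2 + 2 * ?B * t * u + ?C * u\<^sup>2" for t u
  proof -
    have "0 \<le> (\<integral>x. (t * f x + u * g x)\<^sup>2 \<partial>M)" by (rule integral_nonneg_AE) auto
    also have "(\<lambda>x. (t * f x + u * g x)\<^sup>2) = (\<lambda>x. t\<^sup>2 * (f x)\<^sup>2 + (2 * t * u * (f x * g x) + u\<^sup>2 * (g x)\<^sup>2))"
      by (auto simp: power2_sum power_mult_distrib algebra_simps)
    also have "(\<integral>x. t\<^sup>2 * (f x)\<^sup>2 + (2 * t * u * (f x * g x) + u\<^sup>2 * (g x)\<^sup>2) \<partial>M)
       = t\<^sup>2 * ?A + (2 * t * u * ?B + u\<^sup>2 * ?C)"
      using i by simp
    finally show ?thesis by (simp add: algebra_simps)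
  qed
  have A: "0 \<le> ?A" and C: "0 \<le> ?C" by (auto intro: integral_nonneg_AE)
  show ?thesis
  proof (cases "?C = 0")
    case True
    have "?B = 0"
    proof (rule ccontr)
      assume B: "?B \<noteq> 0"
      \<comment> \<open>At this point the quadratic form takes the value \<open>- 1\<close>.\<close>
      have "0 \<le> ?A * 1\<^sup>2 + 2 * ?B * 1 * (- (?A + 1) / (2 * ?B)) + ?C * (- (?A + 1) / (2 * ?B))\<^sup>2" by (rule q)
      then show False using True B by (simp add: field_simps)
    qed
    then show ?thesis using True by simp
  next
    case False
    with C have C': "?C > 0" by linarith
    have "0 \<le> ?A * ?C\<^sup>2 + 2 * ?B * ?C * (- ?B) + ?C * (- ?B)\<^sup>2" by (rule q)
    then have "0 \<le> ?C * (?A * ?C - ?B\<^sup>2)" by (simp add: power2_eq_square algebra_simps)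
    then show ?thesis using C' by (simp add: zero_le_mult_iff)
  qed
qed

lemma integral_sq_add_le:
  assumes f: "sq_int M f" and g: "sq_int M g"
  shows "(\<integral>x. (f x + g x)\<^sup>2 \<partial>M) \<le> 2 * (\<integral>x. (f x)\<^sup>2 \<partial>M) + 2 * (\<integral>x. (g x)\<^sup>2 \<partial>M)"
proof -
  have "(\<integral>x. (f x + g x)\<^sup>2 \<partial>M) \<le> (\<integral>x. 2 * (f x)\<^sup>2 + 2 * (g x)\<^sup>2 \<partial>M)"
  proof (rule integral_mono)
    show "integrable M (\<lambda>x. (f x + g x)\<^sup>2)" using sq_int_add[OF f g] by (simp add: sq_int_def)
    show "integrable M (\<lambda>x. 2 * (f x)\<^sup>2 + 2 * (g x)\<^sup>2)" using assms by (simp add: sq_int_def)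
    show "(f x + g x)\<^sup>2 \<le> 2 * (f x)\<^sup>2 + 2 * (g x)\<^sup>2" for x
      using sum_squares_bound[of "f x" "g x"] by (simp add: power2_sum)
  qed
  then show ?thesis using assms by (simp add: sq_int_def)
qed

text \<open>Square-integrability belongs to the notion: the integral of a function that is not
  integrable is 0 by convention, so the last clause alone would not express convergence.\<close>

definition L2_lim :: "'a measure \<Rightarrow> (nat \<Rightarrow> 'a \<Rightarrow> real) \<Rightarrow> ('a \<Rightarrow> real) \<Rightarrow> bool" where
  "L2_lim M u f \<longleftrightarrow> (\<forall>n. sq_int M (u n)) \<and> sq_int M f \<and> (\<lambda>n. \<integral>x. (u n x - f x)\<^sup>2 \<partial>M) \<longlonglongrightarrow> 0"

lemma L2_lim_bound:
  assumes "\<And>n. sq_int M (u n)" "sq_int M f"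
    and b: "\<And>n. (\<integral>x. (u n x - f x)\<^sup>2 \<partial>M) \<le> b n" and "b \<longlonglongrightarrow> 0"
  shows "L2_lim M u f"
  unfolding L2_lim_def using assms
  by (auto intro!: tendsto_sandwich[OF _ _ tendsto_const \<open>b \<longlonglongrightarrow> 0\<close>] always_eventually integral_nonneg_AE)

lemma L2_lim_add:
  assumes "L2_lim M u f" "L2_lim M v g"
  shows "L2_lim M (\<lambda>n x. u n x + v n x) (\<lambda>x. f x + g x)"
proof (rule L2_lim_bound)
  fix n
  have "(\<integral>x. (u n x + v n x - (f x + g x))\<^sup>2 \<partial>M) = (\<integral>x. ((u n x - f x) + (v n x - g x))\<^sup>2 \<partial>M)"
    by (simp add: algebra_simps)
  also have "\<dots> \<le> 2 * (\<integral>x. (u n x - f x)\<^sup>2 \<partial>M) + 2 * (\<integral>x. (v n x - g x)\<^sup>2 \<partial>M)"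
    using assms by (intro integral_sq_add_le sq_int_diff) (auto simp: L2_lim_def)
  finally show "(\<integral>x. (u n x + v n x - (f x + g x))\<^sup>2 \<partial>M)
     \<le> 2 * (\<integral>x. (u n x - f x)\<^sup>2 \<partial>M) + 2 * (\<integral>x. (v n x - g x)\<^sup>2 \<partial>M)" .
next
  show "(\<lambda>n. 2 * (\<integral>x. (u n x - f x)\<^sup>2 \<partial>M) + 2 * (\<integral>x. (v n x - g x)\<^sup>2 \<partial>M)) \<longlonglongrightarrow> 0"
    using assms by (auto simp: L2_lim_def intro!: tendsto_eq_intros)
qed (use assms in \<open>auto simp: L2_lim_def intro: sq_int_add\<close>)

lemma L2_lim_bounded_mult:
  assumes u: "L2_lim M u f" and h: "h \<in> borel_measurable M" "AE x in M. \<bar>h x\<bar> \<le> B"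
  shows "L2_lim M (\<lambda>n x. h x * u n x) (\<lambda>x. h x * f x)"
proof (rule L2_lim_bound)
  have s: "sq_int M (\<lambda>x. u n x - f x)" for n using u by (auto simp: L2_lim_def intro: sq_int_diff)
  show "(\<integral>x. (h x * u n x - h x * f x)\<^sup>2 \<partial>M) \<le> B\<^sup>2 * (\<integral>x. (u n x - f x)\<^sup>2 \<partial>M)" for n
  proof -
    have "(\<integral>x. (h x * (u n x - f x))\<^sup>2 \<partial>M) \<le> (\<integral>x. B\<^sup>2 * (u n x - f x)\<^sup>2 \<partial>M)"
    proof (rule integral_mono_AE)
      show "integrable M (\<lambda>x. (h x * (u n x - f x))\<^sup>2)"
        using sq_int_bounded_mult[OF s h] by (simp add: sq_int_def)
      show "AE x in M. (h x * (u n x - f x))\<^sup>2 \<le> B\<^sup>2 * (u n x - f x)\<^sup>2"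
        using h(2)
      proof eventually_elim
        case (elim x)
        then have "\<bar>h x\<bar>\<^sup>2 \<le> B\<^sup>2" by (intro power_mono) auto
        then show ?case by (simp add: power_mult_distrib mult_right_mono)
      qed
    qed (use s in \<open>auto simp: sq_int_def\<close>)
    then show ?thesis by (simp add: right_diff_distrib)
  qed
  show "(\<lambda>n. B\<^sup>2 * (\<integral>x. (u n x - f x)\<^sup>2 \<partial>M)) \<longlonglongrightarrow> 0"
    using u by (auto simp: L2_lim_def intro!: tendsto_eq_intros)
qed (use assms in \<open>auto simp: L2_lim_def intro: sq_int_bounded_mult\<close>)

lemma L2_lim_inner:
  assumes u: "L2_lim M u f" and g: "sq_int M g"
  shows "(\<lambda>n. \<integral>x. u n x * g x \<partial>M) \<longlonglongrightarrow> (\<integral>x. f x * g x \<partial>M)"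
proof -
  have s: "sq_int M (u n)" "sq_int M f" "sq_int M (\<lambda>x. u n x - f x)" for n
    using u by (auto simp: L2_lim_def intro: sq_int_diff)
  let ?G = "\<integral>x. (g x)\<^sup>2 \<partial>M"
  have *: "norm ((\<integral>x. u n x * g x \<partial>M) - (\<integral>x. f x * g x \<partial>M)) \<le> sqrt ((\<integral>x. (u n x - f x)\<^sup>2 \<partial>M) * ?G)" for n
  proof -
    have "(\<integral>x. u n x * g x \<partial>M) - (\<integral>x. f x * g x \<partial>M) = (\<integral>x. (u n x - f x) * g x \<partial>M)"
      using sq_int_mult_integrable[OF s(1) g] sq_int_mult_integrable[OF s(2) g]
      by (simp add: left_diff_distrib)
    then show ?thesis using Cauchy_Schwarz_integral[OF s(3) g] by (simp add: real_le_rsqrt)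
  qed
  have "(\<lambda>n. (\<integral>x. u n x * g x \<partial>M) - (\<integral>x. f x * g x \<partial>M)) \<longlonglongrightarrow> 0"
  proof (rule Lim_null_comparison[OF always_eventually])
    show "\<forall>n. norm ((\<integral>x. u n x * g x \<partial>M) - (\<integral>x. f x * g x \<partial>M)) \<le> sqrt ((\<integral>x. (u n x - f x)\<^sup>2 \<partial>M) * ?G)"
      using * by blast
    have "(\<lambda>n. sqrt ((\<integral>x. (u n x - f x)\<^sup>2 \<partial>M) * ?G)) \<longlonglongrightarrow> sqrt (0 * ?G)"
      by (intro tendsto_intros) (use u in \<open>simp add: L2_lim_def\<close>)
    then show "(\<lambda>n. sqrt ((\<integral>x. (u n x - f x)\<^sup>2 \<partial>M) * ?G)) \<longlonglongrightarrow> 0" by simp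
  qed
  then show ?thesis by (simp add: LIM_zero_iff)
qed

lemma L2_lim_unique:
  assumes u: "L2_lim M u f" and v: "L2_lim M u g"
  shows "AE x in M. f x = g x"
proof -
  have s: "sq_int M (\<lambda>x. f x - g x)" using u v by (auto simp: L2_lim_def intro: sq_int_diff)
  have le: "(\<integral>x. (f x - g x)\<^sup>2 \<partial>M) \<le> 2 * (\<integral>x. (u n x - f x)\<^sup>2 \<partial>M) + 2 * (\<integral>x. (u n x - g x)\<^sup>2 \<partial>M)" for n
  proof -
    have "(\<integral>x. (f x - g x)\<^sup>2 \<partial>M) = (\<integral>x. ((f x - u n x) + (u n x - g x))\<^sup>2 \<partial>M)" by simp
    also have "\<dots> \<le> 2 * (\<integral>x. (f x - u n x)\<^sup>2 \<partial>M) + 2 * (\<integral>x. (u n x - g x)\<^sup>2 \<partial>M)"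
      using u v by (intro integral_sq_add_le sq_int_diff) (auto simp: L2_lim_def)
    finally show ?thesis by (simp add: power2_commute)
  qed
  have "(\<lambda>n. 2 * (\<integral>x. (u n x - f x)\<^sup>2 \<partial>M) + 2 * (\<integral>x. (u n x - g x)\<^sup>2 \<partial>M)) \<longlonglongrightarrow> 0"
    using u v by (auto simp: L2_lim_def intro!: tendsto_eq_intros)
  then have "(\<integral>x. (f x - g x)\<^sup>2 \<partial>M) \<le> 0"
    using le by (intro LIMSEQ_le_const) auto
  moreover have "0 \<le> (\<integral>x. (f x - g x)\<^sup>2 \<partial>M)" by (rule integral_nonneg_AE) auto
  ultimately have "(\<integral>x. (f x - g x)\<^sup>2 \<partial>M) = 0" by linarith
  then have "AE x in M. (f x - g x)\<^sup>2 = 0"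
    using s by (subst (asm) integral_nonneg_eq_0_iff_AE) (auto simp: sq_int_def)
  then show ?thesis by eventually_elim auto
qed

section \<open>Affine changes of variables and integration by parts\<close>

lemma nn_integral_lborel_affine:
  fixes f :: "'a::euclidean_space \<Rightarrow> ennreal"
  assumes [measurable]: "f \<in> borel_measurable borel" and c: "c \<noteq> 0"
  shows "(\<integral>\<^sup>+x. f x \<partial>lborel) = ennreal (\<bar>c\<bar>^DIM('a)) * (\<integral>\<^sup>+x. f (t + c *\<^sub>R x) \<partial>lborel)"
  by (subst lborel_affine[OF c, of t])
    (simp add: nn_integral_density nn_integral_distr nn_integral_cmult)

lemma integral_lborel_affine:
  fixes f :: "'a::euclidean_space \<Rightarrow> real"
  assumes f: "f \<in> borel_measurable borel" and c: "c \<noteq> 0"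
  shows "(\<integral>x. f x \<partial>lborel) = \<bar>c\<bar>^DIM('a) * (\<integral>x. f (t + c *\<^sub>R x) \<partial>lborel)"
  using f by (subst lborel_affine[OF c, of t]) (simp add: integral_density integral_distr)

lemma integral_lborel_reflect:
  fixes f :: "'a::euclidean_space \<Rightarrow> real"
  assumes f: "f \<in> borel_measurable borel"
  shows "(\<integral>y. f (x - y) \<partial>lborel) = (\<integral>y. f y \<partial>lborel)"
  using integral_lborel_affine[OF f, of "-1" x] by simp

lemma integral_lborel_translate:
  fixes f :: "'a::euclidean_space \<Rightarrow> real"
  assumes f: "f \<in> borel_measurable borel"
  shows "(\<integral>y. f (x + y) \<partial>lborel) = (\<integral>y. f y \<partial>lborel)"
  using integral_lborel_affine[OF f, of "1" x] by simp

lemma continuous_compact_support_integrable: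
  fixes f :: "'a::euclidean_space \<Rightarrow> real"
  assumes f: "continuous_on UNIV f" and R: "\<And>x. f x \<noteq> 0 \<Longrightarrow> x \<in> cbox a b"
  shows "integrable lborel f" "integral\<^sup>L lborel f = integral (cbox a b) f"
proof -
  have "integrable lborel (\<lambda>x. indicator (cbox a b) x *\<^sub>R f x)"
    by (rule borel_integrable_compact) (auto intro: continuous_on_subset[OF f])
  also have "(\<lambda>x. indicator (cbox a b) x *\<^sub>R f x) = f"
  proof
    show "indicator (cbox a b) x *\<^sub>R f x = f x" for x
      using R[of x] by (cases "f x = 0") (auto simp del: mem_box)
  qed
  finally show i: "integrable lborel f" .
  have "(\<lambda>x. if x \<in> cbox a b then f x else 0) = f"
  proof
    show "(if x \<in> cbox a b then f x else 0) = f x" for x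
      using R[of x] by (cases "f x = 0") (auto simp del: mem_box)
  qed
  then show "integral\<^sup>L lborel f = integral (cbox a b) f"
    using integral_lborel[OF i] integral_restrict_UNIV[of "cbox a b" f] by simp
qed

text \<open>By translation invariance the integral of the translate of \<open>g\<close> by
  \<open>t\<close> in direction \<open>k\<close> does not depend on \<open>t\<close>;
  differentiating it under the integral sign at \<open>t = 0\<close> gives the claim.\<close>

lemma integral_partial_deriv_zero:
  fixes g :: "real^'n \<Rightarrow> real"
  assumes g: "C_order 1 g" and supp: "bounded {x. g x \<noteq> 0}"
  shows "(\<integral>x. partial_deriv k g x \<partial>lborel) = 0"
proof -
  obtain R where R: "\<And>x. g x \<noteq> 0 \<Longrightarrow> norm x \<le> R"
    using supp by (auto simp: bounded_iff)
  \<comment> \<open>The margin 1 keeps the supports of all translates with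
    \<open>\<bar>t\<bar> \<le> 1\<close> inside one box, on which the Leibniz rule is
    applied.\<close>
  obtain a where a: "cball (0::real^'n) (R + 1) \<subseteq> cbox (-a) a"
    using bounded_subset_cbox_symmetric[OF bounded_cball] by metis
  let ?e = "axis k 1 :: real^'n"
  have cg: "continuous_on UNIV g" by (rule C_order_1_continuous[OF g])
  have bg: "g \<in> borel_measurable borel" by (rule borel_measurable_continuous_onI[OF cg])
  have in_box: "x \<in> cbox (-a) a" if "g (t *\<^sub>R ?e + x) \<noteq> 0" "\<bar>t\<bar> \<le> 1" for x t
  proof -
    have "norm (t *\<^sub>R ?e + x) \<le> R" using R that by blast
    moreover have "norm (t *\<^sub>R ?e) \<le> 1" using that by (simp add: norm_axis_1)
    ultimately have "norm x \<le> R + 1"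
      using norm_triangle_sub[of x "- (t *\<^sub>R ?e)"] by (simp add: add.commute)
    then show ?thesis using a by auto
  qed
  define G where "G t = integral (cbox (-a) a) (\<lambda>x. g (t *\<^sub>R ?e + x))" for t
  have const: "G t = integral\<^sup>L lborel g" if "t \<in> {-1..1}" for t
  proof -
    have "integral\<^sup>L lborel (\<lambda>x. g (t *\<^sub>R ?e + x)) = G t"
      unfolding G_def using that
      by (intro continuous_compact_support_integrable(2) continuous_on_compose2[OF cg])
         (auto intro!: continuous_intros in_box)
    then show ?thesis using integral_lborel_translate[OF bg, of "t *\<^sub>R ?e"] by simp
  qed
  have cp: "continuous_on UNIV (partial_deriv k g)" by (rule C_order_1_continuous_partial[OF g])
  have der: "((\<lambda>t. g (t *\<^sub>R ?e + x)) has_vector_derivative partial_deriv k g (t *\<^sub>R ?e + x)) (at t within {-1..1})" for x t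
  proof -
    have 1: "((\<lambda>t. t *\<^sub>R ?e + x) has_derivative (\<lambda>h. h *\<^sub>R ?e)) (at t within {-1..1})"
      by (auto intro!: derivative_eq_intros)
    have "((\<lambda>t. g (t *\<^sub>R ?e + x)) has_derivative
        (\<lambda>h. \<Sum>j\<in>UNIV. (h *\<^sub>R ?e) $ j * partial_deriv j g (t *\<^sub>R ?e + x))) (at t within {-1..1})"
      using has_derivative_compose[OF 1 has_derivative_partial[OF C_order_1_differentiable[OF g]]] .
    moreover have "(\<Sum>j\<in>UNIV. (h *\<^sub>R ?e) $ j * partial_deriv j g (t *\<^sub>R ?e + x)) = h *\<^sub>R partial_deriv k g (t *\<^sub>R ?e + x)" for h
    proof -
      have "(\<Sum>j\<in>UNIV. (h *\<^sub>R ?e) $ j * partial_deriv j g (t *\<^sub>R ?e + x))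
        = (\<Sum>j\<in>UNIV. if j = k then h * partial_deriv k g (t *\<^sub>R ?e + x) else 0)"
        by (rule sum.cong) (auto simp: axis_def)
      then show ?thesis by simp
    qed
    ultimately show ?thesis by (simp add: has_vector_derivative_def)
  qed
  have "(G has_vector_derivative integral (cbox (-a) a) (\<lambda>x. partial_deriv k g (0 *\<^sub>R ?e + x))) (at 0 within {-1..1})"
    unfolding G_def
  proof (rule leibniz_rule_vector_derivative)
    show "(\<lambda>x. g (t *\<^sub>R ?e + x)) integrable_on cbox (-a) a" for t
      by (intro integrable_continuous continuous_on_compose2[OF cg]) (auto intro!: continuous_intros)
    show "continuous_on ({-1..1} \<times> cbox (-a) a) (\<lambda>(t, x). partial_deriv k g (t *\<^sub>R ?e + x))"
      by (auto simp: split_beta intro!: continuous_on_compose2[OF cp] continuous_intros)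
  qed (auto intro: der)
  moreover have "(G has_vector_derivative 0) (at 0 within {-1..1})"
    by (rule has_vector_derivative_transform[of _ _ G "\<lambda>t. integral\<^sup>L lborel g"]) (auto simp: const)
  ultimately have "integral (cbox (-a) a) (partial_deriv k g) = 0"
    using vector_derivative_unique_within[of 0 "{-1..1::real}" G] islimpt_Icc
    by (simp add: trivial_limit_within)
  moreover have "x \<in> cbox (-a) a" if "partial_deriv k g x \<noteq> 0" for x
  proof (rule ccontr)
    assume "x \<notin> cbox (-a) a"
    then have n: "norm x > R + 1" using a by force
    have "(g has_derivative (\<lambda>h. 0)) (at x)"
    proof (rule has_derivative_transform_within_open)
      show "((\<lambda>x. 0) has_derivative (\<lambda>h. 0)) (at x)" by simp
      show "open {y::real^'n. norm y > R}" by (intro open_Collect_less continuous_intros)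
      show "0 = g y" if "y \<in> {y. norm y > R}" for y using R[of y] that by auto
    qed (use n in auto)
    then have "partial_deriv k g x = 0" using partial_deriv_eqI by blast
    then show False using that by simp
  qed
  ultimately show ?thesis
    using continuous_compact_support_integrable(2)[OF cp, of "-a" a] by simp
qed

lemma partial_deriv_support:
  assumes "partial_deriv k g x \<noteq> 0" shows "x \<in> closure {x. g x \<noteq> 0}"
proof (rule ccontr)
  assume x: "x \<notin> closure {x. g x \<noteq> 0}"
  have "(g has_derivative (\<lambda>h. 0)) (at x)"
  proof (rule has_derivative_transform_within_open)
    show "((\<lambda>x. 0) has_derivative (\<lambda>h. 0)) (at x)" by simp
    show "open (- closure {x. g x \<noteq> 0})" by (intro open_Compl closed_closure)
    show "0 = g y" if "y \<in> - closure {x. g x \<noteq> 0}" for y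
      using that closure_subset[of "{x. g x \<noteq> 0}"] by auto
  qed (use x in auto)
  then have "partial_deriv k g x = 0" using partial_deriv_eqI by blast
  with assms show False by simp
qed

lemma integral_by_parts:
  fixes f g :: "real^'n \<Rightarrow> real"
  assumes f: "C_order 1 f" and g: "C_order 1 g" and supp: "bounded {x. g x \<noteq> 0}"
  shows "(\<integral>x. f x * partial_deriv k g x \<partial>lborel) = - (\<integral>x. partial_deriv k f x * g x \<partial>lborel)"
proof -
  obtain a where a: "closure {x. g x \<noteq> 0} \<subseteq> cbox (-a) a"
    using bounded_subset_cbox_symmetric[OF bounded_closure[OF supp]] by metis
  note c = C_order_1_continuous[OF f] C_order_1_continuous[OF g]
    C_order_1_continuous_partial[OF f, of k] C_order_1_continuous_partial[OF g, of k]
  have sg: "x \<in> cbox (-a) a" if "g x \<noteq> 0" for x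
    using that a closure_subset[of "{x. g x \<noteq> 0}"] by blast
  have spg: "x \<in> cbox (-a) a" if "partial_deriv k g x \<noteq> 0" for x
    using partial_deriv_support[OF that] a by blast
  have 1: "integrable lborel (\<lambda>x. f x * partial_deriv k g x)"
    by (rule continuous_compact_support_integrable(1)[OF continuous_on_mult[OF c(1,4)], of "-a" a])
       (use spg mult_eq_0_iff in metis)
  have 2: "integrable lborel (\<lambda>x. partial_deriv k f x * g x)"
    by (rule continuous_compact_support_integrable(1)[OF continuous_on_mult[OF c(3,2)], of "-a" a])
       (use sg mult_eq_0_iff in metis)
  have "(\<integral>x. partial_deriv k (\<lambda>x. f x * g x) x \<partial>lborel) = 0"
    by (rule integral_partial_deriv_zero[OF C_order_mult[OF f g]])
       (rule bounded_subset[OF supp], auto)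
  also have "partial_deriv k (\<lambda>x. f x * g x) = (\<lambda>x. f x * partial_deriv k g x + partial_deriv k f x * g x)"
    using f g by (auto simp: partial_deriv_mult C_order_1_differentiable simp del: One_nat_def)
  finally show ?thesis using 1 2 by simp
qed

section \<open>Convolution\<close>

lemma lebesgue_on_integrable_iff:
  fixes f :: "'a::euclidean_space \<Rightarrow> real"
  assumes "S \<in> sets lebesgue"
  shows "integrable (lebesgue_on S) f \<longleftrightarrow> integrable lebesgue (\<lambda>x. indicator S x * f x)"
  using integrable_restrict_space[of S lebesgue f] assms by simp

lemma lebesgue_on_integral:
  fixes f :: "'a::euclidean_space \<Rightarrow> real"
  assumes "S \<in> sets lebesgue"
  shows "integral\<^sup>L (lebesgue_on S) f = (\<integral>x. indicator S x * f x \<partial>lebesgue)"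
  using integral_restrict_space[of S lebesgue f] assms by simp

lemma lebesgue_on_measurable_iff:
  fixes f :: "'a::euclidean_space \<Rightarrow> real"
  assumes "S \<in> sets lebesgue"
  shows "f \<in> borel_measurable (lebesgue_on S) \<longleftrightarrow> (\<lambda>x. indicator S x * f x) \<in> borel_measurable lebesgue"
  using borel_measurable_restrict_space_iff[of S lebesgue f] assms by simp

lemma indicator_mult_power2: "(indicator S x * f x)\<^sup>2 = indicator S x * (f x :: real)\<^sup>2"
  by (auto simp: indicator_def)

lemma sq_int_lebesgue_on_iff:
  fixes f :: "'a::euclidean_space \<Rightarrow> real"
  assumes "S \<in> sets lebesgue"
  shows "sq_int (lebesgue_on S) f \<longleftrightarrow> sq_int lebesgue (\<lambda>x. indicator S x * f x)"
  unfolding sq_int_def lebesgue_on_measurable_iff[OF assms] lebesgue_on_integrable_iff[OF assms]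
    indicator_mult_power2 ..

lemma lebesgue_on_integrable_subset:
  fixes f :: "'a::euclidean_space \<Rightarrow> real"
  assumes "integrable (lebesgue_on T) f" "S \<subseteq> T" "S \<in> sets lebesgue" "T \<in> sets lebesgue"
  shows "integrable (lebesgue_on S) f"
proof -
  have "integrable lebesgue (\<lambda>x. indicator T x * f x)"
    using assms lebesgue_on_integrable_iff by blast
  from integrable_mult_indicator[OF assms(3) this]
  have "integrable lebesgue (\<lambda>x. indicator S x * (indicator T x * f x))" by simp
  also have "(\<lambda>x. indicator S x * (indicator T x * f x)) = (\<lambda>x. indicator S x * f x)"
    using assms(2) by (auto simp: indicator_def fun_eq_iff)
  finally show ?thesis using lebesgue_on_integrable_iff assms by blast
qed

lemma lebesgue_on_integral_mono_set:
  fixes f :: "'a::euclidean_space \<Rightarrow> real"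
  assumes "integrable (lebesgue_on T) f" "S \<subseteq> T" "S \<in> sets lebesgue" "T \<in> sets lebesgue"
    and nn: "AE x in lebesgue_on T. 0 \<le> f x"
  shows "integral\<^sup>L (lebesgue_on S) f \<le> integral\<^sup>L (lebesgue_on T) f"
  unfolding lebesgue_on_integral[OF assms(3)] lebesgue_on_integral[OF assms(4)]
proof (rule integral_mono_AE)
  show "integrable lebesgue (\<lambda>x. indicator S x * f x)"
    using lebesgue_on_integrable_subset[OF assms(1-4)] lebesgue_on_integrable_iff assms by blast
  show "integrable lebesgue (\<lambda>x. indicator T x * f x)"
    using lebesgue_on_integrable_iff assms by blast
  have "AE x in lebesgue. x \<in> T \<longrightarrow> 0 \<le> f x"
    using nn assms(4) by (simp add: AE_restrict_space_iff)
  then show "AE x in lebesgue. indicator S x * f x \<le> indicator T x * f x"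
    by eventually_elim (use assms(2) in \<open>auto simp: indicator_def\<close>)
qed

lemma sq_int_lebesgue_on_subset:
  fixes f :: "'a::euclidean_space \<Rightarrow> real"
  assumes "sq_int (lebesgue_on T) f" "S \<subseteq> T" "S \<in> sets lebesgue" "T \<in> sets lebesgue"
  shows "sq_int (lebesgue_on S) f"
  unfolding sq_int_def
  using lebesgue_on_integrable_subset[OF sq_int_integrable[OF assms(1)] assms(2-4)]
    measurable_restrict_mono[OF sq_int_measurable[OF assms(1)] assms(2)] by blast

lemma L2_lim_lebesgue_on_subset:
  fixes f :: "'a::euclidean_space \<Rightarrow> real"
  assumes u: "L2_lim (lebesgue_on T) u f" and S: "S \<subseteq> T" "S \<in> sets lebesgue" "T \<in> sets lebesgue"
  shows "L2_lim (lebesgue_on S) u f"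
proof (rule L2_lim_bound)
  show "(\<integral>x. (u n x - f x)\<^sup>2 \<partial>lebesgue_on S) \<le> (\<integral>x. (u n x - f x)\<^sup>2 \<partial>lebesgue_on T)" for n
    using u sq_int_diff[of "lebesgue_on T" "u n" f] S
    by (intro lebesgue_on_integral_mono_set) (auto simp: L2_lim_def sq_int_def)
qed (use u S in \<open>auto simp: L2_lim_def intro: sq_int_lebesgue_on_subset\<close>)

lemma L2_lim_cong_on:
  fixes f :: "'a::euclidean_space \<Rightarrow> real"
  assumes u: "L2_lim (lebesgue_on S) u f"
    and eq: "\<And>n x. x \<in> S \<Longrightarrow> u n x = v n x" "\<And>x. x \<in> S \<Longrightarrow> f x = g x"
  shows "L2_lim (lebesgue_on S) v g"
proof -
  have "sq_int (lebesgue_on S) (u n) = sq_int (lebesgue_on S) (v n)" for n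
    unfolding sq_int_def using eq by (intro conj_cong measurable_cong Bochner_Integration.integrable_cong) auto
  moreover have "sq_int (lebesgue_on S) f = sq_int (lebesgue_on S) g"
    unfolding sq_int_def using eq by (intro conj_cong measurable_cong Bochner_Integration.integrable_cong) auto
  moreover have "(\<integral>x. (u n x - f x)\<^sup>2 \<partial>lebesgue_on S) = (\<integral>x. (v n x - g x)\<^sup>2 \<partial>lebesgue_on S)" for n
    using eq by (intro Bochner_Integration.integral_cong) auto
  ultimately show ?thesis using u by (simp add: L2_lim_def)
qed

lemma continuous_lebesgue_measurable:
  fixes f :: "'a::euclidean_space \<Rightarrow> real"
  shows "continuous_on UNIV f \<Longrightarrow> f \<in> borel_measurable lebesgue"
  by (simp add: borel_measurable_continuous_onI measurable_completion)

lemma sq_int_continuous_compact: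
  fixes \<psi> :: "'a::euclidean_space \<Rightarrow> real"
  assumes "continuous_on UNIV \<psi>" "compact K"
  shows "sq_int (lebesgue_on K) \<psi>"
proof -
  have K: "K \<in> sets lebesgue" using assms(2) by (simp add: compact_imp_closed)
  have "integrable lborel (\<lambda>x. indicator K x *\<^sub>R (\<psi> x)\<^sup>2)"
    by (rule borel_integrable_compact[OF assms(2)]) (intro continuous_intros continuous_on_subset[OF assms(1)], auto)
  then have "integrable (lebesgue_on K) (\<lambda>x. (\<psi> x)\<^sup>2)"
    using borel_measurable_integrable[of lborel]
    by (simp add: lebesgue_on_integrable_iff[OF K] integrable_completion)
  moreover have "\<psi> \<in> borel_measurable (lebesgue_on K)"
    using continuous_lebesgue_measurable[OF assms(1)] measurable_restrict_space1 by blast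
  ultimately show ?thesis by (simp add: sq_int_def)
qed

lemma sq_int_continuous_bounded_support:
  fixes f :: "'a::euclidean_space \<Rightarrow> real"
  assumes "continuous_on UNIV f" "bounded {x. f x \<noteq> 0}"
  shows "sq_int lebesgue f"
proof -
  let ?K = "closure {x. f x \<noteq> 0}"
  have K: "compact ?K" using assms(2) by (simp add: compact_closure)
  then have Ks: "?K \<in> sets lebesgue" by (simp add: compact_imp_closed)
  have "sq_int lebesgue (\<lambda>x. indicator ?K x * f x)"
    using sq_int_continuous_compact[OF assms(1) K] by (simp add: sq_int_lebesgue_on_iff[OF Ks])
  also have "(\<lambda>x. indicator ?K x * f x) = f"
  proof
    show "indicator ?K x * f x = f x" for x
      using closure_subset[of "{x. f x \<noteq> 0}"] by (cases "f x = 0") auto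
  qed
  finally show ?thesis .
qed

text \<open>The values of \<open>f\<close> are first truncated at \<open>n\<close> and
  \<open>- n\<close>. Continuous functions converging to \<open>f\<close> off a null set come from
  \<open>measurable_on\<close>; they are truncated in the same way and multiplied by a cutoff
  \<open>\<zeta>\<close> that is 1 on the support of \<open>f\<close>, so that a constant on a ball
  dominates the squared differences.\<close>

lemma continuous_dense_L2:
  fixes f :: "'a::euclidean_space \<Rightarrow> real"
  assumes f: "sq_int lebesgue f" and R: "\<And>x. f x \<noteq> 0 \<Longrightarrow> norm x \<le> R" and e: "e > 0"
  obtains h where "continuous_on UNIV h" "\<And>x. h x \<noteq> 0 \<Longrightarrow> norm x \<le> R + 1"
    "sq_int lebesgue h" "(\<integral>x. (f x - h x)\<^sup>2 \<partial>lebesgue) < e"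
proof -
  have fm[measurable]: "f \<in> borel_measurable lebesgue" using f by (simp add: sq_int_def)
  define c where "c n y = max (- real n) (min (real n) y)" for n and y :: real
  have cb: "\<bar>c n y\<bar> \<le> real n" "\<bar>c n y\<bar> \<le> \<bar>y\<bar>" "\<bar>y - c n y\<bar> \<le> \<bar>y\<bar>" for n y by (auto simp: c_def)
  have cc: "continuous_on UNIV (c n)" for n unfolding c_def by (intro continuous_intros)
  have [measurable]: "c n \<in> borel_measurable borel" for n using cc by (rule borel_measurable_continuous_onI)
  have "(\<lambda>n. \<integral>x. (f x - c n (f x))\<^sup>2 \<partial>lebesgue) \<longlonglongrightarrow> integral\<^sup>L lebesgue (\<lambda>x::'a. 0::real)"
  proof (rule integral_dominated_convergence[where w = "\<lambda>x. (f x)\<^sup>2"])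
    show "AE x in lebesgue. (\<lambda>n. (f x - c n (f x))\<^sup>2) \<longlonglongrightarrow> 0"
    proof (intro AE_I2 tendsto_eventually)
      fix x
      obtain N where N: "\<bar>f x\<bar> \<le> real N" using real_arch_simple by blast
      then have "c n (f x) = f x" if "n \<ge> N" for n using that by (auto simp: c_def)
      then show "\<forall>\<^sub>F n in sequentially. (f x - c n (f x))\<^sup>2 = 0"
        by (auto simp: eventually_sequentially intro!: exI[of _ N])
    qed
    show "AE x in lebesgue. norm ((f x - c n (f x))\<^sup>2) \<le> (f x)\<^sup>2" for n
      using cb by (auto simp: abs_le_square_iff[symmetric])
  qed (use f in \<open>auto simp: sq_int_def\<close>)
  then have "\<forall>\<^sub>F n in sequentially. (\<integral>x. (f x - c n (f x))\<^sup>2 \<partial>lebesgue) < e / 4"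
    using order_tendstoD(2)[of _ "0::real" sequentially "e / 4"] e by simp
  then obtain n where n: "(\<integral>x. (f x - c n (f x))\<^sup>2 \<partial>lebesgue) < e / 4"
    by (auto simp: eventually_sequentially)
  let ?f = "\<lambda>x. c n (f x)"
  have sf: "sq_int lebesgue ?f"
    by (rule sq_int_bound[OF f, of _ 1]) (auto simp: cb)
  have "f measurable_on UNIV" by (rule lebesgue_measurable_imp_measurable_on_real) auto
  then obtain N g where N: "negligible N" and g: "\<And>i. continuous_on UNIV (g i)"
    and lim: "\<And>x. x \<notin> N \<Longrightarrow> (\<lambda>i. g i x) \<longlonglongrightarrow> f x"
    unfolding measurable_on_def by auto
  define \<zeta> where "\<zeta> x = max 0 (min 1 (R + 1 - norm x))" for x :: 'a
  define h where "h i x = \<zeta> x * c n (g i x)" for i x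
  have chi: "\<bar>\<zeta> x\<bar> \<le> 1" "\<zeta> x \<noteq> 0 \<Longrightarrow> norm x \<le> R + 1" "norm x \<le> R \<Longrightarrow> \<zeta> x = 1" for x
    by (auto simp: \<zeta>_def)
  have ch: "continuous_on UNIV (h i)" for i
    unfolding h_def \<zeta>_def by (intro continuous_intros continuous_on_compose2[OF cc] g) auto
  have hm[measurable]: "h i \<in> borel_measurable lebesgue" for i
    using borel_measurable_continuous_onI[OF ch] by (simp add: measurable_completion)
  have hb: "\<bar>h i x\<bar> \<le> real n" for i x
    using mult_mono[OF chi(1)[of x] cb(1)[of n "g i x"]] by (auto simp: h_def abs_mult)
  have hs: "h i x \<noteq> 0 \<Longrightarrow> norm x \<le> R + 1" for i x by (auto simp: h_def intro: chi)
  let ?w = "\<lambda>x::'a. indicator (cball 0 (R + 1)) x * (2 * real n)\<^sup>2"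
  have w: "integrable lebesgue ?w"
    by (intro integrable_mult_left integrable_real_indicator)
       (use emeasure_bounded_finite[OF bounded_cball, of "0::'a" "R + 1"] in auto)
  have fh: "\<bar>?f x - h i x\<bar> \<le> 2 * real n" for i x
    using cb(1)[of n "f x"] hb[of i x] by linarith
  have "(\<lambda>i. \<integral>x. (?f x - h i x)\<^sup>2 \<partial>lebesgue) \<longlonglongrightarrow> integral\<^sup>L lebesgue (\<lambda>x::'a. 0::real)"
  proof (rule integral_dominated_convergence[where w = ?w])
    have "AE x in lebesgue. x \<notin> N" using N by (simp add: negligible_iff_null_sets AE_not_in)
    then show "AE x in lebesgue. (\<lambda>i. (?f x - h i x)\<^sup>2) \<longlonglongrightarrow> 0"
    proof eventually_elim
      case (elim x)
      have "(\<lambda>i. c n (g i x)) \<longlonglongrightarrow> c n (f x)"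
        using continuous_on_tendsto_compose[OF cc lim[OF elim]] by simp
      then have "(\<lambda>i. h i x) \<longlonglongrightarrow> \<zeta> x * c n (f x)"
        unfolding h_def by (intro tendsto_intros)
      moreover have "\<zeta> x * c n (f x) = ?f x"
      proof (cases "f x = 0")
        case True then show ?thesis by (simp add: c_def)
      next
        case False then show ?thesis using R chi by simp
      qed
      ultimately have "(\<lambda>i. (?f x - h i x)\<^sup>2) \<longlonglongrightarrow> (?f x - ?f x)\<^sup>2"
        by (intro tendsto_intros) auto
      then show ?case by simp
    qed
    show "AE x in lebesgue. norm ((?f x - h i x)\<^sup>2) \<le> ?w x" for i
    proof (intro AE_I2)
      fix x
      show "norm ((?f x - h i x)\<^sup>2) \<le> ?w x"
      proof (cases "norm x \<le> R + 1")
        case True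
        then show ?thesis using fh[of x i] abs_le_square_iff[of "?f x - h i x" "2 * real n"] by simp
      next
        case False
        then have "h i x = 0" "f x = 0" using hs R[of x] by force+
        then show ?thesis by (simp add: c_def)
      qed
    qed
  qed (use w in auto)
  then have "\<forall>\<^sub>F i in sequentially. (\<integral>x. (?f x - h i x)\<^sup>2 \<partial>lebesgue) < e / 4"
    using order_tendstoD(2)[of _ "0::real" sequentially "e / 4"] e by simp
  then obtain i where i: "(\<integral>x. (?f x - h i x)\<^sup>2 \<partial>lebesgue) < e / 4"
    by (auto simp: eventually_sequentially)
  have sh: "sq_int lebesgue (h i)"
    by (rule sq_int_continuous_bounded_support[OF ch bounded_subset[of "cball 0 (R + 1)"]]) (use hs in auto)
  have "(\<integral>x. (f x - h i x)\<^sup>2 \<partial>lebesgue) = (\<integral>x. ((f x - ?f x) + (?f x - h i x))\<^sup>2 \<partial>lebesgue)" by simp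
  also have "\<dots> \<le> 2 * (\<integral>x. (f x - ?f x)\<^sup>2 \<partial>lebesgue) + 2 * (\<integral>x. (?f x - h i x)\<^sup>2 \<partial>lebesgue)"
    by (intro integral_sq_add_le sq_int_diff f sf sh)
  also have "\<dots> < e" using n i by linarith
  finally show ?thesis using that ch hs sh by blast
qed

lemma continuous_bounded_support_bounded:
  fixes f :: "'a::euclidean_space \<Rightarrow> real"
  assumes f: "continuous_on UNIV f" and s: "bounded {x. f x \<noteq> 0}"
  obtains B where "B > 0" "\<And>x. \<bar>f x\<bar> \<le> B"
proof -
  have "compact (closure {x. f x \<noteq> 0})" using s by (simp add: compact_closure)
  then have "bounded (f ` closure {x. f x \<noteq> 0})"
    by (intro compact_imp_bounded compact_continuous_image continuous_on_subset[OF f]) auto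
  then obtain B where B: "B > 0" "\<forall>y\<in>f ` closure {x. f x \<noteq> 0}. \<bar>y\<bar> \<le> B"
    unfolding bounded_pos by auto
  have "\<bar>f x\<bar> \<le> B" for x
    using B closure_subset[of "{x. f x \<noteq> 0}"] by (cases "f x = 0") auto
  then show ?thesis using that B by blast
qed

lemma continuous_bounded_support_uniform:
  fixes f :: "'a::euclidean_space \<Rightarrow> real"
  assumes f: "continuous_on UNIV f" and s: "bounded {x. f x \<noteq> 0}" and e: "e > 0"
  obtains d where "d > 0" "\<And>x y. dist x y < d \<Longrightarrow> \<bar>f x - f y\<bar> < e"
proof -
  obtain R where R: "\<And>x. f x \<noteq> 0 \<Longrightarrow> norm x \<le> R" using s by (auto simp: bounded_iff)
  have "uniformly_continuous_on (cball 0 (R + 1)) f"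
    by (intro compact_uniformly_continuous continuous_on_subset[OF f]) auto
  then obtain d where d: "d > 0" "\<And>x y. x \<in> cball 0 (R+1) \<Longrightarrow> y \<in> cball 0 (R+1) \<Longrightarrow> dist x y < d \<Longrightarrow> dist (f x) (f y) < e"
    using e unfolding uniformly_continuous_on_def by metis
  have *: "\<bar>f x - f y\<bar> < e" if "dist x y < min d 1" "f x \<noteq> 0" for x y
  proof -
    have "norm x \<le> R" using R that by blast
    moreover have "norm y \<le> norm x + dist x y" by (metis dist_0_norm dist_triangle add.commute dist_commute)
    ultimately have "x \<in> cball 0 (R+1)" "y \<in> cball 0 (R+1)" using that by auto
    then show ?thesis using d(2)[of x y] that by (simp add: dist_real_def)
  qed
  have "\<bar>f x - f y\<bar> < e" if "dist x y < min d 1" for x y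
  proof (cases "f x = 0")
    case True
    then show ?thesis using *[of y x] that e by (cases "f y = 0") (auto simp: dist_commute abs_minus_commute)
  next
    case False then show ?thesis using * that by blast
  qed
  then show ?thesis using that[of "min d 1"] d(1) by auto
qed

definition convol :: "('a::euclidean_space \<Rightarrow> real) \<Rightarrow> ('a \<Rightarrow> real) \<Rightarrow> 'a \<Rightarrow> real" where
  "convol f \<eta> x = (\<integral>y. f y * \<eta> (x - y) \<partial>lebesgue)"

lemma bounded_mult_integrable:
  fixes f g :: "'a \<Rightarrow> real"
  assumes f: "integrable M f" and g: "g \<in> borel_measurable M" "\<And>x. \<bar>g x\<bar> \<le> B"
  shows "integrable M (\<lambda>x. f x * g x)"
proof (rule Bochner_Integration.integrable_bound)
  show "integrable M (\<lambda>x. B * f x)" using f by simp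
  show "AE x in M. norm (f x * g x) \<le> norm (B * f x)"
  proof (intro AE_I2)
    fix x
    have "\<bar>g x\<bar> * \<bar>f x\<bar> \<le> \<bar>B\<bar> * \<bar>f x\<bar>" by (intro mult_right_mono) (use g(2)[of x] in linarith, simp)
    then show "norm (f x * g x) \<le> norm (B * f x)" by (simp add: abs_mult mult.commute)
  qed
qed (use assms in measurable)

lemma convol_integrable:
  fixes f :: "'a::euclidean_space \<Rightarrow> real"
  assumes f: "integrable lebesgue f" and \<eta>: "continuous_on UNIV \<eta>" "bounded {x. \<eta> x \<noteq> 0}"
  shows "integrable lebesgue (\<lambda>y. f y * \<eta> (x - y))"
proof -
  obtain B where B: "\<And>x. \<bar>\<eta> x\<bar> \<le> B" using continuous_bounded_support_bounded[OF \<eta>] by blast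
  have "continuous_on UNIV (\<lambda>y. \<eta> (x - y))"
    by (intro continuous_on_compose2[OF \<eta>(1)] continuous_intros) auto
  from bounded_mult_integrable[OF f continuous_lebesgue_measurable[OF this]] B
  show ?thesis by blast
qed

lemma partial_deriv_bounded_support:
  "bounded {x. \<eta> x \<noteq> 0} \<Longrightarrow> bounded {x. partial_deriv k \<eta> x \<noteq> 0}"
  using partial_deriv_support[of k \<eta>] by (auto intro: bounded_subset[OF bounded_closure])

text \<open>The partial derivatives of \<open>\<eta>\<close> are uniformly continuous, so the
  linearisation error of \<open>\<eta>\<close> is small uniformly in the base point and can be
  integrated against \<open>\<bar>f\<bar>\<close>.\<close>

lemma convol_has_derivative:
  fixes f :: "real^'n \<Rightarrow> real"
  assumes f: "integrable lebesgue f" and \<eta>: "C_order 1 \<eta>" "bounded {x. \<eta> x \<noteq> 0}"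
  shows "(convol f \<eta> has_derivative (\<lambda>h. \<Sum>k\<in>UNIV. h$k * convol f (partial_deriv k \<eta>) x)) (at x)"
proof -
  let ?D = "\<lambda>x h. \<Sum>k\<in>UNIV. h$k * partial_deriv k \<eta> x"
  note ci = convol_integrable[OF f C_order_1_continuous[OF \<eta>(1)] \<eta>(2)]
  note cik = convol_integrable[OF f C_order_1_continuous_partial[OF \<eta>(1)] partial_deriv_bounded_support[OF \<eta>(2)]]
  let ?I = "\<integral>y. \<bar>f y\<bar> \<partial>lebesgue"
  have I0: "?I \<ge> 0" by simp
  then have I1: "?I + 1 > 0" by linarith
  have I2: "?I * e / (?I + 1) < e" if "e > 0" for e
  proof -
    have "?I * e < e * (?I + 1)" using that by (simp add: algebra_simps)
    then show ?thesis by (subst pos_divide_less_eq[OF I1])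
  qed
  show ?thesis
    unfolding has_derivative_at_alt
  proof (intro conjI allI impI)
    show "bounded_linear (\<lambda>h. \<Sum>k\<in>UNIV. h$k * convol f (partial_deriv k \<eta>) x)"
      by (intro bounded_linear_intros bounded_linear_vec_nth)
    fix e :: real assume e: "e > 0"
    \<comment> \<open>The linearisation error is at most \<open>CARD('n) * e'\<close> times the
      length of the increment and gets multiplied by \<open>?I\<close>; adding 1 covers the case
      \<open>?I = 0\<close>.\<close>
    define e' where "e' = e / (real CARD('n) * (?I + 1))"
    have e': "e' > 0" unfolding e'_def by (intro divide_pos_pos e mult_pos_pos I1) simp
    have "\<exists>d>0. \<forall>a b. dist a b < d \<longrightarrow> \<bar>partial_deriv k \<eta> a - partial_deriv k \<eta> b\<bar> < e'" for k
      using continuous_bounded_support_uniform[OF C_order_1_continuous_partial[OF \<eta>(1)]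
          partial_deriv_bounded_support[OF \<eta>(2)] e'] by metis
    then obtain d where d: "\<And>k. d k > 0" "\<And>k a b. dist a b < d k \<Longrightarrow> \<bar>partial_deriv k \<eta> a - partial_deriv k \<eta> b\<bar> < e'"
      by metis
    define d0 where "d0 = Min (range d)"
    have d0: "d0 > 0" "\<And>k. d0 \<le> d k" using d(1) by (auto simp: d0_def)
    have lin: "\<bar>\<eta> (a + h) - \<eta> a - ?D a h\<bar> \<le> norm h * (real CARD('n) * e')" if h: "norm h < d0" for a h
    proof -
      have "norm (\<eta> (a + h) - \<eta> a - ?D a ((a + h) - a)) \<le> norm ((a + h) - a) * (real CARD('n) * e')"
      proof (rule differentiable_bound_linearization[where S = "ball a d0"])
        show "a + t *\<^sub>R (a + h - a) \<in> ball a d0" if "t \<in> {0..1}" for t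
        proof -
          have "\<bar>t\<bar> * norm h \<le> norm h" using that by (intro mult_left_le_one_le) auto
          then have "norm (t *\<^sub>R h) < d0" using h by simp
          then show ?thesis by (simp add: dist_norm)
        qed
        show "(\<eta> has_derivative ?D x) (at x within ball a d0)" for x
          using has_derivative_partial[OF C_order_1_differentiable[OF \<eta>(1)]] has_derivative_at_withinI by blast
        fix x assume x: "x \<in> ball a d0"
        show "onorm (?D x - ?D a) \<le> real CARD('n) * e'"
        proof (rule onorm_le)
          fix h
          have "norm ((?D x - ?D a) h) = \<bar>\<Sum>k\<in>UNIV. h$k * (partial_deriv k \<eta> x - partial_deriv k \<eta> a)\<bar>"
            by (simp add: sum_subtractf right_diff_distrib)
          also have "\<dots> \<le> (\<Sum>k\<in>UNIV. \<bar>h$k * (partial_deriv k \<eta> x - partial_deriv k \<eta> a)\<bar>)" by (rule sum_abs)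
          also have "\<dots> \<le> (\<Sum>k\<in>(UNIV::'n set). norm h * e')"
          proof (rule sum_mono)
            fix k
            have "dist x a < d k" using x d0(2)[of k] by (simp add: dist_commute)
            then have "\<bar>partial_deriv k \<eta> x - partial_deriv k \<eta> a\<bar> \<le> e'" using d(2) by (simp add: less_imp_le)
            then show "\<bar>h$k * (partial_deriv k \<eta> x - partial_deriv k \<eta> a)\<bar> \<le> norm h * e'"
              unfolding abs_mult by (intro mult_mono component_le_norm_cart) auto
          qed
          finally show "norm ((?D x - ?D a) h) \<le> real CARD('n) * e' * norm h" by (simp add: mult_ac)
        qed
      qed (use d0 in auto)
      then show ?thesis by simp
    qed
    show "\<exists>d>0. \<forall>y. norm (y - x) < d \<longrightarrow>
      norm (convol f \<eta> y - convol f \<eta> x - (\<Sum>k\<in>UNIV. (y - x)$k * convol f (partial_deriv k \<eta>) x)) \<le> e * norm (y - x)"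
    proof (intro exI[of _ d0] conjI allI impI d0(1))
      fix y assume y: "norm (y - x) < d0"
      let ?h = "y - x"
      have "convol f \<eta> y - convol f \<eta> x - (\<Sum>k\<in>UNIV. ?h$k * convol f (partial_deriv k \<eta>) x)
        = (\<integral>z. f z * \<eta> (y - z) \<partial>lebesgue) - (\<integral>z. f z * \<eta> (x - z) \<partial>lebesgue)
          - (\<Sum>k\<in>UNIV. \<integral>z. ?h$k * (f z * partial_deriv k \<eta> (x - z)) \<partial>lebesgue)"
        by (simp add: convol_def)
      also have "\<dots> = (\<integral>z. f z * \<eta> (y - z) - f z * \<eta> (x - z) - (\<Sum>k\<in>UNIV. ?h$k * (f z * partial_deriv k \<eta> (x - z))) \<partial>lebesgue)"
        using ci cik by (simp add: Bochner_Integration.integral_diff Bochner_Integration.integrable_diff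
            Bochner_Integration.integral_sum Bochner_Integration.integrable_sum)
      also have "(\<lambda>z. f z * \<eta> (y - z) - f z * \<eta> (x - z) - (\<Sum>k\<in>UNIV. ?h$k * (f z * partial_deriv k \<eta> (x - z))))
         = (\<lambda>z. f z * (\<eta> (y - z) - \<eta> (x - z) - ?D (x - z) ?h))"
        by (simp add: fun_eq_iff right_diff_distrib sum_distrib_left mult_ac)
      also have "norm (\<integral>z. f z * (\<eta> (y - z) - \<eta> (x - z) - ?D (x - z) ?h) \<partial>lebesgue)
         \<le> (\<integral>z. \<bar>f z\<bar> * (norm ?h * (real CARD('n) * e')) \<partial>lebesgue)"
      proof (rule Bochner_Integration.integral_norm_bound_integral)
        have "integrable lebesgue (\<lambda>z. f z * \<eta> (y - z) - f z * \<eta> (x - z) - (\<Sum>k\<in>UNIV. ?h$k * (f z * partial_deriv k \<eta> (x - z))))"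
          using ci cik by (intro Bochner_Integration.integrable_diff Bochner_Integration.integrable_sum) auto
        also have "(\<lambda>z. f z * \<eta> (y - z) - f z * \<eta> (x - z) - (\<Sum>k\<in>UNIV. ?h$k * (f z * partial_deriv k \<eta> (x - z))))
         = (\<lambda>z. f z * (\<eta> (y - z) - \<eta> (x - z) - ?D (x - z) ?h))"
          by (simp add: fun_eq_iff right_diff_distrib sum_distrib_left mult_ac)
        finally show "integrable lebesgue (\<lambda>z. f z * (\<eta> (y - z) - \<eta> (x - z) - ?D (x - z) ?h))" .
        show "integrable lebesgue (\<lambda>z. \<bar>f z\<bar> * (norm ?h * (real CARD('n) * e')))" using f by simp
        fix z
        have "(x - z) + ?h = y - z" by simp
        then have "\<bar>\<eta> (y - z) - \<eta> (x - z) - ?D (x - z) ?h\<bar> \<le> norm ?h * (real CARD('n) * e')"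
          using lin[OF y, of "x - z"] by simp
        then show "norm (f z * (\<eta> (y - z) - \<eta> (x - z) - ?D (x - z) ?h)) \<le> \<bar>f z\<bar> * (norm ?h * (real CARD('n) * e'))"
          by (simp add: abs_mult mult_left_mono)
      qed
      also have "\<dots> = norm ?h * (?I * (real CARD('n) * e'))" by simp
      also have "\<dots> \<le> norm ?h * e"
      proof (rule mult_left_mono)
        have "?I * (real CARD('n) * e') = ?I * e / (?I + 1)" using I0 by (simp add: e'_def)
        also have "\<dots> \<le> e" using I2[OF e] by simp
        finally show "?I * (real CARD('n) * e') \<le> e" .
      qed simp
      finally show "norm (convol f \<eta> y - convol f \<eta> x - (\<Sum>k\<in>UNIV. ?h$k * convol f (partial_deriv k \<eta>) x)) \<le> e * norm ?h"
        by (simp add: mult.commute)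
    qed
  qed
qed

lemma partial_deriv_convol:
  fixes f :: "real^'n \<Rightarrow> real"
  assumes f: "integrable lebesgue f" and \<eta>: "C_order 1 \<eta>" "bounded {x. \<eta> x \<noteq> 0}"
  shows "partial_deriv k (convol f \<eta>) = convol f (partial_deriv k \<eta>)"
proof
  fix x
  have "partial_deriv k (convol f \<eta>) x = (\<Sum>j\<in>UNIV. axis k 1 $ j * convol f (partial_deriv j \<eta>) x)"
    by (rule partial_deriv_eqI[OF convol_has_derivative[OF assms]])
  also have "\<dots> = (\<Sum>j\<in>UNIV. if j = k then convol f (partial_deriv k \<eta>) x else 0)"
    by (rule sum.cong) (auto simp: axis_def)
  finally show "partial_deriv k (convol f \<eta>) x = convol f (partial_deriv k \<eta>) x" by simp
qed

lemma smooth_fn_convol: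
  fixes f :: "real^'n \<Rightarrow> real"
  assumes f: "integrable lebesgue f" and \<eta>: "smooth_fn \<eta>" "bounded {x. \<eta> x \<noteq> 0}"
  shows "smooth_fn (convol f \<eta>)"
proof (rule smooth_fn_coinduct[where S = "convol f ` {\<eta>. smooth_fn \<eta> \<and> bounded {x. \<eta> x \<noteq> 0}}"])
  fix g assume "g \<in> convol f ` {\<eta>. smooth_fn \<eta> \<and> bounded {x. \<eta> x \<noteq> 0}}"
  then obtain \<eta> where g: "g = convol f \<eta>" and \<eta>: "smooth_fn \<eta>" "bounded {x. \<eta> x \<noteq> 0}" by blast
  have 1: "C_order 1 \<eta>" using \<eta> smooth_fn_C_order by blast
  have "g differentiable_on UNIV"
    unfolding g differentiable_on_def using convol_has_derivative[OF f 1 \<eta>(2)] differentiableI by blast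
  moreover have "partial_deriv k g = convol f (partial_deriv k \<eta>)" for k
    unfolding g by (rule partial_deriv_convol[OF f 1 \<eta>(2)])
  ultimately show "g differentiable_on UNIV \<and> (\<forall>k. partial_deriv k g \<in> convol f ` {\<eta>. smooth_fn \<eta> \<and> bounded {x. \<eta> x \<noteq> 0}})"
    using smooth_fn_partial[OF \<eta>(1)] partial_deriv_bounded_support[OF \<eta>(2)] by blast
qed (use \<eta> in blast)

lemma convol_continuous:
  fixes f :: "'a::euclidean_space \<Rightarrow> real"
  assumes f: "integrable lebesgue f" and \<eta>: "continuous_on UNIV \<eta>" "bounded {x. \<eta> x \<noteq> 0}"
  shows "continuous_on UNIV (convol f \<eta>)"
proof -
  obtain B where B: "\<And>x. \<bar>\<eta> x\<bar> \<le> B" using continuous_bounded_support_bounded[OF \<eta>] by blast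
  have "(\<lambda>n. convol f \<eta> (u n)) \<longlonglongrightarrow> convol f \<eta> x" if u: "u \<longlonglongrightarrow> x" for u x
    unfolding convol_def
  proof (rule integral_dominated_convergence[where w = "\<lambda>y. B * \<bar>f y\<bar>"])
    have "(\<lambda>n. \<eta> (u n - y)) \<longlonglongrightarrow> \<eta> (x - y)" for y
      by (rule continuous_on_tendsto_compose[OF \<eta>(1)]) (auto intro!: tendsto_intros u)
    then show "AE y in lebesgue. (\<lambda>n. f y * \<eta> (u n - y)) \<longlonglongrightarrow> f y * \<eta> (x - y)"
      by (intro AE_I2 tendsto_intros)
    show "AE y in lebesgue. norm (f y * \<eta> (u n - y)) \<le> B * \<bar>f y\<bar>" for n
      by (intro AE_I2) (auto simp: abs_mult mult.commute[of B] intro!: mult_left_mono B)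
  qed (use f borel_measurable_integrable[OF convol_integrable[OF f \<eta>]] in auto)
  then show ?thesis by (simp add: continuous_on_sequentially comp_def)
qed

text \<open>Tonelli's theorem. It is applied on the product of two Borel measures, but
  \<open>g\<close> is only Lebesgue measurable; hence \<open>g\<close> is replaced by a Borel
  function \<open>g'\<close> that agrees with it almost everywhere, with a maximum to keep it
  nonnegative.\<close>

lemma convol_integral_nonneg:
  fixes g :: "'a::euclidean_space \<Rightarrow> real"
  assumes g: "integrable lebesgue g" "\<And>x. g x \<ge> 0"
    and \<eta>: "continuous_on UNIV \<eta>" "bounded {x. \<eta> x \<noteq> 0}" "\<And>x. \<eta> x \<ge> 0" "(\<integral>x. \<eta> x \<partial>lborel) = 1"
  shows "integrable lebesgue (convol g \<eta>)" "(\<integral>x. convol g \<eta> x \<partial>lebesgue) = (\<integral>x. g x \<partial>lebesgue)"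
proof -
  obtain g0 where g0: "g0 \<in> borel_measurable lborel" "AE x in lborel. g x = g0 x"
    using completion_ex_borel_measurable_real[OF borel_measurable_integrable[OF g(1)]] by blast
  define g' where "g' x = max 0 (g0 x)" for x
  have [measurable]: "g0 \<in> borel_measurable borel" using g0(1) by simp
  have g'[measurable]: "g' \<in> borel_measurable borel" unfolding g'_def by measurable
  have eq: "AE x in lborel. g x = g' x"
    using g0(2) by eventually_elim (metis g(2) g'_def max_absorb2)
  then have eql: "AE x in lebesgue. g x = g' x" by (rule AE_completion)
  have [measurable]: "\<eta> \<in> borel_measurable borel" using \<eta>(1) by (rule borel_measurable_continuous_onI)
  have gl: "integrable lborel g'"
  proof -
    have "integrable lebesgue g'"
      by (rule integrable_cong_AE_imp[OF g(1)]) (use eql in \<open>auto simp: measurable_completion\<close>)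
    then show ?thesis by (simp add: integrable_completion)
  qed
  have i: "integrable lebesgue (\<lambda>y. g y * \<eta> (x - y))" for x by (rule convol_integrable[OF g(1) \<eta>(1,2)])
  have nn: "ennreal (convol g \<eta> x) = (\<integral>\<^sup>+y. ennreal (g' y * \<eta> (x - y)) \<partial>lborel)" for x
  proof -
    have "ennreal (convol g \<eta> x) = (\<integral>\<^sup>+y. ennreal (g y * \<eta> (x - y)) \<partial>lebesgue)"
      unfolding convol_def using i g(2) \<eta>(3) by (subst nn_integral_eq_integral) auto
    also have "\<dots> = (\<integral>\<^sup>+y. ennreal (g' y * \<eta> (x - y)) \<partial>lborel)"
      unfolding nn_integral_completion using eq by (intro nn_integral_cong_AE) auto
    finally show ?thesis .
  qed
  have cm: "convol g \<eta> \<in> borel_measurable borel"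
    using convol_continuous[OF g(1) \<eta>(1,2)] by (rule borel_measurable_continuous_onI)
  \<comment> \<open>A function that is not integrable has integral 0, so the value 1 forces
    integrability.\<close>
  have \<eta>i: "integrable lborel \<eta>"
  proof (rule ccontr)
    assume "\<not> integrable lborel \<eta>" then show False using \<eta>(4) by (simp add: not_integrable_integral_eq)
  qed
  have "(\<integral>\<^sup>+x. ennreal (convol g \<eta> x) \<partial>lborel) = (\<integral>\<^sup>+x. \<integral>\<^sup>+y. ennreal (g' y * \<eta> (x - y)) \<partial>lborel \<partial>lborel)"
    by (simp add: nn)
  also have "\<dots> = (\<integral>\<^sup>+y. \<integral>\<^sup>+x. ennreal (g' y * \<eta> (x - y)) \<partial>lborel \<partial>lborel)"
    by (rule lborel_pair.Fubini') measurable
  also have "\<dots> = (\<integral>\<^sup>+y. ennreal (g' y) \<partial>lborel)"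
  proof (rule nn_integral_cong)
    fix y
    have "(\<integral>\<^sup>+x. ennreal (g' y * \<eta> (x - y)) \<partial>lborel) = ennreal (g' y) * (\<integral>\<^sup>+x. ennreal (\<eta> (x - y)) \<partial>lborel)"
      by (subst nn_integral_cmult[symmetric]) (auto simp: ennreal_mult g'_def \<eta>(3))
    also have "(\<integral>\<^sup>+x. ennreal (\<eta> (x - y)) \<partial>lborel) = (\<integral>\<^sup>+x. ennreal (\<eta> x) \<partial>lborel)"
      using nn_integral_lborel_affine[of "\<lambda>x. ennreal (\<eta> x)" 1 "- y"] by simp
    also have "\<dots> = 1" using \<eta>i \<eta>(3,4) by (subst nn_integral_eq_integral) auto
    finally show "(\<integral>\<^sup>+x. ennreal (g' y * \<eta> (x - y)) \<partial>lborel) = ennreal (g' y)" by simp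
  qed
  also have "\<dots> = ennreal (\<integral>x. g' x \<partial>lborel)"
    by (rule nn_integral_eq_integral[OF gl]) (simp add: g'_def)
  finally have *: "(\<integral>\<^sup>+x. ennreal (convol g \<eta> x) \<partial>lborel) = ennreal (\<integral>x. g' x \<partial>lborel)" .
  have c0: "convol g \<eta> x \<ge> 0" for x unfolding convol_def using g(2) \<eta>(3) by (intro integral_nonneg_AE) auto
  have il: "integrable lborel (convol g \<eta>)"
    using * c0 cm unfolding integrable_iff_bounded by simp
  then show "integrable lebesgue (convol g \<eta>)" using cm by (simp add: integrable_completion)
  have "(\<integral>x. convol g \<eta> x \<partial>lebesgue) = (\<integral>x. convol g \<eta> x \<partial>lborel)" using cm by (simp add: integral_completion)
  also have "\<dots> = (\<integral>x. g' x \<partial>lborel)"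
  proof -
    have "ennreal (\<integral>x. convol g \<eta> x \<partial>lborel) = ennreal (\<integral>x. g' x \<partial>lborel)"
      using * il c0 by (subst (asm) nn_integral_eq_integral) auto
    moreover have "0 \<le> (\<integral>x. g' x \<partial>lborel)" "0 \<le> (\<integral>x. convol g \<eta> x \<partial>lborel)"
      using c0 by (auto intro!: integral_nonneg_AE simp: g'_def)
    ultimately show ?thesis by simp
  qed
  also have "\<dots> = (\<integral>x. g' x \<partial>lebesgue)" by (simp add: integral_completion)
  also have "\<dots> = (\<integral>x. g x \<partial>lebesgue)"
    using eql by (intro integral_cong_AE) (auto simp: measurable_completion borel_measurable_integrable[OF g(1)])
  finally show "(\<integral>x. convol g \<eta> x \<partial>lebesgue) = (\<integral>x. g x \<partial>lebesgue)" .
qed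

text \<open>Jensen's inequality for the probability density \<open>\<eta>\<close>, obtained from
  Cauchy-Schwarz by splitting \<open>\<eta>\<close> into two square roots: the square of the
  convolution is pointwise at most the convolution of the square, whose integral is that of the
  square.\<close>

lemma convol_L2_contraction:
  fixes f :: "'a::euclidean_space \<Rightarrow> real"
  assumes f: "sq_int lebesgue f" "integrable lebesgue f"
    and \<eta>: "continuous_on UNIV \<eta>" "bounded {x. \<eta> x \<noteq> 0}" "\<And>x. \<eta> x \<ge> 0" "(\<integral>x. \<eta> x \<partial>lborel) = 1"
  shows "sq_int lebesgue (convol f \<eta>)" "(\<integral>x. (convol f \<eta> x)\<^sup>2 \<partial>lebesgue) \<le> (\<integral>x. (f x)\<^sup>2 \<partial>lebesgue)"
proof -
  have f2: "integrable lebesgue (\<lambda>x. (f x)\<^sup>2)" using f by (simp add: sq_int_def)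
  have fm: "f \<in> borel_measurable lebesgue" using f by (simp add: sq_int_def)
  note c = convol_integral_nonneg[OF f2 _ \<eta>]
  have \<eta>b: "\<eta> \<in> borel_measurable borel" using \<eta>(1) by (rule borel_measurable_continuous_onI)
  have le: "(convol f \<eta> x)\<^sup>2 \<le> convol (\<lambda>x. (f x)\<^sup>2) \<eta> x" for x
  proof -
    let ?r = "\<lambda>y. sqrt (\<eta> (x - y))"
    have cx: "continuous_on UNIV (\<lambda>y. \<eta> (x - y))"
      by (intro continuous_on_compose2[OF \<eta>(1)] continuous_intros) auto
    have rm: "?r \<in> borel_measurable lebesgue"
      by (intro continuous_lebesgue_measurable continuous_intros cx)
    have \<eta>x: "(\<integral>y. \<eta> (x - y) \<partial>lebesgue) = 1"
      using integral_lborel_reflect[OF \<eta>b, of x] \<eta>(4) borel_measurable_continuous_onI[OF cx]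
      by (simp add: integral_completion)
    have s1: "sq_int lebesgue (\<lambda>y. f y * ?r y)"
      using convol_integrable[OF f2 \<eta>(1,2), of x] fm rm \<eta>(3)
      by (auto simp: sq_int_def power_mult_distrib intro: borel_measurable_times)
    have "integrable lebesgue (\<lambda>y. \<eta> (x - y))"
      using \<eta>x by (metis not_integrable_integral_eq zero_neq_one)
    then have s2: "sq_int lebesgue ?r" using rm \<eta>(3) by (simp add: sq_int_def)
    have "(\<integral>y. (f y * ?r y) * ?r y \<partial>lebesgue)\<^sup>2 \<le> (\<integral>y. (f y * ?r y)\<^sup>2 \<partial>lebesgue) * (\<integral>y. (?r y)\<^sup>2 \<partial>lebesgue)"
      by (rule Cauchy_Schwarz_integral[OF s1 s2])
    also have "(\<lambda>y. (f y * ?r y) * ?r y) = (\<lambda>y. f y * \<eta> (x - y))"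
      using \<eta>(3) by (simp add: mult.assoc)
    also have "(\<lambda>y. (f y * ?r y)\<^sup>2) = (\<lambda>y. (f y)\<^sup>2 * \<eta> (x - y))"
      using \<eta>(3) by (simp add: power_mult_distrib)
    also have "(\<lambda>y. (?r y)\<^sup>2) = (\<lambda>y. \<eta> (x - y))" using \<eta>(3) by simp
    finally show ?thesis using \<eta>x by (simp add: convol_def)
  qed
  have cm: "convol f \<eta> \<in> borel_measurable lebesgue"
    using convol_continuous[OF f(2) \<eta>(1,2)] by (rule continuous_lebesgue_measurable)
  have "integrable lebesgue (\<lambda>x. (convol f \<eta> x)\<^sup>2)"
    by (rule Bochner_Integration.integrable_bound[OF c(1)]) (use le cm in \<open>auto intro: order_trans[OF _ abs_ge_self]\<close>)
  then show "sq_int lebesgue (convol f \<eta>)" using cm by (simp add: sq_int_def)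
  have "(\<integral>x. (convol f \<eta> x)\<^sup>2 \<partial>lebesgue) \<le> (\<integral>x. convol (\<lambda>x. (f x)\<^sup>2) \<eta> x \<partial>lebesgue)"
    by (rule integral_mono) (use le c in \<open>auto simp: \<open>integrable lebesgue (\<lambda>x. (convol f \<eta> x)\<^sup>2)\<close>\<close>)
  then show "(\<integral>x. (convol f \<eta> x)\<^sup>2 \<partial>lebesgue) \<le> (\<integral>x. (f x)\<^sup>2 \<partial>lebesgue)" using c by simp
qed

section \<open>Mollification and weak derivatives\<close>

lemma kernel_exists:
  "\<exists>\<eta>::real^'n \<Rightarrow> real. smooth_fn \<eta> \<and> (\<forall>x. 0 \<le> \<eta> x) \<and> (\<forall>x. \<eta> x \<noteq> 0 \<longrightarrow> norm x < 1) \<and>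
    (\<integral>x. \<eta> x \<partial>lborel) = 1"
proof -
  obtain \<eta> :: "real^'n \<Rightarrow> real" where \<eta>: "smooth_fn \<eta>" "\<And>x. \<eta> x \<ge> 0" "\<eta> 0 > 0" "\<And>x. \<eta> x \<noteq> 0 \<Longrightarrow> dist 0 x < 1"
    using smooth_bump_exists[of 1 "0::real^'n"] by auto
  have c: "continuous_on UNIV \<eta>" using \<eta>(1) smooth_fn_C_order[of \<eta> 0] by simp
  obtain a where "cball (0::real^'n) 1 \<subseteq> cbox (-a) a"
    using bounded_subset_cbox_symmetric[OF bounded_cball] by metis
  then have "x \<in> cbox (-a) a" if "\<eta> x \<noteq> 0" for x using \<eta>(4)[OF that] by fastforce
  from continuous_compact_support_integrable(1)[OF c this]
  have i: "integrable lborel \<eta>" .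
  let ?I = "integral\<^sup>L lborel \<eta>"
  have "?I \<noteq> 0"
  proof
    assume "?I = 0"
    then have "AE x in lborel. \<eta> x = 0" using i \<eta>(2) integral_nonneg_eq_0_iff_AE[of lborel \<eta>] by simp
    then have "AE x in lebesgue. \<eta> x = 0" by (rule AE_completion)
    moreover have op: "open {x. \<eta> x \<noteq> 0}"
      using open_Collect_neq[OF c continuous_on_const[of UNIV 0]] by simp
    moreover from op have "{x. \<eta> x \<noteq> 0} \<in> sets lebesgue" by simp
    ultimately have "{x. \<eta> x \<noteq> 0} \<in> null_sets lebesgue"
      using AE_iff_null_sets[of "{x. \<eta> x \<noteq> 0}" lebesgue] by simp
    then have "negligible {x. \<eta> x \<noteq> 0}" by (simp add: negligible_iff_null_sets)
    moreover have "0 \<in> {x. \<eta> x \<noteq> 0}" using \<eta>(3) by simp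
    ultimately show False using open_not_negligible[OF op] by blast
  qed
  moreover have "?I \<ge> 0" using \<eta>(2) by (intro integral_nonneg_AE) auto
  ultimately have I: "?I > 0" by linarith
  show ?thesis
  proof (intro exI[of _ "\<lambda>x. inverse ?I * \<eta> x"] conjI allI impI)
    show "smooth_fn (\<lambda>x. inverse ?I * \<eta> x)" by (intro smooth_fn_mult smooth_fn_const \<eta>)
    show "0 \<le> inverse ?I * \<eta> x" for x using \<eta>(2)[of x] I by simp
    show "norm x < 1" if "inverse ?I * \<eta> x \<noteq> 0" for x using \<eta>(4)[of x] that by auto
    show "(\<integral>x. inverse ?I * \<eta> x \<partial>lborel) = 1" using I by simp
  qed
qed

definition unit_kernel :: "real^'n \<Rightarrow> real" where
  "unit_kernel = (SOME \<eta>. smooth_fn \<eta> \<and> (\<forall>x. 0 \<le> \<eta> x) \<and> (\<forall>x. \<eta> x \<noteq> 0 \<longrightarrow> norm x < 1) \<and>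
    (\<integral>x. \<eta> x \<partial>lborel) = 1)"

lemma unit_kernel:
  "smooth_fn (unit_kernel :: real^'n \<Rightarrow> real)" "0 \<le> unit_kernel (x :: real^'n)"
  "unit_kernel (x :: real^'n) \<noteq> 0 \<Longrightarrow> norm x < 1" "(\<integral>x. unit_kernel (x :: real^'n) \<partial>lborel) = 1"
  using someI_ex[OF kernel_exists[where 'n='n]] unfolding unit_kernel_def[symmetric] by auto

text \<open>The summand \<open>0\<close> in the argument gives it the form
  \<open>a + c *\<^sub>R x\<close> of \<open>smooth_fn_affine\<close>.\<close>

definition moll :: "real \<Rightarrow> real^'n \<Rightarrow> real" where
  "moll \<epsilon> x = (1 / \<epsilon>) ^ CARD('n) * unit_kernel (0 + (1 / \<epsilon>) *\<^sub>R x)"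

lemma smooth_moll: "smooth_fn (moll \<epsilon>)"
  unfolding moll_def[abs_def] by (intro smooth_fn_mult smooth_fn_const smooth_fn_affine unit_kernel)

lemma moll_continuous: "continuous_on UNIV (moll \<epsilon>)"
  using smooth_fn_C_order[OF smooth_moll, of 0] by simp

lemma moll_C1: "C_order 1 (moll \<epsilon>)"
  using smooth_fn_C_order[OF smooth_moll] .

lemma moll_nonneg: "\<epsilon> > 0 \<Longrightarrow> 0 \<le> moll \<epsilon> x"
  unfolding moll_def by (intro mult_nonneg_nonneg unit_kernel) auto

lemma moll_support: "\<epsilon> > 0 \<Longrightarrow> moll \<epsilon> x \<noteq> 0 \<Longrightarrow> norm x < \<epsilon>"
  using unit_kernel(3)[of "(1 / \<epsilon>) *\<^sub>R x"] by (auto simp: moll_def field_simps)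

lemma moll_bounded_support: "\<epsilon> > 0 \<Longrightarrow> bounded {x. moll \<epsilon> x \<noteq> 0}"
  by (rule bounded_subset[of "ball 0 \<epsilon>"]) (auto dest: moll_support)

lemma moll_integral:
  assumes "\<epsilon> > 0" shows "(\<integral>x. moll \<epsilon> (x::real^'n) \<partial>lborel) = 1"
proof -
  have "continuous_on UNIV (unit_kernel :: real^'n \<Rightarrow> real)" using smooth_fn_C_order[OF unit_kernel(1), of 0] by simp
  then have "(unit_kernel :: real^'n \<Rightarrow> real) \<in> borel_measurable borel" by (rule borel_measurable_continuous_onI)
  from integral_lborel_affine[OF this, of "1/\<epsilon>" 0] assms
  have "(\<integral>x. unit_kernel (x::real^'n) \<partial>lborel) = (1/\<epsilon>) ^ CARD('n) * (\<integral>x. unit_kernel (0 + (1/\<epsilon>) *\<^sub>R (x::real^'n)) \<partial>lborel)"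
    by simp
  then show ?thesis unfolding moll_def by (simp add: unit_kernel(4))
qed

lemmas moll_kernel = moll_continuous moll_bounded_support moll_nonneg moll_integral

lemma convol_support: "convol f \<eta> x \<noteq> 0 \<Longrightarrow> \<exists>y. f y \<noteq> 0 \<and> \<eta> (x - y) \<noteq> 0"
proof (rule ccontr)
  assume c: "convol f \<eta> x \<noteq> 0" and "\<nexists>y. f y \<noteq> 0 \<and> \<eta> (x - y) \<noteq> 0"
  then have "(\<lambda>y. f y * \<eta> (x - y)) = (\<lambda>y. 0)" by auto
  then show False using c by (simp add: convol_def)
qed

lemma sq_int_bounded_support_integrable:
  fixes f :: "'a::euclidean_space \<Rightarrow> real"
  assumes f: "sq_int lebesgue f" and R: "\<And>x. f x \<noteq> 0 \<Longrightarrow> norm x \<le> R"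
  shows "integrable lebesgue f"
proof -
  have e: "emeasure lborel (cball (0::'a) R) < \<infinity>" by (rule emeasure_bounded_finite) simp
  have "integrable lebesgue (indicator (cball 0 R) :: 'a \<Rightarrow> real)"
    by (rule integrable_real_indicator) (use e in auto)
  moreover have "(\<lambda>x::'a. (indicator (cball 0 R) x)\<^sup>2) = (indicator (cball 0 R) :: 'a \<Rightarrow> real)"
    by (auto simp: indicator_def)
  ultimately have "sq_int lebesgue (indicator (cball 0 R) :: 'a \<Rightarrow> real)" by (simp add: sq_int_def)
  from sq_int_mult_integrable[OF f this]
  have "integrable lebesgue (\<lambda>x. f x * indicator (cball 0 R) x)" .
  also have "(\<lambda>x. f x * indicator (cball 0 R) x) = f" using R by (force simp: indicator_def)
  finally show ?thesis .
qed

lemma convol_diff: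
  fixes f :: "'a::euclidean_space \<Rightarrow> real"
  assumes "integrable lebesgue f" "integrable lebesgue g" and \<eta>: "continuous_on UNIV \<eta>" "bounded {x. \<eta> x \<noteq> 0}"
  shows "convol (\<lambda>x. f x - g x) \<eta> x = convol f \<eta> x - convol g \<eta> x"
  unfolding convol_def left_diff_distrib
  using convol_integrable[OF assms(1) \<eta>] convol_integrable[OF assms(2) \<eta>] by simp

lemma moll_integral_shift:
  assumes "\<epsilon> > 0" shows "(\<integral>y. moll \<epsilon> (x - y) \<partial>lebesgue) = 1" "integrable lebesgue (\<lambda>y. moll \<epsilon> (x - y))"
proof -
  have "continuous_on UNIV (\<lambda>y. moll \<epsilon> (x - y))"
    by (intro continuous_on_compose2[OF moll_continuous] continuous_intros) auto
  then have "(\<lambda>y. moll \<epsilon> (x - y)) \<in> borel_measurable borel" by (rule borel_measurable_continuous_onI)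
  then show 1: "(\<integral>y. moll \<epsilon> (x - y) \<partial>lebesgue) = 1"
    using integral_lborel_reflect[OF borel_measurable_continuous_onI[OF moll_continuous], of \<epsilon> x] moll_integral[OF assms]
    by (simp add: integral_completion)
  show "integrable lebesgue (\<lambda>y. moll \<epsilon> (x - y))"
    using 1 by (metis not_integrable_integral_eq zero_neq_one)
qed

lemma convol_near:
  fixes h :: "real^'n \<Rightarrow> real"
  assumes h: "integrable lebesgue h" and eps: "\<epsilon> > 0" and g: "\<And>y. dist x y < \<epsilon> \<Longrightarrow> \<bar>h y - h x\<bar> \<le> \<gamma>"
  shows "\<bar>convol h (moll \<epsilon>) x - h x\<bar> \<le> \<gamma>"
proof -
  note i = convol_integrable[OF h moll_continuous moll_bounded_support[OF eps]]
    moll_integral_shift[OF eps, of x]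
  have "convol h (moll \<epsilon>) x - h x = (\<integral>y. h y * moll \<epsilon> (x - y) - h x * moll \<epsilon> (x - y) \<partial>lebesgue)"
    using i by (subst Bochner_Integration.integral_diff) (auto simp: convol_def)
  also have "\<bar>\<dots>\<bar> \<le> (\<integral>y. \<gamma> * moll \<epsilon> (x - y) \<partial>lebesgue)"
    unfolding real_norm_def[symmetric]
  proof (rule Bochner_Integration.integral_norm_bound_integral)
    show "integrable lebesgue (\<lambda>y. h y * moll \<epsilon> (x - y) - h x * moll \<epsilon> (x - y))"
      by (intro Bochner_Integration.integrable_diff Bochner_Integration.integrable_mult_right i)
    show "integrable lebesgue (\<lambda>y. \<gamma> * moll \<epsilon> (x - y))" using i by simp
    fix y
    show "norm (h y * moll \<epsilon> (x - y) - h x * moll \<epsilon> (x - y)) \<le> \<gamma> * moll \<epsilon> (x - y)"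
    proof (cases "moll \<epsilon> (x - y) = 0")
      case False
      then have "dist x y < \<epsilon>" using moll_support[OF eps] by (simp add: dist_norm)
      then have "\<bar>h y - h x\<bar> * moll \<epsilon> (x - y) \<le> \<gamma> * moll \<epsilon> (x - y)"
        using g moll_nonneg[OF eps] by (intro mult_right_mono) auto
      then show ?thesis using moll_nonneg[OF eps, of "x - y"] by (simp add: left_diff_distrib[symmetric] abs_mult)
    qed simp
  qed
  also have "\<dots> = \<gamma>" using i by simp
  finally show ?thesis .
qed

text \<open>\<open>f\<close> is compared with a continuous \<open>h\<close> of bounded support. The
  contraction property moves the error \<open>f - h\<close> through the convolution at no cost, and
  uniform continuity of \<open>h\<close> makes the convolution uniformly close to \<open>h\<close>
  on a fixed ball.\<close>

lemma moll_L2_lim: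
  fixes f :: "real^'n \<Rightarrow> real"
  assumes f: "sq_int lebesgue f" and R: "\<And>x. f x \<noteq> 0 \<Longrightarrow> norm x \<le> R"
    and e: "\<And>n. 0 < e n" "\<And>n. e n \<le> 1" "e \<longlonglongrightarrow> 0"
  shows "L2_lim lebesgue (\<lambda>n. convol f (moll (e n))) f"
  unfolding L2_lim_def
proof (intro conjI allI f)
  have fi: "integrable lebesgue f" by (rule sq_int_bounded_support_integrable[OF f R])
  show sc: "sq_int lebesgue (convol f (moll (e n)))" for n
    by (rule convol_L2_contraction[OF f fi moll_kernel]) (use e in auto)
  show "(\<lambda>n. \<integral>x. (convol f (moll (e n)) x - f x)\<^sup>2 \<partial>lebesgue) \<longlonglongrightarrow> 0"
  proof (rule LIMSEQ_I)
    fix r :: real assume r: "r > 0"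
    \<comment> \<open>Two uses of \<open>(a + b)\<^sup>2 \<le> 2 * a\<^sup>2 + 2 * b\<^sup>2\<close>
      give the weights 2, 4, 4 to the three errors, and
      \<open>2 * r/12 + 4 * r/8 + 4 * r/12 = r\<close>.\<close>
    then have "r / 12 > 0" by simp
    then obtain h where h: "continuous_on UNIV h" "\<And>x. h x \<noteq> 0 \<Longrightarrow> norm x \<le> R + 1" "sq_int lebesgue h"
      "(\<integral>x. (f x - h x)\<^sup>2 \<partial>lebesgue) < r / 12"
      using continuous_dense_L2[OF f R] by blast
    have hi: "integrable lebesgue h" by (rule sq_int_bounded_support_integrable[OF h(3,2)])
    have hb: "bounded {x. h x \<noteq> 0}" by (rule bounded_subset[of "cball 0 (R+1)"]) (use h(2) in auto)
    \<comment> \<open>The support of \<open>h\<close> has radius \<open>R + 1\<close>, and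
      mollification with \<open>e n \<le> 1\<close> enlarges it by at most 1.\<close>
    define V where "V = measure lebesgue (cball (0::real^'n) (R + 2))"
    have V: "V \<ge> 0" by (simp add: V_def)
    \<comment> \<open>A uniform error \<open>\<gamma>\<close> on a set of measure \<open>V\<close>
      contributes \<open>V * \<gamma>\<^sup>2 < r / 8\<close>; adding 1 to \<open>V\<close> rules
      out a division by 0.\<close>
    define \<gamma> where "\<gamma> = sqrt (r / (16 * (V + 1)))"
    have \<gamma>: "\<gamma> > 0" "\<gamma>\<^sup>2 = r / (16 * (V + 1))" using r V by (auto simp: \<gamma>_def)
    obtain d where d: "d > 0" "\<And>x y. dist x y < d \<Longrightarrow> \<bar>h x - h y\<bar> < \<gamma>"
      using continuous_bounded_support_uniform[OF h(1) hb \<gamma>(1)] by blast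
    obtain N where N: "\<And>n. n \<ge> N \<Longrightarrow> e n < d"
      using order_tendstoD(2)[OF e(3) d(1)] by (auto simp: eventually_sequentially)
    show "\<exists>N. \<forall>n\<ge>N. norm ((\<integral>x. (convol f (moll (e n)) x - f x)\<^sup>2 \<partial>lebesgue) - 0) < r"
    proof (intro exI allI impI)
      fix n assume n: "n \<ge> N"
      let ?m = "moll (e n) :: real^'n \<Rightarrow> real"

      have sh: "sq_int lebesgue (convol h ?m)"
        by (rule convol_L2_contraction[OF h(3) hi moll_kernel]) (use e in auto)
      have b1: "\<bar>convol h ?m x - h x\<bar> \<le> \<gamma>" for x
      proof (rule convol_near[OF hi e(1)])
        show "\<bar>h y - h x\<bar> \<le> \<gamma>" if "dist x y < e n" for y
          using d(2)[of y x] N[OF n] that by (simp add: dist_commute)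
      qed
      have b2: "convol h ?m x - h x = 0" if "norm x > R + 2" for x
      proof -
        have "h x = 0" using h(2)[of x] that by force
        moreover have "convol h ?m x = 0"
        proof (rule ccontr)
          assume "convol h ?m x \<noteq> 0"
          then obtain y where y: "h y \<noteq> 0" "?m (x - y) \<noteq> 0" using convol_support by blast
          have "norm y \<le> R + 1" "norm (x - y) < e n" using h(2)[OF y(1)] moll_support[OF e(1) y(2)] by auto
          then show False using norm_triangle_sub[of x y] e(2)[of n] that by linarith
        qed
        ultimately show ?thesis by simp
      qed
      have "(\<integral>x. (convol h ?m x - h x)\<^sup>2 \<partial>lebesgue) \<le> integral\<^sup>L lebesgue (\<lambda>x::real^'n. indicator (cball 0 (R + 2)) x * \<gamma>\<^sup>2)"
      proof (rule integral_mono)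
        show "integrable lebesgue (\<lambda>x. (convol h ?m x - h x)\<^sup>2)"
          using sq_int_diff[OF sh h(3)] by (simp add: sq_int_def)
        have "emeasure lborel (cball (0::real^'n) (R + 2)) < \<infinity>" by (rule emeasure_bounded_finite) simp
        then show "integrable lebesgue (\<lambda>x::real^'n. indicator (cball 0 (R + 2)) x * \<gamma>\<^sup>2)"
          by (intro integrable_mult_left integrable_real_indicator) auto
        show "(convol h ?m x - h x)\<^sup>2 \<le> indicator (cball 0 (R + 2)) x * \<gamma>\<^sup>2" for x
        proof (cases "norm x \<le> R + 2")
          case True
          then show ?thesis using b1[of x] \<gamma>(1) abs_le_square_iff[of "convol h ?m x - h x" \<gamma>] by simp
        next
          case False then show ?thesis using b2[of x] by simp
        qed
      qed
      also have "\<dots> = V * \<gamma>\<^sup>2" by (simp add: V_def)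
      also have "\<dots> < r / 8"
      proof -
        have "V * r / (16 * (V + 1)) < r / 8" using r V by (simp add: field_simps add_pos_nonneg)
        then show ?thesis by (simp add: \<gamma>(2))
      qed
      finally have B: "(\<integral>x. (convol h ?m x - h x)\<^sup>2 \<partial>lebesgue) < r / 8" .
      have fh: "sq_int lebesgue (\<lambda>x. f x - h x)" "integrable lebesgue (\<lambda>x. f x - h x)"
        using sq_int_diff[OF f h(3)] fi hi by auto
      have cA: "sq_int lebesgue (convol (\<lambda>x. f x - h x) ?m)"
         "(\<integral>x. (convol (\<lambda>x. f x - h x) ?m x)\<^sup>2 \<partial>lebesgue) \<le> (\<integral>x. (f x - h x)\<^sup>2 \<partial>lebesgue)"
        using convol_L2_contraction[OF fh moll_kernel] e(1)[of n] by auto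
      have "(\<integral>x. (convol f ?m x - f x)\<^sup>2 \<partial>lebesgue)
         = (\<integral>x. (convol (\<lambda>x. f x - h x) ?m x + ((convol h ?m x - h x) + (h x - f x)))\<^sup>2 \<partial>lebesgue)"
        using convol_diff[OF fi hi moll_continuous moll_bounded_support[OF e(1)]] by simp
      also have "\<dots> \<le> 2 * (\<integral>x. (convol (\<lambda>x. f x - h x) ?m x)\<^sup>2 \<partial>lebesgue)
          + 2 * (\<integral>x. ((convol h ?m x - h x) + (h x - f x))\<^sup>2 \<partial>lebesgue)"
        by (intro integral_sq_add_le cA sq_int_add sq_int_diff sh h f)
      finally have A1: "(\<integral>x. (convol f ?m x - f x)\<^sup>2 \<partial>lebesgue) \<le> 2 * (\<integral>x. (convol (\<lambda>x. f x - h x) ?m x)\<^sup>2 \<partial>lebesgue)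
          + 2 * (\<integral>x. ((convol h ?m x - h x) + (h x - f x))\<^sup>2 \<partial>lebesgue)" .
      have "(\<integral>x. ((convol h ?m x - h x) + (h x - f x))\<^sup>2 \<partial>lebesgue)
         \<le> 2 * (\<integral>x. (convol h ?m x - h x)\<^sup>2 \<partial>lebesgue) + 2 * (\<integral>x. (h x - f x)\<^sup>2 \<partial>lebesgue)"
        by (intro integral_sq_add_le sq_int_add sq_int_diff sh h f)
      also have "(\<integral>x. (h x - f x)\<^sup>2 \<partial>lebesgue) = (\<integral>x. (f x - h x)\<^sup>2 \<partial>lebesgue)" by (simp add: power2_commute)
      finally have "(\<integral>x. (convol f ?m x - f x)\<^sup>2 \<partial>lebesgue) < r"
        using A1 B cA(2) h(4) by linarith
      moreover have "0 \<le> (\<integral>x. (convol f ?m x - f x)\<^sup>2 \<partial>lebesgue)" by (rule integral_nonneg_AE) auto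
      ultimately show "norm ((\<integral>x. (convol f ?m x - f x)\<^sup>2 \<partial>lebesgue) - 0) < r" by simp
    qed
  qed
qed

section \<open>Test functions and approximation of weak derivatives\<close>

lemma test_functionsD:
  assumes "\<psi> \<in> test_functions \<Omega>"
  shows "smooth_fn \<psi>" "compact (closure {x. \<psi> x \<noteq> 0})" "closure {x. \<psi> x \<noteq> 0} \<subseteq> \<Omega>"
    "C_order 1 \<psi>" "continuous_on UNIV \<psi>" "bounded {x. \<psi> x \<noteq> 0}"
proof -
  show s: "smooth_fn \<psi>" and c: "compact (closure {x. \<psi> x \<noteq> 0})" "closure {x. \<psi> x \<noteq> 0} \<subseteq> \<Omega>"
    using assms by (auto simp: test_functions_def smooth_fn_def)
  show "C_order 1 \<psi>" using s smooth_fn_C_order by blast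
  show "continuous_on UNIV \<psi>" using smooth_fn_C_order[OF s, of 0] by simp
  show "bounded {x. \<psi> x \<noteq> 0}" using compact_imp_bounded[OF c(1)] bounded_subset closure_subset by blast
qed

lemma test_functionsI:
  assumes "smooth_fn \<psi>" "compact K" "K \<subseteq> \<Omega>" "\<And>x. \<psi> x \<noteq> 0 \<Longrightarrow> x \<in> K"
  shows "\<psi> \<in> test_functions \<Omega>"
proof -
  have "closure {x. \<psi> x \<noteq> 0} \<subseteq> K"
    using assms by (intro closure_minimal compact_imp_closed) auto
  moreover from this have "compact (closure {x. \<psi> x \<noteq> 0})"
    using assms(2) compact_Int_closed[of K "closure {x. \<psi> x \<noteq> 0}"] by (simp add: Int_absorb1)
  ultimately show ?thesis using assms by (auto simp: test_functions_def smooth_fn_def)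
qed

lemma test_functions_partial:
  assumes "\<psi> \<in> test_functions \<Omega>" shows "partial_deriv k \<psi> \<in> test_functions \<Omega>"
  by (rule test_functionsI[OF smooth_fn_partial test_functionsD(2,3)[OF assms]])
     (use test_functionsD(1)[OF assms] partial_deriv_support in auto)

lemma test_functions_diff:
  assumes "\<phi> \<in> test_functions \<Omega>" "\<psi> \<in> test_functions \<Omega>" shows "(\<lambda>x. \<phi> x - \<psi> x) \<in> test_functions \<Omega>"
proof (rule test_functionsI[OF smooth_fn_diff compact_Un[OF test_functionsD(2)[OF assms(1)] test_functionsD(2)[OF assms(2)]]])
  fix x assume "\<phi> x - \<psi> x \<noteq> 0"
  then have "x \<in> {x. \<phi> x \<noteq> 0} \<union> {x. \<psi> x \<noteq> 0}" by auto
  then show "x \<in> closure {x. \<phi> x \<noteq> 0} \<union> closure {x. \<psi> x \<noteq> 0}"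
    using closure_subset[of "{x. \<psi> x \<noteq> 0}"] closure_subset[of "{x. \<phi> x \<noteq> 0}"] by blast
qed (use test_functionsD(1,3)[OF assms(1)] test_functionsD(1,3)[OF assms(2)] in auto)

lemma lebesgue_on_integral_support:
  fixes f \<psi> :: "'a::euclidean_space \<Rightarrow> real"
  assumes "\<And>x. \<psi> x \<noteq> 0 \<Longrightarrow> x \<in> K" "K \<subseteq> S" "K \<in> sets lebesgue" "S \<in> sets lebesgue"
  shows "(\<integral>x. f x * \<psi> x \<partial>lebesgue_on S) = (\<integral>x. f x * \<psi> x \<partial>lebesgue_on K)"
proof -
  have "(\<lambda>x. indicator S x * (f x * \<psi> x)) = (\<lambda>x. indicator K x * (f x * \<psi> x))"
    using assms(1,2) by (force simp: indicator_def)
  then show ?thesis by (simp add: lebesgue_on_integral assms)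
qed

lemma AE_bounded_continuous_compact:
  fixes \<psi> :: "'a::euclidean_space \<Rightarrow> real"
  assumes "continuous_on UNIV \<psi>" "compact K"
  obtains B where "\<And>x. x \<in> K \<Longrightarrow> \<bar>\<psi> x\<bar> \<le> B" "AE x in lebesgue_on K. \<bar>\<psi> x\<bar> \<le> B" "\<psi> \<in> borel_measurable (lebesgue_on K)"
proof -
  have "bounded (\<psi> ` K)" by (intro compact_imp_bounded compact_continuous_image continuous_on_subset[OF assms(1)] assms) auto
  then obtain B where B: "\<And>x. x \<in> K \<Longrightarrow> \<bar>\<psi> x\<bar> \<le> B" by (auto simp: bounded_iff)
  moreover have "AE x in lebesgue_on K. \<bar>\<psi> x\<bar> \<le> B"
    using B by (intro AE_I2) (auto simp: space_restrict_space)
  moreover have "\<psi> \<in> borel_measurable (lebesgue_on K)"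
    using continuous_lebesgue_measurable[OF assms(1)] measurable_restrict_space1 by blast
  ultimately show ?thesis using that by blast
qed

lemma L2_loc_sq_int: "f \<in> L2_loc \<Omega> \<Longrightarrow> compact K \<Longrightarrow> K \<subseteq> \<Omega> \<Longrightarrow> sq_int (lebesgue_on K) f"
  by (simp add: L2_loc_def L2_on_iff)

text \<open>The closed neighbourhood is the sum of \<open>K\<close> and a closed ball, hence
  compact.\<close>

lemma compact_neighbourhood:
  fixes K :: "'a::euclidean_space set"
  assumes "compact K" "open \<Omega>" "K \<subseteq> \<Omega>"
  obtains \<delta> L where "\<delta> > 0" "compact L" "L \<subseteq> \<Omega>" "\<And>x. x \<in> K \<Longrightarrow> cball x \<delta> \<subseteq> L"
    "\<And>y. y \<in> L \<Longrightarrow> \<exists>x\<in>K. dist x y \<le> \<delta>"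
proof -
  obtain \<delta> where \<delta>: "\<delta> > 0" "(\<Union>x\<in>K. cball x \<delta>) \<subseteq> \<Omega>"
    using compact_subset_open_imp_cball_epsilon_subset[OF assms] by blast
  let ?L = "{x + y |x y. x \<in> K \<and> y \<in> cball 0 \<delta>}"
  have c: "compact ?L" by (rule compact_sums[OF assms(1) compact_cball])
  have 1: "cball x \<delta> \<subseteq> ?L" if "x \<in> K" for x
  proof
    fix y assume "y \<in> cball x \<delta>"
    then have "y = x + (y - x) \<and> x \<in> K \<and> y - x \<in> cball 0 \<delta>" using that by (simp add: dist_norm norm_minus_commute)
    then show "y \<in> ?L" by blast
  qed
  have 2: "\<exists>x\<in>K. dist x y \<le> \<delta>" if yL: "y \<in> ?L" for y
  proof -
    obtain x z where "y = x + z" "x \<in> K" "z \<in> cball 0 \<delta>" using yL by blast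
    then show ?thesis by (intro bexI[of _ x]) (auto simp: dist_norm)
  qed
  have "?L \<subseteq> \<Omega>" using 2 \<delta>(2) by fastforce
  then show ?thesis using that \<delta>(1) c 1 2 by blast
qed

text \<open>The test function is the reflected kernel \<open>moll \<epsilon> (x - y)\<close> as a
  function of \<open>y\<close>, which is supported in \<open>L\<close>. The sign produced by the
  reflection cancels the one in the definition of the weak derivative.\<close>

lemma weak_deriv_convol:
  fixes f g :: "real^'n \<Rightarrow> real"
  assumes w: "is_weak_deriv \<Omega> k f g" and \<Omega>: "open \<Omega>" and L: "compact L" "L \<subseteq> \<Omega>" and x: "cball x \<epsilon> \<subseteq> L" and eps: "\<epsilon> > 0"
  shows "convol (\<lambda>y. indicator L y * f y) (partial_deriv k (moll \<epsilon>)) x = convol (\<lambda>y. indicator L y * g y) (moll \<epsilon>) x"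
proof -
  define \<psi> where "\<psi> y = moll \<epsilon> (x + (-1) *\<^sub>R y)" for y
  have sm: "smooth_fn \<psi>" unfolding \<psi>_def by (intro smooth_fn_affine smooth_moll)
  have supp: "y \<in> cball x \<epsilon>" if "\<psi> y \<noteq> 0" for y
    using moll_support[OF eps, of "x - y"] that by (simp add: \<psi>_def dist_norm)
  have t: "\<psi> \<in> test_functions \<Omega>"
    by (rule test_functionsI[OF sm compact_cball _ supp]) (use x L in auto)
  have d: "partial_deriv k \<psi> y = - partial_deriv k (moll \<epsilon>) (x - y)" for y
    unfolding \<psi>_def using partial_deriv_affine[where f="moll \<epsilon>" and a=x and c="-1" and x=y and k=k,
        OF C_order_1_differentiable[OF moll_C1]] by simp
  have Ls: "L \<in> sets lebesgue" using L by (simp add: compact_imp_closed)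
  have \<Omega>s: "\<Omega> \<in> sets lebesgue" using \<Omega> by simp
  have sL: "y \<in> L" if "\<psi> y \<noteq> 0" for y using supp that x by blast
  have sL': "y \<in> L" if "partial_deriv k \<psi> y \<noteq> 0" for y
  proof -
    have "closure {y. \<psi> y \<noteq> 0} \<subseteq> L" using sL L by (intro closure_minimal compact_imp_closed) auto
    then show ?thesis using partial_deriv_support[OF that] by blast
  qed
  have "(\<integral>y. f y * partial_deriv k \<psi> y \<partial>lebesgue_on \<Omega>) = - (\<integral>y. g y * \<psi> y \<partial>lebesgue_on \<Omega>)"
    using w t by (simp add: is_weak_deriv_def)
  also have "(\<integral>y. f y * partial_deriv k \<psi> y \<partial>lebesgue_on \<Omega>) = (\<integral>y. f y * partial_deriv k \<psi> y \<partial>lebesgue_on L)"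
    by (rule lebesgue_on_integral_support[OF sL' L(2) Ls \<Omega>s])
  also have "\<dots> = - convol (\<lambda>y. indicator L y * f y) (partial_deriv k (moll \<epsilon>)) x"
    by (simp add: lebesgue_on_integral[OF Ls] convol_def d mult.assoc)
  also have "(\<integral>y. g y * \<psi> y \<partial>lebesgue_on \<Omega>) = (\<integral>y. g y * \<psi> y \<partial>lebesgue_on L)"
    by (rule lebesgue_on_integral_support[OF sL L(2) Ls \<Omega>s])
  also have "\<dots> = convol (\<lambda>y. indicator L y * g y) (moll \<epsilon>) x"
    by (simp add: lebesgue_on_integral[OF Ls] convol_def \<psi>_def mult.assoc)
  finally show ?thesis by simp
qed

lemma compact_bounded_norm:
  assumes "compact L" obtains R where "\<And>x. x \<in> L \<Longrightarrow> norm x \<le> R"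
  using compact_imp_bounded[OF assms] by (auto simp: bounded_iff)

text \<open>\<open>f\<close> need not be square-integrable on \<open>\<Omega>\<close>, so it is cut
  off to a compact neighbourhood \<open>L\<close> of \<open>K\<close> before it is mollified; on
  \<open>K\<close> the kernel does not reach beyond \<open>L\<close>. One sequence \<open>u\<close>
  serves all directions and all versions of the weak derivatives.\<close>

lemma local_smooth_approximation:
  fixes f :: "real^'n \<Rightarrow> real"
  assumes f: "f \<in> L2_loc \<Omega>" and \<Omega>: "open \<Omega>" and K: "compact K" "K \<subseteq> \<Omega>"
  obtains u where "\<And>n. smooth_fn (u n)" "L2_lim (lebesgue_on K) u f"
    "\<And>k g. is_weak_deriv \<Omega> k f g \<Longrightarrow> L2_lim (lebesgue_on K) (\<lambda>n. partial_deriv k (u n)) g"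
proof -
  obtain \<delta> L where \<delta>: "\<delta> > 0" and L: "compact L" "L \<subseteq> \<Omega>" and KL: "\<And>x. x \<in> K \<Longrightarrow> cball x \<delta> \<subseteq> L"
    using compact_neighbourhood[OF K(1) \<Omega> K(2)] by metis
  define e where "e n = min \<delta> 1 / real (n + 1)" for n
  have e: "\<And>n. 0 < e n" "\<And>n. e n \<le> 1" "\<And>n. e n \<le> \<delta>"
  proof -
    fix n
    show "0 < e n" using \<delta> by (simp add: e_def)
    have "min \<delta> 1 / real (n + 1) \<le> min \<delta> 1 / 1" using \<delta> by (intro divide_left_mono) auto
    then have "e n \<le> min \<delta> 1" by (simp add: e_def)
    then show "e n \<le> 1" "e n \<le> \<delta>" by auto
  qed
  have e0: "e \<longlonglongrightarrow> 0" unfolding e_def using LIMSEQ_Suc[OF lim_const_over_n[of "min \<delta> 1"]] by simp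
  have Ls: "L \<in> sets lebesgue" "K \<in> sets lebesgue" using L K by (simp_all add: compact_imp_closed)
  have KsL: "K \<subseteq> L" using KL \<delta> by fastforce
  obtain R where R: "\<And>x. x \<in> L \<Longrightarrow> norm x \<le> R" using compact_bounded_norm[OF L(1)] by blast
  define u where "u n = convol (\<lambda>x. indicator L x * f x) (moll (e n))" for n
  have lim: "L2_lim (lebesgue_on K) (\<lambda>n. convol (\<lambda>x. indicator L x * h x) (moll (e n))) h"
    and int: "integrable lebesgue (\<lambda>x. indicator L x * h x)" if "h \<in> L2_loc \<Omega>" for h
  proof -
    have s: "sq_int lebesgue (\<lambda>x. indicator L x * h x)"
      using L2_loc_sq_int[OF that L] by (simp add: sq_int_lebesgue_on_iff[OF Ls(1)])
    have R': "norm x \<le> R" if "indicator L x * h x \<noteq> 0" for x using R that by (auto simp: indicator_def split: if_splits)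
    show "integrable lebesgue (\<lambda>x. indicator L x * h x)" by (rule sq_int_bounded_support_integrable[OF s R'])
    have "L2_lim lebesgue (\<lambda>n. convol (\<lambda>x. indicator L x * h x) (moll (e n))) (\<lambda>x. indicator L x * h x)"
      by (rule moll_L2_lim[OF s R' e(1,2) e0])
    then have "L2_lim (lebesgue_on K) (\<lambda>n. convol (\<lambda>x. indicator L x * h x) (moll (e n))) (\<lambda>x. indicator L x * h x)"
      using L2_lim_lebesgue_on_subset[of UNIV _ _ K] Ls by (simp add: lebesgue_on_UNIV_eq)
    then show "L2_lim (lebesgue_on K) (\<lambda>n. convol (\<lambda>x. indicator L x * h x) (moll (e n))) h"
      by (rule L2_lim_cong_on) (use KsL in auto)
  qed
  show ?thesis
  proof
    show "smooth_fn (u n)" for n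
      unfolding u_def by (rule smooth_fn_convol[OF int[OF f] smooth_moll moll_bounded_support[OF e(1)]])
    show "L2_lim (lebesgue_on K) u f" using lim[OF f] by (simp add: u_def[abs_def])
    fix k g assume w: "is_weak_deriv \<Omega> k f g"
    then have "g \<in> L2_loc \<Omega>" by (simp add: is_weak_deriv_def)
    from lim[OF this] show "L2_lim (lebesgue_on K) (\<lambda>n. partial_deriv k (u n)) g"
    proof (rule L2_lim_cong_on)
      fix n x assume x: "x \<in> K"
      have "partial_deriv k (u n) x = convol (\<lambda>x. indicator L x * f x) (partial_deriv k (moll (e n))) x"
        unfolding u_def by (simp only: partial_deriv_convol[OF int[OF f] moll_C1 moll_bounded_support[OF e(1)]])
      also have "\<dots> = convol (\<lambda>x. indicator L x * g x) (moll (e n)) x"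
        by (rule weak_deriv_convol[OF w \<Omega> L]) (use KL[OF x] e(3)[of n] e(1) in auto)
      finally show "convol (\<lambda>x. indicator L x * g x) (moll (e n)) x = partial_deriv k (u n) x" by simp
    qed simp
  qed
qed

text \<open>For support in \<open>K\<close>, mollification commutes with weak derivatives at every
  point: near \<open>K\<close> by \<open>weak_deriv_convol\<close>, and elsewhere because the kernel
  does not meet \<open>K\<close>, so that both sides vanish.\<close>

lemma global_smooth_approximation:
  fixes f :: "real^'n \<Rightarrow> real"
  assumes w: "\<And>k. is_weak_deriv \<Omega> k f (g k)" and \<Omega>: "open \<Omega>" and K: "compact K" "K \<subseteq> \<Omega>"
    and f0: "\<And>x. x \<notin> K \<Longrightarrow> f x = 0" and g0: "\<And>k x. x \<notin> K \<Longrightarrow> g k x = 0"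
  obtains u where "\<And>n. u n \<in> test_functions \<Omega>" "L2_lim (lebesgue_on \<Omega>) u f"
    "\<And>k. L2_lim (lebesgue_on \<Omega>) (\<lambda>n. partial_deriv k (u n)) (g k)"
proof -
  obtain \<delta> L where \<delta>: "\<delta> > 0" and L: "compact L" "L \<subseteq> \<Omega>" and KL: "\<And>x. x \<in> K \<Longrightarrow> cball x \<delta> \<subseteq> L"
    using compact_neighbourhood[OF K(1) \<Omega> K(2)] by metis
  \<comment> \<open>The radius is halved because the kernel is also centred at points outside
    \<open>K\<close>: if such a point is within \<open>e n\<close> of \<open>K\<close>, the ball of
    radius \<open>e n\<close> about it must still lie in \<open>L\<close>.\<close>
  define e where "e n = min \<delta> 1 / 2 / real (n + 1)" for n
  have e: "\<And>n. 0 < e n" "\<And>n. e n \<le> 1" "\<And>n. 2 * e n \<le> \<delta>"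
  proof -
    fix n
    show "0 < e n" using \<delta> by (simp add: e_def)
    have "min \<delta> 1 / 2 / real (n + 1) \<le> min \<delta> 1 / 2 / 1" using \<delta> by (intro divide_left_mono) auto
    then have "e n \<le> min \<delta> 1 / 2" by (simp add: e_def)
    then show "e n \<le> 1" "2 * e n \<le> \<delta>" by auto
  qed
  have e0: "e \<longlonglongrightarrow> 0" unfolding e_def using LIMSEQ_Suc[OF lim_const_over_n[of "min \<delta> 1 / 2"]] by simp
  have Ks: "K \<in> sets lebesgue" "L \<in> sets lebesgue" "\<Omega> \<in> sets lebesgue" using L K \<Omega> by (simp_all add: compact_imp_closed)
  have KsL: "K \<subseteq> L" using KL \<delta> by fastforce
  obtain R where R: "\<And>x. x \<in> K \<Longrightarrow> norm x \<le> R" using compact_bounded_norm[OF K(1)] by blast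
  define u where "u n = convol f (moll (e n))" for n
  have lim: "L2_lim (lebesgue_on \<Omega>) (\<lambda>n. convol h (moll (e n))) h"
    and int: "integrable lebesgue h" if h: "h \<in> L2_loc \<Omega>" "\<And>x. x \<notin> K \<Longrightarrow> h x = 0" for h
  proof -
    have "sq_int lebesgue (\<lambda>x. indicator K x * h x)"
      using L2_loc_sq_int[OF h(1) K] by (simp add: sq_int_lebesgue_on_iff[OF Ks(1)])
    also have "(\<lambda>x. indicator K x * h x) = h" using h(2) by (force simp: indicator_def)
    finally have s: "sq_int lebesgue h" .
    have R': "norm x \<le> R" if "h x \<noteq> 0" for x using R h that by blast
    show "integrable lebesgue h" by (rule sq_int_bounded_support_integrable[OF s R'])
    have "L2_lim lebesgue (\<lambda>n. convol h (moll (e n))) h"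
      by (rule moll_L2_lim[OF s R' e(1,2) e0])
    then show "L2_lim (lebesgue_on \<Omega>) (\<lambda>n. convol h (moll (e n))) h"
      using L2_lim_lebesgue_on_subset[of UNIV _ _ \<Omega>] Ks by (simp add: lebesgue_on_UNIV_eq)
  qed
  have f: "f \<in> L2_loc \<Omega>" and g: "g k \<in> L2_loc \<Omega>" for k using w by (auto simp: is_weak_deriv_def)
  have fi: "integrable lebesgue f" by (rule int[OF f f0])
  have ind: "(\<lambda>y. indicator L y * f y) = f" "(\<lambda>y. indicator L y * g k y) = g k" for k
  proof -
    have "indicator L y * h y = h y" if "\<And>x. x \<notin> K \<Longrightarrow> h x = 0" for h :: "real^'n \<Rightarrow> real" and y
      using that[of y] KsL by (cases "y \<in> K") auto
    from this[of f] this[of "g k"] f0 g0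
    show "(\<lambda>y. indicator L y * f y) = f" "(\<lambda>y. indicator L y * g k y) = g k" by auto
  qed
  show ?thesis
  proof
    show "u n \<in> test_functions \<Omega>" for n
      unfolding u_def
    proof (rule test_functionsI[OF smooth_fn_convol[OF fi smooth_moll moll_bounded_support[OF e(1)]] L])
      fix x assume "convol f (moll (e n)) x \<noteq> 0"
      then obtain y where y: "f y \<noteq> 0" "moll (e n) (x - y) \<noteq> 0" using convol_support by blast
      have "y \<in> K" using y(1) f0 by blast
      moreover have "dist y x \<le> \<delta>"
        using moll_support[OF e(1) y(2)] e(3)[of n] e(1)[of n] by (simp add: dist_norm norm_minus_commute)
      ultimately have "y \<in> K" "x \<in> cball y \<delta>" by auto
      then show "x \<in> L" using KL by blast
    qed
    show "L2_lim (lebesgue_on \<Omega>) u f" using lim[OF f f0] by (simp add: u_def[abs_def])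
    fix k
    have "partial_deriv k (u n) x = convol (g k) (moll (e n)) x" for n x
    proof -
      have 1: "partial_deriv k (u n) x = convol f (partial_deriv k (moll (e n))) x"
        unfolding u_def by (simp only: partial_deriv_convol[OF fi moll_C1 moll_bounded_support[OF e(1)]])
      show ?thesis
      proof (cases "\<exists>y\<in>K. dist y x \<le> e n")
        case True
        then obtain y where y: "y \<in> K" "dist y x \<le> e n" by blast
        have "cball x (e n) \<subseteq> cball y \<delta>"
        proof
          fix z assume "z \<in> cball x (e n)"
          then show "z \<in> cball y \<delta>" using dist_triangle[of y z x] y(2) e(3)[of n] by simp
        qed
        then have "cball x (e n) \<subseteq> L" using KL[OF y(1)] by blast
        from weak_deriv_convol[OF w \<Omega> L this e(1)] show ?thesis by (simp add: 1 ind)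
      next
        case False
        have z: "convol h \<eta> x = 0" if h: "\<And>x. x \<notin> K \<Longrightarrow> h x = 0" and \<eta>: "\<And>z. \<eta> z \<noteq> 0 \<Longrightarrow> norm z \<le> e n" for h \<eta>
        proof (rule ccontr)
          assume "convol h \<eta> x \<noteq> 0"
          then obtain y where "h y \<noteq> 0" "\<eta> (x - y) \<noteq> 0" using convol_support by blast
          then have "y \<in> K" "dist y x \<le> e n" using h \<eta> by (auto simp: dist_norm norm_minus_commute)
          then show False using False by blast
        qed
        have "closure {z::real^'n. moll (e n) z \<noteq> 0} \<subseteq> cball 0 (e n)"
        proof (rule closure_minimal)
          show "{z::real^'n. moll (e n) z \<noteq> 0} \<subseteq> cball 0 (e n)"
          proof
            fix z :: "real^'n" assume "z \<in> {z. moll (e n) z \<noteq> 0}"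
            then show "z \<in> cball 0 (e n)" using moll_support[OF e(1), of n z] by simp
          qed
        qed simp
        then have "norm z \<le> e n" if "partial_deriv k (moll (e n)) z \<noteq> 0" for z
          using partial_deriv_support[OF that] by auto
        then have "convol f (partial_deriv k (moll (e n))) x = 0" using z f0 by blast
        moreover have "convol (g k) (moll (e n)) x = 0"
          using z[of "g k" "moll (e n)"] g0 moll_support[OF e(1)] less_imp_le by blast
        ultimately show ?thesis by (simp add: 1)
      qed
    qed
    then show "L2_lim (lebesgue_on \<Omega>) (\<lambda>n. partial_deriv k (u n)) (g k)"
      using lim[OF g g0, of k] by presburger
  qed
qed

text \<open>Only convergence after pairing with the given test function is asked for, and
  \<open>u\<close> may depend on that function. The chain rule needs this generality, since there
  the derivatives of the approximants are treated only after such a pairing.\<close>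

lemma is_weak_deriv_limit:
  fixes f g :: "real^'n \<Rightarrow> real"
  assumes fg: "f \<in> L2_loc \<Omega>" "g \<in> L2_loc \<Omega>" and \<Omega>: "open \<Omega>"
    and lim: "\<And>\<psi> K. \<psi> \<in> test_functions \<Omega> \<Longrightarrow> compact K \<Longrightarrow> K \<subseteq> \<Omega> \<Longrightarrow> (\<And>x. \<psi> x \<noteq> 0 \<Longrightarrow> x \<in> K) \<Longrightarrow>
      \<exists>u. (\<forall>n. C_order 1 (u n)) \<and>
        (\<lambda>n. \<integral>x. u n x * partial_deriv k \<psi> x \<partial>lebesgue_on K) \<longlonglongrightarrow> (\<integral>x. f x * partial_deriv k \<psi> x \<partial>lebesgue_on K) \<and>
        (\<lambda>n. \<integral>x. partial_deriv k (u n) x * \<psi> x \<partial>lebesgue_on K) \<longlonglongrightarrow> (\<integral>x. g x * \<psi> x \<partial>lebesgue_on K)"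
  shows "is_weak_deriv \<Omega> k f g"
  unfolding is_weak_deriv_def
proof (intro conjI fg ballI)
  fix \<psi> assume \<psi>: "\<psi> \<in> test_functions \<Omega>"
  let ?K = "closure {x. \<psi> x \<noteq> 0}"
  note D = test_functionsD[OF \<psi>]
  have sK: "\<psi> x \<noteq> 0 \<Longrightarrow> x \<in> ?K" for x using closure_subset[of "{x. \<psi> x \<noteq> 0}"] by auto
  have s: "?K \<in> sets lebesgue" "\<Omega> \<in> sets lebesgue" using D(2) \<Omega> by (auto simp: compact_imp_closed)
  obtain u where u: "\<And>n. C_order 1 (u n)"
        "(\<lambda>n. \<integral>x. u n x * partial_deriv k \<psi> x \<partial>lebesgue_on ?K) \<longlonglongrightarrow> (\<integral>x. f x * partial_deriv k \<psi> x \<partial>lebesgue_on ?K)"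
        "(\<lambda>n. \<integral>x. partial_deriv k (u n) x * \<psi> x \<partial>lebesgue_on ?K) \<longlonglongrightarrow> (\<integral>x. g x * \<psi> x \<partial>lebesgue_on ?K)"
    using lim[OF \<psi> D(2,3) sK] by blast
  have to_lborel: "(\<integral>x. a x * b x \<partial>lebesgue_on ?K) = (\<integral>x. a x * b x \<partial>lborel)"
    if "continuous_on UNIV a" "continuous_on UNIV b" "\<And>x. b x \<noteq> 0 \<Longrightarrow> x \<in> ?K" for a b :: "real^'n \<Rightarrow> real"
  proof -
    have "(\<integral>x. a x * b x \<partial>lebesgue_on ?K) = (\<integral>x. a x * b x \<partial>lebesgue_on UNIV)"
      using lebesgue_on_integral_support[OF that(3), where S=UNIV and f=a] s by simp
    also have "\<dots> = (\<integral>x. a x * b x \<partial>lborel)"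
      using borel_measurable_continuous_onI[OF continuous_on_mult[OF that(1,2)]]
      by (simp add: lebesgue_on_UNIV_eq integral_completion)
    finally show ?thesis .
  qed
  have "(\<integral>x. u n x * partial_deriv k \<psi> x \<partial>lebesgue_on ?K) = - (\<integral>x. partial_deriv k (u n) x * \<psi> x \<partial>lebesgue_on ?K)" for n
  proof -
    have "(\<integral>x. u n x * partial_deriv k \<psi> x \<partial>lebesgue_on ?K) = (\<integral>x. u n x * partial_deriv k \<psi> x \<partial>lborel)"
      by (rule to_lborel[OF C_order_1_continuous[OF u(1)] C_order_1_continuous_partial[OF D(4)] partial_deriv_support])
    moreover have "(\<integral>x. partial_deriv k (u n) x * \<psi> x \<partial>lebesgue_on ?K) = (\<integral>x. partial_deriv k (u n) x * \<psi> x \<partial>lborel)"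
      by (rule to_lborel[OF C_order_1_continuous_partial[OF u(1)] D(5) sK])
    ultimately show ?thesis using integral_by_parts[OF u(1) D(4,6), of n k] by argo
  qed
  then have "(\<lambda>n. \<integral>x. u n x * partial_deriv k \<psi> x \<partial>lebesgue_on ?K) \<longlonglongrightarrow> - (\<integral>x. g x * \<psi> x \<partial>lebesgue_on ?K)"
    using tendsto_minus[OF u(3)] by simp
  with u(2) have "(\<integral>x. f x * partial_deriv k \<psi> x \<partial>lebesgue_on ?K) = - (\<integral>x. g x * \<psi> x \<partial>lebesgue_on ?K)"
    using LIMSEQ_unique by blast
  moreover have "(\<integral>x. f x * partial_deriv k \<psi> x \<partial>lebesgue_on \<Omega>) = (\<integral>x. f x * partial_deriv k \<psi> x \<partial>lebesgue_on ?K)"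
    by (rule lebesgue_on_integral_support[OF partial_deriv_support D(3) s])
  ultimately show "(\<integral>x. f x * partial_deriv k \<psi> x \<partial>lebesgue_on \<Omega>) = - (\<integral>x. g x * \<psi> x \<partial>lebesgue_on \<Omega>)"
    using lebesgue_on_integral_support[OF sK D(3) s, where f=g] by simp
qed

lemma is_weak_deriv_L2_limit:
  fixes f g :: "real^'n \<Rightarrow> real"
  assumes fg: "f \<in> L2_loc \<Omega>" "g \<in> L2_loc \<Omega>" and \<Omega>: "open \<Omega>"
    and lim: "\<And>K. compact K \<Longrightarrow> K \<subseteq> \<Omega> \<Longrightarrow> \<exists>u. (\<forall>n. C_order 1 (u n)) \<and> L2_lim (lebesgue_on K) u f \<and>
       L2_lim (lebesgue_on K) (\<lambda>n. partial_deriv k (u n)) g"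
  shows "is_weak_deriv \<Omega> k f g"
proof (rule is_weak_deriv_limit[OF fg \<Omega>])
  fix \<psi> K assume \<psi>: "\<psi> \<in> test_functions \<Omega>" and K: "compact K" "K \<subseteq> \<Omega>"
  obtain u where u: "\<And>n. C_order 1 (u n)" "L2_lim (lebesgue_on K) u f"
       "L2_lim (lebesgue_on K) (\<lambda>n. partial_deriv k (u n)) g" using lim[OF K] by blast
  have "sq_int (lebesgue_on K) \<psi>" "sq_int (lebesgue_on K) (partial_deriv k \<psi>)"
    using test_functionsD(5)[OF \<psi>] test_functionsD(5)[OF test_functions_partial[OF \<psi>]] K
    by (auto intro: sq_int_continuous_compact)
  then show "\<exists>u. (\<forall>n. C_order 1 (u n)) \<and>
        (\<lambda>n. \<integral>x. u n x * partial_deriv k \<psi> x \<partial>lebesgue_on K) \<longlonglongrightarrow> (\<integral>x. f x * partial_deriv k \<psi> x \<partial>lebesgue_on K) \<and>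
        (\<lambda>n. \<integral>x. partial_deriv k (u n) x * \<psi> x \<partial>lebesgue_on K) \<longlonglongrightarrow> (\<integral>x. g x * \<psi> x \<partial>lebesgue_on K)"
    using u L2_lim_inner by blast
qed

lemma continuous_L2_loc: "continuous_on UNIV f \<Longrightarrow> f \<in> L2_loc \<Omega>"
  by (simp add: L2_loc_def L2_on_iff sq_int_continuous_compact)

lemma is_weak_deriv_C1:
  fixes f :: "real^'n \<Rightarrow> real"
  assumes "C_order 1 f" "open \<Omega>"
  shows "is_weak_deriv \<Omega> k f (partial_deriv k f)"
proof (rule is_weak_deriv_limit)
  show "f \<in> L2_loc \<Omega>" "partial_deriv k f \<in> L2_loc \<Omega>"
    using assms by (auto intro: continuous_L2_loc C_order_1_continuous C_order_1_continuous_partial simp del: One_nat_def)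
qed (use assms in \<open>auto intro!: exI[of _ "\<lambda>n. f"]\<close>)

lemma L2_loc_continuous_mult:
  assumes "f \<in> L2_loc \<Omega>" "continuous_on UNIV \<eta>" shows "(\<lambda>x. \<eta> x * f x) \<in> L2_loc \<Omega>"
  unfolding L2_loc_def L2_on_iff mem_Collect_eq
proof (intro allI impI)
  fix K assume K: "compact K \<and> K \<subseteq> \<Omega>"
  obtain B where "AE x in lebesgue_on K. \<bar>\<eta> x\<bar> \<le> B" "\<eta> \<in> borel_measurable (lebesgue_on K)"
    using AE_bounded_continuous_compact[OF assms(2), of K] K by blast
  then show "sq_int (lebesgue_on K) (\<lambda>x. \<eta> x * f x)"
    using L2_loc_sq_int[OF assms(1)] K by (intro sq_int_bounded_mult[where B=B]) auto
qed

lemma L2_loc_add: "f \<in> L2_loc \<Omega> \<Longrightarrow> g \<in> L2_loc \<Omega> \<Longrightarrow> (\<lambda>x. f x + g x) \<in> L2_loc \<Omega>"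
  by (auto simp: L2_loc_def L2_on_iff intro: sq_int_add)

lemma is_weak_deriv_smooth_mult:
  fixes f g :: "real^'n \<Rightarrow> real"
  assumes w: "is_weak_deriv \<Omega> k f g" and \<Omega>: "open \<Omega>" and \<eta>: "smooth_fn \<eta>"
  shows "is_weak_deriv \<Omega> k (\<lambda>x. \<eta> x * f x) (\<lambda>x. \<eta> x * g x + partial_deriv k \<eta> x * f x)"
proof (rule is_weak_deriv_L2_limit[OF _ _ \<Omega>])
  have f: "f \<in> L2_loc \<Omega>" and g: "g \<in> L2_loc \<Omega>" using w by (auto simp: is_weak_deriv_def)
  note c1 = smooth_fn_C_order[OF \<eta>, of 1]
  note c = C_order_1_continuous[OF c1] C_order_1_continuous_partial[OF c1, of k]
  show "(\<lambda>x. \<eta> x * f x) \<in> L2_loc \<Omega>" "(\<lambda>x. \<eta> x * g x + partial_deriv k \<eta> x * f x) \<in> L2_loc \<Omega>"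
    using c f g by (auto intro: L2_loc_continuous_mult L2_loc_add)
  fix K assume K: "compact K" "K \<subseteq> \<Omega>"
  obtain u where u: "\<And>n. smooth_fn (u n)" "L2_lim (lebesgue_on K) u f"
    "L2_lim (lebesgue_on K) (\<lambda>n. partial_deriv k (u n)) g"
    using local_smooth_approximation[OF f \<Omega> K] w by metis
  have pd: "partial_deriv k (\<lambda>x. \<eta> x * u n x) = (\<lambda>x. \<eta> x * partial_deriv k (u n) x + partial_deriv k \<eta> x * u n x)" for n
    using C_order_1_differentiable[OF smooth_fn_C_order[OF u(1)]] C_order_1_differentiable[OF c1]
    by (simp add: fun_eq_iff partial_deriv_mult)
  obtain B1 where B1: "AE x in lebesgue_on K. \<bar>\<eta> x\<bar> \<le> B1" "\<eta> \<in> borel_measurable (lebesgue_on K)"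
    using AE_bounded_continuous_compact[OF c(1) K(1)] by blast
  obtain B2 where B2: "AE x in lebesgue_on K. \<bar>partial_deriv k \<eta> x\<bar> \<le> B2" "partial_deriv k \<eta> \<in> borel_measurable (lebesgue_on K)"
    using AE_bounded_continuous_compact[OF c(2) K(1)] by blast
  have "L2_lim (lebesgue_on K) (\<lambda>n x. \<eta> x * u n x) (\<lambda>x. \<eta> x * f x)"
    by (rule L2_lim_bounded_mult[OF u(2) B1(2,1)])
  moreover have "L2_lim (lebesgue_on K) (\<lambda>n. partial_deriv k (\<lambda>x. \<eta> x * u n x)) (\<lambda>x. \<eta> x * g x + partial_deriv k \<eta> x * f x)"
    unfolding pd by (rule L2_lim_add[OF L2_lim_bounded_mult[OF u(3) B1(2,1)] L2_lim_bounded_mult[OF u(2) B2(2,1)]])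
  ultimately show "\<exists>u. (\<forall>n. C_order 1 (u n)) \<and> L2_lim (lebesgue_on K) u (\<lambda>x. \<eta> x * f x) \<and>
       L2_lim (lebesgue_on K) (\<lambda>n. partial_deriv k (u n)) (\<lambda>x. \<eta> x * g x + partial_deriv k \<eta> x * f x)"
    using smooth_fn_C_order[OF smooth_fn_mult[OF \<eta> u(1)]] by (intro exI[of _ "\<lambda>n x. \<eta> x * u n x"]) blast
qed

lemma AE_lebesgue_on_open_compacts:
  fixes \<Omega> :: "(real^'n) set"
  assumes \<Omega>: "open \<Omega>" and K: "\<And>K. compact K \<Longrightarrow> K \<subseteq> \<Omega> \<Longrightarrow> AE x in lebesgue_on K. P x"
  shows "AE x in lebesgue_on \<Omega>. P x"
proof -
  obtain C where C: "\<And>n::nat. compact (C n)" "\<And>n. C n \<subseteq> \<Omega>" "\<Union>(range C) = \<Omega>"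
    using open_Union_compact_subsets[OF \<Omega>] by metis
  have "AE x in lebesgue. x \<in> C n \<longrightarrow> P x" for n
    using K[OF C(1,2), of n] C(1)[of n] by (simp add: AE_restrict_space_iff compact_imp_closed)
  then have "AE x in lebesgue. \<forall>n. x \<in> C n \<longrightarrow> P x" by (subst AE_all_countable) blast
  then have "AE x in lebesgue. x \<in> \<Omega> \<longrightarrow> P x" by eventually_elim (use C(3) in blast)
  then show ?thesis using \<Omega> by (simp add: AE_restrict_space_iff)
qed

text \<open>On each compact set both functions are L2 limits of the derivatives of one and the same
  sequence of smooth functions.\<close>

lemma is_weak_deriv_unique:
  fixes f g :: "real^'n \<Rightarrow> real"
  assumes w: "is_weak_deriv \<Omega> k f g" "is_weak_deriv \<Omega> k f g'" and \<Omega>: "open \<Omega>"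
  shows "AE x in lebesgue_on \<Omega>. g x = g' x"
proof (rule AE_lebesgue_on_open_compacts[OF \<Omega>])
  fix K assume K: "compact K" "K \<subseteq> \<Omega>"
  have f: "f \<in> L2_loc \<Omega>" using w by (simp add: is_weak_deriv_def)
  obtain u where "L2_lim (lebesgue_on K) (\<lambda>n. partial_deriv k (u n)) g" "L2_lim (lebesgue_on K) (\<lambda>n. partial_deriv k (u n)) g'"
    using local_smooth_approximation[OF f \<Omega> K] w by metis
  then show "AE x in lebesgue_on K. g x = g' x" by (rule L2_lim_unique)
qed

lemma L2_lim_Lipschitz:
  assumes u: "L2_lim M u f" and G: "\<And>a b. \<bar>G a - G b\<bar> \<le> B * \<bar>a - b\<bar>"
    and s: "\<And>n. sq_int M (\<lambda>x. G (u n x))" "sq_int M (\<lambda>x. G (f x))"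
  shows "L2_lim M (\<lambda>n x. G (u n x)) (\<lambda>x. G (f x))"
proof (rule L2_lim_bound[OF s])
  have sd: "sq_int M (\<lambda>x. u n x - f x)" for n using u by (auto simp: L2_lim_def intro: sq_int_diff)
  show "(\<integral>x. (G (u n x) - G (f x))\<^sup>2 \<partial>M) \<le> B\<^sup>2 * (\<integral>x. (u n x - f x)\<^sup>2 \<partial>M)" for n
  proof -
    have "(\<integral>x. (G (u n x) - G (f x))\<^sup>2 \<partial>M) \<le> (\<integral>x. B\<^sup>2 * (u n x - f x)\<^sup>2 \<partial>M)"
    proof (rule integral_mono)
      show "integrable M (\<lambda>x. (G (u n x) - G (f x))\<^sup>2)" using sq_int_diff[OF s(1) s(2)] by (simp add: sq_int_def)
      show "(G (u n x) - G (f x))\<^sup>2 \<le> B\<^sup>2 * (u n x - f x)\<^sup>2" for x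
        using power_mono[OF G[of "u n x" "f x"], of 2] by (simp add: power_mult_distrib)
    qed (use sd in \<open>auto simp: sq_int_def\<close>)
    then show ?thesis by simp
  qed
  show "(\<lambda>n. B\<^sup>2 * (\<integral>x. (u n x - f x)\<^sup>2 \<partial>M)) \<longlonglongrightarrow> 0"
    using u by (auto simp: L2_lim_def intro!: tendsto_eq_intros)
qed

text \<open>For smooth approximants \<open>u n\<close>, the product
  \<open>G' (u n) * partial_deriv k (u n)\<close> splits into \<open>G' (u n) * g\<close> and a
  remainder. The first part, tested with \<open>\<psi>\<close>, converges because
  \<open>G' (u n)\<close> converges in L2 by the Lipschitz condition on \<open>G'\<close>, while
  \<open>\<psi> * g\<close> is fixed in L2; the remainder tends to 0 in L2 because \<open>G'\<close>
  is bounded. The condition \<open>G 0 = 0\<close> turns the Lipschitz condition on \<open>G\<close>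
  into a bound of \<open>G (v x)\<close> by a multiple of \<open>v x\<close>.\<close>

lemma is_weak_deriv_chain:
  fixes f g :: "real^'n \<Rightarrow> real"
  assumes w: "is_weak_deriv \<Omega> k f g" and \<Omega>: "open \<Omega>"
    and G: "\<And>t. (G has_real_derivative G' t) (at t)" "continuous_on UNIV G'"
    and B: "\<And>t. \<bar>G' t\<bar> \<le> B" "\<And>a b. \<bar>G a - G b\<bar> \<le> B * \<bar>a - b\<bar>" "\<And>a b. \<bar>G' a - G' b\<bar> \<le> B * \<bar>a - b\<bar>" "G 0 = 0"
  shows "is_weak_deriv \<Omega> k (\<lambda>x. G (f x)) (\<lambda>x. G' (f x) * g x)"
proof (rule is_weak_deriv_limit[OF _ _ \<Omega>])
  have f: "f \<in> L2_loc \<Omega>" and g: "g \<in> L2_loc \<Omega>" using w by (auto simp: is_weak_deriv_def)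
  have Gm [measurable]: "G' \<in> borel_measurable borel" "G \<in> borel_measurable borel"
  proof -
    have "isCont G t" for t using G(1) DERIV_isCont by blast
    then show "G \<in> borel_measurable borel"
      by (intro borel_measurable_continuous_onI continuous_at_imp_continuous_on) blast
  qed (rule borel_measurable_continuous_onI[OF G(2)])
  have sG: "sq_int M (\<lambda>x. G (v x))" if "sq_int M v" for M :: "(real^'n) measure" and v
    by (rule sq_int_bound[OF that, where B=B]) (use that B(2)[of _ 0] B(4) in \<open>auto simp: sq_int_def\<close>)
  have sG': "sq_int M (\<lambda>x. G' (v x) * h x)" if "v \<in> borel_measurable M" "sq_int M h" for M :: "(real^'n) measure" and v h
    by (rule sq_int_bounded_mult[OF that(2), where B=B]) (use that B(1) in auto)
  show "(\<lambda>x. G (f x)) \<in> L2_loc \<Omega>" using f by (auto simp: L2_loc_def L2_on_iff intro: sG)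
  show "(\<lambda>x. G' (f x) * g x) \<in> L2_loc \<Omega>"
    unfolding L2_loc_def L2_on_iff using L2_loc_sq_int[OF f] L2_loc_sq_int[OF g]
    by (auto intro!: sG' sq_int_measurable)
  fix \<psi> K assume \<psi>: "\<psi> \<in> test_functions \<Omega>" and K: "compact K" "K \<subseteq> \<Omega>"
  let ?M = "lebesgue_on K"
  obtain u where u: "\<And>n. smooth_fn (u n)" "L2_lim ?M u f" "L2_lim ?M (\<lambda>n. partial_deriv k (u n)) g"
    using local_smooth_approximation[OF f \<Omega> K] w by metis
  have su: "sq_int ?M (u n)" "sq_int ?M f" "sq_int ?M (partial_deriv k (u n))" "sq_int ?M g" for n
    using u by (auto simp: L2_lim_def)
  have [measurable]: "u n \<in> borel_measurable ?M" "f \<in> borel_measurable ?M" "partial_deriv k (u n) \<in> borel_measurable ?M" "g \<in> borel_measurable ?M" for n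
    using su by (auto simp: sq_int_def)
  have du: "u n differentiable (at x)" for n x using C_order_1_differentiable[OF smooth_fn_C_order[OF u(1)]] .
  have hd: "((\<lambda>x. G (u n x)) has_derivative (\<lambda>h. G' (u n x) * frechet_derivative (u n) (at x) h)) (at x)" for n x
    using has_derivative_compose[OF du[unfolded frechet_derivative_works] G(1)[unfolded has_field_derivative_def]] .
  have pd: "partial_deriv j (\<lambda>x. G (u n x)) = (\<lambda>x. G' (u n x) * partial_deriv j (u n) x)" for n j
    using partial_deriv_eqI[OF hd] by (auto simp: partial_deriv_def)
  have c1u: "C_order 1 (u n)" for n by (rule smooth_fn_C_order[OF u(1)])
  have c1: "C_order 1 (\<lambda>x. G (u n x))" for n
    unfolding C_order_1_iff pd using hd C_order_1_continuous[OF c1u] C_order_1_continuous_partial[OF c1u]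
    by (auto intro!: differentiableI continuous_intros continuous_on_compose2[OF G(2)])
  have s\<psi>: "sq_int ?M \<psi>" "sq_int ?M (partial_deriv k \<psi>)"
    using test_functionsD(5)[OF \<psi>] test_functionsD(5)[OF test_functions_partial[OF \<psi>]] K
    by (auto intro: sq_int_continuous_compact)
  obtain B' where B': "AE x in ?M. \<bar>\<psi> x\<bar> \<le> B'" "\<psi> \<in> borel_measurable ?M"
    using AE_bounded_continuous_compact[OF test_functionsD(5)[OF \<psi>] K(1)] by blast
  have g\<psi>: "sq_int ?M (\<lambda>x. \<psi> x * g x)" by (rule sq_int_bounded_mult[OF su(4) B'(2,1)])
  have "L2_lim ?M (\<lambda>n x. G (u n x)) (\<lambda>x. G (f x))"
    by (rule L2_lim_Lipschitz[OF u(2) B(2)]) (use sG su in auto)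
  from L2_lim_inner[OF this s\<psi>(2)]
  have 1: "(\<lambda>n. \<integral>x. G (u n x) * partial_deriv k \<psi> x \<partial>?M) \<longlonglongrightarrow> (\<integral>x. G (f x) * partial_deriv k \<psi> x \<partial>?M)" .
  have sone: "sq_int ?M (\<lambda>x. 1)" by (rule sq_int_continuous_compact[OF continuous_on_const K(1)])
  have sG1: "sq_int ?M (\<lambda>x. G' (v x))" if "v \<in> borel_measurable ?M" for v
    using sG'[OF that sone] by simp
  have "L2_lim ?M (\<lambda>n x. G' (u n x)) (\<lambda>x. G' (f x))"
    by (rule L2_lim_Lipschitz[OF u(2) B(3)]) (use sG1 in auto)
  from L2_lim_inner[OF this g\<psi>]
  have 2: "(\<lambda>n. \<integral>x. G' (u n x) * (\<psi> x * g x) \<partial>?M) \<longlonglongrightarrow> (\<integral>x. G' (f x) * (\<psi> x * g x) \<partial>?M)" .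
  have 3: "(\<lambda>n. \<integral>x. (G' (u n x) * (partial_deriv k (u n) x - g x)) * \<psi> x \<partial>?M) \<longlonglongrightarrow> (\<integral>x. 0 * \<psi> x \<partial>?M)"
  proof (rule L2_lim_inner[OF L2_lim_bound s\<psi>(1)])
    show s: "sq_int ?M (\<lambda>x. G' (u n x) * (partial_deriv k (u n) x - g x))" for n
      by (intro sG' sq_int_diff su) auto
    show "(\<integral>x. (G' (u n x) * (partial_deriv k (u n) x - g x) - 0)\<^sup>2 \<partial>?M) \<le> B\<^sup>2 * (\<integral>x. (partial_deriv k (u n) x - g x)\<^sup>2 \<partial>?M)" for n
    proof -
      have "(\<integral>x. (G' (u n x) * (partial_deriv k (u n) x - g x))\<^sup>2 \<partial>?M) \<le> (\<integral>x. B\<^sup>2 * (partial_deriv k (u n) x - g x)\<^sup>2 \<partial>?M)"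
      proof (rule integral_mono)
        show "integrable ?M (\<lambda>x. (G' (u n x) * (partial_deriv k (u n) x - g x))\<^sup>2)" using s by (simp add: sq_int_def)
        show "integrable ?M (\<lambda>x. B\<^sup>2 * (partial_deriv k (u n) x - g x)\<^sup>2)" using sq_int_diff[OF su(3,4)] by (simp add: sq_int_def)
        fix x
        have "\<bar>G' (u n x)\<bar>\<^sup>2 \<le> B\<^sup>2" using B(1) by (intro power_mono) auto
        then show "(G' (u n x) * (partial_deriv k (u n) x - g x))\<^sup>2 \<le> B\<^sup>2 * (partial_deriv k (u n) x - g x)\<^sup>2"
          by (simp add: power_mult_distrib mult_right_mono)
      qed
      then show ?thesis by simp
    qed
    show "(\<lambda>n. B\<^sup>2 * (\<integral>x. (partial_deriv k (u n) x - g x)\<^sup>2 \<partial>?M)) \<longlonglongrightarrow> 0"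
      using u(3) by (auto simp: L2_lim_def intro!: tendsto_eq_intros)
  qed simp
  have "(\<integral>x. G' (u n x) * partial_deriv k (u n) x * \<psi> x \<partial>?M)
     = (\<integral>x. G' (u n x) * (\<psi> x * g x) \<partial>?M) + (\<integral>x. (G' (u n x) * (partial_deriv k (u n) x - g x)) * \<psi> x \<partial>?M)" for n
  proof -
    have "integrable ?M (\<lambda>x. G' (u n x) * (\<psi> x * g x))" by (rule sq_int_mult_integrable[OF sG1 g\<psi>]) auto
    moreover have "integrable ?M (\<lambda>x. (G' (u n x) * (partial_deriv k (u n) x - g x)) * \<psi> x)"
      by (intro sq_int_mult_integrable sG' sq_int_diff su s\<psi>) auto
    ultimately show ?thesis by (subst Bochner_Integration.integral_add[symmetric]) (auto simp: algebra_simps)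
  qed
  then have "(\<lambda>n. \<integral>x. G' (u n x) * partial_deriv k (u n) x * \<psi> x \<partial>?M) \<longlonglongrightarrow> (\<integral>x. G' (f x) * g x * \<psi> x \<partial>?M)"
    using tendsto_add[OF 2 3] by (simp add: mult_ac)
  with 1 c1 show "\<exists>u. (\<forall>n. C_order 1 (u n)) \<and>
        (\<lambda>n. \<integral>x. u n x * partial_deriv k \<psi> x \<partial>lebesgue_on K) \<longlonglongrightarrow> (\<integral>x. G (f x) * partial_deriv k \<psi> x \<partial>lebesgue_on K) \<and>
        (\<lambda>n. \<integral>x. partial_deriv k (u n) x * \<psi> x \<partial>lebesgue_on K) \<longlonglongrightarrow> (\<integral>x. G' (f x) * g x * \<psi> x \<partial>lebesgue_on K)"
    by (intro exI[of _ "\<lambda>n x. G (u n x)"]) (auto simp: pd simp del: One_nat_def)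
qed

section \<open>The forms\<close>

definition mat_form :: "real^'n^'n \<Rightarrow> ('n::finite \<Rightarrow> real) \<Rightarrow> real" where
  "mat_form A w = (\<Sum>k\<in>UNIV. \<Sum>l\<in>UNIV. A $ k $ l * w k * w l)"

lemma energy_density_mat_form: "energy_density C g x = mat_form (C x) (\<lambda>k. g k x)"
  by (simp add: energy_density_def mat_form_def)

lemma mat_form_inner: "v \<bullet> (A *v v) = mat_form A (\<lambda>k. v $ k)"
  by (simp add: mat_form_def inner_vec_def matrix_vector_mult_def sum_distrib_left mult_ac)

lemma mat_form_inner': "mat_form A w = (\<chi> k. w k) \<bullet> (A *v (\<chi> k. w k))"
  by (simp add: mat_form_inner)

lemma mat_form_scaled_identity: "(v::real^'n) \<bullet> (mat c *v v) = c * (\<Sum>k\<in>UNIV. (v $ k)\<^sup>2)"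
proof -
  have "(mat c *v v) $ i = c * v $ i" for i
  proof -
    have "(mat c *v v) $ i = (\<Sum>j\<in>UNIV. (if i = j then c else 0) * v $ j)"
      by (simp add: matrix_vector_mult_def mat_def)
    also have "\<dots> = (\<Sum>j\<in>UNIV. if j = i then c * v $ i else 0)" by (rule sum.cong) auto
    finally show ?thesis by simp
  qed
  then show ?thesis by (simp add: inner_vec_def power2_eq_square sum_distrib_left mult_ac)
qed

lemma mat_form_zero [simp]: "mat_form A (\<lambda>k. 0) = 0"
  by (simp add: mat_form_def)

lemma mat_form_scale: "mat_form A (\<lambda>k. c * w k) = c\<^sup>2 * mat_form A w"
  by (simp add: mat_form_def sum_distrib_left power2_eq_square mult_ac)

lemma mat_form_expand:
  "mat_form A (\<lambda>k. a k + b k) = mat_form A a + (\<Sum>k\<in>UNIV. \<Sum>l\<in>UNIV. A$k$l * (a k * b l + b k * a l)) + mat_form A b"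
  by (simp add: mat_form_def sum.distrib[symmetric] algebra_simps)

text \<open>The parallelogram identity with one nonnegative term dropped.\<close>

lemma mat_form_add_le:
  assumes nn: "\<And>w. mat_form A w \<ge> 0"
  shows "mat_form A (\<lambda>k. a k + b k) \<le> 2 * mat_form A a + 2 * mat_form A b"
proof -
  have "mat_form A (\<lambda>k. a k + b k) + mat_form A (\<lambda>k. a k + (-1) * b k) = 2 * mat_form A a + 2 * mat_form A b"
    unfolding mat_form_expand mat_form_scale
    by (simp add: algebra_simps sum_negf sum.distrib sum_subtractf sum_distrib_left)
  then show ?thesis using nn[of "\<lambda>k. a k + (-1) * b k"] by linarith
qed

text \<open>With \<open>e = a - b\<close>, nonnegativity at \<open>t * b + e\<close> and at
  \<open>t * b - e\<close> bounds the cross term from both sides. The parameter \<open>t\<close> is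
  free, so that the part proportional to the form at \<open>b\<close> can be made small.\<close>

lemma mat_form_diff_le:
  assumes nn: "\<And>w. mat_form A w \<ge> 0" and t: "t > 0"
  shows "\<bar>mat_form A a - mat_form A b\<bar> \<le> t * mat_form A b + (1 + 1/t) * mat_form A (\<lambda>k. a k - b k)"
proof -
  define e where "e k = a k - b k" for k
  define P where "P = (\<Sum>k\<in>UNIV. \<Sum>l\<in>UNIV. A$k$l * (b k * e l + e k * b l))"
  have a: "a = (\<lambda>k. b k + e k)" by (simp add: e_def)
  have 1: "mat_form A a = mat_form A b + P + mat_form A e" unfolding a P_def by (rule mat_form_expand)
  have s: "mat_form A (\<lambda>k. t * b k + c * e k) = t\<^sup>2 * mat_form A b + c * t * P + c\<^sup>2 * mat_form A e" for c
    unfolding mat_form_expand mat_form_scale P_def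
    by (simp add: sum_distrib_left algebra_simps)
  have "0 \<le> t\<^sup>2 * mat_form A b + t * P + mat_form A e"    using nn[of "\<lambda>k. t * b k + 1 * e k"] s[of 1] by simp
  moreover have "0 \<le> t\<^sup>2 * mat_form A b - t * P + mat_form A e"    using nn[of "\<lambda>k. t * b k + (-1) * e k"] s[of "-1"] by simp
  ultimately have "t * \<bar>P\<bar> \<le> t\<^sup>2 * mat_form A b + mat_form A e" by (auto simp: abs_if)
  then have "\<bar>P\<bar> \<le> t * mat_form A b + (1/t) * mat_form A e"
    using t by (simp add: field_simps power2_eq_square)
  moreover have "mat_form A e \<ge> 0" by (rule nn)
  ultimately show ?thesis unfolding 1 e_def[symmetric] by (simp add: algebra_simps)
qed

lemma tendsto_mat_form:
  "(\<And>k. (\<lambda>i. w i k) \<longlonglongrightarrow> v k) \<Longrightarrow> (\<lambda>i. mat_form A (w i)) \<longlonglongrightarrow> mat_form A v"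
  unfolding mat_form_def by (intro tendsto_intros)

lemma fatou_real:
  fixes f :: "nat \<Rightarrow> 'a \<Rightarrow> real"
  assumes f: "\<And>i. integrable M (f i)" and nn: "\<And>i. AE x in M. 0 \<le> f i x"
    and lim: "AE x in M. (\<lambda>i. f i x) \<longlonglongrightarrow> g x" and g: "g \<in> borel_measurable M"
    and b: "\<forall>\<^sub>F i in sequentially. integral\<^sup>L M (f i) \<le> e"
  shows "integrable M g" "integral\<^sup>L M g \<le> e"
proof -
  have gn: "AE x in M. 0 \<le> g x"
  proof -
    have "AE x in M. \<forall>i. 0 \<le> f i x" using nn by (subst AE_all_countable) blast
    with lim show ?thesis by eventually_elim (auto intro: LIMSEQ_le_const)
  qed
  obtain N where N: "\<And>i. i \<ge> N \<Longrightarrow> integral\<^sup>L M (f i) \<le> e" using b by (auto simp: eventually_sequentially)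
  have e: "0 \<le> e" using N[of N] integral_nonneg_AE[OF nn[of N]] by simp
  have "(\<integral>\<^sup>+x. ennreal (g x) \<partial>M) = (\<integral>\<^sup>+x. liminf (\<lambda>i. ennreal (f i x)) \<partial>M)"
  proof (rule nn_integral_cong_AE)
    show "AE x in M. ennreal (g x) = liminf (\<lambda>i. ennreal (f i x))"
      using lim
    proof eventually_elim
      case (elim x)
      then have "(\<lambda>i. ennreal (f i x)) \<longlonglongrightarrow> ennreal (g x)" by (rule tendsto_ennrealI)
      then show ?case by (simp add: lim_imp_Liminf)
    qed
  qed
  also have "\<dots> \<le> liminf (\<lambda>i. \<integral>\<^sup>+x. ennreal (f i x) \<partial>M)"
    by (rule nn_integral_liminf) (use f in measurable)
  also have "\<dots> = liminf (\<lambda>i. ennreal (integral\<^sup>L M (f i)))"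
    using nn_integral_eq_integral[OF f nn] by simp
  also have "\<dots> \<le> liminf (\<lambda>i. ennreal e)"
    using N by (intro Liminf_mono) (auto simp: eventually_sequentially intro!: exI[of _ N] ennreal_leI)
  also have "\<dots> = ennreal e" by (simp add: Liminf_const)
  finally have le: "(\<integral>\<^sup>+x. ennreal (g x) \<partial>M) \<le> ennreal e" .
  show gi: "integrable M g"
  proof (rule integrableI_nonneg[OF g gn])
    show "(\<integral>\<^sup>+x. ennreal (g x) \<partial>M) < \<infinity>" using le by (simp add: le_less_trans[OF _ ennreal_less_top])
  qed
  show "integral\<^sup>L M g \<le> e"
    using le nn_integral_eq_integral[OF gi gn] e by (simp add: ennreal_le_iff)
qed

text \<open>After weighting with \<open>4 ^ i\<close> the integrals are still summable, with ratio
  4/8. So the weighted series is finite almost everywhere, and there the increments are bounded by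
  \<open>sqrt S * (1/2)^i\<close>.\<close>

lemma AE_convergent_of_summable_sq:
  fixes v :: "nat \<Rightarrow> 'a \<Rightarrow> real"
  assumes v: "\<And>i. sq_int M (v i)" and B: "\<And>i. (\<integral>x. (v (Suc i) x - v i x)\<^sup>2 \<partial>M) \<le> B * (1/8)^i"
  shows "AE x in M. convergent (\<lambda>i. v i x)"
proof -
  have [measurable]: "v i \<in> borel_measurable M" for i using v by (simp add: sq_int_def)
  have "0 \<le> (\<integral>x. (v (Suc 0) x - v 0 x)\<^sup>2 \<partial>M)" by (intro integral_nonneg_AE) auto
  also have "\<dots> \<le> B * (1/8)^0" by (rule B)
  finally have B0: "B \<ge> 0" by simp
  define d where "d i x = 4^i * (v (Suc i) x - v i x)\<^sup>2" for i x
  have [measurable]: "d i \<in> borel_measurable M" for i unfolding d_def by measurable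
  have sd: "integrable M (\<lambda>x. (v (Suc i) x - v i x)\<^sup>2)" for i using sq_int_diff[OF v v] by (simp add: sq_int_def)
  have "(\<integral>\<^sup>+x. ennreal (d i x) \<partial>M) \<le> ennreal (B * (1/2)^i)" for i
  proof -
    have "(\<integral>\<^sup>+x. ennreal (d i x) \<partial>M) = ennreal (\<integral>x. d i x \<partial>M)"
      using sd by (intro nn_integral_eq_integral) (auto simp: d_def)
    also have "(\<integral>x. d i x \<partial>M) \<le> 4^i * (B * (1/8)^i)"
      unfolding d_def using B[of i] by simp
    also have "4^i * (B * (1/8)^i) = B * (1/2)^i" by (simp add: power_mult_distrib[symmetric] mult.left_commute)
    finally show ?thesis by (simp add: ennreal_leI)
  qed
  then have "(\<Sum>i. \<integral>\<^sup>+x. ennreal (d i x) \<partial>M) \<le> (\<Sum>i. ennreal (B * (1/2)^i))"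
    by (intro suminf_le) auto
  also have "\<dots> = ennreal (\<Sum>i. B * (1/2)^i)"
    using B0 by (intro suminf_ennreal2) (auto intro!: summable_mult summable_geometric)
  also have "\<dots> < \<infinity>" by simp
  finally have "(\<integral>\<^sup>+x. (\<Sum>i. ennreal (d i x)) \<partial>M) \<noteq> \<infinity>"
    by (subst nn_integral_suminf) auto
  then have "AE x in M. (\<Sum>i. ennreal (d i x)) \<noteq> \<infinity>"
    by (intro nn_integral_PInf_AE) auto
  then show ?thesis
  proof eventually_elim
    case (elim x)
    then obtain S where S: "(\<Sum>i. ennreal (d i x)) = ennreal S" "S \<ge> 0"
      by (cases "\<Sum>i. ennreal (d i x)") auto
    have "ennreal (d i x) \<le> ennreal S" for i
      using sum_le_suminf[of "\<lambda>i. ennreal (d i x)" "{i}"] S by simp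
    then have dS: "d i x \<le> S" for i using S(2) by (simp add: ennreal_le_iff)
    have "norm (v (Suc i) x - v i x) \<le> sqrt S * (1/2)^i" for i
    proof -
      have "(2^i * \<bar>v (Suc i) x - v i x\<bar>)\<^sup>2 \<le> S"
      proof -
        have "(2^i * \<bar>v (Suc i) x - v i x\<bar>)\<^sup>2 = (2^i)\<^sup>2 * (v (Suc i) x - v i x)\<^sup>2"
          by (simp add: power_mult_distrib)
        also have "((2::real)^i)\<^sup>2 = 4^i" by (simp add: power2_eq_square power_mult_distrib[symmetric])
        finally show ?thesis using dS[of i] by (simp add: d_def)
      qed
      then have "2^i * \<bar>v (Suc i) x - v i x\<bar> \<le> sqrt S" by (rule real_le_rsqrt)
      then show ?thesis
        by (simp add: power_one_over pos_le_divide_eq mult.commute)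
    qed
    moreover have "summable (\<lambda>i. sqrt S * (1/2)^i)"
      by (rule summable_mult[OF summable_geometric]) simp
    ultimately have "summable (\<lambda>i. v (Suc i) x - v i x)"
      using summable_comparison_test'[of "\<lambda>i. sqrt S * (1/2)^i" 0 "\<lambda>i. v (Suc i) x - v i x"] by blast
    then have "convergent (\<lambda>n. \<Sum>i<n. v (Suc i) x - v i x)" by (simp add: summable_iff_convergent)
    moreover have "(\<lambda>n. \<Sum>i<n. v (Suc i) x - v i x) = (\<lambda>n. v n x - v 0 x)"
      using sum_lessThan_telescope[of "\<lambda>n. v n x"] by blast
    ultimately have "convergent (\<lambda>n. (v n x - v 0 x) + v 0 x)"
      by (intro convergent_add convergent_const) auto
    then show ?case by simp
  qed
qed

lemma measurable_open_compacts:
  fixes f :: "real^'n \<Rightarrow> real"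
  assumes \<Omega>: "open \<Omega>" and K: "\<And>K. compact K \<Longrightarrow> K \<subseteq> \<Omega> \<Longrightarrow> f \<in> borel_measurable (lebesgue_on K)"
  shows "f \<in> borel_measurable (lebesgue_on \<Omega>)"
proof -
  obtain C where C: "\<And>n::nat. compact (C n)" "\<And>n. C n \<subseteq> \<Omega>" "\<And>K. compact K \<Longrightarrow> K \<subseteq> \<Omega> \<Longrightarrow> \<exists>N. \<forall>n\<ge>N. K \<subseteq> C n"
    using open_Union_compact_subsets[OF \<Omega>] by metis
  have "(\<lambda>x. indicator \<Omega> x * f x) \<in> borel_measurable lebesgue"
  proof (rule borel_measurable_LIMSEQ_real)
    show "(\<lambda>x. indicator (C n) x * f x) \<in> borel_measurable lebesgue" for n
      using K[OF C(1)[of n] C(2)[of n]] C(1)[of n] by (simp add: lebesgue_on_measurable_iff compact_imp_closed)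
    show "(\<lambda>n. indicator (C n) x * f x) \<longlonglongrightarrow> indicator \<Omega> x * f x" for x
    proof (rule tendsto_eventually, cases "x \<in> \<Omega>")
      case True
      then obtain N where "\<And>n. n \<ge> N \<Longrightarrow> x \<in> C n" using C(3)[of "{x}"] by auto
      then show "\<forall>\<^sub>F n in sequentially. indicator (C n) x * f x = indicator \<Omega> x * f x"
        using True by (auto simp: eventually_sequentially intro!: exI[of _ N])
    next
      case False
      then have "x \<notin> C n" for n using C(2) by blast
      then show "\<forall>\<^sub>F n in sequentially. indicator (C n) x * f x = indicator \<Omega> x * f x" using False by simp
    qed
  qed
  then show ?thesis using \<Omega> by (simp add: lebesgue_on_measurable_iff)
qed

lemma L2_loc_measurable:
  assumes "open \<Omega>" "f \<in> L2_loc \<Omega>" shows "f \<in> borel_measurable (lebesgue_on \<Omega>)"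
  using measurable_open_compacts[OF assms(1)] L2_loc_sq_int[OF assms(2)] sq_int_measurable by blast

lemma sq_int_imp_L2_loc:
  assumes "open \<Omega>" "sq_int (lebesgue_on \<Omega>) f" shows "f \<in> L2_loc \<Omega>"
  unfolding L2_loc_def L2_on_iff using sq_int_lebesgue_on_subset[OF assms(2)] assms(1)
  by (auto simp: compact_imp_closed)

locale coefficients =
  fixes \<Omega> :: "(real^'n) set" and C :: "real^'n \<Rightarrow> real^'n^'n"
  assumes open_\<Omega>: "open \<Omega>"
    and bounded_C: "\<And>k l. (\<lambda>x. C x $ k $ l) \<in> Linfty_on \<Omega>"
    and pos_C: "AE x in lebesgue_on \<Omega>. mat_less 0 (C x)"
    and elliptic_C: "\<And>K. compact K \<Longrightarrow> K \<subseteq> \<Omega> \<Longrightarrow> \<exists>c>0. AE x in lebesgue_on K. mat_le (mat c) (C x)"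
begin

lemma sets_\<Omega> [simp]: "\<Omega> \<in> sets lebesgue"
  using open_\<Omega> by simp

abbreviation "L\<Omega> \<equiv> lebesgue_on \<Omega>"
abbreviation "energy g \<equiv> integral\<^sup>L L\<Omega> (energy_density C g)"
abbreviation "finite_energy g \<equiv> integrable L\<Omega> (energy_density C g)"

lemma mat_form_nonneg: "AE x in L\<Omega>. \<forall>w. 0 \<le> mat_form (C x) w"
  using pos_C
proof eventually_elim
  case (elim x)
  show ?case
  proof
    fix w :: "'n \<Rightarrow> real"
    let ?v = "\<chi> k. w k"
    show "0 \<le> mat_form (C x) w"
    proof (cases "?v = 0")
      case True
      then show ?thesis unfolding mat_form_inner' by simp
    next
      case False
      then have "?v \<bullet> (0 *v ?v) < ?v \<bullet> (C x *v ?v)" using elim by (simp add: mat_less_def)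
      then show ?thesis unfolding mat_form_inner' by simp
    qed
  qed
qed

lemma energy_nonneg: "AE x in L\<Omega>. 0 \<le> energy_density C g x"
  using mat_form_nonneg by eventually_elim (simp add: energy_density_mat_form)

lemma mat_form_bounded: obtains M where "M > 0" "AE x in L\<Omega>. \<forall>w. mat_form (C x) w \<le> M * (\<Sum>k\<in>UNIV. (w k)\<^sup>2)"
proof -
  have "\<exists>M. AE x in L\<Omega>. \<bar>C x $ k $ l\<bar> \<le> M" for k l
    using bounded_C[of k l] by (simp add: Linfty_on_def)
  then obtain m where m: "\<And>k l. AE x in L\<Omega>. \<bar>C x $ k $ l\<bar> \<le> m k l" by metis
  define M where "M = 1 + (\<Sum>k\<in>UNIV. \<Sum>l\<in>UNIV. \<bar>m k l\<bar>)"
  have M: "M > 0" unfolding M_def by (intro add_pos_nonneg sum_nonneg) auto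
  have "AE x in L\<Omega>. \<forall>k l. \<bar>C x $ k $ l\<bar> \<le> m k l"
    using m by (simp add: AE_all_countable AE_finite_all)
  then have "AE x in L\<Omega>. \<forall>w. mat_form (C x) w \<le> M * (\<Sum>k\<in>UNIV. (w k)\<^sup>2)"
  proof eventually_elim
    case (elim x)
    show ?case
    proof
      fix w :: "'n \<Rightarrow> real"
      let ?S = "\<Sum>k\<in>UNIV. (w k)\<^sup>2"
      have S: "0 \<le> ?S" by (intro sum_nonneg) auto
      have wS: "(w k)\<^sup>2 \<le> ?S" for k by (rule member_le_sum) auto
      have "mat_form (C x) w \<le> (\<Sum>k\<in>UNIV. \<Sum>l\<in>UNIV. \<bar>m k l\<bar> * ?S)"
        unfolding mat_form_def
      proof (intro sum_mono)
        fix k l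
        have "2 * (\<bar>w k\<bar> * \<bar>w l\<bar>) \<le> (w k)\<^sup>2 + (w l)\<^sup>2"
          using sum_squares_bound[of "\<bar>w k\<bar>" "\<bar>w l\<bar>"] by (simp add: mult.assoc)
        then have "\<bar>w k\<bar> * \<bar>w l\<bar> \<le> ?S" using wS[of k] wS[of l] by linarith
        moreover have "\<bar>C x $ k $ l\<bar> \<le> \<bar>m k l\<bar>" using elim by (meson abs_ge_self order_trans)
        ultimately have "\<bar>C x $ k $ l\<bar> * (\<bar>w k\<bar> * \<bar>w l\<bar>) \<le> \<bar>m k l\<bar> * ?S" by (intro mult_mono) auto
        then show "C x $ k $ l * w k * w l \<le> \<bar>m k l\<bar> * ?S"
          using abs_ge_self[of "C x $ k $ l * w k * w l"] by (simp add: abs_mult mult.assoc)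
      qed
      also have "\<dots> = (\<Sum>k\<in>UNIV. \<Sum>l\<in>UNIV. \<bar>m k l\<bar>) * ?S" by (simp add: sum_distrib_right)
      also have "\<dots> \<le> M * ?S" using S by (intro mult_right_mono) (auto simp: M_def)
      finally show "mat_form (C x) w \<le> M * ?S" .
    qed
  qed
  with M show ?thesis using that by blast
qed

lemma mat_form_elliptic:
  assumes "compact K" "K \<subseteq> \<Omega>"
  obtains c where "c > 0" "AE x in lebesgue_on K. \<forall>w. c * (\<Sum>k\<in>UNIV. (w k)\<^sup>2) \<le> mat_form (C x) w"
proof -
  obtain c where c: "c > 0" "AE x in lebesgue_on K. mat_le (mat c) (C x)" using elliptic_C[OF assms] by blast
  have "AE x in lebesgue_on K. \<forall>w. c * (\<Sum>k\<in>UNIV. (w k)\<^sup>2) \<le> mat_form (C x) w"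
    using c(2)
  proof eventually_elim
    case (elim x)
    show ?case
    proof
      fix w :: "'n \<Rightarrow> real"
      have "(\<chi> k. w k) \<bullet> (mat c *v (\<chi> k. w k)) \<le> (\<chi> k. w k) \<bullet> (C x *v (\<chi> k. w k))" using elim by (simp add: mat_le_def)
      then show "c * (\<Sum>k\<in>UNIV. (w k)\<^sup>2) \<le> mat_form (C x) w"
        by (simp add: mat_form_scaled_identity mat_form_inner')
    qed
  qed
  with c(1) show ?thesis using that by blast
qed

lemma energy_measurable [measurable (raw)]:
  assumes [measurable]: "\<And>k. g k \<in> borel_measurable L\<Omega>"
  shows "energy_density C g \<in> borel_measurable L\<Omega>"
proof -
  have [measurable]: "(\<lambda>x. C x $ k $ l) \<in> borel_measurable L\<Omega>" for k l
    using bounded_C[of k l] by (simp add: Linfty_on_def)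
  show ?thesis unfolding energy_density_def[abs_def] by measurable
qed

lemma energy_bound_integrable:
  assumes "integrable L\<Omega> h" "\<And>k. g k \<in> borel_measurable L\<Omega>" "AE x in L\<Omega>. energy_density C g x \<le> h x"
  shows "finite_energy g"
proof (rule Bochner_Integration.integrable_bound[OF assms(1)])
  show "AE x in L\<Omega>. norm (energy_density C g x) \<le> norm (h x)"
    using assms(3) energy_nonneg[of g] by eventually_elim auto
qed (use assms energy_measurable in auto)

lemma energy_sq_int:
  obtains M where "M > 0" "\<And>g. (\<And>k. sq_int L\<Omega> (g k)) \<Longrightarrow> finite_energy g"
    "\<And>g. (\<And>k. sq_int L\<Omega> (g k)) \<Longrightarrow> energy g \<le> M * (\<Sum>k\<in>UNIV. \<integral>x. (g k x)\<^sup>2 \<partial>L\<Omega>)"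
proof -
  obtain M where M: "M > 0" "AE x in L\<Omega>. \<forall>w. mat_form (C x) w \<le> M * (\<Sum>k\<in>UNIV. (w k)\<^sup>2)"
    using mat_form_bounded by blast
  have le: "AE x in L\<Omega>. energy_density C g x \<le> M * (\<Sum>k\<in>UNIV. (g k x)\<^sup>2)" for g
    using M(2) by eventually_elim (simp add: energy_density_mat_form)
  show ?thesis
  proof
    show "M > 0" by fact
    fix g :: "'n \<Rightarrow> real^'n \<Rightarrow> real" assume g: "\<And>k. sq_int L\<Omega> (g k)"
    have i: "integrable L\<Omega> (\<lambda>x. M * (\<Sum>k\<in>UNIV. (g k x)\<^sup>2))" using g by (simp add: sq_int_def)
    show ei: "finite_energy g"
      by (rule energy_bound_integrable[OF i _ le]) (use g in \<open>simp add: sq_int_def\<close>)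
    have "energy g \<le> (\<integral>x. M * (\<Sum>k\<in>UNIV. (g k x)\<^sup>2) \<partial>L\<Omega>)"
      by (rule integral_mono_AE[OF ei i le])
    also have "\<dots> = M * (\<Sum>k\<in>UNIV. \<integral>x. (g k x)\<^sup>2 \<partial>L\<Omega>)"
      using g by (simp add: sq_int_def)
    finally show "energy g \<le> M * (\<Sum>k\<in>UNIV. \<integral>x. (g k x)\<^sup>2 \<partial>L\<Omega>)" .
  qed
qed

lemma energy_add:
  assumes g: "\<And>k. g k \<in> borel_measurable L\<Omega>" "finite_energy g"
    and h: "\<And>k. h k \<in> borel_measurable L\<Omega>" "finite_energy h"
  shows "finite_energy (\<lambda>k x. g k x + h k x)"
    "energy (\<lambda>k x. g k x + h k x)
       \<le> 2 * energy g + 2 * energy h"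
proof -
  have le: "AE x in L\<Omega>. energy_density C (\<lambda>k x. g k x + h k x) x \<le> 2 * energy_density C g x + 2 * energy_density C h x"
    using mat_form_nonneg by eventually_elim (simp add: energy_density_mat_form mat_form_add_le)
  have i: "integrable L\<Omega> (\<lambda>x. 2 * energy_density C g x + 2 * energy_density C h x)" using g h by simp
  show e: "finite_energy (\<lambda>k x. g k x + h k x)"
    by (rule energy_bound_integrable[OF i _ le]) (use g h in auto)
  show "energy (\<lambda>k x. g k x + h k x)
       \<le> 2 * energy g + 2 * energy h"
    using integral_mono_AE[OF e i le] g h by simp
qed

lemma energy_scale: "energy_density C (\<lambda>k x. c x * g k x) x = (c x)\<^sup>2 * energy_density C g x"
  by (simp add: energy_density_mat_form mat_form_scale)

lemma energy_diff_commute: "energy_density C (\<lambda>k x. g k x - h k x) = energy_density C (\<lambda>k x. h k x - g k x)"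
proof
  show "energy_density C (\<lambda>k x. g k x - h k x) x = energy_density C (\<lambda>k x. h k x - g k x) x" for x
    using energy_scale[of "\<lambda>x. -1" "\<lambda>k x. h k x - g k x" x] by simp
qed

lemma energy_diff:
  assumes g: "\<And>k. g k \<in> borel_measurable L\<Omega>" "finite_energy g"
    and h: "\<And>k. h k \<in> borel_measurable L\<Omega>" "finite_energy h"
  shows "finite_energy (\<lambda>k x. g k x - h k x)"
    "energy (\<lambda>k x. g k x - h k x)
       \<le> 2 * energy g + 2 * energy h"
proof -
  have e: "energy_density C (\<lambda>k x. - h k x) = energy_density C h"
    using energy_scale[of "\<lambda>x. -1" h] by auto
  show "finite_energy (\<lambda>k x. g k x - h k x)"
    "energy (\<lambda>k x. g k x - h k x)
       \<le> 2 * energy g + 2 * energy h"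
    using energy_add[of g "\<lambda>k x. - h k x"] g h by (simp_all add: e)
qed

lemma energy_tendsto:
  assumes g: "\<And>k. g k \<in> borel_measurable L\<Omega>" "finite_energy g"
    and h: "\<And>n k. h n k \<in> borel_measurable L\<Omega>" "\<And>n. finite_energy (h n)"
    and lim: "(\<lambda>n. energy (\<lambda>k x. h n k x - g k x)) \<longlonglongrightarrow> 0"
  shows "(\<lambda>n. energy (h n)) \<longlonglongrightarrow> energy g"
proof (rule LIMSEQ_I)
  fix r :: real assume r: "r > 0"
  let ?I = "\<lambda>g. energy g"
  have I0: "?I g \<ge> 0" by (intro integral_nonneg_AE energy_nonneg)
  \<comment> \<open>With this \<open>t\<close> the first term of \<open>mat_form_diff_le\<close>
    contributes less than \<open>r / 2\<close> for every \<open>n\<close>; only afterwards is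
    \<open>n\<close> chosen for the second term.\<close>
  define t where "t = r / (2 * (?I g + 1))"
  have I1: "?I g + 1 > 0" using I0 by linarith
  have t: "t > 0" unfolding t_def using r I1 by (intro divide_pos_pos) auto
  have t': "t * ?I g < r / 2"
  proof -
    have "t * (?I g + 1) = r / 2" unfolding t_def using I1 by (simp add: field_simps)
    then show ?thesis using t by (simp add: algebra_simps)
  qed
  have "(\<lambda>n. (1 + 1/t) * ?I (\<lambda>k x. h n k x - g k x)) \<longlonglongrightarrow> (1 + 1/t) * 0" by (intro tendsto_intros lim)
  then have "\<forall>\<^sub>F n in sequentially. (1 + 1/t) * ?I (\<lambda>k x. h n k x - g k x) < r / 2"
    using r by (intro order_tendstoD(2)[of _ 0]) auto
  then obtain N where N: "\<And>n. n \<ge> N \<Longrightarrow> (1 + 1/t) * ?I (\<lambda>k x. h n k x - g k x) < r / 2"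
    by (auto simp: eventually_sequentially)
  show "\<exists>N. \<forall>n\<ge>N. norm (?I (h n) - ?I g) < r"
  proof (intro exI allI impI)
    fix n assume n: "n \<ge> N"
    note d = energy_diff(1)[OF h(1,2) g, of n]
    have "norm (?I (h n) - ?I g) = norm (\<integral>x. energy_density C (h n) x - energy_density C g x \<partial>L\<Omega>)"
      using g h by simp
    also have "\<dots> \<le> (\<integral>x. \<bar>energy_density C (h n) x - energy_density C g x\<bar> \<partial>L\<Omega>)"
      unfolding real_norm_def[symmetric] by (rule integral_norm_bound)
    also have "\<dots> \<le> (\<integral>x. t * energy_density C g x + (1 + 1/t) * energy_density C (\<lambda>k x. h n k x - g k x) x \<partial>L\<Omega>)"
    proof (rule integral_mono_AE)
      show "AE x in L\<Omega>. \<bar>energy_density C (h n) x - energy_density C g x\<bar>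
         \<le> t * energy_density C g x + (1 + 1/t) * energy_density C (\<lambda>k x. h n k x - g k x) x"
        using mat_form_nonneg by eventually_elim (simp only: energy_density_mat_form mat_form_diff_le[OF _ t])
    qed (use g h d in auto)
    also have "\<dots> = t * ?I g + (1 + 1/t) * ?I (\<lambda>k x. h n k x - g k x)" using g d by simp
    also have "\<dots> < r" using N[OF n] t' by linarith
    finally show "norm (?I (h n) - ?I g) < r" .
  qed
qed

text \<open>\<open>g\<close> is any version of the weak gradient, so that functions obtained by
  products and truncations can carry explicit gradients instead of the arbitrary choice made by
  \<open>weak_deriv\<close>. By \<open>form_fn_form_N\<close> the value of the form does not depend
  on the version.\<close>

definition form_fn :: "(real^'n \<Rightarrow> real) \<Rightarrow> ('n \<Rightarrow> real^'n \<Rightarrow> real) \<Rightarrow> bool" where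
  "form_fn \<phi> g \<longleftrightarrow> (\<forall>k. is_weak_deriv \<Omega> k \<phi> (g k)) \<and> finite_energy g \<and> sq_int L\<Omega> \<phi>"

lemma form_fn_measurable: "form_fn \<phi> g \<Longrightarrow> g k \<in> borel_measurable L\<Omega>"
  using L2_loc_measurable[OF open_\<Omega>] by (auto simp: form_fn_def is_weak_deriv_def)

lemma form_fn_form_N:
  assumes "form_fn \<phi> g"
  shows "form_N \<Omega> C \<phi> = Some (energy g)"
proof -
  have w: "is_weak_deriv \<Omega> k \<phi> (g k)" for k using assms by (simp add: form_fn_def)
  have w': "is_weak_deriv \<Omega> k \<phi> (weak_deriv \<Omega> k \<phi>)" for k
    unfolding weak_deriv_def by (rule someI[where P="is_weak_deriv \<Omega> k \<phi>"]) (rule w)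
  have m: "weak_deriv \<Omega> k \<phi> \<in> borel_measurable L\<Omega>" for k
    using w'[of k] L2_loc_measurable[OF open_\<Omega>] by (auto simp: is_weak_deriv_def)
  have "AE x in L\<Omega>. weak_deriv \<Omega> k \<phi> x = g k x" for k
    by (rule is_weak_deriv_unique[OF w' w open_\<Omega>])
  then have "AE x in L\<Omega>. \<forall>k. weak_deriv \<Omega> k \<phi> x = g k x" by (subst AE_all_countable) blast
  then have ae: "AE x in L\<Omega>. energy_density C g x = energy_density C (\<lambda>k. weak_deriv \<Omega> k \<phi>) x"
    by eventually_elim (simp add: energy_density_def)
  have gi: "finite_energy g" and s: "sq_int L\<Omega> \<phi>" using assms by (auto simp: form_fn_def)
  have i: "finite_energy (\<lambda>k. weak_deriv \<Omega> k \<phi>)"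
    by (rule integrable_cong_AE_imp[OF gi energy_measurable[OF m]]) (use ae in auto)
  have e: "energy (\<lambda>k. weak_deriv \<Omega> k \<phi>) = energy g"
    using ae by (intro integral_cong_AE) (use i gi in auto)
  have "\<phi> \<in> W12_loc \<Omega>" using w by (auto simp: W12_loc_def is_weak_deriv_def)
  then show ?thesis using i e s by (simp add: form_N_def sq_int_def)
qed

text \<open>Both summands in the integrability condition of \<open>form_N\<close> are nonnegative
  almost everywhere, so each of them is integrable by itself.\<close>

lemma form_N_form_fn:
  assumes "form_N \<Omega> C \<phi> = Some a"
  obtains g where "form_fn \<phi> g" "a = energy g"
proof -
  let ?g = "\<lambda>k. weak_deriv \<Omega> k \<phi>"
  have W: "\<phi> \<in> W12_loc \<Omega>" and i: "integrable L\<Omega> (\<lambda>x. energy_density C ?g x + (\<phi> x)\<^sup>2)"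
    and a: "a = energy ?g"
    using assms by (auto simp: form_N_def split: if_splits)
  have w: "is_weak_deriv \<Omega> k \<phi> (?g k)" for k
  proof -
    have "\<exists>g. is_weak_deriv \<Omega> k \<phi> g" using W by (simp add: W12_loc_def)
    then show ?thesis unfolding weak_deriv_def by (rule someI_ex)
  qed
  have mg: "?g k \<in> borel_measurable L\<Omega>" for k
    using w[of k] L2_loc_measurable[OF open_\<Omega>] by (auto simp: is_weak_deriv_def)
  have mf: "\<phi> \<in> borel_measurable L\<Omega>" using W L2_loc_measurable[OF open_\<Omega>] by (auto simp: W12_loc_def)
  have "finite_energy ?g"
    by (rule energy_bound_integrable[OF i mg]) auto
  moreover have "integrable L\<Omega> (\<lambda>x. (\<phi> x)\<^sup>2)"
    by (rule Bochner_Integration.integrable_bound[OF i])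
      (use mf energy_nonneg[of ?g] in \<open>auto elim!: eventually_mono\<close>)
  ultimately have "form_fn \<phi> ?g" using w mf by (simp add: form_fn_def sq_int_def)
  then show ?thesis using that a by blast
qed

section \<open>Test functions in the form domain, and closability\<close>

lemma continuous_bounded_support_sq_int:
  "continuous_on UNIV f \<Longrightarrow> bounded {x. f x \<noteq> 0} \<Longrightarrow> sq_int L\<Omega> f"
  using sq_int_lebesgue_on_subset[of UNIV f \<Omega>] sq_int_continuous_bounded_support[of f]
  by (simp add: lebesgue_on_UNIV_eq)

lemma smooth_bounded_support_form_fn:
  assumes \<phi>: "smooth_fn \<phi>" "bounded {x. \<phi> x \<noteq> 0}"
  shows "form_fn \<phi> (grad \<phi>)"
proof -
  have c1: "C_order 1 \<phi>" by (rule smooth_fn_C_order[OF \<phi>(1)])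
  have s: "sq_int L\<Omega> \<phi>" by (intro continuous_bounded_support_sq_int C_order_1_continuous c1 \<phi>)
  have s': "sq_int L\<Omega> (partial_deriv k \<phi>)" for k
    by (intro continuous_bounded_support_sq_int C_order_1_continuous_partial c1 partial_deriv_bounded_support \<phi>)
  obtain M where M: "\<And>g. (\<And>k. sq_int L\<Omega> (g k)) \<Longrightarrow> finite_energy g"
    using energy_sq_int by blast
  have "finite_energy (grad \<phi>)" by (rule M) (rule s')
  then show ?thesis using is_weak_deriv_C1[OF c1 open_\<Omega>] s by (simp add: form_fn_def)
qed

lemma test_sq_int: "\<psi> \<in> test_functions \<Omega> \<Longrightarrow> sq_int L\<Omega> \<psi>"
  using test_functionsD(5,6)[of \<psi>] by (rule continuous_bounded_support_sq_int)

lemma test_form_fn: "\<psi> \<in> test_functions \<Omega> \<Longrightarrow> form_fn \<psi> (grad \<psi>)"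
  using test_functionsD(1,6)[of \<psi>] by (rule smooth_bounded_support_form_fn)

lemma form_0_test: "\<psi> \<in> test_functions \<Omega> \<Longrightarrow> the (form_0 \<Omega> C \<psi>) = energy (grad \<psi>)"
  by (simp add: form_0_def)

lemma form_0_dom: "u \<in> dom (form_0 \<Omega> C) \<longleftrightarrow> u \<in> test_functions \<Omega>"
  by (simp add: form_0_def dom_def)

lemma form_0_test_diff:
  assumes "\<phi> \<in> test_functions \<Omega>" "\<psi> \<in> test_functions \<Omega>"
  shows "the (form_0 \<Omega> C (\<lambda>x. \<phi> x - \<psi> x)) =
    energy (\<lambda>k x. partial_deriv k \<phi> x - partial_deriv k \<psi> x)"
proof -
  have "partial_deriv k (\<lambda>x. \<phi> x - \<psi> x) = (\<lambda>x. partial_deriv k \<phi> x - partial_deriv k \<psi> x)" for k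
    using C_order_1_differentiable[OF test_functionsD(4)[OF assms(1)]]
      C_order_1_differentiable[OF test_functionsD(4)[OF assms(2)]]
    by (simp add: fun_eq_iff partial_deriv_diff)
  then show ?thesis using form_0_test[OF test_functions_diff[OF assms]] by simp
qed

text \<open>The constant is the inverse of the ellipticity constant on \<open>K\<close>. The
  statement is about a whole sequence so that one constant serves all its members.\<close>

lemma L2_norm_le_energy:
  assumes K: "compact K" "K \<subseteq> \<Omega>"
    and v: "\<And>n k. v n k \<in> borel_measurable L\<Omega>" "\<And>n. finite_energy (v n)"
  obtains c where "c > 0" "\<And>n k. integrable (lebesgue_on K) (\<lambda>x. (v n k x)\<^sup>2)"
    "\<And>n k. (\<integral>x. (v n k x)\<^sup>2 \<partial>lebesgue_on K) \<le> c * energy (v n)"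
proof -
  have Ks: "K \<in> sets lebesgue" using K by (simp add: compact_imp_closed)
  obtain c where c: "c > 0" "AE x in lebesgue_on K. \<forall>w. c * (\<Sum>k\<in>UNIV. (w k)\<^sup>2) \<le> mat_form (C x) w"
    using mat_form_elliptic[OF K] by blast
  have m: "v n k \<in> borel_measurable (lebesgue_on K)" for n k using measurable_restrict_mono[OF v(1) K(2)] .
  have le: "AE x in lebesgue_on K. (v n k x)\<^sup>2 \<le> (1/c) * energy_density C (v n) x" for n k
    using c(2)
  proof eventually_elim
    case (elim x)
    have "(v n k x)\<^sup>2 \<le> (\<Sum>k\<in>UNIV. (v n k x)\<^sup>2)" by (rule member_le_sum) auto
    then have "c * (v n k x)\<^sup>2 \<le> c * (\<Sum>k\<in>UNIV. (v n k x)\<^sup>2)" using c(1) by (intro mult_left_mono) auto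
    also have "\<dots> \<le> energy_density C (v n) x" using elim by (simp add: energy_density_mat_form)
    finally show ?case using c(1) by (simp add: field_simps)
  qed
  have eK: "integrable (lebesgue_on K) (energy_density C (v n))" for n
    by (rule lebesgue_on_integrable_subset[OF v(2) K(2) Ks sets_\<Omega>])
  have i: "integrable (lebesgue_on K) (\<lambda>x. (v n k x)\<^sup>2)" for n k
  proof (rule Bochner_Integration.integrable_bound)
    show "integrable (lebesgue_on K) (\<lambda>x. (1/c) * energy_density C (v n) x)" using eK by simp
    show "AE x in lebesgue_on K. norm ((v n k x)\<^sup>2) \<le> norm ((1/c) * energy_density C (v n) x)"
      using le[of n k] by eventually_elim (metis abs_ge_self abs_of_nonneg order_trans real_norm_def zero_le_power2)
  qed (use m in measurable)
  show ?thesis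
  proof
    show "1/c > 0" using c by simp
    show "integrable (lebesgue_on K) (\<lambda>x. (v n k x)\<^sup>2)" for n k by (rule i)
    show "(\<integral>x. (v n k x)\<^sup>2 \<partial>lebesgue_on K) \<le> 1/c * energy (v n)" for n k
    proof -
      have "(\<integral>x. (v n k x)\<^sup>2 \<partial>lebesgue_on K) \<le> (\<integral>x. (1/c) * energy_density C (v n) x \<partial>lebesgue_on K)"
        by (rule integral_mono_AE[OF i _ le]) (use eK in simp)
      also have "\<dots> = 1/c * integral\<^sup>L (lebesgue_on K) (energy_density C (v n))" by simp
      also have "\<dots> \<le> 1/c * energy (v n)"
        using lebesgue_on_integral_mono_set[OF v(2) K(2) Ks sets_\<Omega> energy_nonneg] c(1)
        by (intro mult_left_mono) auto
      finally show ?thesis .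
    qed
  qed
qed

text \<open>This contains closability. By local ellipticity the gradients are Cauchy in L2 on
  compact sets, so a fast subsequence converges almost everywhere, to \<open>g\<close> say. Fatou's
  lemma along this subsequence bounds the energy of \<open>G n - g\<close> by the Cauchy tails,
  which gives convergence in energy on all of \<open>\<Omega>\<close>. The same estimate gives local
  L2 convergence, so \<open>g\<close> is a weak gradient of \<open>\<phi>\<close>.\<close>

lemma form_approx_limit:
  assumes "form_approx \<Omega> (form_0 \<Omega> C) u \<phi>"
  obtains g where "form_fn \<phi> g"
    "(\<lambda>n. the (form_0 \<Omega> C (u n))) \<longlonglongrightarrow> energy g"
proof -
  have u: "u n \<in> test_functions \<Omega>" for n using assms by (auto simp: form_approx_def form_0_dom[symmetric])
  have \<phi>: "sq_int L\<Omega> \<phi>" and lim\<phi>: "(\<lambda>n. \<integral>x. (u n x - \<phi> x)\<^sup>2 \<partial>L\<Omega>) \<longlonglongrightarrow> 0"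
    using assms by (auto simp: form_approx_def L2_on_iff)
  define G where "G n k = partial_deriv k (u n)" for n k
  define E where "E n p = energy (\<lambda>k x. G n k x - G p k x)" for n p
  have cauchy: "\<exists>N. \<forall>n\<ge>N. \<forall>p\<ge>N. E n p < \<epsilon>" if "\<epsilon> > 0" for \<epsilon>
    using assms that unfolding form_approx_def E_def G_def by (simp add: form_0_test_diff[OF u u])
  have Gs: "sq_int L\<Omega> (G n k)" for n k
    unfolding G_def using test_sq_int[OF test_functions_partial[OF u]] .
  have Gm: "G n k \<in> borel_measurable L\<Omega>" for n k using Gs by (simp add: sq_int_def)
  have Ge: "finite_energy (G n)" for n
    using test_form_fn[OF u, of n] by (simp add: form_fn_def G_def[abs_def])
  note Gd = energy_diff(1)[OF Gm Ge Gm Ge]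
  have "\<exists>N. \<forall>n\<ge>N. \<forall>p\<ge>N. E n p < (1/8)^i" for i :: nat using cauchy by simp
  then obtain N where N: "\<And>i n p. n \<ge> N i \<Longrightarrow> p \<ge> N i \<Longrightarrow> E n p < (1/8)^i" by metis
  \<comment> \<open>Taking maxima makes \<open>r\<close> monotone, so that all later indices of the
    subsequence stay beyond \<open>N i\<close>.\<close>
  define r where "r i = Max (N ` {..i})" for i
  have rN: "N i \<le> r i" "r i \<le> r (Suc i)" for i
    unfolding r_def by (auto intro!: Max_mono Max_ge)
  have Er: "E (r (Suc i)) (r i) < (1/8)^i" for i using N[of i "r (Suc i)" "r i"] rN[of i] by linarith
  have r_mono: "r i \<le> r j" if "i \<le> j" for i j using that rN(2) by (rule lift_Suc_mono_le[rotated])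
  have r_tail: "N i \<le> r j" if "i \<le> j" for i j using rN(1)[of i] r_mono[OF that] by linarith
  have convK: "AE x in lebesgue_on K. convergent (\<lambda>i. G (r i) k x)" if K: "compact K" "K \<subseteq> \<Omega>" for K k
  proof -
    have Ks: "K \<in> sets lebesgue" using K by (simp add: compact_imp_closed)
    obtain c where c: "c > 0" "\<And>n k. (\<integral>x. (G (r (Suc n)) k x - G (r n) k x)\<^sup>2 \<partial>lebesgue_on K) \<le> c * E (r (Suc n)) (r n)"
    proof (rule L2_norm_le_energy[OF K, of "\<lambda>n k x. G (r (Suc n)) k x - G (r n) k x"])
      show "(\<lambda>x. G (r (Suc n)) k x - G (r n) k x) \<in> borel_measurable L\<Omega>" for n k using Gm by simp
      show "finite_energy (\<lambda>k x. G (r (Suc n)) k x - G (r n) k x)" for n by (rule Gd)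
    qed (auto simp: E_def)
    show ?thesis
    proof (rule AE_convergent_of_summable_sq)
      show "sq_int (lebesgue_on K) (G (r i) k)" for i by (rule sq_int_lebesgue_on_subset[OF Gs K(2) Ks sets_\<Omega>])
      show "(\<integral>x. (G (r (Suc i)) k x - G (r i) k x)\<^sup>2 \<partial>lebesgue_on K) \<le> c * (1/8)^i" for i
        using c(2)[of i k] mult_left_mono[OF less_imp_le[OF Er[of i]], of c] c(1) by linarith
    qed
  qed
  \<comment> \<open>Where the sequence does not converge the value of \<open>lim\<close> is
    arbitrary; this concerns only a null set.\<close>
  define g where "g k x = lim (\<lambda>i. G (r i) k x)" for k x
  have gm: "g k \<in> borel_measurable L\<Omega>" for k
    unfolding g_def[abs_def] using Gm by (intro borel_measurable_lim_metric) auto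
  have "AE x in L\<Omega>. convergent (\<lambda>i. G (r i) k x)" for k
    by (rule AE_lebesgue_on_open_compacts[OF open_\<Omega> convK])
  then have "AE x in L\<Omega>. \<forall>k. convergent (\<lambda>i. G (r i) k x)" by (subst AE_all_countable) blast
  then have conv: "AE x in L\<Omega>. \<forall>k. (\<lambda>i. G (r i) k x) \<longlonglongrightarrow> g k x"
    by eventually_elim (simp add: g_def convergent_LIMSEQ_iff)
  have fat: "finite_energy (\<lambda>k x. G n k x - g k x) \<and>
      energy (\<lambda>k x. G n k x - g k x) \<le> (1/8)^i" if n: "n \<ge> N i" for n i
  proof -
    have 1: "AE x in L\<Omega>. (\<lambda>j. energy_density C (\<lambda>k x. G n k x - G (r j) k x) x) \<longlonglongrightarrow> energy_density C (\<lambda>k x. G n k x - g k x) x"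
      using conv unfolding energy_density_mat_form
      by eventually_elim (auto intro!: tendsto_mat_form tendsto_intros)
    have 2: "energy_density C (\<lambda>k x. G n k x - g k x) \<in> borel_measurable L\<Omega>"
      by (rule energy_measurable) (use Gm gm in measurable)
    have 3: "\<forall>\<^sub>F j in sequentially. energy (\<lambda>k x. G n k x - G (r j) k x) \<le> (1/8)^i"
      unfolding eventually_sequentially
    proof (intro exI[of _ i] allI impI)
      fix j assume "i \<le> j"
      then have "E n (r j) < (1/8)^i" using N n r_tail by blast
      then show "energy (\<lambda>k x. G n k x - G (r j) k x) \<le> (1/8)^i" by (simp add: E_def)
    qed
    show ?thesis using fatou_real[OF Gd energy_nonneg 1 2 3] by blast
  qed
  have fi: "finite_energy (\<lambda>k x. G n k x - g k x)" if "n \<ge> N 0" for n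
    using fat that by blast
  have gi: "finite_energy g"
  proof -
    have "finite_energy (\<lambda>k x. G (N 0) k x - (G (N 0) k x - g k x))"
      by (rule energy_diff(1)[OF Gm Ge _ fi]) (use Gm gm in auto)
    then show ?thesis by simp
  qed
  have fi': "finite_energy (\<lambda>k x. G n k x - g k x)" for n
    by (rule energy_diff(1)[OF Gm Ge gm gi])
  have limE: "(\<lambda>n. energy (\<lambda>k x. G n k x - g k x)) \<longlonglongrightarrow> 0"
  proof (rule LIMSEQ_I)
    fix e :: real assume "e > 0"
    then obtain i where i: "(1/8::real)^i < e" using real_arch_pow_inv[of e "1/8"] by auto
    show "\<exists>M. \<forall>n\<ge>M. norm (energy (\<lambda>k x. G n k x - g k x) - 0) < e"
    proof (intro exI[of _ "N i"] allI impI)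
      fix n assume "n \<ge> N i"
      then have "energy (\<lambda>k x. G n k x - g k x) < e" using fat[of i n] i by linarith
      moreover have "0 \<le> energy (\<lambda>k x. G n k x - g k x)"
        by (intro integral_nonneg_AE energy_nonneg)
      ultimately show "norm (energy (\<lambda>k x. G n k x - g k x) - 0) < e" by simp
    qed
  qed
  have lim\<phi>': "L2_lim L\<Omega> u \<phi>" using lim\<phi> \<phi> test_sq_int[OF u] by (simp add: L2_lim_def)
  have limK: "L2_lim (lebesgue_on K) (\<lambda>n. G n k) (g k)" if K: "compact K" "K \<subseteq> \<Omega>" for K k
  proof -
    have Ks: "K \<in> sets lebesgue" using K by (simp add: compact_imp_closed)
    obtain c where c: "c > 0" "\<And>n k. integrable (lebesgue_on K) (\<lambda>x. (G n k x - g k x)\<^sup>2)"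
      "\<And>n k. (\<integral>x. (G n k x - g k x)\<^sup>2 \<partial>lebesgue_on K) \<le> c * energy (\<lambda>k x. G n k x - g k x)"
    proof (rule L2_norm_le_energy[OF K, of "\<lambda>n k x. G n k x - g k x"])
      show "(\<lambda>x. G n k x - g k x) \<in> borel_measurable L\<Omega>" for n k using Gm gm by simp
      show "finite_energy (\<lambda>k x. G n k x - g k x)" for n by (rule fi')
    qed auto
    have sG: "sq_int (lebesgue_on K) (G n k)" for n by (rule sq_int_lebesgue_on_subset[OF Gs K(2) Ks sets_\<Omega>])
    have gmK: "g k \<in> borel_measurable (lebesgue_on K)" by (rule measurable_restrict_mono[OF gm K(2)])
    have "sq_int (lebesgue_on K) (\<lambda>x. G 0 k x - g k x)"
      unfolding sq_int_def using c(2)[of 0 k] borel_measurable_diff[OF sq_int_measurable[OF sG[of 0]] gmK] by blast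
    from sq_int_diff[OF sG[of 0] this] have sg: "sq_int (lebesgue_on K) (g k)" by simp
    show ?thesis
    proof (rule L2_lim_bound[OF sG sg c(3)])
      show "(\<lambda>n. c * energy (\<lambda>k x. G n k x - g k x)) \<longlonglongrightarrow> 0"
        using limE by (auto intro!: tendsto_eq_intros)
    qed
  qed
  have "is_weak_deriv \<Omega> k \<phi> (g k)" for k
  proof (rule is_weak_deriv_L2_limit[OF sq_int_imp_L2_loc[OF open_\<Omega> \<phi>] _ open_\<Omega>])
    show "g k \<in> L2_loc \<Omega>" using limK by (auto simp: L2_loc_def L2_on_iff L2_lim_def)
    fix K assume K: "compact K" "K \<subseteq> \<Omega>"
    then have Ks: "K \<in> sets lebesgue" by (simp add: compact_imp_closed)
    show "\<exists>u. (\<forall>n. C_order 1 (u n)) \<and> L2_lim (lebesgue_on K) u \<phi> \<and> L2_lim (lebesgue_on K) (\<lambda>n. partial_deriv k (u n)) (g k)"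
      using test_functionsD(4)[OF u] L2_lim_lebesgue_on_subset[OF lim\<phi>' K(2) Ks sets_\<Omega>] limK[OF K, of k]
      by (intro exI[of _ u]) (simp add: G_def[abs_def] del: One_nat_def)
  qed
  then have "form_fn \<phi> g" using gi \<phi> by (simp add: form_fn_def)
  moreover have "(\<lambda>n. the (form_0 \<Omega> C (u n))) \<longlonglongrightarrow> energy g"
    using energy_tendsto[OF gm gi Gm Ge limE] by (simp add: form_0_test[OF u] G_def[abs_def])
  ultimately show ?thesis using that by blast
qed

text \<open>For every approximating sequence the energies converge to the energy of some weak
  gradient of \<open>\<phi>\<close>, which is the value of \<open>form_N\<close> at
  \<open>\<phi>\<close>. So the definite description in \<open>form_closure\<close> has exactly one
  candidate.\<close>

lemma form_D_eq_form_N: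
  assumes "\<exists>u. form_approx \<Omega> (form_0 \<Omega> C) u \<phi>"
  shows "form_D \<Omega> C \<phi> = form_N \<Omega> C \<phi>"
proof -
  obtain u where u: "form_approx \<Omega> (form_0 \<Omega> C) u \<phi>" using assms by blast
  obtain g where g: "form_fn \<phi> g" "(\<lambda>n. the (form_0 \<Omega> C (u n))) \<longlonglongrightarrow> energy g"
    using form_approx_limit[OF u] by blast
  have "(THE a. \<exists>u. form_approx \<Omega> (form_0 \<Omega> C) u \<phi> \<and> (\<lambda>n. the (form_0 \<Omega> C (u n))) \<longlonglongrightarrow> a)
    = energy g"
  proof (rule the_equality)
    show "\<exists>u. form_approx \<Omega> (form_0 \<Omega> C) u \<phi> \<and> (\<lambda>n. the (form_0 \<Omega> C (u n))) \<longlonglongrightarrow> energy g"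
      using u g by blast
    fix a assume "\<exists>u. form_approx \<Omega> (form_0 \<Omega> C) u \<phi> \<and> (\<lambda>n. the (form_0 \<Omega> C (u n))) \<longlonglongrightarrow> a"
    then obtain u' where u': "form_approx \<Omega> (form_0 \<Omega> C) u' \<phi>" "(\<lambda>n. the (form_0 \<Omega> C (u' n))) \<longlonglongrightarrow> a" by blast
    obtain g' where g': "form_fn \<phi> g'" "(\<lambda>n. the (form_0 \<Omega> C (u' n))) \<longlonglongrightarrow> energy g'"
      using form_approx_limit[OF u'(1)] by blast
    have "a = energy g'" using LIMSEQ_unique[OF u'(2) g'(2)] .
    then show "a = energy g"
      using form_fn_form_N[OF g(1)] form_fn_form_N[OF g'(1)] by simp
  qed
  then show ?thesis using assms form_fn_form_N[OF g(1)] by (simp add: form_D_def form_closure_def)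
qed

definition close_to :: "real \<Rightarrow> (real^'n \<Rightarrow> real) \<Rightarrow> ('n \<Rightarrow> real^'n \<Rightarrow> real) \<Rightarrow>
    (real^'n \<Rightarrow> real) \<Rightarrow> ('n \<Rightarrow> real^'n \<Rightarrow> real) \<Rightarrow> bool" where
  "close_to e \<phi> g \<psi> h \<longleftrightarrow> (\<integral>x. (\<phi> x - \<psi> x)\<^sup>2 \<partial>L\<Omega>) < e \<and>
     energy (\<lambda>k x. g k x - h k x) < e"

definition approximable :: "(real^'n \<Rightarrow> real) \<Rightarrow> ('n \<Rightarrow> real^'n \<Rightarrow> real) \<Rightarrow> bool" where
  "approximable \<phi> g \<longleftrightarrow> (\<forall>e>0. \<exists>\<psi>\<in>test_functions \<Omega>. close_to e \<psi> (grad \<psi>) \<phi> g)"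

text \<open>Squared norms satisfy the triangle inequality only up to a factor 2, whence
  \<open>e/4\<close>.\<close>

lemma close_to_trans:
  assumes f: "form_fn \<phi> g" "form_fn \<psi> h" "form_fn \<chi>' j"
    and c: "close_to (e/4) \<phi> g \<psi> h" "close_to (e/4) \<psi> h \<chi>' j"
  shows "close_to e \<phi> g \<chi>' j"
proof -
  have s: "sq_int L\<Omega> \<phi>" "sq_int L\<Omega> \<psi>" "sq_int L\<Omega> \<chi>'" using f by (auto simp: form_fn_def)
  have i: "finite_energy g" "finite_energy h" "finite_energy j"
    using f by (auto simp: form_fn_def)
  note m = form_fn_measurable[OF f(1)] form_fn_measurable[OF f(2)] form_fn_measurable[OF f(3)]
  have "(\<integral>x. (\<phi> x - \<chi>' x)\<^sup>2 \<partial>L\<Omega>) = (\<integral>x. ((\<phi> x - \<psi> x) + (\<psi> x - \<chi>' x))\<^sup>2 \<partial>L\<Omega>)" by simp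
  also have "\<dots> \<le> 2 * (\<integral>x. (\<phi> x - \<psi> x)\<^sup>2 \<partial>L\<Omega>) + 2 * (\<integral>x. (\<psi> x - \<chi>' x)\<^sup>2 \<partial>L\<Omega>)"
    by (intro integral_sq_add_le sq_int_diff s)
  finally have 1: "(\<integral>x. (\<phi> x - \<chi>' x)\<^sup>2 \<partial>L\<Omega>) < e" using c by (simp add: close_to_def)
  have "energy (\<lambda>k x. g k x - j k x) = energy (\<lambda>k x. (g k x - h k x) + (h k x - j k x))"
    by simp
  also have "\<dots> \<le> 2 * energy (\<lambda>k x. g k x - h k x) + 2 * energy (\<lambda>k x. h k x - j k x)"
    by (rule energy_add(2)) (use m in \<open>auto intro!: energy_diff(1) i\<close>)
  finally have 2: "energy (\<lambda>k x. g k x - j k x) < e" using c by (simp add: close_to_def)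
  show ?thesis using 1 2 by (simp add: close_to_def)
qed

lemma close_to_commute: "close_to e \<phi> g \<psi> h \<Longrightarrow> close_to e \<psi> h \<phi> g"
  using energy_diff_commute[of g h] by (simp add: close_to_def power2_commute)

text \<open>Each reduction step goes through this lemma: it suffices to come close, within the form
  domain, by functions that are already known to be approximable.\<close>

lemma approximable_closure:
  assumes f: "form_fn \<phi> g" and a: "\<And>e. e > 0 \<Longrightarrow> \<exists>\<psi> h. form_fn \<psi> h \<and> approximable \<psi> h \<and> close_to e \<psi> h \<phi> g"
  shows "approximable \<phi> g"
  unfolding approximable_def
proof (intro allI impI)
  fix e :: real assume e: "e > 0"
  obtain \<psi> h where \<psi>: "form_fn \<psi> h" "approximable \<psi> h" "close_to (e/4) \<psi> h \<phi> g" using a[of "e/4"] e by auto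
  obtain \<xi> where \<xi>: "\<xi> \<in> test_functions \<Omega>" "close_to (e/4) \<xi> (grad \<xi>) \<psi> h"
    using \<psi>(2) e unfolding approximable_def by (metis divide_pos_pos zero_less_numeral)
  show "\<exists>\<psi>\<in>test_functions \<Omega>. close_to e \<psi> (grad \<psi>) \<phi> g"
    using close_to_trans[OF test_form_fn[OF \<xi>(1)] \<psi>(1) f \<xi>(2) \<psi>(3)] \<xi>(1) by blast
qed

lemma approximable_form_approx:
  assumes f: "form_fn \<phi> g" and a: "approximable \<phi> g"
  shows "\<exists>u. form_approx \<Omega> (form_0 \<Omega> C) u \<phi>"
proof -
  have "\<exists>\<psi>\<in>test_functions \<Omega>. close_to (1 / real (Suc n)) \<psi> (grad \<psi>) \<phi> g" for n
    using a unfolding approximable_def by simp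
  then obtain u where u: "\<And>n. u n \<in> test_functions \<Omega>"
    and c: "\<And>n. close_to (1 / real (Suc n)) (u n) (grad (u n)) \<phi> g" by metis
  have mono: "close_to e' \<psi> h \<phi> g" if "close_to e \<psi> h \<phi> g" "e \<le> e'" for e e' \<psi> h
    using that by (auto simp: close_to_def)
  have "(\<lambda>n. \<integral>x. (u n x - \<phi> x)\<^sup>2 \<partial>L\<Omega>) \<longlonglongrightarrow> 0"
  proof (rule tendsto_sandwich[OF _ _ tendsto_const LIMSEQ_inverse_real_of_nat])
    show "\<forall>\<^sub>F n in sequentially. (\<integral>x. (u n x - \<phi> x)\<^sup>2 \<partial>L\<Omega>) \<le> inverse (real (Suc n))"
      using c by (intro always_eventually) (auto simp: close_to_def inverse_eq_divide less_imp_le)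
  qed (auto intro!: always_eventually integral_nonneg_AE)
  moreover have "\<exists>N. \<forall>n\<ge>N. \<forall>p\<ge>N. the (form_0 \<Omega> C (\<lambda>x. u n x - u p x)) < \<epsilon>" if \<epsilon>0: "\<epsilon> > 0" for \<epsilon>
  proof -
    have "\<epsilon> / 4 > 0" using \<epsilon>0 by simp
    then obtain N where N: "1 / real (Suc N) < \<epsilon> / 4" using nat_approx_posE by metis
    show ?thesis
    proof (intro exI[of _ N] allI impI)
      fix n p assume "n \<ge> N" "p \<ge> N"
      then have "1 / real (Suc n) \<le> 1 / real (Suc N)" "1 / real (Suc p) \<le> 1 / real (Suc N)"
        by (auto intro!: divide_left_mono)
      then have "1 / real (Suc n) \<le> \<epsilon>/4" "1 / real (Suc p) \<le> \<epsilon>/4"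
        using N by linarith+
      then have "close_to (\<epsilon>/4) (u n) (grad (u n)) \<phi> g" "close_to (\<epsilon>/4) (u p) (grad (u p)) \<phi> g"
        using mono[OF c] by blast+
      from close_to_trans[OF test_form_fn[OF u] f test_form_fn[OF u] this(1) close_to_commute[OF this(2)]]
      show "the (form_0 \<Omega> C (\<lambda>x. u n x - u p x)) < \<epsilon>"
        by (simp add: form_0_test_diff[OF u u] close_to_def)
    qed
  qed
  ultimately have "form_approx \<Omega> (form_0 \<Omega> C) u \<phi>"
    using u f by (simp add: form_approx_def form_0_dom L2_on_iff form_fn_def)
  then show ?thesis by blast
qed

text \<open>Mollification gives test functions whose gradients converge in L2 on
  \<open>\<Omega>\<close>; since the coefficients are bounded, the energies of the differences tend
  to 0 as well.\<close>

lemma approximable_compact_support: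
  assumes f: "form_fn \<phi> g" and K: "compact K" "K \<subseteq> \<Omega>"
    and f0: "\<And>x. x \<notin> K \<Longrightarrow> \<phi> x = 0" and g0: "\<And>k x. x \<notin> K \<Longrightarrow> g k x = 0"
  shows "approximable \<phi> g"
  unfolding approximable_def
proof (intro allI impI)
  fix e :: real assume e: "e > 0"
  have w: "is_weak_deriv \<Omega> k \<phi> (g k)" for k using f by (simp add: form_fn_def)
  obtain u where u: "\<And>n. u n \<in> test_functions \<Omega>" "L2_lim L\<Omega> u \<phi>"
    "\<And>k. L2_lim L\<Omega> (\<lambda>n. partial_deriv k (u n)) (g k)"
    using global_smooth_approximation[OF w open_\<Omega> K f0 g0] by metis
  obtain M where M: "M > 0" "\<And>g. (\<And>k. sq_int L\<Omega> (g k)) \<Longrightarrow> energy g \<le> M * (\<Sum>k\<in>UNIV. \<integral>x. (g k x)\<^sup>2 \<partial>L\<Omega>)"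
    using energy_sq_int by metis
  have "sq_int L\<Omega> (\<lambda>x. partial_deriv k (u n) x - g k x)" for k n using u(3) by (auto simp: L2_lim_def intro: sq_int_diff)
  then have le: "energy (\<lambda>k x. partial_deriv k (u n) x - g k x) \<le> M * (\<Sum>k\<in>UNIV. \<integral>x. (partial_deriv k (u n) x - g k x)\<^sup>2 \<partial>L\<Omega>)" for n
    by (rule M(2))
  have "(\<lambda>n. \<integral>x. (partial_deriv k (u n) x - g k x)\<^sup>2 \<partial>L\<Omega>) \<longlonglongrightarrow> 0" for k using u(3) by (auto simp: L2_lim_def)
  then have "(\<lambda>n. M * (\<Sum>k\<in>UNIV. \<integral>x. (partial_deriv k (u n) x - g k x)\<^sup>2 \<partial>L\<Omega>)) \<longlonglongrightarrow> M * (\<Sum>k\<in>(UNIV::'n set). 0)"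
    by (intro tendsto_intros)
  then have "\<forall>\<^sub>F n in sequentially. M * (\<Sum>k\<in>UNIV. \<integral>x. (partial_deriv k (u n) x - g k x)\<^sup>2 \<partial>L\<Omega>) < e"
    using e by (intro order_tendstoD(2)[of _ 0]) auto
  moreover have "\<forall>\<^sub>F n in sequentially. (\<integral>x. (u n x - \<phi> x)\<^sup>2 \<partial>L\<Omega>) < e"
    using u(2) e by (intro order_tendstoD(2)[of _ 0]) (auto simp: L2_lim_def)
  ultimately have "\<forall>\<^sub>F n in sequentially. close_to e (u n) (grad (u n)) \<phi> g"
    by eventually_elim (use le in \<open>auto simp: close_to_def intro: le_less_trans\<close>)
  then obtain n where "close_to e (u n) (grad (u n)) \<phi> g" by (auto simp: eventually_sequentially)
  then show "\<exists>\<psi>\<in>test_functions \<Omega>. close_to e \<psi> (grad \<psi>) \<phi> g" using u(1) by blast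
qed

end

section \<open>Boundary layers and cutoff functions\<close>

lemma infdist_lessE:
  assumes "infdist x A < t" "A \<noteq> {}"
  obtains a where "a \<in> A" "dist x a < t"
proof -
  have "(INF a\<in>A. dist x a) < t" using assms by (simp add: infdist_def)
  then have "\<exists>a\<in>A. dist x a < t" using assms(2) by (subst (asm) cINF_less_iff) auto
  then show ?thesis using that by blast
qed

text \<open>The data that \<open>ahlfors_regular\<close> yields for one ball, with measure and
  constant made explicit so that they can be passed between lemmas.\<close>

definition ahlfors_bounds ::
  "(real^'n) measure \<Rightarrow> (real^'n) set \<Rightarrow> real^'n \<Rightarrow> real \<Rightarrow> real \<Rightarrow> real \<Rightarrow> bool" where
  "ahlfors_bounds \<mu> F x0 R0 c s \<longleftrightarrow> sets \<mu> = sets (restrict_space borel F) \<and> c > 0 \<and>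
     (\<forall>x\<in>F \<inter> ball x0 R0. \<forall>r. 0 < r \<and> r < 2 * R0 \<longrightarrow>
        ennreal (inverse c * r powr s) \<le> emeasure \<mu> ((F \<inter> ball x0 R0) \<inter> ball x r) \<and>
        emeasure \<mu> ((F \<inter> ball x0 R0) \<inter> ball x r) \<le> ennreal (c * r powr s))"

lemma ahlfors_boundsD:
  assumes "ahlfors_bounds \<mu> F x0 R0 c s"
  shows "sets \<mu> = sets (restrict_space borel F)" "c > 0"
    "\<And>x r. x \<in> F \<inter> ball x0 R0 \<Longrightarrow> 0 < r \<Longrightarrow> r < 2 * R0 \<Longrightarrow>
       ennreal (inverse c * r powr s) \<le> emeasure \<mu> ((F \<inter> ball x0 R0) \<inter> ball x r) \<and>
       emeasure \<mu> ((F \<inter> ball x0 R0) \<inter> ball x r) \<le> ennreal (c * r powr s)"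
  using assms unfolding ahlfors_bounds_def by blast+

lemma ahlfors_regular_bounds:
  assumes "ahlfors_regular s F" "x0 \<in> F" "R0 > 0"
  obtains \<mu> c where "ahlfors_bounds \<mu> F x0 R0 c s"
  using assms unfolding ahlfors_regular_def ahlfors_bounds_def regular_borel_measure_on_def by meson

text \<open>The balls of radius \<open>t/2\<close> about the points of \<open>S\<close> are
  disjoint, have mass at least \<open>(t/2) powr s / c\<close> and lie in
  \<open>ball x (3 * r)\<close>, whose mass is at most \<open>c * (3 * r) powr s\<close>.\<close>

lemma separated_card_bound:
  fixes F :: "(real^'n) set"
  assumes A: "ahlfors_bounds \<mu> F x0 R0 c s" and x: "x \<in> F" "dist x0 x + 2 * r < R0" and t: "0 < t" "t \<le> r"
    and S: "finite S" "S \<subseteq> F \<inter> ball x (2 * r)" "\<And>p q. p \<in> S \<Longrightarrow> q \<in> S \<Longrightarrow> p \<noteq> q \<Longrightarrow> t \<le> dist p q"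
  shows "real (card S) \<le> c\<^sup>2 * (6 * r / t) powr s"
proof -
  note \<mu> = ahlfors_boundsD(1)[OF A] and c = ahlfors_boundsD(2)[OF A] and reg = ahlfors_boundsD(3)[OF A]
  let ?A = "F \<inter> ball x0 R0"
  have SA: "p \<in> ?A" if "p \<in> S" for p
  proof -
    have "dist x0 p \<le> dist x0 x + dist x p" by (rule dist_triangle)
    then show ?thesis using S(2) that x by auto
  qed
  have R0: "3 * r < 2 * R0" "t / 2 < 2 * R0" using x t zero_le_dist[of x0 x] by linarith+
  have meas: "?A \<inter> ball p u \<in> sets \<mu>" for p u
    unfolding \<mu> sets_restrict_space by (auto intro!: image_eqI[of _ _ "ball x0 R0 \<inter> ball p u"])
  have disj: "disjoint_family_on (\<lambda>p. ?A \<inter> ball p (t/2)) S"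
    unfolding disjoint_family_on_def
  proof (intro ballI impI)
    fix p q assume pq: "p \<in> S" "q \<in> S" "p \<noteq> q"
    show "(?A \<inter> ball p (t/2)) \<inter> (?A \<inter> ball q (t/2)) = {}"
    proof (rule ccontr)
      assume "(?A \<inter> ball p (t/2)) \<inter> (?A \<inter> ball q (t/2)) \<noteq> {}"
      then obtain z where "dist p z < t/2" "dist q z < t/2" by auto
      then have "dist p q < t" using dist_triangle2[of p q z] by linarith
      then show False using S(3)[OF pq] by linarith
    qed
  qed
  have "ennreal (real (card S) * (inverse c * (t/2) powr s)) = (\<Sum>p\<in>S. ennreal (inverse c * (t/2) powr s))"
    using c by (simp add: ennreal_mult ennreal_of_nat_eq_real_of_nat)
  also have "\<dots> \<le> (\<Sum>p\<in>S. emeasure \<mu> (?A \<inter> ball p (t/2)))"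
    using reg[OF SA, of _ "t/2"] t R0 by (intro sum_mono) auto
  also have "\<dots> = emeasure \<mu> (\<Union>p\<in>S. ?A \<inter> ball p (t/2))"
    by (rule sum_emeasure[OF _ disj S(1)]) (use meas in auto)
  also have "\<dots> \<le> emeasure \<mu> (?A \<inter> ball x (3 * r))"
  proof (rule emeasure_mono[OF _ meas])
    show "(\<Union>p\<in>S. ?A \<inter> ball p (t/2)) \<subseteq> ?A \<inter> ball x (3 * r)"
    proof
      fix z assume "z \<in> (\<Union>p\<in>S. ?A \<inter> ball p (t/2))"
      then obtain p where p: "p \<in> S" "z \<in> ?A" "dist p z < t/2" by auto
      have "dist x z \<le> dist x p + dist p z" by (rule dist_triangle)
      also have "\<dots> < 3 * r" using S(2) p t by auto
      finally show "z \<in> ?A \<inter> ball x (3 * r)" using p by simp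
    qed
  qed
  also have "\<dots> \<le> ennreal (c * (3 * r) powr s)"
    using reg[of x "3 * r"] x t R0 zero_le_dist[of x0 x] by auto
  finally have "real (card S) * (inverse c * (t/2) powr s) \<le> c * (3 * r) powr s"
    using c by (simp add: ennreal_le_iff)
  then have "real (card S) \<le> c\<^sup>2 * ((3 * r) powr s / (t/2) powr s)"
    using c t by (simp add: field_simps power2_eq_square)
  also have "(3 * r) powr s / (t/2) powr s = (6 * r / t) powr s"
    using t by (subst powr_divide[symmetric]) (auto simp: field_simps)
  finally show ?thesis .
qed

text \<open>A \<open>t\<close>-separated subset of \<open>F\<close> of maximal size is a
  \<open>t\<close>-net, so the balls of radius \<open>2 * t\<close> about its points cover the
  layer. The packing bound on their number times their volume gives the estimate.\<close>

lemma ahlfors_volume: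
  fixes F :: "(real^'n) set"
  assumes F: "ahlfors_regular s F" and x0: "x0 \<in> F" and R0: "R0 > 0"
  obtains c where "c > 0" "\<And>x r t. x \<in> F \<Longrightarrow> 0 < t \<Longrightarrow> t \<le> r \<Longrightarrow> dist x0 x + 2 * r < R0 \<Longrightarrow>
     measure lebesgue {y. dist x y < r \<and> infdist y F < t} \<le> c * t powr (real CARD('n) - s) * r powr s"
proof -
  obtain \<mu> c where A: "ahlfors_bounds \<mu> F x0 R0 c s" using ahlfors_regular_bounds[OF F x0 R0] .
  note c = ahlfors_boundsD(2)[OF A]
  define \<omega> where "\<omega> = unit_ball_vol (real CARD('n))"
  have \<omega>: "\<omega> > 0" by (simp add: \<omega>_def)
  show ?thesis
  proof
    let ?d = "real CARD('n)"
    show "c\<^sup>2 * 6 powr s * \<omega> * 2 ^ CARD('n) > 0" using c \<omega> by simp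
    fix x r t assume x: "x \<in> F" "dist x0 x + 2 * r < R0" and t: "0 < t" "t \<le> r"
    \<comment> \<open>The radius \<open>2 * r\<close> takes in every point of \<open>F\<close> that
      is within \<open>t \<le> r\<close> of a point of \<open>ball x r\<close>.\<close>
    define P where "P S \<longleftrightarrow> finite S \<and> S \<subseteq> F \<inter> ball x (2 * r) \<and> (\<forall>p\<in>S. \<forall>q\<in>S. p \<noteq> q \<longrightarrow> t \<le> dist p q)" for S
    have bd: "real (card S) \<le> c\<^sup>2 * (6 * r / t) powr s" if "P S" for S
      using separated_card_bound[OF A x t, of S] that by (auto simp: P_def)
    have "P {}" by (simp add: P_def)
    moreover obtain N where N: "c\<^sup>2 * (6 * r / t) powr s \<le> real N" using real_arch_simple by blast
    then have "\<forall>S. P S \<longrightarrow> card S < Suc N"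
      using bd by (metis less_Suc_eq_le of_nat_le_iff order_trans)
    ultimately obtain S where S: "P S" and max: "\<And>T. P T \<Longrightarrow> card T \<le> card S"
      using ex_has_greatest_nat[of P "{}" card] by blast
    have cov: "\<exists>p\<in>S. dist f p < t" if f: "f \<in> F" "dist x f < 2 * r" for f
    proof (rule ccontr)
      assume n: "\<not> (\<exists>p\<in>S. dist f p < t)"
      then have nS: "f \<notin> S" using t by auto
      have "P (insert f S)" unfolding P_def using S f n by (auto simp: P_def dist_commute not_less)
      from max[OF this] show False using nS S by (simp add: P_def)
    qed
    have sub: "{y. dist x y < r \<and> infdist y F < t} \<subseteq> (\<Union>p\<in>S. ball p (2 * t))"
    proof
      fix y assume "y \<in> {y. dist x y < r \<and> infdist y F < t}"
      then have y: "dist x y < r" "infdist y F < t" by auto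
      obtain f where f: "f \<in> F" "dist y f < t" using infdist_lessE[OF y(2)] x(1) by blast
      have "dist x f < 2 * r" using dist_triangle[of x f y] y(1) f(2) t by linarith
      then obtain p where p: "p \<in> S" "dist f p < t" using cov f by blast
      have "dist p y < 2 * t" using dist_triangle[of p y f] f(2) p(2) by (simp add: dist_commute)
      then show "y \<in> (\<Union>p\<in>S. ball p (2 * t))" using p(1) by auto
    qed
    have fS: "finite S" using S by (simp add: P_def)
    have "measure lebesgue {y. dist x y < r \<and> infdist y F < t} \<le> measure lebesgue (\<Union>p\<in>S. ball p (2 * t))"
    proof (rule measure_mono_fmeasurable[OF sub])
      have "open {y. dist x y < r \<and> infdist y F < t}"
        by (intro open_Collect_conj open_Collect_less continuous_intros)
      then show "{y. dist x y < r \<and> infdist y F < t} \<in> sets lebesgue" by simp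
      show "(\<Union>p\<in>S. ball p (2 * t)) \<in> lmeasurable" using fS by (intro fmeasurable.finite_UN) auto
    qed
    also have "\<dots> \<le> (\<Sum>p\<in>S. measure lebesgue (ball p (2 * t)))"
      by (rule measure_UNION_le[OF fS]) auto
    also have "\<dots> = real (card S) * (\<omega> * (2 * t) ^ CARD('n))"
      using t by (simp add: content_ball \<omega>_def)
    also have "\<dots> \<le> (c\<^sup>2 * (6 * r / t) powr s) * (\<omega> * (2 * t) ^ CARD('n))"
      using bd[OF S] \<omega> t by (intro mult_right_mono) auto
    also have "(6 * r / t) powr s = 6 powr s * r powr s / t powr s"
      using t by (simp add: powr_divide powr_mult)
    also have "(2 * t) ^ CARD('n) = 2 ^ CARD('n) * t powr ?d"
      using t by (simp add: power_mult_distrib powr_realpow)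
    also have "(c\<^sup>2 * (6 powr s * r powr s / t powr s)) * (\<omega> * (2 ^ CARD('n) * t powr ?d))
       = c\<^sup>2 * 6 powr s * \<omega> * 2 ^ CARD('n) * (t powr ?d / t powr s) * r powr s" by simp
    also have "t powr ?d / t powr s = t powr (?d - s)" by (simp add: powr_diff)
    finally show "measure lebesgue {y. dist x y < r \<and> infdist y F < t}
      \<le> c\<^sup>2 * 6 powr s * \<omega> * 2 ^ CARD('n) * t powr (?d - s) * r powr s" .
  qed
qed

text \<open>By scaling, one derivative of the kernel costs a factor \<open>1 / \<epsilon>\<close> in
  the L1 norm.\<close>

lemma moll_partial_L1:
  obtains M where "M > 0" "\<And>\<epsilon> k (x::real^'n). \<epsilon> > 0 \<Longrightarrow> (\<integral>y. \<bar>partial_deriv k (moll \<epsilon>) (x - y)\<bar> \<partial>lebesgue) \<le> M / \<epsilon>"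
    "\<And>\<epsilon> k (x::real^'n). \<epsilon> > 0 \<Longrightarrow> integrable lebesgue (\<lambda>y. \<bar>partial_deriv k (moll \<epsilon>) (x - y)\<bar>)"
proof -
  let ?U = "unit_kernel :: real^'n \<Rightarrow> real"
  let ?I = "\<lambda>k. \<integral>y. \<bar>partial_deriv k ?U y\<bar> \<partial>lborel"
  define M where "M = 1 + (\<Sum>k\<in>UNIV. ?I k)"
  have I0: "0 \<le> ?I k" for k by (intro integral_nonneg_AE) auto
  have M: "M > 0" unfolding M_def using I0 by (intro add_pos_nonneg sum_nonneg) auto
  have IM: "?I k \<le> M" for k
    unfolding M_def using I0 member_le_sum[of k UNIV ?I] by simp
  have U1: "C_order 1 ?U" using smooth_fn_C_order[OF unit_kernel(1)] .
  have cU: "continuous_on UNIV (partial_deriv k ?U)" for k by (rule C_order_1_continuous_partial[OF U1])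
  have pd: "partial_deriv k (moll \<epsilon>) z = (1/\<epsilon>) ^ CARD('n) * ((1/\<epsilon>) * partial_deriv k ?U (0 + (1/\<epsilon>) *\<^sub>R z))" for k \<epsilon> z
  proof -
    have d: "?U differentiable at (0 + (1/\<epsilon>) *\<^sub>R z)" by (rule C_order_1_differentiable[OF U1])
    have d': "(\<lambda>x. ?U (0 + (1/\<epsilon>) *\<^sub>R x)) differentiable at z"
      using C_order_1_differentiable[OF C_order_affine[OF U1]] .
    show ?thesis unfolding moll_def[abs_def]
      by (simp only: partial_deriv_mult[OF differentiable_const d'] partial_deriv_const partial_deriv_affine[OF d] mult_zero_left add_0_right)
  qed
  have eq: "(\<integral>y. \<bar>partial_deriv k (moll \<epsilon>) (x - y)\<bar> \<partial>lebesgue) = ?I k / \<epsilon>" if e: "\<epsilon> > 0" for \<epsilon> k and x :: "real^'n"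
  proof -
    have b1: "(\<lambda>y. \<bar>partial_deriv k (moll \<epsilon>) y\<bar>) \<in> borel_measurable borel"
      by (intro borel_measurable_continuous_onI continuous_intros C_order_1_continuous_partial moll_C1)
    have b2: "(\<lambda>y. \<bar>partial_deriv k ?U y\<bar>) \<in> borel_measurable borel"
      by (intro borel_measurable_continuous_onI continuous_intros cU)
    have b3: "(\<lambda>y. \<bar>partial_deriv k (moll \<epsilon>) (x - y)\<bar>) \<in> borel_measurable borel"
      by (intro borel_measurable_continuous_onI continuous_intros continuous_on_compose2[OF C_order_1_continuous_partial[OF moll_C1]]) auto
    have "(\<integral>y. \<bar>partial_deriv k (moll \<epsilon>) (x - y)\<bar> \<partial>lebesgue) = (\<integral>y. \<bar>partial_deriv k (moll \<epsilon>) (x - y)\<bar> \<partial>lborel)"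
      using b3 by (simp add: integral_completion)
    also have "\<dots> = (\<integral>y. \<bar>partial_deriv k (moll \<epsilon>) y\<bar> \<partial>lborel)" by (rule integral_lborel_reflect[OF b1])
    also have "\<dots> = (\<integral>y. (1/\<epsilon>) * ((1/\<epsilon>) ^ CARD('n) * \<bar>partial_deriv k ?U (0 + (1/\<epsilon>) *\<^sub>R y)\<bar>) \<partial>lborel)"
      using e by (intro Bochner_Integration.integral_cong) (auto simp: pd abs_mult)
    also have "\<dots> = (1/\<epsilon>) * ((1/\<epsilon>) ^ CARD('n) * (\<integral>y. \<bar>partial_deriv k ?U (0 + (1/\<epsilon>) *\<^sub>R y)\<bar> \<partial>lborel))" by simp
    also have "(1/\<epsilon>) ^ CARD('n) * (\<integral>y. \<bar>partial_deriv k ?U (0 + (1/\<epsilon>) *\<^sub>R y)\<bar> \<partial>lborel) = ?I k"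
      using integral_lborel_affine[OF b2, of "1/\<epsilon>" 0] e by simp
    finally show ?thesis by simp
  qed
  show ?thesis
  proof
    show "M > 0" by fact
    fix \<epsilon> :: real and k and x :: "real^'n" assume e: "\<epsilon> > 0"
    show "(\<integral>y. \<bar>partial_deriv k (moll \<epsilon>) (x - y)\<bar> \<partial>lebesgue) \<le> M / \<epsilon>"
      unfolding eq[OF e] using IM e by (intro divide_right_mono) auto
    let ?f = "\<lambda>y. \<bar>partial_deriv k (moll \<epsilon>) (x - y)\<bar>"
    have "bounded {y. partial_deriv k (moll \<epsilon>) y \<noteq> 0}"
      by (rule partial_deriv_bounded_support[OF moll_bounded_support[OF e]])
    then obtain R where R: "\<And>y. partial_deriv k (moll \<epsilon>) y \<noteq> 0 \<Longrightarrow> norm y \<le> R" by (auto simp: bounded_iff)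
    obtain a where a: "cball x R \<subseteq> cbox (-a) a" using bounded_subset_cbox_symmetric[OF bounded_cball] by metis
    have cf: "continuous_on UNIV ?f"
      by (intro continuous_intros continuous_on_compose2[OF C_order_1_continuous_partial[OF moll_C1]]) auto
    have "y \<in> cbox (-a) a" if "?f y \<noteq> 0" for y
    proof -
      have "y \<in> cball x R" using R[of "x - y"] that by (simp add: dist_norm)
      then show ?thesis using a by blast
    qed
    from continuous_compact_support_integrable(1)[OF cf this]
    show "integrable lebesgue ?f" using borel_measurable_continuous_onI[OF cf] by (simp add: integrable_completion)
  qed
qed

definition soft_indicator :: "real \<Rightarrow> (real^'n) set \<Rightarrow> real \<Rightarrow> (real^'n \<Rightarrow> real) \<Rightarrow> bool" where
  "soft_indicator M U \<epsilon> \<zeta> \<longleftrightarrow> smooth_fn \<zeta> \<and>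
     (\<forall>x. 0 \<le> \<zeta> x \<and> \<zeta> x \<le> 1) \<and> (\<forall>x k. \<bar>partial_deriv k \<zeta> x\<bar> \<le> M / \<epsilon>) \<and>
     (\<forall>x. ball x \<epsilon> \<subseteq> U \<longrightarrow> \<zeta> x = 1) \<and> (\<forall>x. ball x \<epsilon> \<inter> U = {} \<longrightarrow> \<zeta> x = 0)"

text \<open>\<open>M\<close> is chosen before \<open>U\<close> and \<open>\<epsilon>\<close>: the
  derivative falls on the kernel, whose L1 norm bounds the gradient whatever the set is. This
  uniformity is what allows the scales to be compared.\<close>

lemma mollified_indicator:
  obtains M where "M > 0" "\<And>U \<epsilon>. compact U \<Longrightarrow> \<epsilon> > 0 \<Longrightarrow> \<exists>\<zeta>::real^'n \<Rightarrow> real. soft_indicator M U \<epsilon> \<zeta>"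
proof -
  obtain M where M: "M > 0" "\<And>\<epsilon> k (x::real^'n). \<epsilon> > 0 \<Longrightarrow> (\<integral>y. \<bar>partial_deriv k (moll \<epsilon>) (x - y)\<bar> \<partial>lebesgue) \<le> M / \<epsilon>"
    "\<And>\<epsilon> k (x::real^'n). \<epsilon> > 0 \<Longrightarrow> integrable lebesgue (\<lambda>y. \<bar>partial_deriv k (moll \<epsilon>) (x - y)\<bar>)"
    using moll_partial_L1 by metis
  show ?thesis
  proof
    show "M > 0" by fact
    fix U :: "(real^'n) set" and \<epsilon> :: real assume U: "compact U" and e: "\<epsilon> > 0"
    let ?i = "indicator U :: real^'n \<Rightarrow> real"
    have "emeasure lborel U < \<infinity>" by (rule emeasure_bounded_finite) (use U compact_imp_bounded in auto)
    then have i: "integrable lebesgue ?i" using U by (intro integrable_real_indicator) (auto simp: compact_imp_closed)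
    define \<zeta> where "\<zeta> = convol ?i (moll \<epsilon>)"
    note mi = moll_integral_shift[OF e]
    note ci = convol_integrable[OF i moll_continuous moll_bounded_support[OF e]]
    have "smooth_fn \<zeta>" unfolding \<zeta>_def by (rule smooth_fn_convol[OF i smooth_moll moll_bounded_support[OF e]])
    moreover have "0 \<le> \<zeta> x" for x
      unfolding \<zeta>_def convol_def by (intro integral_nonneg_AE AE_I2 mult_nonneg_nonneg moll_nonneg e) auto
    moreover have "\<zeta> x \<le> 1" for x
    proof -
      have "\<zeta> x \<le> (\<integral>y. moll \<epsilon> (x - y) \<partial>lebesgue)"
        unfolding \<zeta>_def convol_def
        by (rule integral_mono[OF ci mi(2)]) (use moll_nonneg[OF e] in \<open>auto simp: indicator_def\<close>)
      then show ?thesis by (simp add: mi)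
    qed
    moreover have "\<bar>partial_deriv k \<zeta> x\<bar> \<le> M / \<epsilon>" for k x
    proof -
      have "partial_deriv k \<zeta> x = (\<integral>y. ?i y * partial_deriv k (moll \<epsilon>) (x - y) \<partial>lebesgue)"
        unfolding \<zeta>_def partial_deriv_convol[OF i moll_C1 moll_bounded_support[OF e]] convol_def ..
      also have "\<bar>\<dots>\<bar> \<le> (\<integral>y. \<bar>partial_deriv k (moll \<epsilon>) (x - y)\<bar> \<partial>lebesgue)"
        unfolding real_norm_def[symmetric]
      proof (rule Bochner_Integration.integral_norm_bound_integral)
        show "integrable lebesgue (\<lambda>y. ?i y * partial_deriv k (moll \<epsilon>) (x - y))"
          by (rule convol_integrable[OF i C_order_1_continuous_partial[OF moll_C1] partial_deriv_bounded_support[OF moll_bounded_support[OF e]]])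
        show "integrable lebesgue (\<lambda>y. norm (partial_deriv k (moll \<epsilon>) (x - y)))"
          using M(3)[OF e] by simp
      qed (auto simp: indicator_def)
      also have "\<dots> \<le> M / \<epsilon>" by (rule M(2)[OF e])
      finally show ?thesis .
    qed
    moreover have "\<zeta> x = 1" if "ball x \<epsilon> \<subseteq> U" for x
    proof -
      have "?i y * moll \<epsilon> (x - y) = moll \<epsilon> (x - y)" for y
        using moll_support[OF e, of "x - y"] that by (cases "moll \<epsilon> (x - y) = 0") (auto simp: dist_norm indicator_def)
      then have "(\<lambda>y. ?i y * moll \<epsilon> (x - y)) = (\<lambda>y. moll \<epsilon> (x - y))" by blast
      then show ?thesis unfolding \<zeta>_def convol_def by (simp only: mi)
    qed
    moreover have "\<zeta> x = 0" if "ball x \<epsilon> \<inter> U = {}" for x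
    proof -
      have "?i y * moll \<epsilon> (x - y) = 0" for y
        using moll_support[OF e, of "x - y"] that by (cases "moll \<epsilon> (x - y) = 0") (auto simp: dist_norm indicator_def)
      then have "(\<lambda>y. ?i y * moll \<epsilon> (x - y)) = (\<lambda>y. 0)" by blast
      then show ?thesis unfolding \<zeta>_def convol_def by simp
    qed
    ultimately show "\<exists>\<zeta>::real^'n \<Rightarrow> real. soft_indicator M U \<epsilon> \<zeta>" unfolding soft_indicator_def by blast
  qed
qed

section \<open>Steps along the boundary and nearest boundary pieces\<close>

lemma partial_deriv_locally_const:
  assumes "open S" "x \<in> S" "\<And>y. y \<in> S \<Longrightarrow> f y = c"
  shows "partial_deriv k f x = 0"
proof (rule partial_deriv_eqI)
  show "(f has_derivative (\<lambda>h. 0)) (at x)"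
    by (rule has_derivative_transform_within_open[OF has_derivative_const assms(1,2)]) (simp add: assms(3))
qed

text \<open>A smooth step across the level set of height \<open>t\<close> of the distance to \<open>G\<close>; restricting the
  first condition to a ball makes the indicator function to be mollified integrable.\<close>

definition layer_cutoff :: "(real^'n) set \<Rightarrow> real \<Rightarrow> real \<Rightarrow> (real^'n \<Rightarrow> real) \<Rightarrow> bool" where
  "layer_cutoff G \<rho> t \<zeta> \<longleftrightarrow> smooth_fn \<zeta> \<and>
     (\<forall>x. 0 \<le> \<zeta> x \<and> \<zeta> x \<le> 1) \<and>
     (\<forall>x. norm x < \<rho> - 1 \<and> infdist x G < 3/4 * t \<longrightarrow> \<zeta> x = 1 \<and> (\<forall>k. partial_deriv k \<zeta> x = 0)) \<and>
     (\<forall>x. infdist x G > 5/4 * t \<longrightarrow> \<zeta> x = 0 \<and> (\<forall>k. partial_deriv k \<zeta> x = 0))"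

text \<open>Mollifying the indicator of \<open>infdist x G \<le> t\<close> at radius
  \<open>t / 4\<close> leaves a transition only between \<open>3/4 * t\<close> and
  \<open>5/4 * t\<close>. The constant is common to all \<open>G\<close>, \<open>\<rho>\<close> and
  \<open>t\<close>.\<close>

lemma scale_cutoff:
  obtains M where "M > 0" "\<And>(G::(real^'n) set) \<rho> t. 0 < t \<Longrightarrow> t \<le> 1 \<Longrightarrow> \<exists>\<zeta>. layer_cutoff G \<rho> t \<zeta> \<and> (\<forall>x k. \<bar>partial_deriv k \<zeta> x\<bar> \<le> M / t)"
proof -
  obtain M where M: "M > 0" "\<And>U \<epsilon>. compact U \<Longrightarrow> \<epsilon> > 0 \<Longrightarrow> \<exists>\<zeta>::real^'n \<Rightarrow> real. soft_indicator M U \<epsilon> \<zeta>"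
    using mollified_indicator by blast
  show ?thesis
  proof
    show "4 * M > 0" using M by simp
    fix G :: "(real^'n) set" and \<rho> t :: real assume t: "0 < t" "t \<le> 1"
    define U where "U = {x \<in> cball 0 \<rho>. infdist x G \<le> t}"
    have "closed {x. infdist x G \<le> t}" by (intro closed_Collect_le continuous_intros)
    then have "compact (cball 0 \<rho> \<inter> {x. infdist x G \<le> t})" by (intro compact_Int_closed) auto
    also have "cball 0 \<rho> \<inter> {x. infdist x G \<le> t} = U" by (auto simp: U_def)
    finally have "compact U" .
    from M(2)[OF this, of "t/4"] t obtain \<zeta> where \<zeta>: "smooth_fn \<zeta>" "\<And>x. 0 \<le> \<zeta> x \<and> \<zeta> x \<le> 1"
      "\<And>x k. \<bar>partial_deriv k \<zeta> x\<bar> \<le> M / (t/4)"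
      "\<And>x. ball x (t/4) \<subseteq> U \<Longrightarrow> \<zeta> x = 1" "\<And>x. ball x (t/4) \<inter> U = {} \<Longrightarrow> \<zeta> x = 0" unfolding soft_indicator_def by auto
    have 1: "\<zeta> x = 1" if x: "norm x < \<rho> - 1" "infdist x G < 3/4 * t" for x
    proof (rule \<zeta>(4), rule subsetI)
      fix y assume "y \<in> ball x (t/4)"
      then have y: "dist x y < t/4" by simp
      have "norm y \<le> norm x + dist x y" using norm_triangle_sub[of y x] by (simp add: dist_norm norm_minus_commute)
      moreover have "infdist y G \<le> infdist x G + dist y x" by (rule infdist_triangle)
      ultimately show "y \<in> U" using x y t by (auto simp: U_def dist_commute)
    qed
    have 0: "\<zeta> x = 0" if x: "infdist x G > 5/4 * t" for x
    proof (rule \<zeta>(5), rule ccontr)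
      assume "ball x (t/4) \<inter> U \<noteq> {}"
      then obtain y where y: "dist x y < t/4" "infdist y G \<le> t" by (auto simp: U_def)
      have "infdist x G \<le> infdist y G + dist x y" by (rule infdist_triangle)
      then show False using x y by linarith
    qed
    have d1: "partial_deriv k \<zeta> x = 0" if x: "norm x < \<rho> - 1" "infdist x G < 3/4 * t" for x k
      by (rule partial_deriv_locally_const[of "{x. norm x < \<rho> - 1 \<and> infdist x G < 3/4 * t}" _ _ 1])
         (use x 1 in \<open>auto intro!: open_Collect_conj open_Collect_less continuous_intros\<close>)
    have d0: "partial_deriv k \<zeta> x = 0" if x: "infdist x G > 5/4 * t" for x k
      by (rule partial_deriv_locally_const[of "{x. infdist x G > 5/4 * t}" _ _ 0])
         (use x 0 in \<open>auto intro!: open_Collect_less continuous_intros\<close>)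
    show "\<exists>\<zeta>. layer_cutoff G \<rho> t \<zeta> \<and> (\<forall>x k. \<bar>partial_deriv k \<zeta> x\<bar> \<le> 4 * M / t)"
      unfolding layer_cutoff_def using \<zeta>(1,2,3) 1 0 d1 d0 by (intro exI[of _ \<zeta>]) (auto simp: mult.commute)
  qed
qed

lemma infdist_frontier_pos:
  assumes "open \<Omega>" "x \<in> \<Omega>" "frontier \<Omega> \<noteq> {}"
  shows "0 < infdist x (frontier \<Omega>)"
proof -
  have "x \<notin> frontier \<Omega>" using assms by (simp add: frontier_def interior_open)
  then have "infdist x (frontier \<Omega>) \<noteq> 0"
    using in_closed_iff_infdist_zero[OF frontier_closed assms(3)] by blast
  then show ?thesis using infdist_nonneg[of x "frontier \<Omega>"] by linarith
qed

text \<open>A nearest point of \<open>\<Gamma>\<close> lies in \<open>U\<close> and in the closure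
  of some \<open>F j\<close>, hence in the closure of \<open>F j \<inter> U\<close>. For bounded
  \<open>U\<close> this bounded piece therefore realises the distance to \<open>\<Gamma>\<close>, as
  the hypotheses on the coefficients require of \<open>A\<close>.\<close>

lemma nearest_boundary_part:
  fixes \<Gamma> :: "'a::heine_borel set"
  assumes \<Gamma>: "closed \<Gamma>" "\<Gamma> \<noteq> {}" "\<Gamma> = (\<Union>j\<in>J. closure (F j))" and U: "open U" "ball x r \<subseteq> U" "infdist x \<Gamma> < r"
  obtains j where "j \<in> J" "F j \<inter> U \<noteq> {}" "infdist x (F j \<inter> U) = infdist x \<Gamma>" "infdist x (F j) = infdist x \<Gamma>"
proof -
  obtain y where y: "y \<in> \<Gamma>" "infdist x \<Gamma> = dist x y" using infdist_attains_inf[OF \<Gamma>(1,2)] by blast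
  then obtain j where j: "j \<in> J" "y \<in> closure (F j)" using \<Gamma>(3) by blast
  have "y \<in> U" using y U by auto
  then have yc: "y \<in> closure (F j \<inter> U)"
    using open_Int_closure_subset[OF U(1), of "F j"] j by (auto simp: Int_commute)
  then have ne: "F j \<inter> U \<noteq> {}" by force
  have sub: "F j \<subseteq> \<Gamma>" using \<Gamma>(3) j(1) closure_subset by blast
  have le: "infdist x A \<le> infdist x \<Gamma>" if "y \<in> closure A" for A
  proof -
    have A: "A \<noteq> {}" using that by force
    have "infdist y A = 0" using that in_closure_iff_infdist_zero[OF A] by blast
    then show ?thesis using infdist_triangle[of x A y] y(2) by simp
  qed
  have "infdist x (F j \<inter> U) = infdist x \<Gamma>"
    using le[OF yc] infdist_mono[OF le_infI1[OF sub] ne, of x] by linarith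
  moreover have "infdist x (F j) = infdist x \<Gamma>"
    using le[OF j(2)] infdist_mono[OF sub, of x] ne by fastforce
  ultimately show ?thesis using that j ne by blast
qed

section \<open>Truncation\<close>

lemma is_weak_deriv_cong:
  fixes f g :: "real^'n \<Rightarrow> real"
  assumes w: "is_weak_deriv \<Omega> k f g" and \<Omega>: "open \<Omega>"
    and eq: "\<And>x. x \<in> \<Omega> \<Longrightarrow> f' x = f x" "\<And>x. x \<in> \<Omega> \<Longrightarrow> g' x = g x"
  shows "is_weak_deriv \<Omega> k f' g'"
proof -
  have L: "h' \<in> L2_loc \<Omega>" if "h \<in> L2_loc \<Omega>" "\<And>x. x \<in> \<Omega> \<Longrightarrow> h' x = h x" for h h' :: "real^'n \<Rightarrow> real"
    unfolding L2_loc_def L2_on_iff mem_Collect_eq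
  proof (intro allI impI)
    fix K assume K: "compact K \<and> K \<subseteq> \<Omega>"
    then have "sq_int (lebesgue_on K) h" using L2_loc_sq_int[OF that(1)] by blast
    moreover have "sq_int (lebesgue_on K) h = sq_int (lebesgue_on K) h'"
      unfolding sq_int_def using that(2) K
      by (intro conj_cong measurable_cong Bochner_Integration.integrable_cong) auto
    ultimately show "sq_int (lebesgue_on K) h'" by simp
  qed
  have I: "(\<integral>x. h' x * \<psi> x \<partial>lebesgue_on \<Omega>) = (\<integral>x. h x * \<psi> x \<partial>lebesgue_on \<Omega>)"
    if "\<And>x. x \<in> \<Omega> \<Longrightarrow> h' x = h x" for h h' \<psi> :: "real^'n \<Rightarrow> real"
    by (rule Bochner_Integration.integral_cong) (use that in auto)
  show ?thesis using w L[of f f'] L[of g g'] eq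
    by (simp add: is_weak_deriv_def I[of f' f] I[of g' g])
qed

text \<open>Arctangents are used rather than \<open>min\<close> and \<open>max\<close> because their
  derivatives are bounded and Lipschitz, as \<open>is_weak_deriv_chain\<close> requires.
  \<open>Suc n\<close> avoids division by 0.\<close>

definition arctan_trunc :: "nat \<Rightarrow> real \<Rightarrow> real" where
  "arctan_trunc n t = real (Suc n) * arctan (t / real (Suc n))"

definition arctan_trunc' :: "nat \<Rightarrow> real \<Rightarrow> real" where
  "arctan_trunc' n t = inverse (1 + (t / real (Suc n))\<^sup>2)"

lemma arctan_trunc_deriv: "(arctan_trunc n has_real_derivative arctan_trunc' n t) (at t)"
  unfolding arctan_trunc_def[abs_def] arctan_trunc'_def
  by (auto intro!: derivative_eq_intros simp del: of_nat_Suc)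

lemma arctan_trunc'_bounds: "0 < arctan_trunc' n t" "arctan_trunc' n t \<le> 1"
proof -
  have 1: "1 \<le> 1 + (t / real (Suc n))\<^sup>2" using zero_le_power2[of "t / real (Suc n)"] by linarith
  then have "0 < 1 + (t / real (Suc n))\<^sup>2" by linarith
  then show "0 < arctan_trunc' n t" unfolding arctan_trunc'_def by (rule positive_imp_inverse_positive)
  show "arctan_trunc' n t \<le> 1" unfolding arctan_trunc'_def using le_imp_inverse_le[OF 1] by simp
qed

lemma arctan_trunc_Lipschitz: "\<bar>arctan_trunc n a - arctan_trunc n b\<bar> \<le> 1 * \<bar>a - b\<bar>"
  using field_differentiable_bound[of UNIV "arctan_trunc n" "arctan_trunc' n" 1 a b]
    arctan_trunc_deriv[of n] arctan_trunc'_bounds[of n] by (simp add: less_imp_le)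

lemma arctan_trunc'_Lipschitz: "\<bar>arctan_trunc' n a - arctan_trunc' n b\<bar> \<le> 1 * \<bar>a - b\<bar>"
proof -
  have *: "\<bar>inverse (1 + x\<^sup>2) - inverse (1 + y\<^sup>2)\<bar> \<le> \<bar>x - y\<bar>" for x y :: real
  proof -
    have p: "1 + x\<^sup>2 > 0" "1 + y\<^sup>2 > 0" by (auto intro: add_pos_nonneg)
    have "inverse (1 + x\<^sup>2) - inverse (1 + y\<^sup>2) = (y - x) * (y + x) / ((1 + x\<^sup>2) * (1 + y\<^sup>2))"
      using p by (simp add: field_simps power2_eq_square)
    then have "\<bar>inverse (1 + x\<^sup>2) - inverse (1 + y\<^sup>2)\<bar> = \<bar>x - y\<bar> * (\<bar>y + x\<bar> / ((1 + x\<^sup>2) * (1 + y\<^sup>2)))"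
      using p by (simp add: abs_mult abs_minus_commute)
    also have "\<dots> \<le> \<bar>x - y\<bar> * 1"
    proof (intro mult_left_mono)
      have "2 * \<bar>x\<bar> \<le> 1 + x\<^sup>2" "2 * \<bar>y\<bar> \<le> 1 + y\<^sup>2"
        using sum_squares_bound[of 1 "\<bar>x\<bar>"] sum_squares_bound[of 1 "\<bar>y\<bar>"] by auto
      then have "\<bar>y + x\<bar> \<le> 1 + x\<^sup>2 + y\<^sup>2" using abs_triangle_ineq[of y x] zero_le_power2[of x] zero_le_power2[of y] by linarith
      also have "\<dots> \<le> (1 + x\<^sup>2) * (1 + y\<^sup>2)" by (simp add: algebra_simps)
      finally show "\<bar>y + x\<bar> / ((1 + x\<^sup>2) * (1 + y\<^sup>2)) \<le> 1" using p by simp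
    qed simp
    finally show ?thesis by simp
  qed
  have "\<bar>arctan_trunc' n a - arctan_trunc' n b\<bar> \<le> \<bar>a / real (Suc n) - b / real (Suc n)\<bar>"
    unfolding arctan_trunc'_def by (rule *)
  also have "\<dots> = \<bar>a - b\<bar> / real (Suc n)" by (simp add: diff_divide_distrib[symmetric] del: of_nat_Suc)
  also have "\<dots> \<le> \<bar>a - b\<bar> / 1" by (intro divide_left_mono) auto
  finally show ?thesis by simp
qed

lemma arctan_trunc_lim: "(\<lambda>n. arctan_trunc n t) \<longlonglongrightarrow> t"
proof (cases "t = 0")
  case False
  have "(\<lambda>h. arctan h / h) \<midarrow>0\<rightarrow> 1"
    using DERIV_arctan[of 0] by (simp add: DERIV_def)
  moreover have "filterlim (\<lambda>n. t / real (Suc n)) (at 0) sequentially"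
    unfolding filterlim_at
  proof
    show "(\<lambda>n. t / real (Suc n)) \<longlonglongrightarrow> 0" by (rule LIMSEQ_Suc[OF lim_const_over_n])
  qed (use False in \<open>auto simp del: of_nat_Suc\<close>)
  ultimately have "(\<lambda>n. arctan (t / real (Suc n)) / (t / real (Suc n))) \<longlonglongrightarrow> 1" by (rule filterlim_compose)
  then have "(\<lambda>n. t * (arctan (t / real (Suc n)) / (t / real (Suc n)))) \<longlonglongrightarrow> t * 1" by (intro tendsto_intros)
  then show ?thesis using False by (simp add: arctan_trunc_def mult.commute del: of_nat_Suc)
qed (simp add: arctan_trunc_def)

lemma arctan_trunc'_lim: "(\<lambda>n. arctan_trunc' n t) \<longlonglongrightarrow> 1"
proof -
  have "(\<lambda>n. t / real (Suc n)) \<longlonglongrightarrow> 0" by (rule LIMSEQ_Suc[OF lim_const_over_n])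
  then have "(\<lambda>n. inverse (1 + (t / real (Suc n))\<^sup>2)) \<longlonglongrightarrow> inverse (1 + 0\<^sup>2)" by (intro tendsto_intros) auto
  then show ?thesis by (simp add: arctan_trunc'_def)
qed

lemma arctan_trunc_bounded: "\<bar>arctan_trunc n t\<bar> \<le> real (Suc n) * 2"
proof -
  have "\<bar>arctan (t / real (Suc n))\<bar> \<le> 2"
    using arctan_lbound[of "t / real (Suc n)"] arctan_ubound[of "t / real (Suc n)"] pi_less_4 by linarith
  then show ?thesis unfolding arctan_trunc_def abs_mult by (intro mult_mono) auto
qed

context coefficients begin

section \<open>Reduction to bounded functions of bounded support\<close>

lemma mult_L2_tendsto:
  assumes \<phi>: "sq_int L\<Omega> \<phi>" and a: "\<And>n. a n \<in> borel_measurable L\<Omega>" "\<And>n x. x \<in> \<Omega> \<Longrightarrow> \<bar>a n x\<bar> \<le> B"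
    "\<And>x. x \<in> \<Omega> \<Longrightarrow> (\<lambda>n. a n x) \<longlonglongrightarrow> 0"
  shows "(\<lambda>n. \<integral>x. (a n x * \<phi> x)\<^sup>2 \<partial>L\<Omega>) \<longlonglongrightarrow> 0"
proof -
  have [measurable]: "\<phi> \<in> borel_measurable L\<Omega>" "\<And>n. a n \<in> borel_measurable L\<Omega>" using \<phi> a by (auto simp: sq_int_def)
  have "(\<lambda>n. \<integral>x. (a n x * \<phi> x)\<^sup>2 \<partial>L\<Omega>) \<longlonglongrightarrow> (\<integral>x. 0 \<partial>L\<Omega>)"
  proof (rule integral_dominated_convergence[where w = "\<lambda>x. B\<^sup>2 * (\<phi> x)\<^sup>2"])
    show "AE x in L\<Omega>. (\<lambda>n. (a n x * \<phi> x)\<^sup>2) \<longlonglongrightarrow> 0"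
    proof (intro AE_I2)
      fix x assume "x \<in> space L\<Omega>"
      then have "(\<lambda>n. a n x) \<longlonglongrightarrow> 0" using a(3) by simp
      then have "(\<lambda>n. (a n x * \<phi> x)\<^sup>2) \<longlonglongrightarrow> (0 * \<phi> x)\<^sup>2" by (intro tendsto_intros)
      then show "(\<lambda>n. (a n x * \<phi> x)\<^sup>2) \<longlonglongrightarrow> 0" by simp
    qed
    show "AE x in L\<Omega>. norm ((a n x * \<phi> x)\<^sup>2) \<le> B\<^sup>2 * (\<phi> x)\<^sup>2" for n
    proof (intro AE_I2)
      fix x assume "x \<in> space L\<Omega>"
      then have "(a n x)\<^sup>2 \<le> B\<^sup>2" using power_mono[OF a(2)[of x n], of 2] by simp
      then show "norm ((a n x * \<phi> x)\<^sup>2) \<le> B\<^sup>2 * (\<phi> x)\<^sup>2" by (simp add: power_mult_distrib mult_right_mono)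
    qed
  qed (use \<phi> in \<open>auto simp: sq_int_def\<close>)
  then show ?thesis by simp
qed

lemma energy_mult_bound:
  assumes g: "\<And>k. g k \<in> borel_measurable L\<Omega>" "finite_energy g"
    and a: "a \<in> borel_measurable L\<Omega>" "\<And>x. x \<in> \<Omega> \<Longrightarrow> \<bar>a x\<bar> \<le> 1"
  shows "finite_energy (\<lambda>k x. a x * g k x)"
proof (rule energy_bound_integrable[OF g(2)])
  show "(\<lambda>x. a x * g k x) \<in> borel_measurable L\<Omega>" for k using g a by simp
  show "AE x in L\<Omega>. energy_density C (\<lambda>k x. a x * g k x) x \<le> energy_density C g x"
    using energy_nonneg[of g] AE_space
  proof eventually_elim
    case (elim x)
    then have "(a x)\<^sup>2 \<le> 1" using a(2)[of x] abs_le_square_iff[of "a x" 1] by simp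
    then show ?case using elim unfolding energy_scale by (simp add: mult_left_le_one_le)
  qed
qed

lemma mult_energy_tendsto:
  assumes g: "\<And>k. g k \<in> borel_measurable L\<Omega>" "finite_energy g"
    and a: "\<And>n. a n \<in> borel_measurable L\<Omega>" "\<And>n x. x \<in> \<Omega> \<Longrightarrow> \<bar>a n x\<bar> \<le> 1"
    "\<And>x. x \<in> \<Omega> \<Longrightarrow> (\<lambda>n. a n x) \<longlonglongrightarrow> 0"
  shows "(\<lambda>n. energy (\<lambda>k x. a n x * g k x)) \<longlonglongrightarrow> 0"
proof -
  have "(\<lambda>n. energy (\<lambda>k x. a n x * g k x)) \<longlonglongrightarrow> (\<integral>x. 0 \<partial>L\<Omega>)"
  proof (rule integral_dominated_convergence[where w = "energy_density C g"])
    show "AE x in L\<Omega>. (\<lambda>n. energy_density C (\<lambda>k x. a n x * g k x) x) \<longlonglongrightarrow> 0"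
    proof (intro AE_I2)
      fix x assume "x \<in> space L\<Omega>"
      then have "(\<lambda>n. a n x) \<longlonglongrightarrow> 0" using a(3) by simp
      then have "(\<lambda>n. (a n x)\<^sup>2 * energy_density C g x) \<longlonglongrightarrow> 0\<^sup>2 * energy_density C g x" by (intro tendsto_intros)
      then show "(\<lambda>n. energy_density C (\<lambda>k x. a n x * g k x) x) \<longlonglongrightarrow> 0" unfolding energy_scale by simp
    qed
    show "AE x in L\<Omega>. norm (energy_density C (\<lambda>k x. a n x * g k x) x) \<le> energy_density C g x" for n
      using energy_nonneg[of g] AE_space
    proof eventually_elim
      case (elim x)
      then have "(a n x)\<^sup>2 \<le> 1" using a(2)[of x n] abs_le_square_iff[of "a n x" 1] by simp
      then show ?case using elim unfolding energy_scale by (simp add: mult_left_le_one_le abs_mult)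
    qed
    show "energy_density C (\<lambda>k x. a n x * g k x) \<in> borel_measurable L\<Omega>" for n
      by (rule energy_measurable) (use g a in simp)
  qed (use g in auto)
  then show ?thesis by simp
qed

lemma form_fn_smooth_mult:
  assumes f: "form_fn \<phi> g" and \<eta>: "smooth_fn \<eta>" "\<And>x. \<bar>\<eta> x\<bar> \<le> 1"
    and e: "finite_energy (\<lambda>k x. partial_deriv k \<eta> x * \<phi> x)"
  shows "form_fn (\<lambda>x. \<eta> x * \<phi> x) (\<lambda>k x. \<eta> x * g k x + partial_deriv k \<eta> x * \<phi> x)"
proof -
  have c1: "C_order 1 \<eta>" using smooth_fn_C_order[OF \<eta>(1)] .
  have m: "\<eta> \<in> borel_measurable L\<Omega>" "partial_deriv k \<eta> \<in> borel_measurable L\<Omega>" for k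
    using continuous_lebesgue_measurable[OF C_order_1_continuous[OF c1]]
      continuous_lebesgue_measurable[OF C_order_1_continuous_partial[OF c1]] measurable_restrict_space1 by blast+
  note mg = form_fn_measurable[OF f]
  have s: "sq_int L\<Omega> \<phi>" and gi: "finite_energy g" using f by (auto simp: form_fn_def)
  have "finite_energy (\<lambda>k x. \<eta> x * g k x + partial_deriv k \<eta> x * \<phi> x)"
    by (rule energy_add(1)[OF _ energy_mult_bound[OF mg gi m(1)] _ e]) (use \<eta> m mg s in \<open>auto simp: sq_int_def\<close>)
  moreover have "sq_int L\<Omega> (\<lambda>x. \<eta> x * \<phi> x)" by (rule sq_int_bounded_mult[OF s m(1), of 1]) (use \<eta> in auto)
  ultimately show ?thesis
    using f is_weak_deriv_smooth_mult[OF _ open_\<Omega> \<eta>(1)] by (simp add: form_fn_def)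
qed

lemma sequence_close_to:
  assumes 1: "(\<lambda>n. \<integral>x. (\<psi> n x - \<phi> x)\<^sup>2 \<partial>L\<Omega>) \<longlonglongrightarrow> 0"
    and 2: "(\<lambda>n. energy (\<lambda>k x. h n k x - g k x)) \<longlonglongrightarrow> 0" and e: "e > 0"
  shows "\<exists>n. close_to e (\<psi> n) (h n) \<phi> g"
proof -
  have "\<forall>\<^sub>F n in sequentially. close_to e (\<psi> n) (h n) \<phi> g"
    using order_tendstoD(2)[OF 1 e] order_tendstoD(2)[OF 2 e] by eventually_elim (simp add: close_to_def)
  then show ?thesis by (auto simp: eventually_sequentially)
qed

text \<open>Truncation multiplies the gradient by a factor between 0 and 1 that tends to 1
  pointwise, so both parts of \<open>close_to\<close> follow by dominated convergence.\<close>

lemma approximable_of_bounded: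
  assumes f: "form_fn \<phi> g" and b: "\<And>\<psi> h B. form_fn \<psi> h \<Longrightarrow> (\<And>x. \<bar>\<psi> x\<bar> \<le> B) \<Longrightarrow> approximable \<psi> h"
  shows "approximable \<phi> g"
proof (rule approximable_closure[OF f])
  fix e :: real assume e: "e > 0"
  have w: "is_weak_deriv \<Omega> k \<phi> (g k)" for k using f by (simp add: form_fn_def)
  have s: "sq_int L\<Omega> \<phi>" and gi: "finite_energy g" using f by (auto simp: form_fn_def)
  note mg = form_fn_measurable[OF f]
  have m\<phi>: "\<phi> \<in> borel_measurable L\<Omega>" using s by (simp add: sq_int_def)
  let ?\<psi> = "\<lambda>n x. arctan_trunc n (\<phi> x)" and ?a = "\<lambda>n x. arctan_trunc' n (\<phi> x)"
  have c': "continuous_on UNIV (arctan_trunc' n)" for n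
  proof -
    have "1 + (x / real (Suc n))\<^sup>2 \<noteq> 0" for x using sum_power2_eq_zero_iff[of 1 "x / real (Suc n)"] by auto
    then show ?thesis unfolding arctan_trunc'_def[abs_def] by (intro continuous_intros) auto
  qed
  have c: "continuous_on UNIV (arctan_trunc n)" for n
    unfolding arctan_trunc_def[abs_def] by (intro continuous_intros) auto
  have [measurable]: "arctan_trunc' n \<in> borel_measurable borel" "arctan_trunc n \<in> borel_measurable borel" for n
    by (rule borel_measurable_continuous_onI c c')+
  have ma: "?a n \<in> borel_measurable L\<Omega>" "?\<psi> n \<in> borel_measurable L\<Omega>" for n using m\<phi> by measurable
  have w\<psi>: "is_weak_deriv \<Omega> k (?\<psi> n) (\<lambda>x. ?a n x * g k x)" for k n
    by (rule is_weak_deriv_chain[OF w open_\<Omega> arctan_trunc_deriv c' _ arctan_trunc_Lipschitz arctan_trunc'_Lipschitz])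
       (use arctan_trunc'_bounds[of n] in \<open>auto simp: less_imp_le arctan_trunc_def\<close>)
  have s\<psi>: "sq_int L\<Omega> (?\<psi> n)" for n
    by (rule sq_int_bound[OF s ma(2), of _ 1]) (use arctan_trunc_Lipschitz[of n _ 0] in \<open>auto simp: arctan_trunc_def\<close>)
  have f\<psi>: "form_fn (?\<psi> n) (\<lambda>k x. ?a n x * g k x)" for n
    unfolding form_fn_def using w\<psi> s\<psi> arctan_trunc'_bounds[of n]
    by (auto intro!: energy_mult_bound mg gi ma simp: less_imp_le)
  have "(\<lambda>n. \<integral>x. (?\<psi> n x - \<phi> x)\<^sup>2 \<partial>L\<Omega>) \<longlonglongrightarrow> (\<integral>x. 0 \<partial>L\<Omega>)"
  proof (rule integral_dominated_convergence[where w = "\<lambda>x. (2 * \<phi> x)\<^sup>2"])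
    show "AE x in L\<Omega>. (\<lambda>n. (?\<psi> n x - \<phi> x)\<^sup>2) \<longlonglongrightarrow> 0"
    proof (intro AE_I2)
      fix x
      have "(\<lambda>n. (?\<psi> n x - \<phi> x)\<^sup>2) \<longlonglongrightarrow> (\<phi> x - \<phi> x)\<^sup>2" by (intro tendsto_intros arctan_trunc_lim)
      then show "(\<lambda>n. (?\<psi> n x - \<phi> x)\<^sup>2) \<longlonglongrightarrow> 0" by simp
    qed
    show "AE x in L\<Omega>. norm ((?\<psi> n x - \<phi> x)\<^sup>2) \<le> (2 * \<phi> x)\<^sup>2" for n
    proof (intro AE_I2)
      fix x
      have "\<bar>?\<psi> n x - \<phi> x\<bar> \<le> \<bar>2 * \<phi> x\<bar>" using arctan_trunc_Lipschitz[of n "\<phi> x" 0] by (simp add: arctan_trunc_def)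
      then show "norm ((?\<psi> n x - \<phi> x)\<^sup>2) \<le> (2 * \<phi> x)\<^sup>2" by (simp add: abs_le_square_iff)
    qed
    show "integrable L\<Omega> (\<lambda>x. (2 * \<phi> x)\<^sup>2)" using s by (simp add: sq_int_def power_mult_distrib)
  qed (use ma m\<phi> in measurable)
  then have 1: "(\<lambda>n. \<integral>x. (?\<psi> n x - \<phi> x)\<^sup>2 \<partial>L\<Omega>) \<longlonglongrightarrow> 0" by simp
  have "(\<lambda>n. energy (\<lambda>k x. (?a n x - 1) * g k x)) \<longlonglongrightarrow> 0"
  proof (rule mult_energy_tendsto[OF mg gi])
    show "(\<lambda>x. ?a n x - 1) \<in> borel_measurable L\<Omega>" for n using ma by simp
    show "\<bar>?a n x - 1\<bar> \<le> 1" for n x using arctan_trunc'_bounds[of n "\<phi> x"] by simp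
    show "(\<lambda>n. ?a n x - 1) \<longlonglongrightarrow> 0" for x using tendsto_diff[OF arctan_trunc'_lim[of "\<phi> x"] tendsto_const[of 1]] by simp
  qed
  then have 2: "(\<lambda>n. energy (\<lambda>k x. ?a n x * g k x - g k x)) \<longlonglongrightarrow> 0"
    by (simp add: left_diff_distrib)
  obtain n where "close_to e (?\<psi> n) (\<lambda>k x. ?a n x * g k x) \<phi> g" using sequence_close_to[OF 1 2 e] by blast
  moreover have "approximable (?\<psi> n) (\<lambda>k x. ?a n x * g k x)"
    by (rule b[OF f\<psi>, of _ "real (Suc n) * 2"]) (rule arctan_trunc_bounded)
  ultimately show "\<exists>\<psi> h. form_fn \<psi> h \<and> approximable \<psi> h \<and> close_to e \<psi> h \<phi> g" using f\<psi> by blast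
qed

text \<open>The gradient error of a cutoff consists of \<open>(\<eta> n - 1) * g\<close>, which
  dominated convergence handles, and of \<open>\<phi>\<close> times the gradient of
  \<open>\<eta> n\<close>, whose energy has to be shown small case by case. The lemma serves for the
  radial cutoff and for the one at the boundary.\<close>

lemma cutoff_close_to:
  assumes f: "form_fn \<phi> g" and \<eta>: "\<And>n. smooth_fn (\<eta> n)" "\<And>n x. 0 \<le> \<eta> n x \<and> \<eta> n x \<le> 1"
    and lim: "\<And>x. x \<in> \<Omega> \<Longrightarrow> (\<lambda>n. \<eta> n x - 1) \<longlonglongrightarrow> 0"
    and ei: "\<And>n. finite_energy (\<lambda>k x. partial_deriv k (\<eta> n) x * \<phi> x)"
    and e2: "(\<lambda>n. energy (\<lambda>k x. partial_deriv k (\<eta> n) x * \<phi> x)) \<longlonglongrightarrow> 0" and e: "e > 0"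
  obtains n where "form_fn (\<lambda>x. \<eta> n x * \<phi> x) (\<lambda>k x. \<eta> n x * g k x + partial_deriv k (\<eta> n) x * \<phi> x)"
    "close_to e (\<lambda>x. \<eta> n x * \<phi> x) (\<lambda>k x. \<eta> n x * g k x + partial_deriv k (\<eta> n) x * \<phi> x) \<phi> g"
proof -
  let ?\<psi> = "\<lambda>n x. \<eta> n x * \<phi> x" and ?h = "\<lambda>n k x. \<eta> n x * g k x + partial_deriv k (\<eta> n) x * \<phi> x"
  have s: "sq_int L\<Omega> \<phi>" and gi: "finite_energy g" using f by (auto simp: form_fn_def)
  note mg = form_fn_measurable[OF f]
  have c1: "C_order 1 (\<eta> n)" for n using smooth_fn_C_order[OF \<eta>(1)] .
  have m: "(\<lambda>x. \<eta> n x - 1) \<in> borel_measurable L\<Omega>" "partial_deriv k (\<eta> n) \<in> borel_measurable L\<Omega>" for n k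
    using continuous_lebesgue_measurable[OF C_order_1_continuous[OF c1]]
      continuous_lebesgue_measurable[OF C_order_1_continuous_partial[OF c1]] measurable_restrict_space1
    by (blast intro: borel_measurable_diff borel_measurable_const)+
  have b: "\<bar>\<eta> n x - 1\<bar> \<le> 1" for n x using \<eta>(2)[of n x] by simp
  have "(\<lambda>n. \<integral>x. ((\<eta> n x - 1) * \<phi> x)\<^sup>2 \<partial>L\<Omega>) \<longlonglongrightarrow> 0" by (rule mult_L2_tendsto[OF s m(1) b lim])
  then have 1: "(\<lambda>n. \<integral>x. (?\<psi> n x - \<phi> x)\<^sup>2 \<partial>L\<Omega>) \<longlonglongrightarrow> 0" by (simp add: left_diff_distrib)
  have e1: "(\<lambda>n. energy (\<lambda>k x. (\<eta> n x - 1) * g k x)) \<longlonglongrightarrow> 0" by (rule mult_energy_tendsto[OF mg gi m(1) b lim])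
  have le: "energy (\<lambda>k x. ?h n k x - g k x)
     \<le> 2 * energy (\<lambda>k x. (\<eta> n x - 1) * g k x) + 2 * energy (\<lambda>k x. partial_deriv k (\<eta> n) x * \<phi> x)" for n
  proof -
    have "(\<lambda>k x. ?h n k x - g k x) = (\<lambda>k x. (\<eta> n x - 1) * g k x + partial_deriv k (\<eta> n) x * \<phi> x)"
      by (simp add: fun_eq_iff left_diff_distrib)
    then show ?thesis
      using energy_add(2)[OF _ energy_mult_bound[OF mg gi m(1) b] _ ei, of n n] m mg sq_int_measurable[OF s] by simp
  qed
  have lim2: "(\<lambda>n. 2 * energy (\<lambda>k x. (\<eta> n x - 1) * g k x) + 2 * energy (\<lambda>k x. partial_deriv k (\<eta> n) x * \<phi> x)) \<longlonglongrightarrow> 0"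
    using tendsto_add[OF tendsto_mult_left[OF e1, of 2] tendsto_mult_left[OF e2, of 2]] by simp
  have 2: "(\<lambda>n. energy (\<lambda>k x. ?h n k x - g k x)) \<longlonglongrightarrow> 0"
    by (rule tendsto_sandwich[OF _ _ tendsto_const lim2])
       (use le in \<open>auto intro!: always_eventually integral_nonneg_AE energy_nonneg\<close>)
  have "form_fn (?\<psi> n) (?h n)" for n by (rule form_fn_smooth_mult[OF f \<eta>(1) _ ei]) (use \<eta>(2) in auto)
  then show ?thesis using that sequence_close_to[OF 1 2 e] by blast
qed

text \<open>The gradients of the radial cutoffs are bounded by one constant and vanish on balls
  whose radii tend to infinity, so their products with the square-integrable \<open>\<phi>\<close>
  tend to 0 in L2 and hence in energy.\<close>

lemma approximable_of_bounded_support: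
  assumes f: "form_fn \<phi> g" and B: "\<And>x. \<bar>\<phi> x\<bar> \<le> B"
    and b: "\<And>\<psi> h R. form_fn \<psi> h \<Longrightarrow> (\<And>x. \<bar>\<psi> x\<bar> \<le> B) \<Longrightarrow> (\<And>x. norm x > R \<Longrightarrow> \<psi> x = 0 \<and> (\<forall>k. h k x = 0)) \<Longrightarrow> approximable \<psi> h"
  shows "approximable \<phi> g"
proof (rule approximable_closure[OF f])
  fix e :: real assume e: "e > 0"
  obtain M where M: "\<And>U \<epsilon>. compact U \<Longrightarrow> \<epsilon> > 0 \<Longrightarrow> \<exists>\<zeta>::real^'n \<Rightarrow> real. soft_indicator M U \<epsilon> \<zeta>"
    using mollified_indicator by blast
  have "\<forall>n. \<exists>\<zeta>::real^'n \<Rightarrow> real. soft_indicator M (cball 0 (real n)) 1 \<zeta>" by (intro allI M) auto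
  from choice[OF this] obtain \<zeta> :: "nat \<Rightarrow> real^'n \<Rightarrow> real" where "\<And>n. soft_indicator M (cball 0 (real n)) 1 (\<zeta> n)" by blast
  then have \<zeta>: "\<And>n. smooth_fn (\<zeta> n)" "\<And>n x. 0 \<le> \<zeta> n x \<and> \<zeta> n x \<le> 1" "\<And>n x k. \<bar>partial_deriv k (\<zeta> n) x\<bar> \<le> M"
     "\<And>n x. ball x 1 \<subseteq> cball 0 (real n) \<Longrightarrow> \<zeta> n x = 1" "\<And>n x. ball x 1 \<inter> cball 0 (real n) = {} \<Longrightarrow> \<zeta> n x = 0"
    unfolding soft_indicator_def by auto
  have in1: "\<zeta> n x = 1" if "norm x < real n - 1" for n x
  proof (rule \<zeta>(4), rule subsetI)
    fix y assume "y \<in> ball x 1"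
    then show "y \<in> cball 0 (real n)" using norm_triangle_sub[of y x] that by (simp add: dist_norm norm_minus_commute)
  qed
  have out0: "\<zeta> n x = 0" if "norm x > real n + 1" for n x
  proof (rule \<zeta>(5), rule ccontr)
    assume "ball x 1 \<inter> cball 0 (real n) \<noteq> {}"
    then obtain y where "dist x y < 1" "norm y \<le> real n" by auto
    then show False using norm_triangle_sub[of x y] that by (simp add: dist_norm)
  qed
  have d_in: "partial_deriv k (\<zeta> n) x = 0" if "norm x < real n - 1" for n x k
    by (rule partial_deriv_locally_const[of "{x. norm x < real n - 1}" _ _ 1])
       (use that in1 in \<open>auto intro!: open_Collect_less continuous_intros\<close>)
  have d_out: "partial_deriv k (\<zeta> n) x = 0" if "norm x > real n + 1" for n x k
    by (rule partial_deriv_locally_const[of "{x. norm x > real n + 1}" _ _ 0])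
       (use that out0 in \<open>auto intro!: open_Collect_less continuous_intros\<close>)
  have s: "sq_int L\<Omega> \<phi>" using f by (simp add: form_fn_def)
  have m: "partial_deriv k (\<zeta> n) \<in> borel_measurable L\<Omega>" for n k
    using continuous_lebesgue_measurable[OF C_order_1_continuous_partial[OF smooth_fn_C_order[OF \<zeta>(1)]]] measurable_restrict_space1 by blast
  have sd: "sq_int L\<Omega> (\<lambda>x. partial_deriv k (\<zeta> n) x * \<phi> x)" for n k
    by (rule sq_int_bounded_mult[OF s m, of _ _ M]) (use \<zeta>(3) in auto)
  obtain M' where M': "M' > 0" "\<And>g. (\<And>k. sq_int L\<Omega> (g k)) \<Longrightarrow> finite_energy g"
    "\<And>g. (\<And>k. sq_int L\<Omega> (g k)) \<Longrightarrow> energy g \<le> M' * (\<Sum>k\<in>UNIV. \<integral>x. (g k x)\<^sup>2 \<partial>L\<Omega>)"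
    using energy_sq_int by metis
  have ei: "finite_energy (\<lambda>k x. partial_deriv k (\<zeta> n) x * \<phi> x)" for n
    by (rule M'(2)) (rule sd)
  have far: "\<forall>\<^sub>F n in sequentially. norm x < real n - 1" for x :: "real^'n"
  proof -
    obtain N where N: "norm x + 1 < real N" using reals_Archimedean2 by blast
    have "norm x < real n - 1" if "n \<ge> N" for n using N of_nat_mono[OF that, where 'a=real] by linarith
    then show ?thesis unfolding eventually_sequentially by blast
  qed
  have lim\<zeta>: "(\<lambda>n. \<zeta> n x - 1) \<longlonglongrightarrow> 0" for x
    by (rule tendsto_eventually, rule eventually_mono[OF far[of x]]) (simp add: in1)
  have "(\<lambda>n. \<integral>x. (partial_deriv k (\<zeta> n) x * \<phi> x)\<^sup>2 \<partial>L\<Omega>) \<longlonglongrightarrow> 0" for k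
  proof (rule mult_L2_tendsto[OF s m \<zeta>(3)])
    show "(\<lambda>n. partial_deriv k (\<zeta> n) x) \<longlonglongrightarrow> 0" for x
      by (rule tendsto_eventually, rule eventually_mono[OF far[of x]]) (simp add: d_in)
  qed
  then have "(\<lambda>n. M' * (\<Sum>k\<in>UNIV. \<integral>x. (partial_deriv k (\<zeta> n) x * \<phi> x)\<^sup>2 \<partial>L\<Omega>)) \<longlonglongrightarrow> M' * (\<Sum>k\<in>(UNIV::'n set). 0)"
    by (intro tendsto_intros)
  then have l2: "(\<lambda>n. M' * (\<Sum>k\<in>UNIV. \<integral>x. (partial_deriv k (\<zeta> n) x * \<phi> x)\<^sup>2 \<partial>L\<Omega>)) \<longlonglongrightarrow> 0" by simp
  have e2: "(\<lambda>n. energy (\<lambda>k x. partial_deriv k (\<zeta> n) x * \<phi> x)) \<longlonglongrightarrow> 0"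
    by (rule tendsto_sandwich[OF _ _ tendsto_const l2])
       (use M'(3)[OF sd] in \<open>auto intro!: always_eventually integral_nonneg_AE energy_nonneg\<close>)
  obtain n where n: "form_fn (\<lambda>x. \<zeta> n x * \<phi> x) (\<lambda>k x. \<zeta> n x * g k x + partial_deriv k (\<zeta> n) x * \<phi> x)"
    "close_to e (\<lambda>x. \<zeta> n x * \<phi> x) (\<lambda>k x. \<zeta> n x * g k x + partial_deriv k (\<zeta> n) x * \<phi> x) \<phi> g" (is "close_to e ?\<psi> ?h \<phi> g")
    by (rule cutoff_close_to[OF f \<zeta>(1,2) lim\<zeta> ei e2 e])
  have "approximable ?\<psi> ?h"
  proof (rule b[OF n(1)])
    show "\<bar>?\<psi> x\<bar> \<le> B" for x
    proof -
      have "\<bar>\<zeta> n x\<bar> * \<bar>\<phi> x\<bar> \<le> 1 * \<bar>\<phi> x\<bar>" using \<zeta>(2)[of n x] by (intro mult_right_mono) auto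
      then show ?thesis using B[of x] by (simp add: abs_mult)
    qed
    show "?\<psi> x = 0 \<and> (\<forall>k. ?h k x = 0)" if "norm x > real n + 1" for x
      using out0[OF that] d_out[OF that] by simp
  qed
  then show "\<exists>\<psi> h. form_fn \<psi> h \<and> approximable \<psi> h \<and> close_to e \<psi> h \<phi> g" using n by blast
qed

end

section \<open>Upper bounds on the coefficients\<close>

text \<open>At most one summand is nonzero, so there are no cross terms. For averages of steps on
  disjoint layers this is the gain over a crude bound by the square of the number of steps.\<close>

lemma mat_form_sum_disjoint:
  assumes I: "finite I" and d: "\<And>i j. i \<in> I \<Longrightarrow> j \<in> I \<Longrightarrow> i \<noteq> j \<Longrightarrow> (\<forall>k. w i k = 0) \<or> (\<forall>k. w j k = 0)"
  shows "mat_form A (\<lambda>k. \<Sum>i\<in>I. w i k) = (\<Sum>i\<in>I. mat_form A (w i))"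
proof (cases "\<exists>i\<in>I. \<exists>k. w i k \<noteq> 0")
  case True
  then obtain i where i: "i \<in> I" "\<exists>k. w i k \<noteq> 0" by blast
  have z: "w j = (\<lambda>k. 0)" if "j \<in> I - {i}" for j using d[of i j] i that by fastforce
  have "(\<Sum>i\<in>I. w i k) = w i k" for k using z by (simp add: sum.remove[OF I i(1)])
  moreover have "(\<Sum>i\<in>I. mat_form A (w i)) = mat_form A (w i)" using z by (simp add: sum.remove[OF I i(1)])
  ultimately show ?thesis by simp
next
  case False
  then have "w i = (\<lambda>k. 0)" if "i \<in> I" for i using that by fastforce
  then show ?thesis by simp
qed

text \<open>The absolute value in the exponent covers negative \<open>a\<close>: the exponents
  \<open>\<delta> j\<close> of the first part may be negative when \<open>s j\<close> is
  small.\<close>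

lemma powr_comparable:
  fixes t u a :: real
  assumes t: "0 < t" and u: "t / 2 \<le> u" "u \<le> 2 * t"
  shows "u powr a \<le> 2 powr \<bar>a\<bar> * t powr a"
proof -
  have u0: "u > 0" using t u by linarith
  have "(u / t) powr a \<le> 2 powr \<bar>a\<bar>"
  proof (cases "a \<ge> 0")
    case True
    have "(u / t) powr a \<le> 2 powr a" using True t u u0 by (intro powr_mono2) (auto simp: field_simps)
    then show ?thesis using True by simp
  next
    case False
    have "(u / t) powr a = (t / u) powr (-a)" using t u0 by (simp add: powr_divide powr_minus field_simps)
    also have "\<dots> \<le> 2 powr (-a)" using False t u u0 by (intro powr_mono2) (auto simp: field_simps)
    finally show ?thesis using False by simp
  qed
  moreover have "u powr a = (u / t) powr a * t powr a" using t u0 by (simp add: powr_divide)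
  ultimately show ?thesis by (simp add: mult_right_mono)
qed

context coefficients begin

text \<open>Values outside \<open>\<Omega>\<close> are irrelevant to the form, so they may be
  changed to give a function vanishing everywhere off a compact set.\<close>

lemma form_fn_cong:
  assumes f: "form_fn \<phi> g" and eq: "\<And>x. x \<in> \<Omega> \<Longrightarrow> \<phi>' x = \<phi> x" "\<And>k x. x \<in> \<Omega> \<Longrightarrow> g' k x = g k x"
  shows "form_fn \<phi>' g'"
proof -
  have "is_weak_deriv \<Omega> k \<phi>' (g' k)" for k
    using f is_weak_deriv_cong[OF _ open_\<Omega> eq] by (simp add: form_fn_def)
  moreover have "finite_energy g' = finite_energy g"
    by (rule Bochner_Integration.integrable_cong) (use eq in \<open>auto simp: energy_density_def\<close>)
  moreover have "sq_int L\<Omega> \<phi>' = sq_int L\<Omega> \<phi>"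
    unfolding sq_int_def using eq by (intro conj_cong measurable_cong Bochner_Integration.integrable_cong) auto
  ultimately show ?thesis using f by (simp add: form_fn_def)
qed

lemma close_to_cong:
  assumes f: "close_to e \<phi> g \<psi> h" and eq: "\<And>x. x \<in> \<Omega> \<Longrightarrow> \<phi>' x = \<phi> x" "\<And>k x. x \<in> \<Omega> \<Longrightarrow> g' k x = g k x"
  shows "close_to e \<phi>' g' \<psi> h"
proof -
  have "(\<integral>x. (\<phi>' x - \<psi> x)\<^sup>2 \<partial>L\<Omega>) = (\<integral>x. (\<phi> x - \<psi> x)\<^sup>2 \<partial>L\<Omega>)"
    by (rule Bochner_Integration.integral_cong) (use eq in auto)
  moreover have "energy (\<lambda>k x. g' k x - h k x) = energy (\<lambda>k x. g k x - h k x)"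
    by (rule Bochner_Integration.integral_cong) (use eq in \<open>auto simp: energy_density_def\<close>)
  ultimately show ?thesis using f by (simp add: close_to_def)
qed

end

locale degenerate_coefficients = coefficients \<Omega> C for \<Omega> :: "(real^'n) set" and C +
  fixes J :: "'j set" and F :: "'j \<Rightarrow> (real^'n) set" and s \<delta> b r :: "'j \<Rightarrow> real"
  assumes J: "finite J" "J \<noteq> {}"
    and \<Gamma>: "frontier \<Omega> = (\<Union>j\<in>J. closure (F j))"
    and F_ne: "\<And>j. j \<in> J \<Longrightarrow> F j \<noteq> {}"
    and F_reg: "\<And>j. j \<in> J \<Longrightarrow> ahlfors_regular (s j) (F j)"
    and \<delta>: "\<And>j. j \<in> J \<Longrightarrow> \<delta> j \<ge> critical_exponent TYPE('n) (s j)"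
    and br: "\<And>j. j \<in> J \<Longrightarrow> b j > 0" "\<And>j. j \<in> J \<Longrightarrow> r j > 0"
    and upper: "\<And>j A. j \<in> J \<Longrightarrow> bounded A \<Longrightarrow> A \<subseteq> F j \<Longrightarrow> AE x in lebesgue_on \<Omega>. x \<in> near_part \<Omega> A (r j) \<longrightarrow>
       mat_le 0 (C x) \<and> mat_le (C x) (mat (b j * infdist x (frontier \<Omega>) powr \<delta> j))"
begin

abbreviation "dist_bd x \<equiv> infdist x (frontier \<Omega>)"

lemma frontier_ne: "frontier \<Omega> \<noteq> {}"
proof -
  obtain j where j: "j \<in> J" using J by blast
  then show ?thesis using \<Gamma> F_ne[OF j] by auto
qed

text \<open>The layer near \<open>F j\<close> has volume of order \<open>t powr (?d - s j)\<close>,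
  and the energy density there is at most of order \<open>t powr (cr j - 2)\<close>; the product is
  bounded. The indicator restricts to the region where the step is exact, since the indicator
  function that was mollified had been cut off at radius \<open>\<rho>\<close>.\<close>

lemma single_scale_energy:
  assumes \<rho>: "\<rho> \<ge> 2"
  obtains K r0 where "K > 0" "r0 > 0" "\<And>t. 0 < t \<Longrightarrow> t \<le> 1 \<Longrightarrow> 2 * t < r0 \<Longrightarrow> \<exists>\<zeta>. layer_cutoff (frontier \<Omega>) \<rho> t \<zeta> \<and>
     finite_energy (\<lambda>k x. indicator (ball 0 (\<rho> - 1)) x * partial_deriv k \<zeta> x) \<and>
     energy (\<lambda>k x. indicator (ball 0 (\<rho> - 1)) x * partial_deriv k \<zeta> x) \<le> K"
proof -
  let ?d = "real CARD('n)"
  obtain M where M: "M > 0" "\<And>(G::(real^'n) set) \<rho> t. 0 < t \<Longrightarrow> t \<le> 1 \<Longrightarrow> \<exists>\<zeta>. layer_cutoff G \<rho> t \<zeta> \<and> (\<forall>x k. \<bar>partial_deriv k \<zeta> x\<bar> \<le> M / t)"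
    using scale_cutoff by blast
  \<comment> \<open>\<open>a j\<close> is a base point in \<open>F j\<close>, and the ball of radius
    \<open>p j\<close> about it contains \<open>ball 0 \<rho>\<close>, so one application of
    \<open>ahlfors_volume\<close> per \<open>j\<close> covers the whole region.\<close>
  define a where "a j = (SOME x. x \<in> F j)" for j
  have a: "a j \<in> F j" if "j \<in> J" for j
    unfolding a_def using F_ne[OF that] by (simp add: some_in_eq)
  define p where "p j = \<rho> + norm (a j)" for j
  have p: "p j \<ge> 2" for j using \<rho> by (simp add: p_def add_increasing2)
  have "\<exists>c>0. \<forall>t. 0 < t \<longrightarrow> t \<le> p j \<longrightarrow>
     measure lebesgue {y. dist (a j) y < p j \<and> infdist y (F j) < t} \<le> c * t powr (?d - s j) * p j powr s j" if j: "j \<in> J" for j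
  proof -
    \<comment> \<open>The radius admits the centre \<open>a j\<close> itself with
      \<open>r = p j\<close>, as \<open>2 * p j < 2 * p j + 1\<close>.\<close>
    have R: "2 * p j + 1 > 0" using p[of j] by linarith
    obtain c where c: "c > 0" "\<And>x r t. x \<in> F j \<Longrightarrow> 0 < t \<Longrightarrow> t \<le> r \<Longrightarrow> dist (a j) x + 2 * r < 2 * p j + 1 \<Longrightarrow>
     measure lebesgue {y. dist x y < r \<and> infdist y (F j) < t} \<le> c * t powr (?d - s j) * r powr s j"
      by (rule ahlfors_volume[OF F_reg[OF j] a[OF j] R]) (rule that; blast)
    have "measure lebesgue {y. dist (a j) y < p j \<and> infdist y (F j) < t} \<le> c * t powr (?d - s j) * p j powr s j"
      if "0 < t" "t \<le> p j" for t by (rule c(2)[OF a[OF j] that]) simp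
    then show ?thesis using c(1) by blast
  qed
  then have "\<forall>j\<in>J. \<exists>c. c > 0 \<and> (\<forall>t. 0 < t \<longrightarrow> t \<le> p j \<longrightarrow>
     measure lebesgue {y. dist (a j) y < p j \<and> infdist y (F j) < t} \<le> c * t powr (?d - s j) * p j powr s j)" by blast
  from bchoice[OF this] obtain c where c0: "\<forall>j\<in>J. c j > 0 \<and> (\<forall>t. 0 < t \<longrightarrow> t \<le> p j \<longrightarrow>
     measure lebesgue {y. dist (a j) y < p j \<and> infdist y (F j) < t} \<le> c j * t powr (?d - s j) * p j powr s j)" by blast
  then have c: "\<And>j. j \<in> J \<Longrightarrow> c j > 0" "\<And>j t. j \<in> J \<Longrightarrow> 0 < t \<Longrightarrow> t \<le> p j \<Longrightarrow>
     measure lebesgue {y. dist (a j) y < p j \<and> infdist y (F j) < t} \<le> c j * t powr (?d - s j) * p j powr s j"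
    by blast+
  \<comment> \<open>The factors are the constant of the hypothesis, the loss from replacing
    \<open>dist_bd x\<close> by \<open>t\<close>, and the bound \<open>(M / t)\<^sup>2\<close>
    summed over the coordinates, without its power of \<open>t\<close>.\<close>
  define \<kappa> where "\<kappa> j = b j * 2 powr \<bar>\<delta> j\<bar> * ?d * M\<^sup>2" for j
  have \<kappa>: "\<kappa> j > 0" if "j \<in> J" for j using br[OF that] M(1) by (simp add: \<kappa>_def)
  define cr where "cr j = critical_exponent TYPE('n) (s j)" for j
  define K where "K = (\<Sum>j\<in>J. \<kappa> j * c j * 2 powr (?d - s j) * p j powr s j)"
  define r0 where "r0 = Min (r ` J)"
  have r0: "r0 > 0" "\<And>j. j \<in> J \<Longrightarrow> r0 \<le> r j" using J br by (auto simp: r0_def)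
  have K: "K > 0" unfolding K_def
  proof (rule sum_pos[OF J])
    fix j assume j: "j \<in> J"
    show "\<kappa> j * c j * 2 powr (?d - s j) * p j powr s j > 0"
      using \<kappa>[OF j] c(1)[OF j] p[of j] by simp
  qed
  show ?thesis
  proof
    show "K > 0" "r0 > 0" by fact+
    fix t :: real assume t: "0 < t" "t \<le> 1" "2 * t < r0"
    obtain \<zeta> where \<zeta>: "smooth_fn \<zeta>" "\<And>x. 0 \<le> \<zeta> x \<and> \<zeta> x \<le> 1" "\<And>x k. \<bar>partial_deriv k \<zeta> x\<bar> \<le> M / t"
      "\<And>x. norm x < \<rho> - 1 \<Longrightarrow> dist_bd x < 3/4 * t \<Longrightarrow> \<zeta> x = 1 \<and> (\<forall>k. partial_deriv k \<zeta> x = 0)"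
      "\<And>x. dist_bd x > 5/4 * t \<Longrightarrow> \<zeta> x = 0 \<and> (\<forall>k. partial_deriv k \<zeta> x = 0)"
      using M(2)[OF t(1,2), of "frontier \<Omega>" \<rho>] unfolding layer_cutoff_def by blast
    let ?g = "\<lambda>k x. indicator (ball 0 (\<rho> - 1)) x * partial_deriv k \<zeta> x"
    let ?V = "\<lambda>j. {y. dist (a j) y < p j \<and> infdist y (F j) < 2 * t}"
    let ?W = "\<lambda>x. \<Sum>j\<in>J. \<kappa> j * t powr (cr j - 2) * indicator (?V j) x"
    have V: "?V j \<in> lmeasurable" for j
    proof (rule bounded_set_imp_lmeasurable)
      show "bounded (?V j)" by (rule bounded_subset[of "ball (a j) (p j)"]) auto
      have "open (?V j)" by (intro open_Collect_conj open_Collect_less continuous_intros)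
      then show "?V j \<in> sets lebesgue" by simp
    qed
    have c1: "C_order 1 \<zeta>" using smooth_fn_C_order[OF \<zeta>(1)] .
    have mg: "?g k \<in> borel_measurable L\<Omega>" for k
    proof -
      have "partial_deriv k \<zeta> \<in> borel_measurable lebesgue"
        using continuous_lebesgue_measurable[OF C_order_1_continuous_partial[OF c1]] .
      then have "?g k \<in> borel_measurable lebesgue" by (intro borel_measurable_times borel_measurable_indicator) auto
      then show ?thesis by (rule measurable_restrict_space1)
    qed
    have W0: "0 \<le> ?W x" for x using \<kappa> by (intro sum_nonneg mult_nonneg_nonneg) (auto simp: less_imp_le)
    have Wi: "integrable lebesgue (indicator (?V j) :: real^'n \<Rightarrow> real)" for j
      using V[of j] by (intro integrable_real_indicator) (auto simp: fmeasurable_def)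
    have Wi': "integrable lebesgue ?W" using Wi by (intro Bochner_Integration.integrable_sum Bochner_Integration.integrable_mult_right)
    \<comment> \<open>The hypothesis speaks of bounded sets, so \<open>F j\<close> is cut to
      \<open>ball 0 (\<rho> + 1)\<close>; for \<open>norm x < \<rho> - 1\<close> and
      \<open>dist_bd x < 2\<close> the nearest boundary points are still inside.\<close>
    have "AE x in L\<Omega>. \<forall>j\<in>J. x \<in> near_part \<Omega> (F j \<inter> ball 0 (\<rho> + 1)) (r j) \<longrightarrow>
       mat_le 0 (C x) \<and> mat_le (C x) (mat (b j * dist_bd x powr \<delta> j))"
      using upper J(1) bounded_subset[OF bounded_ball[of "0::real^'n" "\<rho> + 1"]] by (subst AE_finite_all) auto
    then have le: "AE x in L\<Omega>. energy_density C ?g x \<le> ?W x"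
      using AE_space
    proof eventually_elim
      case (elim x)
      then have x\<Omega>: "x \<in> \<Omega>" by simp
      show ?case
      proof (cases "norm x < \<rho> - 1 \<and> 3/4 * t \<le> dist_bd x \<and> dist_bd x \<le> 5/4 * t")
        case False
        then have "?g k x = 0" for k using \<zeta>(4)[of x] \<zeta>(5)[of x] by (auto simp: indicator_def not_le)
        then have "(\<lambda>k. ?g k x) = (\<lambda>k. 0)" by blast
        then have "energy_density C ?g x = 0" unfolding energy_density_mat_form by simp
        then show ?thesis using W0[of x] by linarith
      next
        case True
        have "ball x 2 \<subseteq> ball 0 (\<rho> + 1)"
        proof
          fix y assume "y \<in> ball x 2"
          then show "y \<in> ball 0 (\<rho> + 1)" using norm_triangle_sub[of y x] True by (simp add: dist_norm norm_minus_commute)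
        qed
        moreover have "dist_bd x < 2" using True t by linarith
        ultimately obtain j where j: "j \<in> J" "F j \<inter> ball 0 (\<rho> + 1) \<noteq> {}"
          "infdist x (F j \<inter> ball 0 (\<rho> + 1)) = dist_bd x" "infdist x (F j) = dist_bd x"
          by (rule nearest_boundary_part[OF frontier_closed frontier_ne \<Gamma> open_ball])
        have "x \<in> near_part \<Omega> (F j \<inter> ball 0 (\<rho> + 1)) (r j)"
          using j x\<Omega> True t r0(2)[OF j(1)] by (simp add: near_part_def)
        then have ml: "mat_le (C x) (mat (b j * dist_bd x powr \<delta> j))" using elim(1) j(1) by blast
        let ?v = "\<chi> k. partial_deriv k \<zeta> x"
        have "energy_density C ?g x = ?v \<bullet> (C x *v ?v)"
          unfolding energy_density_mat_form mat_form_inner' using True by simp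
        also have "\<dots> \<le> (b j * dist_bd x powr \<delta> j) * (\<Sum>k\<in>UNIV. (partial_deriv k \<zeta> x)\<^sup>2)"
        proof -
          have "?v \<bullet> (C x *v ?v) \<le> ?v \<bullet> (mat (b j * dist_bd x powr \<delta> j) *v ?v)"
            using ml unfolding mat_le_def by blast
          then show ?thesis by (simp add: mat_form_scaled_identity)
        qed
        also have "\<dots> \<le> (b j * (2 powr \<bar>\<delta> j\<bar> * t powr cr j)) * (\<Sum>k\<in>(UNIV::'n set). (M / t)\<^sup>2)"
        proof (intro mult_mono mult_nonneg_nonneg sum_mono sum_nonneg)
          have "dist_bd x powr \<delta> j \<le> 2 powr \<bar>\<delta> j\<bar> * t powr \<delta> j" by (rule powr_comparable) (use t True in auto)
          \<comment> \<open>Since \<open>t \<le> 1\<close>, the larger exponent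
            \<open>\<delta> j\<close> gives the smaller power.\<close>
          also have "\<dots> \<le> 2 powr \<bar>\<delta> j\<bar> * t powr cr j"
            using t \<delta>[OF j(1)] by (intro mult_left_mono powr_mono') (auto simp: cr_def)
          finally show "dist_bd x powr \<delta> j \<le> 2 powr \<bar>\<delta> j\<bar> * t powr cr j" .
          show "(partial_deriv k \<zeta> x)\<^sup>2 \<le> (M / t)\<^sup>2" for k
            using power_mono[OF \<zeta>(3)[of k x], of 2] by simp
        qed (use br[OF j(1)] in auto)
        also have "\<dots> = \<kappa> j * (t powr cr j / t\<^sup>2)" by (simp add: \<kappa>_def power_divide)
        also have "t powr cr j / t\<^sup>2 = t powr (cr j - 2)" using t by (simp add: powr_diff)
        also have "\<kappa> j * t powr (cr j - 2) = \<kappa> j * t powr (cr j - 2) * indicator (?V j) x"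
        proof -
          have "dist (a j) x \<le> norm (a j) + norm x" by (metis norm_triangle_ineq4 dist_norm)
          then have "x \<in> ?V j" using True j(4) t by (simp add: p_def)
          then show ?thesis by simp
        qed
        also have "\<dots> \<le> ?W x"
          using \<kappa> by (intro member_le_sum[OF j(1) _ J(1)]) (auto simp: less_imp_le)
        finally show ?thesis .
      qed
    qed
    have WL: "integrable L\<Omega> ?W"
    proof (rule lebesgue_on_integrable_subset)
      show "integrable (lebesgue_on UNIV) ?W" unfolding lebesgue_on_UNIV_eq by (rule Wi')
    qed auto
    have ei: "finite_energy ?g" by (rule energy_bound_integrable[OF WL mg le])
    have "energy ?g \<le> integral\<^sup>L L\<Omega> ?W" by (rule integral_mono_AE[OF ei WL le])
    also have "\<dots> \<le> integral\<^sup>L lebesgue ?W"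
    proof -
      have "integral\<^sup>L L\<Omega> ?W \<le> integral\<^sup>L (lebesgue_on UNIV) ?W"
      proof (rule lebesgue_on_integral_mono_set)
        show "integrable (lebesgue_on UNIV) ?W" unfolding lebesgue_on_UNIV_eq by (rule Wi')
        show "AE x in lebesgue_on UNIV. 0 \<le> ?W x" by (rule AE_I2) (rule W0)
      qed auto
      then show ?thesis unfolding lebesgue_on_UNIV_eq .
    qed
    also have "\<dots> = (\<Sum>j\<in>J. \<kappa> j * t powr (cr j - 2) * measure lebesgue (?V j))"
    proof -
      have "integral\<^sup>L lebesgue ?W = (\<Sum>j\<in>J. integral\<^sup>L lebesgue (\<lambda>x. \<kappa> j * t powr (cr j - 2) * indicator (?V j) x))"
        using Wi by (intro Bochner_Integration.integral_sum Bochner_Integration.integrable_mult_right)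
      also have "\<dots> = (\<Sum>j\<in>J. \<kappa> j * t powr (cr j - 2) * measure lebesgue (?V j))"
        using V by (intro sum.cong) (auto simp: fmeasurable_def)
      finally show ?thesis .
    qed
    also have "\<dots> \<le> K" unfolding K_def
    proof (rule sum_mono)
      fix j assume j: "j \<in> J"
      have "2 * t \<le> p j" using p[of j] t by linarith
      then have "measure lebesgue (?V j) \<le> c j * (2 * t) powr (?d - s j) * p j powr s j" using c(2)[OF j, of "2 * t"] t by simp
      then have "\<kappa> j * t powr (cr j - 2) * measure lebesgue (?V j) \<le> \<kappa> j * t powr (cr j - 2) * (c j * (2 * t) powr (?d - s j) * p j powr s j)"
        using \<kappa>[OF j] by (intro mult_left_mono) auto
      also have "(2 * t) powr (?d - s j) = 2 powr (?d - s j) * t powr (?d - s j)" using t by (simp add: powr_mult)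
      also have "\<kappa> j * t powr (cr j - 2) * (c j * (2 powr (?d - s j) * t powr (?d - s j)) * p j powr s j)
         = \<kappa> j * c j * 2 powr (?d - s j) * p j powr s j * (t powr (cr j - 2) * t powr (?d - s j))" by simp
      \<comment> \<open>By definition of the critical exponent the powers cancel, which makes
        \<open>K\<close> independent of \<open>t\<close>.\<close>
      also have "t powr (cr j - 2) * t powr (?d - s j) = 1"
        using t by (simp add: powr_add[symmetric] cr_def critical_exponent_def)
      finally show "\<kappa> j * t powr (cr j - 2) * measure lebesgue (?V j) \<le> \<kappa> j * c j * 2 powr (?d - s j) * p j powr s j" by simp
    qed
    finally have "energy ?g \<le> K" .
    then show "\<exists>\<zeta>. layer_cutoff (frontier \<Omega>) \<rho> t \<zeta> \<and>
     finite_energy (\<lambda>k x. indicator (ball 0 (\<rho> - 1)) x * partial_deriv k \<zeta> x) \<and>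
     energy (\<lambda>k x. indicator (ball 0 (\<rho> - 1)) x * partial_deriv k \<zeta> x) \<le> K"
      unfolding layer_cutoff_def using \<zeta>(1,2) \<zeta>(4) \<zeta>(5) ei by (intro exI[of _ \<zeta>] conjI allI impI) auto
  qed
qed

text \<open>\<open>\<theta> N\<close> is a discrete form of a logarithmic cutoff: its gradient
  consists of \<open>N + 1\<close> pieces on disjoint layers, each divided by \<open>N + 1\<close>,
  so in the region that matters the energies add up to at most \<open>K / (N + 1)\<close>. The bound
  \<open>B\<close> allows \<open>\<psi>\<close> to be taken out of the energy of its product with
  this gradient.\<close>

lemma approximable_bounded_support:
  assumes f: "form_fn \<psi> h" and B: "\<And>x. \<bar>\<psi> x\<bar> \<le> B" and R: "\<And>x. norm x > R \<Longrightarrow> \<psi> x = 0 \<and> (\<forall>k. h k x = 0)"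
  shows "approximable \<psi> h"
proof (rule approximable_closure[OF f])
  fix e :: real assume e: "e > 0"
  define \<rho> where "\<rho> = \<bar>R\<bar> + 3"
  have \<rho>: "\<rho> \<ge> 2" "R < \<rho> - 1" by (auto simp: \<rho>_def)
  obtain K r0 where K: "K > 0" and r0: "r0 > 0" and cut: "\<And>t. 0 < t \<Longrightarrow> t \<le> 1 \<Longrightarrow> 2 * t < r0 \<Longrightarrow> \<exists>\<zeta>. layer_cutoff (frontier \<Omega>) \<rho> t \<zeta> \<and>
     finite_energy (\<lambda>k x. indicator (ball 0 (\<rho> - 1)) x * partial_deriv k \<zeta> x) \<and>
     energy (\<lambda>k x. indicator (ball 0 (\<rho> - 1)) x * partial_deriv k \<zeta> x) \<le> K"
    using single_scale_energy[OF \<rho>(1)] by blast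
  \<comment> \<open>The ratio 1/2 separates the layers: step \<open>j\<close> varies only up to
    height \<open>5/4 * t j\<close>, which for \<open>i < j\<close> is at most
    \<open>5/8 * t i\<close> and so below the lower end \<open>3/4 * t i\<close> of layer
    \<open>i\<close>. The initial value meets the conditions of \<open>cut\<close>.\<close>
  define t where "t i = min 1 (r0 / 4) * (1/2) ^ i" for i :: nat
  have t0: "0 < t i" "t i \<le> 1" "2 * t i < r0" for i
  proof -
    show "0 < t i" using r0 by (simp add: t_def)
    have "t i \<le> min 1 (r0/4) * 1" unfolding t_def using r0 by (intro mult_left_mono power_le_one) auto
    then show "t i \<le> 1" "2 * t i < r0" using r0 by auto
  qed
  have t_anti: "t j \<le> t i" if "i \<le> j" for i j
    unfolding t_def using r0 that by (intro mult_left_mono power_decreasing) auto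
  have t_half: "t j \<le> t i / 2" if "i < j" for i j
    using t_anti[of "Suc i" j] that by (simp add: t_def)
  define P where "P i \<zeta> \<longleftrightarrow> layer_cutoff (frontier \<Omega>) \<rho> (t i) \<zeta> \<and>
     finite_energy (\<lambda>k x. indicator (ball 0 (\<rho> - 1)) x * partial_deriv k \<zeta> x) \<and>
     energy (\<lambda>k x. indicator (ball 0 (\<rho> - 1)) x * partial_deriv k \<zeta> x) \<le> K" for i \<zeta>
  have "\<forall>i. \<exists>\<zeta>. P i \<zeta>" unfolding P_def using cut[OF t0] by blast
  from choice[OF this] obtain \<zeta> where P: "\<And>i. P i (\<zeta> i)" by blast
  have \<zeta>: "\<And>i. smooth_fn (\<zeta> i)" "\<And>i x. 0 \<le> \<zeta> i x \<and> \<zeta> i x \<le> 1"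
     "\<And>i x. norm x < \<rho> - 1 \<Longrightarrow> dist_bd x < 3/4 * t i \<Longrightarrow> \<zeta> i x = 1 \<and> (\<forall>k. partial_deriv k (\<zeta> i) x = 0)"
     "\<And>i x. dist_bd x > 5/4 * t i \<Longrightarrow> \<zeta> i x = 0 \<and> (\<forall>k. partial_deriv k (\<zeta> i) x = 0)"
     "\<And>i. finite_energy (\<lambda>k x. indicator (ball 0 (\<rho> - 1)) x * partial_deriv k (\<zeta> i) x)"
     "\<And>i. energy (\<lambda>k x. indicator (ball 0 (\<rho> - 1)) x * partial_deriv k (\<zeta> i) x) \<le> K"
    using P[unfolded P_def layer_cutoff_def] by blast+
  define n1 where "n1 N = real (Suc N)" for N
  have n1: "n1 N > 0" for N by (simp add: n1_def)
  \<comment> \<open>At a fixed point of \<open>\<Omega>\<close> only finitely many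
    \<open>\<zeta> i\<close> are nonzero, so the average tends to 0; inside the ball and below
    height \<open>3/4 * t N\<close> all of them equal 1, so \<open>\<eta> N\<close> vanishes
    there.\<close>
  define \<theta> where "\<theta> N x = (1 / n1 N) * (\<Sum>i\<le>N. \<zeta> i x)" for N x
  define \<eta> where "\<eta> N x = 1 - \<theta> N x" for N x
  have \<theta>01: "0 \<le> \<theta> N x \<and> \<theta> N x \<le> 1" for N x
  proof -
    have "0 \<le> (\<Sum>i\<le>N. \<zeta> i x)" using \<zeta>(2) by (intro sum_nonneg) auto
    moreover have "(\<Sum>i\<le>N. \<zeta> i x) \<le> (\<Sum>i\<le>N. 1)" using \<zeta>(2) by (intro sum_mono) auto
    moreover have "(\<Sum>i\<le>N. 1::real) = n1 N" by (simp add: n1_def)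
    ultimately show ?thesis using n1[of N] unfolding \<theta>_def by (simp add: field_simps)
  qed
  have sm\<theta>: "smooth_fn (\<theta> N)" for N
    unfolding \<theta>_def by (intro smooth_fn_mult smooth_fn_const smooth_fn_sum \<zeta>)
  have sm\<eta>: "smooth_fn (\<eta> N)" for N
    unfolding \<eta>_def by (intro smooth_fn_diff smooth_fn_const sm\<theta>)
  have pd\<eta>: "partial_deriv k (\<eta> N) x = - ((1 / n1 N) * (\<Sum>i\<le>N. partial_deriv k (\<zeta> i) x))" for k N x
  proof -
    have hd: "(\<zeta> i has_derivative frechet_derivative (\<zeta> i) (at x)) (at x)" for i
      using C_order_1_differentiable[OF smooth_fn_C_order[OF \<zeta>(1)]] frechet_derivative_works by blast
    have "(\<eta> N has_derivative (\<lambda>h. 0 - (1 / n1 N) * (\<Sum>i\<le>N. frechet_derivative (\<zeta> i) (at x) h))) (at x)"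
      unfolding \<eta>_def[abs_def] \<theta>_def
      by (intro has_derivative_diff has_derivative_const has_derivative_mult_right has_derivative_sum hd)
    from partial_deriv_eqI[OF this] show ?thesis by (simp add: partial_deriv_def)
  qed
  have \<theta>lim: "(\<lambda>N. \<theta> N x) \<longlonglongrightarrow> 0" if x: "x \<in> \<Omega>" for x
  proof -
    have \<delta>x: "dist_bd x > 0" by (rule infdist_frontier_pos[OF open_\<Omega> x frontier_ne])
    have "(\<lambda>i. 5/4 * t i) \<longlonglongrightarrow> 5/4 * (min 1 (r0/4) * 0)"
      unfolding t_def by (intro tendsto_intros LIMSEQ_power_zero) auto
    then have "\<forall>\<^sub>F i in sequentially. 5/4 * t i < dist_bd x" using \<delta>x by (intro order_tendstoD(2)[of _ 0]) auto
    then obtain I where I: "\<And>i. i \<ge> I \<Longrightarrow> 5/4 * t i < dist_bd x" by (auto simp: eventually_sequentially)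
    have "(\<Sum>i\<le>N. \<zeta> i x) \<le> real I" for N
    proof -
      have "(\<Sum>i\<le>N. \<zeta> i x) \<le> (\<Sum>i\<le>N. if i < I then 1 else 0)"
        using \<zeta>(2) \<zeta>(4)[OF I] by (intro sum_mono) (auto simp: not_less)
      also have "\<dots> = real (card ({..N} \<inter> {i. i < I}))" by (simp add: sum.If_cases)
      also have "\<dots> \<le> real (card {..<I})" by (intro of_nat_mono card_mono) auto
      finally show ?thesis by simp
    qed
    then have "\<theta> N x \<le> real I / real (Suc N)" for N
      unfolding \<theta>_def n1_def by (simp add: divide_right_mono del: of_nat_Suc)
    then show ?thesis
      by (intro tendsto_sandwich[OF _ _ tendsto_const LIMSEQ_Suc[OF lim_const_over_n[of "real I"]]])
         (use \<theta>01 in auto)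
  qed
  have s: "sq_int L\<Omega> \<psi>" using f by (simp add: form_fn_def)
  have m\<eta>: "partial_deriv k (\<eta> N) \<in> borel_measurable L\<Omega>" for N k
    using continuous_lebesgue_measurable[OF C_order_1_continuous_partial[OF smooth_fn_C_order[OF sm\<eta>]]] measurable_restrict_space1 by blast
  let ?g = "\<lambda>i k x. indicator (ball 0 (\<rho> - 1)) x * partial_deriv k (\<zeta> i) x"
  let ?W = "\<lambda>N x. (B / n1 N)\<^sup>2 * (\<Sum>i\<le>N. energy_density C (?g i) x)"
  have mgrad: "(\<lambda>x. partial_deriv k (\<eta> N) x * \<psi> x) \<in> borel_measurable L\<Omega>" for k N
    by (rule borel_measurable_times[OF m\<eta> sq_int_measurable[OF s]])
  have leW: "AE x in L\<Omega>. energy_density C (\<lambda>k x. partial_deriv k (\<eta> N) x * \<psi> x) x \<le> ?W N x" for N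
    using mat_form_nonneg
  proof eventually_elim
    case (elim x)
    show ?case
    proof (cases "norm x > R")
      case True
      then have "energy_density C (\<lambda>k x. partial_deriv k (\<eta> N) x * \<psi> x) x = 0" using R[OF True] by (simp add: energy_density_def)
      moreover have "0 \<le> ?W N x" using elim by (intro mult_nonneg_nonneg sum_nonneg) (auto simp: energy_density_mat_form)
      ultimately show ?thesis by linarith
    next
      case False
      then have nx: "norm x < \<rho> - 1" using \<rho> by linarith
      have "energy_density C (\<lambda>k x. partial_deriv k (\<eta> N) x * \<psi> x) x
         = mat_form (C x) (\<lambda>k. (- \<psi> x / n1 N) * (\<Sum>i\<le>N. ?g i k x))"
        using nx by (simp add: energy_density_mat_form pd\<eta> mult_ac)
      also have "\<dots> = (- \<psi> x / n1 N)\<^sup>2 * mat_form (C x) (\<lambda>k. \<Sum>i\<le>N. ?g i k x)" by (rule mat_form_scale)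
      also have "mat_form (C x) (\<lambda>k. \<Sum>i\<le>N. ?g i k x) = (\<Sum>i\<le>N. mat_form (C x) (\<lambda>k. ?g i k x))"
      proof (rule mat_form_sum_disjoint)
        have ord: "(\<forall>k. ?g i k x = 0) \<or> (\<forall>k. ?g j k x = 0)" if ij: "i < j" for i j
        proof (cases "dist_bd x > 5/4 * t j")
          case True then show ?thesis using \<zeta>(4) by simp
        next
          case False
          then have "dist_bd x < 3/4 * t i" using t_half[OF ij] t0(1)[of i] by linarith
          then show ?thesis using \<zeta>(3)[OF nx] by simp
        qed
        show "(\<forall>k. ?g i k x = 0) \<or> (\<forall>k. ?g j k x = 0)" if "i \<noteq> j" for i j
          using ord[of i j] ord[of j i] that by (meson linorder_neqE_nat)
      qed simp
      also have "(- \<psi> x / n1 N)\<^sup>2 * (\<Sum>i\<le>N. mat_form (C x) (\<lambda>k. ?g i k x)) \<le> ?W N x"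
        unfolding energy_density_mat_form
      proof (rule mult_right_mono)
        have "\<bar>- \<psi> x / n1 N\<bar> \<le> \<bar>B / n1 N\<bar>" using B[of x] n1[of N] by (simp add: divide_right_mono)
        then show "(- \<psi> x / n1 N)\<^sup>2 \<le> (B / n1 N)\<^sup>2" by (simp only: abs_le_square_iff)
        show "0 \<le> (\<Sum>i\<le>N. mat_form (C x) (\<lambda>k. ?g i k x))" using elim by (intro sum_nonneg) blast
      qed
      finally show ?thesis .
    qed
  qed
  have Wi: "integrable L\<Omega> (?W N)" for N using \<zeta>(5) by simp
  have ei: "finite_energy (\<lambda>k x. partial_deriv k (\<eta> N) x * \<psi> x)" for N
    by (rule energy_bound_integrable[OF Wi mgrad leW])
  have eb: "energy (\<lambda>k x. partial_deriv k (\<eta> N) x * \<psi> x) \<le> B\<^sup>2 * K / real (Suc N)" for N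
  proof -
    have "energy (\<lambda>k x. partial_deriv k (\<eta> N) x * \<psi> x) \<le> integral\<^sup>L L\<Omega> (?W N)"
      by (rule integral_mono_AE[OF ei Wi leW])
    also have "\<dots> = (B / n1 N)\<^sup>2 * (\<Sum>i\<le>N. energy (?g i))" using \<zeta>(5) by simp
    also have "\<dots> \<le> (B / n1 N)\<^sup>2 * (\<Sum>i\<le>N. K)" using \<zeta>(6) by (intro mult_left_mono sum_mono) auto
    also have "(\<Sum>i\<le>N. K) = n1 N * K" by (simp add: n1_def)
    also have "(B / n1 N)\<^sup>2 * (n1 N * K) = B\<^sup>2 * K / n1 N" using n1[of N] by (simp add: power2_eq_square)
    finally show ?thesis by (simp add: n1_def)
  qed
  have lim\<eta>: "(\<lambda>N. \<eta> N x - 1) \<longlonglongrightarrow> 0" if "x \<in> \<Omega>" for x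
    using tendsto_minus[OF \<theta>lim[OF that]] by (simp add: \<eta>_def)
  have e2: "(\<lambda>n. energy (\<lambda>k x. partial_deriv k (\<eta> n) x * \<psi> x)) \<longlonglongrightarrow> 0"
    by (rule tendsto_sandwich[OF _ _ tendsto_const LIMSEQ_Suc[OF lim_const_over_n[of "B\<^sup>2 * K"]]])
       (use eb in \<open>auto intro!: always_eventually integral_nonneg_AE energy_nonneg simp del: of_nat_Suc\<close>)
  have \<eta>01: "0 \<le> \<eta> N x \<and> \<eta> N x \<le> 1" for N x using \<theta>01[of N x] by (simp add: \<eta>_def)
  obtain N where f\<psi>: "form_fn (\<lambda>x. \<eta> N x * \<psi> x) (\<lambda>k x. \<eta> N x * h k x + partial_deriv k (\<eta> N) x * \<psi> x)"
    and N: "close_to e (\<lambda>x. \<eta> N x * \<psi> x) (\<lambda>k x. \<eta> N x * h k x + partial_deriv k (\<eta> N) x * \<psi> x) \<psi> h" (is "close_to e ?\<psi> ?h \<psi> h")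
    by (rule cutoff_close_to[OF f sm\<eta> \<eta>01 lim\<eta> ei e2 e])
  \<comment> \<open>At points of \<open>\<Omega>\<close> outside \<open>Q\<close> either
    \<open>\<psi>\<close> and its gradient or \<open>\<eta> N\<close> and its gradient vanish. The
    closure makes \<open>Q\<close> compact, and the positive distance keeps \<open>Q\<close> off the
    frontier and thus inside \<open>\<Omega>\<close>.\<close>
  define Q where "Q = (cball 0 \<bar>R\<bar> \<inter> {x. 3/4 * t N \<le> dist_bd x}) \<inter> closure \<Omega>"
  have "closed {x. 3/4 * t N \<le> dist_bd x}" by (intro closed_Collect_le continuous_intros)
  then have Q: "compact Q" unfolding Q_def by (intro compact_Int_closed) auto
  have Q\<Omega>: "Q \<subseteq> \<Omega>"
  proof
    fix x assume x: "x \<in> Q"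
    then have "dist_bd x > 0" using t0(1)[of N] by (simp add: Q_def)
    then have "x \<notin> frontier \<Omega>" by (metis infdist_zero less_irrefl)
    then show "x \<in> \<Omega>" using x open_\<Omega> by (auto simp: Q_def frontier_def interior_open)
  qed
  have off: "?\<psi> x = 0 \<and> (\<forall>k. ?h k x = 0)" if x: "x \<in> \<Omega>" "x \<notin> Q" for x
  proof (cases "norm x > R")
    case True then show ?thesis using R[OF True] by simp
  next
    case False
    then have "dist_bd x < 3/4 * t N" using x closure_subset[of \<Omega>] by (auto simp: Q_def not_le)
    then have d: "dist_bd x < 3/4 * t i" if "i \<le> N" for i using t_anti[OF that] by linarith
    have nx: "norm x < \<rho> - 1" using False \<rho> by linarith
    have "(\<Sum>i\<le>N. \<zeta> i x) = (\<Sum>i\<le>N. 1)" using \<zeta>(3)[OF nx d] by (intro sum.cong) auto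
    also have "\<dots> = n1 N" by (simp add: n1_def)
    finally have "\<eta> N x = 0" using n1[of N] by (simp add: \<eta>_def \<theta>_def)
    moreover have "partial_deriv k (\<eta> N) x = 0" for k using \<zeta>(3)[OF nx d] by (simp add: pd\<eta>)
    ultimately show ?thesis by simp
  qed
  \<comment> \<open>The indicator changes nothing on \<open>\<Omega>\<close> but makes both
    functions vanish everywhere off \<open>Q\<close>, as \<open>approximable_compact_support\<close>
    demands.\<close>
  let ?\<psi>' = "\<lambda>x. indicator Q x * ?\<psi> x" and ?h' = "\<lambda>k x. indicator Q x * ?h k x"
  have eq: "?\<psi>' x = ?\<psi> x" "?h' k x = ?h k x" if "x \<in> \<Omega>" for x k
    using off[OF that] by (cases "x \<in> Q"; simp)+
  have f': "form_fn ?\<psi>' ?h'" by (rule form_fn_cong[OF f\<psi>]) (rule eq; assumption)+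
  moreover have "approximable ?\<psi>' ?h'" by (rule approximable_compact_support[OF f' Q Q\<Omega>]) auto
  moreover have "close_to e ?\<psi>' ?h' \<psi> h" by (rule close_to_cong[OF N]) (rule eq; assumption)+
  ultimately show "\<exists>\<psi>' h'. form_fn \<psi>' h' \<and> approximable \<psi>' h' \<and> close_to e \<psi>' h' \<psi> h" by blast
qed

lemma form_D_eq_N: "form_D \<Omega> C = form_N \<Omega> C"
proof
  fix \<phi>
  show "form_D \<Omega> C \<phi> = form_N \<Omega> C \<phi>"
  proof (cases "\<exists>u. form_approx \<Omega> (form_0 \<Omega> C) u \<phi>")
    case True then show ?thesis by (rule form_D_eq_form_N)
  next
    case False
    have "form_N \<Omega> C \<phi> = None"
    proof (rule ccontr)
      assume "form_N \<Omega> C \<phi> \<noteq> None"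
      then obtain a where "form_N \<Omega> C \<phi> = Some a" by blast
      then obtain g where g: "form_fn \<phi> g" using form_N_form_fn by blast
      have "approximable \<phi> g"
      proof (rule approximable_of_bounded[OF g])
        fix \<psi> h B assume \<psi>: "form_fn \<psi> h" "\<And>x. \<bar>\<psi> x\<bar> \<le> B"
        show "approximable \<psi> h"
          by (rule approximable_of_bounded_support[OF \<psi>]) (rule approximable_bounded_support)
      qed
      then show False using approximable_form_approx[OF g] False by blast
    qed
    then show ?thesis using False by (simp add: form_D_def form_closure_def)
  qed
qed

end

section \<open>Whitney chains\<close>

abbreviation unit_cube :: "(real^'n) set" where
  "unit_cube \<equiv> cbox (-1) 1"

text \<open>Up to the factor \<open>2 ^ CARD('n)\<close>, the mean of \<open>f\<close> over the cube
  with centre \<open>p\<close> and half side \<open>\<rho>\<close>. Integrating over a fixed cube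
  turns \<open>p\<close> and \<open>\<rho>\<close> into parameters, to which the Leibniz rule
  applies.\<close>

definition cube_avg :: "(real^'n \<Rightarrow> real) \<Rightarrow> real^'n \<Rightarrow> real \<Rightarrow> real" where
  "cube_avg f p \<rho> = integral unit_cube (\<lambda>y. f (p + \<rho> *\<^sub>R y))"

definition sq_grad :: "(real^'n \<Rightarrow> real) \<Rightarrow> real^'n \<Rightarrow> real" where
  "sq_grad f x = (\<Sum>k\<in>UNIV. (partial_deriv k f x)\<^sup>2)"

lemma sq_grad_nonneg: "0 \<le> sq_grad f x"
  unfolding sq_grad_def by (intro sum_nonneg) auto

lemma sq_grad_continuous: "C_order 1 f \<Longrightarrow> continuous_on UNIV (sq_grad f)"
  unfolding sq_grad_def[abs_def] by (intro continuous_intros C_order_1_continuous_partial)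

lemma unit_cube_norm: "(y::real^'n) \<in> unit_cube \<Longrightarrow> norm y \<le> real CARD('n)"
proof -
  assume y: "y \<in> unit_cube"
  have "norm y \<le> (\<Sum>k\<in>UNIV. \<bar>y $ k\<bar>)" by (rule norm_le_l1_cart)
  also have "\<dots> \<le> (\<Sum>k\<in>(UNIV::'n set). 1)"
  proof (rule sum_mono)
    fix k
    have "- 1 \<le> y $ k \<and> y $ k \<le> 1" using y by (auto simp: mem_box_cart)
    then show "\<bar>y $ k\<bar> \<le> 1" by auto
  qed
  finally show ?thesis by simp
qed

lemma content_unit_cube: "measure lborel (unit_cube :: (real^'n) set) = 2 ^ CARD('n)"
proof -
  have "(0::real^'n) \<in> unit_cube" by (simp add: mem_box_cart)
  then have "(unit_cube :: (real^'n) set) \<noteq> {}" by blast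
  then show ?thesis by (simp add: content_cbox_cart)
qed

lemma cube_integral_eq:
  fixes f :: "real^'n \<Rightarrow> real"
  assumes "continuous_on UNIV f"
  shows "integral unit_cube f = (\<integral>y. f y \<partial>lebesgue_on unit_cube)" "integrable (lebesgue_on unit_cube) f"
proof -
  have "sq_int (lebesgue_on (unit_cube :: (real^'n) set)) (\<lambda>x. 1)"
    by (rule sq_int_continuous_compact) auto
  from sq_int_mult_integrable[OF sq_int_continuous_compact[OF assms compact_cbox] this]
  show "integrable (lebesgue_on unit_cube) f" by simp
  then show "integral unit_cube f = (\<integral>y. f y \<partial>lebesgue_on unit_cube)"
    by (rule lebesgue_integral_eq_integral[symmetric]) simp
qed

lemma cube_scaled_integral_le:
  fixes G :: "real^'n \<Rightarrow> real"
  assumes G: "G \<in> borel_measurable borel" "\<And>x. 0 \<le> G x" and S: "S \<in> sets lebesgue" "integrable (lebesgue_on S) G"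
    and \<rho>: "\<rho> > 0" and sub: "\<And>y. y \<in> unit_cube \<Longrightarrow> p + \<rho> *\<^sub>R y \<in> S"
  shows "(\<integral>y. G (p + \<rho> *\<^sub>R y) \<partial>lebesgue_on unit_cube) \<le> (1/\<rho>) ^ CARD('n) * (\<integral>x. G x \<partial>lebesgue_on S)"
proof -
  let ?Q = "unit_cube :: (real^'n) set"
  \<comment> \<open>The indicator of the scaled cube, instead of that of \<open>S\<close>, keeps
    \<open>h\<close> Borel measurable although \<open>S\<close> is only Lebesgue measurable.\<close>
  define h where "h x = indicator ?Q ((1/\<rho>) *\<^sub>R (x - p)) * G x" for x
  have [measurable]: "G \<in> borel_measurable borel" by fact
  have hm: "h \<in> borel_measurable borel" unfolding h_def by measurable
  have hp: "h (p + \<rho> *\<^sub>R y) = indicator ?Q y * G (p + \<rho> *\<^sub>R y)" for y using \<rho> by (simp add: h_def)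
  have hb: "(\<lambda>y. indicator ?Q y * G (p + \<rho> *\<^sub>R y)) \<in> borel_measurable borel" by measurable
  have le: "h x \<le> indicator S x * G x" for x
  proof (cases "(1/\<rho>) *\<^sub>R (x - p) \<in> ?Q")
    case True
    have "p + \<rho> *\<^sub>R ((1/\<rho>) *\<^sub>R (x - p)) \<in> S" by (rule sub[OF True])
    then have "x \<in> S" using \<rho> by simp
    then show ?thesis using True by (simp add: h_def)
  next
    case False then show ?thesis using G by (simp add: h_def)
  qed
  have Si: "integrable lebesgue (\<lambda>x. indicator S x * G x)" using S by (simp add: lebesgue_on_integrable_iff)
  have hi: "integrable lebesgue h"
    by (rule Bochner_Integration.integrable_bound[OF Si]) (use hm le G in \<open>auto simp: measurable_completion h_def\<close>)
  have "(\<integral>y. G (p + \<rho> *\<^sub>R y) \<partial>lebesgue_on ?Q) = (\<integral>y. indicator ?Q y * G (p + \<rho> *\<^sub>R y) \<partial>lborel)"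
    using hb by (simp add: lebesgue_on_integral integral_completion)
  also have "\<dots> = (1/\<rho>) ^ CARD('n) * (\<integral>x. h x \<partial>lborel)"
    using integral_lborel_affine[OF hm, of \<rho> p] \<rho> by (simp add: hp power_one_over)
  also have "(\<integral>x. h x \<partial>lborel) = (\<integral>x. h x \<partial>lebesgue)" using hm by (simp add: integral_completion)
  also have "\<dots> \<le> (\<integral>x. indicator S x * G x \<partial>lebesgue)" by (rule integral_mono[OF hi Si le])
  also have "\<dots> = (\<integral>x. G x \<partial>lebesgue_on S)" using S by (simp add: lebesgue_on_integral)
  finally show ?thesis using \<rho> by (simp add: mult_left_mono)
qed

text \<open>An estimate of Poincare type: while the cube moves and changes size linearly, each of
  its points travels at most \<open>dist p q + CARD('n) * \<bar>\<rho>' - \<rho>\<bar>\<close>. The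
  derivative of the average is bounded by Cauchy-Schwarz; the volume of the unit cube and the
  Jacobian \<open>(1/\<rho>0) ^ CARD('n)\<close> give the factor under the root.\<close>

lemma cube_avg_segment:
  fixes f :: "real^'n \<Rightarrow> real"
  assumes f: "C_order 1 f" and S: "S \<in> sets lebesgue" "integrable (lebesgue_on S) (sq_grad f)"
    and \<rho>: "\<rho>0 > 0" "\<rho>0 \<le> \<rho>" "\<rho>0 \<le> \<rho>'"
    and sub: "\<And>t y. t \<in> {0..1} \<Longrightarrow> y \<in> unit_cube \<Longrightarrow> (p + t *\<^sub>R (q - p)) + (\<rho> + t * (\<rho>' - \<rho>)) *\<^sub>R y \<in> S"
  shows "\<bar>cube_avg f q \<rho>' - cube_avg f p \<rho>\<bar> \<le> (dist p q + real CARD('n) * \<bar>\<rho>' - \<rho>\<bar>) *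
     sqrt ((2/\<rho>0) ^ CARD('n) * integral\<^sup>L (lebesgue_on S) (sq_grad f))"
proof -
  let ?Q = "unit_cube :: (real^'n) set" and ?M = "lebesgue_on (unit_cube :: (real^'n) set)"
  let ?D = "real CARD('n)"
  let ?E = "integral\<^sup>L (lebesgue_on S) (sq_grad f)"
  define \<Lambda> where "\<Lambda> = dist p q + ?D * \<bar>\<rho>' - \<rho>\<bar>"
  have \<Lambda>: "\<Lambda> \<ge> 0" by (simp add: \<Lambda>_def)
  define X where "X t y = (p + t *\<^sub>R (q - p)) + (\<rho> + t * (\<rho>' - \<rho>)) *\<^sub>R y" for t and y :: "real^'n"
  define V where "V y = (q - p) + (\<rho>' - \<rho>) *\<^sub>R y" for y :: "real^'n"
  define g where "g t y = (\<Sum>k\<in>UNIV. V y $ k * partial_deriv k f (X t y))" for t y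
  have cf: "continuous_on UNIV f" by (rule C_order_1_continuous[OF f])
  have cp: "continuous_on UNIV (partial_deriv k f)" for k by (rule C_order_1_continuous_partial[OF f])
  have E0: "?E \<ge> 0" by (intro integral_nonneg_AE) (simp add: sq_grad_nonneg)
  have dX: "((\<lambda>t. X t y) has_derivative (\<lambda>h. h *\<^sub>R V y)) (at t within {0..1})" for t y
    unfolding X_def V_def by (auto intro!: derivative_eq_intros simp: algebra_simps scaleR_add_right)
  have df: "((\<lambda>t. f (X t y)) has_field_derivative g t y) (at t within {0..1})" for t y
  proof -
    have "((\<lambda>t. f (X t y)) has_derivative (\<lambda>h. \<Sum>k\<in>UNIV. (h *\<^sub>R V y) $ k * partial_deriv k f (X t y))) (at t within {0..1})"
      by (rule has_derivative_compose[OF dX has_derivative_partial[OF C_order_1_differentiable[OF f]]])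
    moreover have "(\<lambda>h. \<Sum>k\<in>UNIV. (h *\<^sub>R V y) $ k * partial_deriv k f (X t y)) = (*) (g t y)"
      by (rule ext) (simp add: g_def sum_distrib_right sum_distrib_left mult_ac)
    ultimately show ?thesis by (simp add: has_field_derivative_def)
  qed
  have cX: "continuous_on UNIV (X t)" for t unfolding X_def by (intro continuous_intros)
  have cg: "continuous_on UNIV (g t)" for t
    unfolding g_def V_def by (intro continuous_intros continuous_on_compose2[OF cp cX]) auto
  have dM: "((\<lambda>t. integral ?Q (\<lambda>y. f (X t y))) has_field_derivative integral ?Q (g t)) (at t within {0..1})"
    if t: "t \<in> {0..1}" for t
  proof (rule leibniz_rule_field_derivative[OF df _ _ t])
    show "(\<lambda>y. f (X t y)) integrable_on ?Q" for t
      by (intro integrable_continuous continuous_on_subset[OF continuous_on_compose2[OF cf cX]]) auto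
    show "continuous_on ({0..1} \<times> ?Q) (\<lambda>(t, y). g t y)"
      unfolding g_def V_def X_def split_beta
      by (intro continuous_intros continuous_on_compose2[OF cp]) auto
  qed auto
  have gb: "\<bar>g t y\<bar> \<le> \<Lambda> * sqrt (sq_grad f (X t y))" if y: "y \<in> ?Q" for t y
  proof -
    let ?G = "\<chi> k. partial_deriv k f (X t y)"
    have "g t y = V y \<bullet> ?G" by (simp add: g_def inner_vec_def)
    also have "\<bar>\<dots>\<bar> \<le> norm (V y) * norm ?G" by (rule Cauchy_Schwarz_ineq2)
    also have "norm ?G = sqrt (sq_grad f (X t y))" by (simp add: norm_vec_def L2_set_def sq_grad_def)
    also have "norm (V y) * sqrt (sq_grad f (X t y)) \<le> \<Lambda> * sqrt (sq_grad f (X t y))"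
    proof (rule mult_right_mono)
      have "norm (V y) \<le> norm (q - p) + norm ((\<rho>' - \<rho>) *\<^sub>R y)" unfolding V_def by (rule norm_triangle_ineq)
      also have "norm ((\<rho>' - \<rho>) *\<^sub>R y) \<le> \<bar>\<rho>' - \<rho>\<bar> * ?D" using unit_cube_norm[OF y] by (simp add: mult_left_mono)
      finally show "norm (V y) \<le> \<Lambda>" by (simp add: \<Lambda>_def dist_norm norm_minus_commute mult.commute)
    qed (simp add: sq_grad_nonneg)
    finally show ?thesis .
  qed
  have bound: "norm (integral ?Q (g t)) \<le> \<Lambda> * sqrt ((2/\<rho>0) ^ CARD('n) * ?E)" if t: "t \<in> {0..1}" for t
  proof -
    let ?r = "\<rho> + t * (\<rho>' - \<rho>)"
    have r: "?r \<ge> \<rho>0"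
    proof -
      have "?r = (1 - t) * \<rho> + t * \<rho>'" by (simp add: algebra_simps)
      also have "\<dots> \<ge> (1 - t) * \<rho>0 + t * \<rho>0" using t \<rho> by (intro add_mono mult_left_mono) auto
      finally show ?thesis by (simp add: algebra_simps)
    qed
    have cs: "continuous_on UNIV (\<lambda>y. sq_grad f (X t y))"
      by (rule continuous_on_compose2[OF sq_grad_continuous[OF f] cX]) auto
    have css: "continuous_on UNIV (\<lambda>y. sqrt (sq_grad f (X t y)))" by (intro continuous_intros cs)
    have s1: "sq_int ?M (\<lambda>y. sqrt (sq_grad f (X t y)))" by (rule sq_int_continuous_compact[OF css compact_cbox])
    have s2: "sq_int ?M (\<lambda>y. 1)" by (rule sq_int_continuous_compact[OF continuous_on_const compact_cbox])
    have "norm (integral ?Q (g t)) = norm (\<integral>y. g t y \<partial>?M)" using cube_integral_eq(1)[OF cg] by simp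
    also have "\<dots> \<le> (\<integral>y. \<Lambda> * sqrt (sq_grad f (X t y)) \<partial>?M)"
    proof (rule Bochner_Integration.integral_norm_bound_integral)
      show "integrable ?M (g t)" by (rule cube_integral_eq(2)[OF cg])
      show "integrable ?M (\<lambda>y. \<Lambda> * sqrt (sq_grad f (X t y)))"
        by (rule cube_integral_eq(2)) (intro continuous_intros css)
      show "norm (g t y) \<le> \<Lambda> * sqrt (sq_grad f (X t y))" if "y \<in> space ?M" for y
        using gb that by (simp add: space_restrict_space)
    qed
    also have "\<dots> = \<Lambda> * (\<integral>y. sqrt (sq_grad f (X t y)) * 1 \<partial>?M)" by simp
    also have "\<dots> \<le> \<Lambda> * sqrt ((2/\<rho>0) ^ CARD('n) * ?E)"
    proof (rule mult_left_mono[OF _ \<Lambda>], rule real_le_rsqrt)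
      have "(\<integral>y. sqrt (sq_grad f (X t y)) * 1 \<partial>?M)\<^sup>2 \<le> (\<integral>y. (sqrt (sq_grad f (X t y)))\<^sup>2 \<partial>?M) * (\<integral>y. 1\<^sup>2 \<partial>?M)"
        by (rule Cauchy_Schwarz_integral[OF s1 s2])
      also have "(\<integral>y. (1::real)\<^sup>2 \<partial>?M) = 2 ^ CARD('n)"
        using content_unit_cube by (simp add: measure_restrict_space space_restrict_space)
      also have "(\<integral>y. (sqrt (sq_grad f (X t y)))\<^sup>2 \<partial>?M) = (\<integral>y. sq_grad f ((p + t *\<^sub>R (q - p)) + ?r *\<^sub>R y) \<partial>?M)"
        by (simp add: sq_grad_nonneg X_def)
      also have "(\<integral>y. sq_grad f ((p + t *\<^sub>R (q - p)) + ?r *\<^sub>R y) \<partial>?M) \<le> (1/?r) ^ CARD('n) * ?E"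
        by (rule cube_scaled_integral_le[OF borel_measurable_continuous_onI[OF sq_grad_continuous[OF f]] sq_grad_nonneg S])
           (use r \<rho> sub[OF t] in auto)
      also have "(1/?r) ^ CARD('n) \<le> (1/\<rho>0) ^ CARD('n)" using r \<rho> by (intro power_mono divide_left_mono) auto
      finally show "(\<integral>y. sqrt (sq_grad f (X t y)) * 1 \<partial>?M)\<^sup>2 \<le> (2/\<rho>0) ^ CARD('n) * ?E"
        using E0 by (simp add: power_divide mult_right_mono mult_ac)
    qed
    finally show ?thesis .
  qed
  have "norm (integral ?Q (\<lambda>y. f (X 1 y)) - integral ?Q (\<lambda>y. f (X 0 y))) \<le> \<Lambda> * sqrt ((2/\<rho>0) ^ CARD('n) * ?E) * norm (1 - 0 :: real)"
    by (rule field_differentiable_bound[OF _ dM bound]) auto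
  then show ?thesis by (simp add: cube_avg_def X_def \<Lambda>_def)
qed

text \<open>With \<open>f\<close> quantified inside, this is a relation between two cubes in
  \<open>S\<close>; it is established geometrically and only later applied to test
  functions.\<close>

definition linked :: "(real^'n) set \<Rightarrow> real \<Rightarrow> real \<Rightarrow> real^'n \<Rightarrow> real^'n \<Rightarrow> bool" where
  "linked S \<rho> \<Lambda> p q \<longleftrightarrow> (\<forall>f. C_order 1 f \<longrightarrow> integrable (lebesgue_on S) (sq_grad f) \<longrightarrow>
     \<bar>cube_avg f q \<rho> - cube_avg f p \<rho>\<bar> \<le> \<Lambda> * sqrt ((2/\<rho>) ^ CARD('n) * integral\<^sup>L (lebesgue_on S) (sq_grad f)))"

lemma linked_polygon:
  fixes w :: "nat \<Rightarrow> real^'n"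
  assumes S: "S \<in> sets lebesgue" and \<rho>: "\<rho> > 0"
    and sub: "\<And>i t y. i < N \<Longrightarrow> t \<in> {0..1} \<Longrightarrow> y \<in> unit_cube \<Longrightarrow> (w i + t *\<^sub>R (w (Suc i) - w i)) + \<rho> *\<^sub>R y \<in> S"
  shows "linked S \<rho> (\<Sum>i<N. dist (w i) (w (Suc i))) (w 0) (w N)"
  unfolding linked_def
proof (intro allI impI)
  fix f :: "real^'n \<Rightarrow> real" assume f: "C_order 1 f" "integrable (lebesgue_on S) (sq_grad f)"
  let ?B = "sqrt ((2/\<rho>) ^ CARD('n) * integral\<^sup>L (lebesgue_on S) (sq_grad f))"
  have step: "\<bar>cube_avg f (w (Suc i)) \<rho> - cube_avg f (w i) \<rho>\<bar> \<le> dist (w i) (w (Suc i)) * ?B" if i: "i < N" for i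
    using cube_avg_segment[OF f(1) S f(2) \<rho> order_refl order_refl, of "w i" "w (Suc i)"] sub[OF i] by simp
  have "cube_avg f (w N) \<rho> - cube_avg f (w 0) \<rho> = (\<Sum>i<N. cube_avg f (w (Suc i)) \<rho> - cube_avg f (w i) \<rho>)"
    using sum_lessThan_telescope[of "\<lambda>i. cube_avg f (w i) \<rho>" N] by simp
  also have "\<bar>\<dots>\<bar> \<le> (\<Sum>i<N. \<bar>cube_avg f (w (Suc i)) \<rho> - cube_avg f (w i) \<rho>\<bar>)" by (rule sum_abs)
  also have "\<dots> \<le> (\<Sum>i<N. dist (w i) (w (Suc i)) * ?B)" using step by (intro sum_mono) auto
  also have "\<dots> = (\<Sum>i<N. dist (w i) (w (Suc i))) * ?B" by (simp add: sum_distrib_right)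
  finally show "\<bar>cube_avg f (w N) \<rho> - cube_avg f (w 0) \<rho>\<bar> \<le> (\<Sum>i<N. dist (w i) (w (Suc i))) * ?B" .
qed

lemma linked_mono:
  assumes "linked S \<rho> \<Lambda> p q" "\<Lambda> \<le> \<Lambda>'" "\<rho> > 0"
  shows "linked S \<rho> \<Lambda>' p q"
  unfolding linked_def
proof (intro allI impI)
  fix f :: "real^'a \<Rightarrow> real" assume f: "C_order 1 f" "integrable (lebesgue_on S) (sq_grad f)"
  let ?B = "sqrt ((2/\<rho>) ^ CARD('a) * integral\<^sup>L (lebesgue_on S) (sq_grad f))"
  have "0 \<le> integral\<^sup>L (lebesgue_on S) (sq_grad f)" by (intro integral_nonneg_AE) (simp add: sq_grad_nonneg)
  then have "0 \<le> ?B" using assms(3) by simp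
  then have "\<Lambda> * ?B \<le> \<Lambda>' * ?B" using assms(2) by (rule mult_right_mono[rotated])
  then show "\<bar>cube_avg f q \<rho> - cube_avg f p \<rho>\<bar> \<le> \<Lambda>' * ?B" using assms(1) f unfolding linked_def by fastforce
qed

text \<open>The segment from \<open>w\<close> to a point outside \<open>\<Omega>\<close> would meet
  the frontier at a distance from \<open>w\<close> smaller than \<open>infdist\<close>
  allows.\<close>

lemma near_in_open:
  fixes w :: "'a::real_normed_vector"
  assumes "w \<in> \<Omega>" "dist w y < infdist w (frontier \<Omega>)"
  shows "y \<in> \<Omega>"
proof (rule ccontr)
  assume y: "y \<notin> \<Omega>"
  have "closed_segment w y \<inter> frontier \<Omega> \<noteq> {}"
    by (rule connected_Int_frontier) (use assms(1) y in auto)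
  then obtain u where u: "u \<in> closed_segment w y" "u \<in> frontier \<Omega>" by blast
  have "infdist w (frontier \<Omega>) \<le> dist w u" by (rule infdist_le[OF u(2)])
  also have "\<dots> \<le> dist w y" using segment_bound(1)[OF u(1)] by (simp add: dist_norm norm_minus_commute)
  finally show False using assms(2) by linarith
qed

section \<open>Corkscrew points and polygonal chains\<close>

definition whitney_part :: "(real^'n) set \<Rightarrow> real \<Rightarrow> real \<Rightarrow> real^'n \<Rightarrow> real \<Rightarrow> (real^'n) set" where
  "whitney_part \<Omega> \<kappa> L x r = {y\<in>\<Omega>. dist x y < L * r \<and> \<kappa> * r \<le> infdist y (frontier \<Omega>)}"

lemma whitney_part_sets: "open \<Omega> \<Longrightarrow> whitney_part \<Omega> \<kappa> L x r \<in> sets lebesgue"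
proof -
  assume \<Omega>: "open \<Omega>"
  have "closed {y. \<kappa> * r \<le> infdist y (frontier \<Omega>)}" by (intro closed_Collect_le continuous_intros)
  then have "\<Omega> \<inter> ball x (L * r) \<inter> {y. \<kappa> * r \<le> infdist y (frontier \<Omega>)} \<in> sets lebesgue"
    using \<Omega> by (intro sets.Int) auto
  also have "\<Omega> \<inter> ball x (L * r) \<inter> {y. \<kappa> * r \<le> infdist y (frontier \<Omega>)} = whitney_part \<Omega> \<kappa> L x r"
    by (auto simp: whitney_part_def)
  finally show ?thesis .
qed

text \<open>The interior corkscrew condition at the points of \<open>G\<close>, for scales up to
  \<open>R\<close>.\<close>

definition accessible :: "(real^'n) set \<Rightarrow> (real^'n) set \<Rightarrow> real \<Rightarrow> real \<Rightarrow> bool" where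
  "accessible \<Omega> G R \<kappa> \<longleftrightarrow> (\<forall>x\<in>G. \<forall>r. 0 < r \<and> r \<le> R \<longrightarrow>
     (\<exists>p\<in>\<Omega>. dist x p \<le> r \<and> \<kappa> * r \<le> infdist p (frontier \<Omega>)))"

text \<open>The total length is bounded and not the number of vertices, so curves may be subdivided
  as finely as necessary. Steps of half the clearance keep the segments away from
  \<open>\<Gamma>\<close>.\<close>

definition chain_near :: "(real^'n) set \<Rightarrow> real^'n \<Rightarrow> real \<Rightarrow> real \<Rightarrow> real \<Rightarrow> real^'n \<Rightarrow> real^'n \<Rightarrow> bool" where
  "chain_near \<Gamma> x r \<eta> L p q \<longleftrightarrow> (\<exists>N w. w 0 = p \<and> w N = q \<and>
     (\<forall>i\<le>N. dist x (w i) \<le> L * r \<and> \<eta> * r \<le> infdist (w i) \<Gamma>) \<and>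
     (\<forall>i<N. dist (w i) (w (Suc i)) \<le> \<eta> * r / 2) \<and> (\<Sum>i<N. dist (w i) (w (Suc i))) \<le> L * r)"

lemma chain_near_in_open:
  assumes c: "chain_near (frontier \<Omega>) x r \<eta> L p q" and p: "p \<in> \<Omega>" and pos: "\<eta> > 0" "r > 0"
  obtains N w where "w 0 = p" "w N = q" "\<And>i. i \<le> N \<Longrightarrow> w i \<in> \<Omega> \<and> dist x (w i) \<le> L * r \<and> \<eta> * r \<le> infdist (w i) (frontier \<Omega>)"
    "\<And>i. i < N \<Longrightarrow> dist (w i) (w (Suc i)) \<le> \<eta> * r / 2" "(\<Sum>i<N. dist (w i) (w (Suc i))) \<le> L * r"
proof -
  obtain N w where w: "w 0 = p" "w N = q" "\<And>i. i \<le> N \<Longrightarrow> dist x (w i) \<le> L * r \<and> \<eta> * r \<le> infdist (w i) (frontier \<Omega>)"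
    "\<And>i. i < N \<Longrightarrow> dist (w i) (w (Suc i)) \<le> \<eta> * r / 2" "(\<Sum>i<N. dist (w i) (w (Suc i))) \<le> L * r"
    using c unfolding chain_near_def by blast
  have "w i \<in> \<Omega>" if "i \<le> N" for i
    using that
  proof (induction i)
    case (Suc i)
    have "\<eta> * r > 0" using pos by simp
    then show ?case using Suc w(3)[of i] w(4)[of i] by (intro near_in_open[of "w i" \<Omega> "w (Suc i)"]) auto
  qed (use w p in simp)
  then show ?thesis using that w by blast
qed

text \<open>A variant of the Harnack chain condition: corkscrew points of one scale are joined by
  chains at that scale.\<close>

definition linkable :: "(real^'n) set \<Rightarrow> (real^'n) set \<Rightarrow> real \<Rightarrow> real \<Rightarrow> real \<Rightarrow> real \<Rightarrow> bool" where
  "linkable \<Omega> G R \<kappa> \<eta> L \<longleftrightarrow> (\<forall>x\<in>G. \<forall>r p q. 0 < r \<and> r \<le> R \<and> p \<in> \<Omega> \<and> q \<in> \<Omega> \<and> dist x p \<le> r \<and> dist x q \<le> r \<and>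
     \<kappa> * r \<le> infdist p (frontier \<Omega>) \<and> \<kappa> * r \<le> infdist q (frontier \<Omega>) \<longrightarrow> chain_near (frontier \<Omega>) x r \<eta> L p q)"

text \<open>The second average belongs to the scale \<open>r / 2\<close>, so that the steps at
  scales \<open>R / 2^k\<close> telescope. The 4 under the root, in place of 2, accounts for the
  smaller cube.\<close>

definition whitney_step :: "(real^'n) set \<Rightarrow> real \<Rightarrow> real \<Rightarrow> real \<Rightarrow> real^'n \<Rightarrow> real \<Rightarrow> real^'n \<Rightarrow> real^'n \<Rightarrow> bool" where
  "whitney_step \<Omega> \<kappa> \<eta> L x r p q \<longleftrightarrow>
     (\<forall>y\<in>unit_cube. p + (\<eta> * r) *\<^sub>R y \<in> whitney_part \<Omega> \<kappa> L x r) \<and>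
     (\<forall>f. C_order 1 f \<longrightarrow> integrable (lebesgue_on (whitney_part \<Omega> \<kappa> L x r)) (sq_grad f) \<longrightarrow>
        \<bar>cube_avg f p (\<eta> * r) - cube_avg f q (\<eta> * (r / 2))\<bar> \<le>
          L * r * sqrt ((4 / (\<eta> * r)) ^ CARD('n) * integral\<^sup>L (lebesgue_on (whitney_part \<Omega> \<kappa> L x r)) (sq_grad f)))"

definition whitney_chain :: "(real^'n) set \<Rightarrow> (real^'n) set \<Rightarrow> real \<Rightarrow> real \<Rightarrow> real \<Rightarrow> real \<Rightarrow> bool" where
  "whitney_chain \<Omega> G R \<kappa> \<eta> L \<longleftrightarrow>
     (\<forall>x\<in>G. \<exists>P. \<forall>k::nat. whitney_step \<Omega> \<kappa> \<eta> L x (R / 2^k) (P k) (P (Suc k)))"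

text \<open>Corkscrew points are chosen at all scales \<open>R / 2^k\<close>. The point of the next
  scale has clearance \<open>\<kappa>/2 * r\<close> at scale \<open>r\<close>, which is why linking
  is assumed for \<open>\<kappa>/2\<close>.\<close>

lemma whitney_chain_exists:
  fixes \<Omega> G :: "(real^'n) set"
  assumes \<Omega>: "open \<Omega>" and acc: "accessible \<Omega> G R \<kappa>" and link: "linkable \<Omega> G R (\<kappa>/2) \<eta> L"
    and pos: "R > 0" "\<kappa> > 0" "\<eta> > 0" "L > 0"
  shows "\<exists>\<kappa>' \<eta>' L'. \<kappa>' > 0 \<and> \<eta>' > 0 \<and> L' > 0 \<and> whitney_chain \<Omega> G R \<kappa>' \<eta>' L'"
proof -
  let ?D = "real CARD('n)"
  let ?d = "\<lambda>y. infdist y (frontier \<Omega>)"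
  have D: "?D \<ge> 1" by simp
  \<comment> \<open>The clearance \<open>m * r\<close> is available at both corkscrew points and at
    the vertices between them; a quarter of it remains after the segments and cubes have been
    added.\<close>
  define m where "m = min \<eta> (\<kappa>/2)"
  have m: "m > 0" "m \<le> \<eta>" "m \<le> \<kappa>/2" using pos by (auto simp: m_def)
  \<comment> \<open>Points of the unit cube have norm at most \<open>?D\<close>, so a cube of half
    side \<open>\<eta>' * r\<close> stays within \<open>m * r / 4\<close> of its centre.\<close>
  define \<eta>' where "\<eta>' = m / (4 * ?D)"
  have \<eta>': "\<eta>' > 0" "?D * \<eta>' = m / 4" using m by (auto simp: \<eta>'_def)
  define L' where "L' = L + 2 * \<eta> + m + 2"
  have L': "L' > 0" using pos m by (simp add: L'_def)
  have "whitney_chain \<Omega> G R (m/4) \<eta>' L'"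
    unfolding whitney_chain_def
  proof
    fix x assume x: "x \<in> G"
    have R: "0 < R / 2^k \<and> R / 2^k \<le> R" for k :: nat
    proof -
      have "R / 2^k \<le> R / 1" using pos by (intro divide_left_mono) auto
      then show ?thesis using pos by simp
    qed
    have "\<forall>k::nat. \<exists>p. p \<in> \<Omega> \<and> dist x p \<le> R / 2^k \<and> \<kappa> * (R / 2^k) \<le> ?d p"
      using acc x R unfolding accessible_def by blast
    from choice[OF this] obtain P where P: "\<And>k. P k \<in> \<Omega>" "\<And>k. dist x (P k) \<le> R / 2^k" "\<And>k. \<kappa> * (R / 2^k) \<le> ?d (P k)" by blast
    show "\<exists>P. \<forall>k. whitney_step \<Omega> (m/4) \<eta>' L' x (R / 2^k) (P k) (P (Suc k))"
    proof (intro exI[of _ P] allI)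
      fix k :: nat
      define r where "r = R / 2^k"
      have r: "r > 0" "r \<le> R" using R[of k] by (auto simp: r_def)
      have r2: "R / 2 ^ Suc k = r / 2" by (simp add: r_def)
      let ?S = "whitney_part \<Omega> (m/4) L' x r"
      have S: "?S \<in> sets lebesgue" by (rule whitney_part_sets[OF \<Omega>])
      have inS: "v + u \<in> ?S" if v: "v \<in> \<Omega>" "dist x v \<le> (L + 1) * r" "m * r \<le> ?d v" and u: "norm u \<le> 3/4 * (m * r)" for v u
      proof -
        have mr: "m * r > 0" using m r by simp
        then have "dist v (v + u) < ?d v" using u v by (simp add: dist_norm)
        then have "v + u \<in> \<Omega>" by (rule near_in_open[OF v(1)])
        moreover have "dist x (v + u) < L' * r"
        proof -
          have "dist x (v + u) \<le> dist x v + dist v (v + u)" by (rule dist_triangle)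
          also have "dist v (v + u) = norm u" by (simp add: dist_norm)
          also have "dist x v + norm u \<le> (L + 1) * r + m * r" using u v(2) mr by linarith
          also have "\<dots> < L' * r" using r mult_pos_pos[OF pos(3) r(1)] by (simp add: L'_def algebra_simps)
          finally show ?thesis .
        qed
        moreover have "?d v \<le> ?d (v + u) + dist v (v + u)" by (rule infdist_triangle)
        then have "m/4 * r \<le> ?d (v + u)" using u v(3) by (simp add: dist_norm)
        ultimately show ?thesis by (simp add: whitney_part_def)
      qed
      have cube: "norm ((c * (\<eta>' * r)) *\<^sub>R y) \<le> m * r / 4" if "y \<in> unit_cube" "0 \<le> c" "c \<le> 1" for c and y :: "real^'n"
      proof -
        have "norm ((c * (\<eta>' * r)) *\<^sub>R y) = c * (\<eta>' * r) * norm y" using that \<eta>' r by (simp add: abs_mult)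
        also have "\<dots> \<le> 1 * (\<eta>' * r) * ?D" using that \<eta>' r unit_cube_norm[OF that(1)] by (intro mult_mono) auto
        also have "\<dots> = (?D * \<eta>') * r" by simp
        finally show ?thesis by (simp add: \<eta>'(2))
      qed
      have Pk: "P k \<in> \<Omega>" "dist x (P k) \<le> r" "m * r \<le> ?d (P k)" "\<kappa>/2 * r \<le> ?d (P k)"
      proof -
        show "P k \<in> \<Omega>" "dist x (P k) \<le> r" using P by (auto simp: r_def)
        have "m * r \<le> \<kappa>/2 * r" "\<kappa>/2 * r \<le> \<kappa> * r" using m r pos by auto
        then show "m * r \<le> ?d (P k)" "\<kappa>/2 * r \<le> ?d (P k)" using P(3)[of k] by (auto simp: r_def[symmetric])
      qed
      have Pk': "P (Suc k) \<in> \<Omega>" "dist x (P (Suc k)) \<le> r" "m * r \<le> ?d (P (Suc k))" "\<kappa>/2 * r \<le> ?d (P (Suc k))"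
      proof -
        show "P (Suc k) \<in> \<Omega>" using P by auto
        show "dist x (P (Suc k)) \<le> r" using P(2)[of "Suc k"] r unfolding r2 by linarith
        have "m * r \<le> \<kappa>/2 * r" using m r by auto
        then show "m * r \<le> ?d (P (Suc k))" "\<kappa>/2 * r \<le> ?d (P (Suc k))" using P(3)[of "Suc k"] unfolding r2 by auto
      qed
      have rL: "r \<le> (L + 1) * r" using r pos by (simp add: algebra_simps)
      have cube_in: "P k + (\<eta>' * r) *\<^sub>R y \<in> ?S" if y: "y \<in> unit_cube" for y
      proof (rule inS[OF Pk(1) _ Pk(3)])
        show "dist x (P k) \<le> (L + 1) * r" using Pk(2) rL by linarith
        show "norm ((\<eta>' * r) *\<^sub>R y) \<le> 3/4 * (m * r)" using cube[OF y, of 1] mult_pos_pos[OF m(1) r(1)] by simp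
      qed
      show "whitney_step \<Omega> (m/4) \<eta>' L' x (R / 2^k) (P k) (P (Suc k))"
        unfolding whitney_step_def r_def[symmetric]
      proof (intro conjI ballI allI impI cube_in)
      fix f :: "real^'n \<Rightarrow> real" assume f: "C_order 1 f" and fi': "integrable (lebesgue_on ?S) (sq_grad f)"
      let ?E = "integral\<^sup>L (lebesgue_on ?S) (sq_grad f)"
      have E0: "?E \<ge> 0" by (intro integral_nonneg_AE) (simp add: sq_grad_nonneg)
      have "chain_near (frontier \<Omega>) x r \<eta> L (P k) (P (Suc k))"
        using link x r Pk(1,2,4) Pk'(1,2,4) unfolding linkable_def by blast
      then obtain N w where w: "w 0 = P k" "w N = P (Suc k)"
         "\<And>i. i \<le> N \<Longrightarrow> w i \<in> \<Omega> \<and> dist x (w i) \<le> L * r \<and> \<eta> * r \<le> ?d (w i)"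
         "\<And>i. i < N \<Longrightarrow> dist (w i) (w (Suc i)) \<le> \<eta> * r / 2" "(\<Sum>i<N. dist (w i) (w (Suc i))) \<le> L * r"
        by (rule chain_near_in_open[OF _ Pk(1) pos(3) r(1)]) (rule that)
      have lk: "linked ?S (\<eta>' * r) (\<Sum>i<N. dist (w i) (w (Suc i))) (w 0) (w N)"
      proof (rule linked_polygon[OF S])
        show "\<eta>' * r > 0" using \<eta>' r by simp
        fix i t and y :: "real^'n" assume i: "i < N" and t: "t \<in> {0..1::real}" and y: "y \<in> unit_cube"
        let ?v = "w i + t *\<^sub>R (w (Suc i) - w i)"
        have wi: "w i \<in> \<Omega>" "dist x (w i) \<le> L * r" "\<eta> * r \<le> ?d (w i)" using w(3)[of i] i by auto
        have nt: "norm (t *\<^sub>R (w (Suc i) - w i)) \<le> \<eta> * r / 2"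
        proof -
          have "norm (t *\<^sub>R (w (Suc i) - w i)) \<le> 1 * norm (w (Suc i) - w i)"
            unfolding norm_scaleR using t by (intro mult_right_mono) auto
          then show ?thesis using w(4)[OF i] by (simp add: dist_norm norm_minus_commute)
        qed
        have nu: "norm ((\<eta>' * r) *\<^sub>R y) \<le> m * r / 4" using cube[OF y, of 1] by simp
        let ?u = "t *\<^sub>R (w (Suc i) - w i) + (\<eta>' * r) *\<^sub>R y"
        have nn: "norm ?u \<le> \<eta> * r / 2 + m * r / 4" using norm_triangle_mono[OF nt nu] .
        have mr: "m * r \<le> \<eta> * r" "\<eta> * r > 0" "m * r > 0" using m r pos by auto
        have dwu: "dist (w i) (w i + ?u) \<le> \<eta> * r / 2 + m * r / 4"         proof -
          have "dist (w i) (w i + ?u) = norm ?u" by (metis add_diff_cancel_left' dist_norm dist_commute)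
          then show ?thesis using nn by simp
        qed
        then have "w i + ?u \<in> \<Omega>" using wi mr by (intro near_in_open[OF wi(1)]) linarith
        moreover have "dist x (w i + ?u) < L' * r"
        proof -
          have "dist x (w i + ?u) \<le> dist x (w i) + dist (w i) (w i + ?u)" by (rule dist_triangle)
          also have "\<dots> \<le> L * r + (\<eta> * r / 2 + m * r / 4)" using wi dwu by linarith
          also have "\<dots> < L' * r" using r mr by (simp add: L'_def algebra_simps)
          finally show ?thesis .
        qed
        moreover have "?d (w i) \<le> ?d (w i + ?u) + dist (w i) (w i + ?u)" by (rule infdist_triangle)
        then have "m/4 * r \<le> ?d (w i + ?u)" using wi(3) dwu mr by linarith
        ultimately have "w i + ?u \<in> ?S" by (simp add: whitney_part_def)
        then show "?v + (\<eta>' * r) *\<^sub>R y \<in> ?S" by (simp add: add.assoc)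
      qed
      have "linked ?S (\<eta>' * r) (L * r) (P k) (P (Suc k))"
        using linked_mono[OF lk w(5)] \<eta>' r w(1,2) by simp
      then have 1: "\<bar>cube_avg f (P (Suc k)) (\<eta>' * r) - cube_avg f (P k) (\<eta>' * r)\<bar> \<le> L * r * sqrt ((2 / (\<eta>' * r)) ^ CARD('n) * ?E)"
        using f fi' unfolding linked_def by blast
      \<comment> \<open>The polygon moves the cube at constant size; now it is shrunk in place to
        the size of the next scale.\<close>
      have 2: "\<bar>cube_avg f (P (Suc k)) (\<eta>' * r / 2) - cube_avg f (P (Suc k)) (\<eta>' * r)\<bar>
         \<le> (dist (P (Suc k)) (P (Suc k)) + ?D * \<bar>\<eta>' * r / 2 - \<eta>' * r\<bar>) * sqrt ((2 / (\<eta>' * r / 2)) ^ CARD('n) * ?E)"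
      proof (rule cube_avg_segment[OF f S fi'])
        show "\<eta>' * r / 2 > 0" "\<eta>' * r / 2 \<le> \<eta>' * r" "\<eta>' * r / 2 \<le> \<eta>' * r / 2" using \<eta>' r by auto
        fix t and y :: "real^'n" assume t: "t \<in> {0..1::real}" and y: "y \<in> unit_cube"
        have e: "\<eta>' * r + t * (\<eta>' * r / 2 - \<eta>' * r) = (1 - t/2) * (\<eta>' * r)" by (simp add: algebra_simps)
        have "norm (((1 - t/2) * (\<eta>' * r)) *\<^sub>R y) \<le> m * r / 4" by (rule cube[OF y]) (use t in auto)
        moreover have "m * r > 0" using m r by simp
        ultimately have "norm ((\<eta>' * r + t * (\<eta>' * r / 2 - \<eta>' * r)) *\<^sub>R y) \<le> 3/4 * (m * r)" unfolding e by linarith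
        moreover have "dist x (P (Suc k)) \<le> (L + 1) * r" using Pk'(2) rL by linarith
        ultimately have "P (Suc k) + (\<eta>' * r + t * (\<eta>' * r / 2 - \<eta>' * r)) *\<^sub>R y \<in> ?S"
          using inS[OF Pk'(1) _ Pk'(3)] by blast
        then show "(P (Suc k) + t *\<^sub>R (P (Suc k) - P (Suc k))) + (\<eta>' * r + t * (\<eta>' * r / 2 - \<eta>' * r)) *\<^sub>R y \<in> ?S" by simp
      qed
      let ?B = "sqrt ((4 / (\<eta>' * r)) ^ CARD('n) * ?E)"
      have B: "?B \<ge> 0" using E0 \<eta>' r by simp
      have sB: "sqrt ((2 / (\<eta>' * r)) ^ CARD('n) * ?E) \<le> ?B"
        using E0 \<eta>' r by (intro real_sqrt_le_mono mult_right_mono power_mono divide_right_mono) auto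
      have "L * r * sqrt ((2 / (\<eta>' * r)) ^ CARD('n) * ?E) \<le> L * r * ?B"
        using sB pos r by (intro mult_left_mono) auto
      moreover have "\<bar>cube_avg f (P (Suc k)) (\<eta>' * r / 2) - cube_avg f (P (Suc k)) (\<eta>' * r)\<bar> \<le> m * r / 8 * ?B"
      proof -
        have e1: "2 / (\<eta>' * r / 2) = 4 / (\<eta>' * r)" by simp
        have e2: "\<bar>\<eta>' * r / 2 - \<eta>' * r\<bar> = \<eta>' * r / 2" using mult_pos_pos[OF \<eta>'(1) r(1)] by linarith
        have "?D * (\<eta>' * r / 2) = (?D * \<eta>') * r / 2" by simp
        then have e3: "?D * (\<eta>' * r / 2) = m * r / 8" unfolding \<eta>'(2) by simp
        show ?thesis using 2 unfolding e1 e2 e3 dist_self add_0 .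
      qed
      ultimately have "\<bar>cube_avg f (P k) (\<eta>' * r) - cube_avg f (P (Suc k)) (\<eta>' * r / 2)\<bar> \<le> L * r * ?B + m * r / 8 * ?B"
        using 1 by linarith
      also have "\<dots> = (L + m / 8) * r * ?B" by (simp add: algebra_simps)
      also have "\<dots> \<le> L' * r * ?B" using B r m pos by (intro mult_right_mono) (auto simp: L'_def)
      finally show "\<bar>cube_avg f (P k) (\<eta>' * r) - cube_avg f (P (Suc k)) (\<eta>' * (r / 2))\<bar> \<le>
          L' * r * sqrt ((4 / (\<eta>' * r)) ^ CARD('n) * ?E)" by simp
      qed
    qed
  qed
  then show ?thesis using m \<eta>' L' by (intro exI[of _ "m/4"] exI[of _ \<eta>'] exI[of _ L']) auto
qed

section \<open>Lower bounds on the coefficients\<close>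

text \<open>Were all differences below these bounds, their sum would be at most
  \<open>H / 2\<close>, whatever \<open>m\<close> is. Independence of \<open>m\<close> matters
  because the number of scales will depend on the test function.\<close>

lemma geometric_step:
  fixes a :: "nat \<Rightarrow> real"
  assumes a: "H \<le> \<bar>a 0\<bar>" "a m = 0" and H: "H > 0" and q: "0 < q" "q < 1"
  shows "\<exists>j<m. (1 - q) * (H / 2) * q ^ j < \<bar>a j - a (Suc j)\<bar>"
proof (rule ccontr)
  assume "\<not> ?thesis"
  then have le: "\<bar>a j - a (Suc j)\<bar> \<le> (1 - q) * (H / 2) * q ^ j" if "j < m" for j using that by (meson not_le)
  have "a 0 = (\<Sum>j<m. a j - a (Suc j))" using sum_lessThan_telescope'[of a m] a by simp
  then have "\<bar>a 0\<bar> \<le> (\<Sum>j<m. \<bar>a j - a (Suc j)\<bar>)" by simp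
  also have "\<dots> \<le> (\<Sum>j<m. (1 - q) * (H / 2) * q ^ j)" using le by (intro sum_mono) auto
  also have "\<dots> = (H / 2) * ((1 - q) * (\<Sum>j<m. q ^ j))" by (simp add: sum_distrib_left mult_ac)
  also have "(1 - q) * (\<Sum>j<m. q ^ j) = 1 - q ^ m" by (simp add: one_diff_power_eq)
  also have "(H / 2) * (1 - q ^ m) \<le> H / 2 * 1" using H q by (intro mult_left_mono) auto
  finally show False using a H by simp
qed

text \<open>Vitali's lemma selects disjoint balls whose fivefold enlargements cover
  \<open>F \<inter> ball z R0\<close>. Disjointness bounds the sum of
  \<open>c2 * \<rho> i powr s\<close> by \<open>E\<close>, and the covering bounds the mass of this
  part of \<open>F\<close> by a multiple of the same sum.\<close>

lemma ahlfors_energy_bound: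
  fixes F \<Omega> :: "(real^'n) set" and e :: "real^'n \<Rightarrow> real"
  assumes A: "ahlfors_bounds \<mu> F z R0 c s" and z: "z \<in> F" and c': "R0 > 0" "s > 0"
    and e: "\<Omega> \<in> sets lebesgue" "integrable (lebesgue_on \<Omega>) e" "AE x in lebesgue_on \<Omega>. 0 \<le> e x" "integral\<^sup>L (lebesgue_on \<Omega>) e \<le> E"
    and \<rho>: "\<And>x. x \<in> F \<inter> ball z R0 \<Longrightarrow> rmin \<le> \<rho> x \<and> 5 * \<rho> x < 2 * R0" "rmin > 0"
    and low: "\<And>x. x \<in> F \<inter> ball z R0 \<Longrightarrow> c2 * \<rho> x powr s \<le> integral\<^sup>L (lebesgue_on (\<Omega> \<inter> ball x (\<rho> x))) e" and c2: "c2 > 0"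
  shows "inverse c * R0 powr s \<le> c * 5 powr s * (E / c2)"
proof -
  note \<mu> = ahlfors_boundsD(1)[OF A] and reg = ahlfors_boundsD(3)[OF A] and c = ahlfors_boundsD(2)[OF A] c'
  let ?K = "F \<inter> ball z R0"
  have \<rho>p: "0 < \<rho> x \<and> \<rho> x \<le> R0" if "x \<in> ?K" for x using \<rho>(1)[OF that] \<rho>(2) by linarith
  obtain T where T: "countable T" "T \<subseteq> ?K" "pairwise (\<lambda>i j. disjnt (ball i (\<rho> i)) (ball j (\<rho> j))) T"
     "?K \<subseteq> (\<Union>i\<in>T. ball i (5 * \<rho> i))"
  proof (rule Vitali_covering_lemma_balls[where S = ?K and K = ?K and a = "\<lambda>x. x" and r = \<rho> and B = R0])
    show "?K \<subseteq> (\<Union>i\<in>?K. ball i (\<rho> i))" using \<rho>p by force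
    show "0 < \<rho> i \<and> \<rho> i \<le> R0" if "i \<in> ?K" for i by (rule \<rho>p[OF that])
  qed auto
  have fin_sum: "(\<Sum>i\<in>U. c2 * \<rho> i powr s) \<le> E" if U: "finite U" "U \<subseteq> T" for U
  proof -
    have sb: "\<Omega> \<inter> ball i (\<rho> i) \<in> sets lebesgue" for i using e by (intro sets.Int) auto
    have ie: "integrable (lebesgue_on (\<Omega> \<inter> ball i (\<rho> i))) e" for i
      by (rule lebesgue_on_integrable_subset[OF e(2) _ sb e(1)]) auto
    have ii: "integrable lebesgue (\<lambda>x. indicator (\<Omega> \<inter> ball i (\<rho> i)) x * e x)" for i
      using ie[of i] by (simp add: lebesgue_on_integrable_iff[OF sb])
    have iO: "integrable lebesgue (\<lambda>x. indicator \<Omega> x * e x)" using e by (simp add: lebesgue_on_integrable_iff)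
    have "(\<Sum>i\<in>U. c2 * \<rho> i powr s) \<le> (\<Sum>i\<in>U. \<integral>x. indicator (\<Omega> \<inter> ball i (\<rho> i)) x * e x \<partial>lebesgue)"
    proof (rule sum_mono)
      fix i assume "i \<in> U"
      then have "i \<in> ?K" using U T by blast
      then show "c2 * \<rho> i powr s \<le> (\<integral>x. indicator (\<Omega> \<inter> ball i (\<rho> i)) x * e x \<partial>lebesgue)"
        using low[of i] by (simp add: lebesgue_on_integral[OF sb])
    qed
    also have "\<dots> = (\<integral>x. (\<Sum>i\<in>U. indicator (\<Omega> \<inter> ball i (\<rho> i)) x * e x) \<partial>lebesgue)"
      using ii by simp
    also have "\<dots> \<le> (\<integral>x. indicator \<Omega> x * e x \<partial>lebesgue)"
    proof (rule integral_mono_AE[OF _ iO])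
      show "integrable lebesgue (\<lambda>x. \<Sum>i\<in>U. indicator (\<Omega> \<inter> ball i (\<rho> i)) x * e x)" using ii by simp
      have "AE x in lebesgue. x \<in> \<Omega> \<longrightarrow> 0 \<le> e x" using e by (simp add: AE_restrict_space_iff)
      then show "AE x in lebesgue. (\<Sum>i\<in>U. indicator (\<Omega> \<inter> ball i (\<rho> i)) x * e x) \<le> indicator \<Omega> x * e x"
      proof eventually_elim
        case (elim x)
        show ?case
        proof (cases "x \<in> \<Omega> \<and> (\<exists>i\<in>U. x \<in> ball i (\<rho> i))")
          case True
          then obtain i where i: "i \<in> U" "x \<in> ball i (\<rho> i)" by blast
          have "x \<notin> ball j (\<rho> j)" if "j \<in> U - {i}" for j
            using T(3) U(2) i that unfolding pairwise_def disjnt_def by blast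
          then have "(\<Sum>j\<in>U. indicator (\<Omega> \<inter> ball j (\<rho> j)) x * e x) = indicator (\<Omega> \<inter> ball i (\<rho> i)) x * e x"
            by (simp add: sum.remove[OF U(1) i(1)])
          then show ?thesis using True i by simp
        next
          case False
          then have "(\<Sum>j\<in>U. indicator (\<Omega> \<inter> ball j (\<rho> j)) x * e x) = 0" by (intro sum.neutral) auto
          moreover have "0 \<le> indicator \<Omega> x * e x" using elim by (auto simp: indicator_def)
          ultimately show ?thesis by linarith
        qed
      qed
    qed
    also have "\<dots> \<le> E" using e by (simp add: lebesgue_on_integral)
    finally show ?thesis .
  qed
  \<comment> \<open>Each selected ball carries energy at least \<open>c2 * rmin powr s\<close>,
    which limits their number in terms of \<open>E\<close>.\<close>
  have finT: "finite T"
  proof (rule ccontr)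
    assume inf: "infinite T"
    obtain N where N: "E / (c2 * rmin powr s) < real N" using reals_Archimedean2 by blast
    obtain U where U: "finite U" "U \<subseteq> T" "card U = N" using infinite_arbitrarily_large[OF inf] by blast
    have "real N * (c2 * rmin powr s) = (\<Sum>i\<in>U. c2 * rmin powr s)" using U by simp
    also have "\<dots> \<le> (\<Sum>i\<in>U. c2 * \<rho> i powr s)"
    proof (rule sum_mono)
      fix i assume "i \<in> U"
      then have "i \<in> ?K" using U T by blast
      then have "rmin \<le> \<rho> i" using \<rho>(1)[of i] by blast
      then show "c2 * rmin powr s \<le> c2 * \<rho> i powr s" using c2 c \<rho>(2) by (intro mult_left_mono powr_mono2) auto
    qed
    also have "\<dots> \<le> E" by (rule fin_sum[OF U(1,2)])
    finally have "real N * (c2 * rmin powr s) \<le> E" .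
    moreover have "c2 * rmin powr s > 0" using c2 \<rho>(2) by simp
    ultimately show False using N by (simp add: field_simps)
  qed
  have meas: "?K \<inter> ball p u \<in> sets \<mu>" for p u
    unfolding \<mu> sets_restrict_space by (auto intro!: image_eqI[of _ _ "ball z R0 \<inter> ball p u"])
  have S0: "0 \<le> (\<Sum>i\<in>T. c * (5 * \<rho> i) powr s)" using c by (intro sum_nonneg) auto
  have "ennreal (inverse c * R0 powr s) \<le> emeasure \<mu> (?K \<inter> ball z R0)"
    using reg[of z R0] z c by auto
  also have "\<dots> \<le> emeasure \<mu> (\<Union>i\<in>T. ?K \<inter> ball i (5 * \<rho> i))"
  proof (rule emeasure_mono)
    show "?K \<inter> ball z R0 \<subseteq> (\<Union>i\<in>T. ?K \<inter> ball i (5 * \<rho> i))" using T(4) by blast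
    show "(\<Union>i\<in>T. ?K \<inter> ball i (5 * \<rho> i)) \<in> sets \<mu>" by (intro sets.finite_UN finT meas)
  qed
  also have "\<dots> \<le> (\<Sum>i\<in>T. emeasure \<mu> (?K \<inter> ball i (5 * \<rho> i)))"
    by (rule emeasure_subadditive_finite[OF finT]) (use meas in auto)
  also have "\<dots> \<le> (\<Sum>i\<in>T. ennreal (c * (5 * \<rho> i) powr s))"
    using reg \<rho>p \<rho>(1) T(2) by (intro sum_mono) (meson subsetD mult_pos_pos zero_less_numeral)
  also have "\<dots> = ennreal (\<Sum>i\<in>T. c * (5 * \<rho> i) powr s)" using c by (intro sum_ennreal) auto
  finally have "inverse c * R0 powr s \<le> (\<Sum>i\<in>T. c * (5 * \<rho> i) powr s)"
    using S0 by (simp add: ennreal_le_iff)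
  also have "\<dots> = (\<Sum>i\<in>T. c * 5 powr s / c2 * (c2 * \<rho> i powr s))"
  proof (rule sum.cong[OF refl])
    fix i assume "i \<in> T"
    then have "0 < \<rho> i" using \<rho>p T(2) by blast
    then show "c * (5 * \<rho> i) powr s = c * 5 powr s / c2 * (c2 * \<rho> i powr s)" using c2 by (simp add: powr_mult)
  qed
  also have "\<dots> = c * 5 powr s / c2 * (\<Sum>i\<in>T. c2 * \<rho> i powr s)" by (simp add: sum_distrib_left)
  also have "\<dots> \<le> c * 5 powr s / c2 * E" using fin_sum[OF finT] c c2 by (intro mult_left_mono) auto
  finally show ?thesis by simp
qed

lemma test_function_vanishes_near_frontier:
  assumes "f \<in> test_functions \<Omega>" "open \<Omega>" "frontier \<Omega> \<noteq> {}"
  obtains \<tau> where "\<tau> > 0" "\<And>y. infdist y (frontier \<Omega>) < \<tau> \<Longrightarrow> f y = 0"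
proof -
  note D = test_functionsD[OF assms(1)]
  have disj: "closure {x. f x \<noteq> 0} \<inter> frontier \<Omega> = {}" using D(3) assms(2) by (auto simp: frontier_def interior_open)
  have "\<exists>d>0. \<forall>x\<in>closure {x. f x \<noteq> 0}. \<forall>y\<in>frontier \<Omega>. d \<le> dist x y"
    by (rule separate_compact_closed[OF D(2) frontier_closed disj])
  then obtain d where d: "d > 0" "\<And>x y. x \<in> closure {x. f x \<noteq> 0} \<Longrightarrow> y \<in> frontier \<Omega> \<Longrightarrow> d \<le> dist x y"
    by auto
  have "f y = 0" if y: "infdist y (frontier \<Omega>) < d" for y
  proof (rule ccontr)
    assume "f y \<noteq> 0"
    then have yc: "y \<in> closure {x. f x \<noteq> 0}" using closure_subset[of "{x. f x \<noteq> 0}"] by auto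
    obtain w where "w \<in> frontier \<Omega>" "dist y w < d" using infdist_lessE[OF y assms(3)] .
    then show False using d(2)[OF yc] by force
  qed
  with d(1) show ?thesis using that by blast
qed

lemma cube_avg_L2_diff:
  fixes f g :: "real^'n \<Rightarrow> real"
  assumes f: "continuous_on UNIV f" "continuous_on UNIV g" and S: "S \<in> sets lebesgue" "integrable (lebesgue_on S) (\<lambda>x. (f x - g x)\<^sup>2)"
    and \<rho>: "\<rho> > 0" and sub: "\<And>y. y \<in> unit_cube \<Longrightarrow> p + \<rho> *\<^sub>R y \<in> S"
  shows "\<bar>cube_avg f p \<rho> - cube_avg g p \<rho>\<bar> \<le> sqrt ((2/\<rho>) ^ CARD('n) * (\<integral>x. (f x - g x)\<^sup>2 \<partial>lebesgue_on S))"
proof -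
  let ?M = "lebesgue_on (unit_cube :: (real^'n) set)"
  let ?h = "\<lambda>y. f (p + \<rho> *\<^sub>R y) - g (p + \<rho> *\<^sub>R y)"
  have cf: "continuous_on UNIV (\<lambda>y. f (p + \<rho> *\<^sub>R y))" "continuous_on UNIV (\<lambda>y. g (p + \<rho> *\<^sub>R y))"
    by (intro continuous_on_compose2[OF f(1)] continuous_on_compose2[OF f(2)] continuous_intros; simp)+
  have s1: "sq_int ?M ?h" by (rule sq_int_continuous_compact[OF continuous_on_diff[OF cf] compact_cbox])
  have s2: "sq_int ?M (\<lambda>y. 1)" by (rule sq_int_continuous_compact[OF continuous_on_const compact_cbox])
  have "cube_avg f p \<rho> - cube_avg g p \<rho> = (\<integral>y. ?h y * 1 \<partial>?M)"
    unfolding cube_avg_def using cube_integral_eq[OF cf(1)] cube_integral_eq[OF cf(2)] by simp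
  moreover have "(\<integral>y. ?h y * 1 \<partial>?M)\<^sup>2 \<le> (2/\<rho>) ^ CARD('n) * (\<integral>x. (f x - g x)\<^sup>2 \<partial>lebesgue_on S)"
  proof -
    have "(\<integral>y. ?h y * 1 \<partial>?M)\<^sup>2 \<le> (\<integral>y. (?h y)\<^sup>2 \<partial>?M) * (\<integral>y. 1\<^sup>2 \<partial>?M)" by (rule Cauchy_Schwarz_integral[OF s1 s2])
    also have "(\<integral>y. (1::real)\<^sup>2 \<partial>?M) = 2 ^ CARD('n)"
      using content_unit_cube[where 'n='n] by (simp add: measure_restrict_space space_restrict_space)
    also have "(\<integral>y. (?h y)\<^sup>2 \<partial>?M) \<le> (1/\<rho>) ^ CARD('n) * (\<integral>x. (f x - g x)\<^sup>2 \<partial>lebesgue_on S)"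
    proof (rule cube_scaled_integral_le[OF _ _ S \<rho> sub])
      show "(\<lambda>x. (f x - g x)\<^sup>2) \<in> borel_measurable borel"
        by (intro borel_measurable_continuous_onI continuous_intros f)
    qed auto
    finally show ?thesis by (simp add: power_divide mult_right_mono mult_ac)
  qed
  ultimately show ?thesis by (simp add: real_le_rsqrt abs_le_square_iff real_sqrt_abs[symmetric] del: real_sqrt_abs)
qed

lemma cube_avg_ge:
  fixes f :: "real^'n \<Rightarrow> real"
  assumes f: "continuous_on UNIV f" and le: "\<And>y. y \<in> unit_cube \<Longrightarrow> c \<le> f (p + \<rho> *\<^sub>R y)"
  shows "c * 2 ^ CARD('n) \<le> cube_avg f p \<rho>"
proof -
  let ?M = "lebesgue_on (unit_cube :: (real^'n) set)"
  have cf: "continuous_on UNIV (\<lambda>y. f (p + \<rho> *\<^sub>R y))"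
    by (intro continuous_on_compose2[OF f] continuous_intros; simp)
  have "c * 2 ^ CARD('n) = (\<integral>y. c \<partial>?M)"
    using content_unit_cube[where 'n='n] by (simp add: measure_restrict_space space_restrict_space)
  also have "\<dots> \<le> (\<integral>y. f (p + \<rho> *\<^sub>R y) \<partial>?M)"
    by (rule integral_mono) (use cube_integral_eq(2)[OF cf] cube_integral_eq(2)[OF continuous_on_const, of c] le in \<open>auto simp: space_restrict_space\<close>)
  also have "\<dots> = cube_avg f p \<rho>" unfolding cube_avg_def using cube_integral_eq[OF cf] by simp
  finally show ?thesis .
qed

context coefficients begin

lemma form_approx_energy_bounded:
  assumes "form_approx \<Omega> (form_0 \<Omega> C) u \<phi>"
  obtains N E where "E > 0" "\<And>n. n \<ge> N \<Longrightarrow> energy (grad (u n)) \<le> E"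
proof -
  have u: "u n \<in> test_functions \<Omega>" for n using assms by (auto simp: form_approx_def form_0_dom[symmetric])
  obtain N where N: "\<And>n p. n \<ge> N \<Longrightarrow> p \<ge> N \<Longrightarrow> the (form_0 \<Omega> C (\<lambda>x. u n x - u p x)) < 1"
    using assms unfolding form_approx_def by (metis zero_less_one)
  let ?I = "\<lambda>n. energy (grad (u n))"
  have m: "partial_deriv k (u n) \<in> borel_measurable L\<Omega>" for n k using form_fn_measurable[OF test_form_fn[OF u]] .
  have i: "finite_energy (grad (u n))" for n using test_form_fn[OF u, of n] by (simp add: form_fn_def)
  show ?thesis
  proof
    have "?I N \<ge> 0" by (intro integral_nonneg_AE energy_nonneg)
    then show "2 * ?I N + 2 > 0" by linarith
    fix n assume n: "n \<ge> N"
    have d: "finite_energy (\<lambda>k x. partial_deriv k (u n) x - partial_deriv k (u N) x)"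
      by (rule energy_diff(1)[OF m i m i])
    have "?I n = energy (\<lambda>k x. partial_deriv k (u N) x + (partial_deriv k (u n) x - partial_deriv k (u N) x))"
      by simp
    also have "\<dots> \<le> 2 * ?I N + 2 * energy (\<lambda>k x. partial_deriv k (u n) x - partial_deriv k (u N) x)"
      by (rule energy_add(2)[OF m i _ d]) (use m in auto)
    also have "energy (\<lambda>k x. partial_deriv k (u n) x - partial_deriv k (u N) x) < 1"
      using N[OF n order_refl] by (simp add: form_0_test_diff[OF u u])
    finally show "?I n \<le> 2 * ?I N + 2" by simp
  qed
qed

text \<open>On the Whitney part the distance to the frontier is at least
  \<open>\<kappa> * r\<close>, so by \<open>\<delta> \<ge> 0\<close> the degenerate bound becomes
  the uniform ellipticity constant \<open>b * (\<kappa> * r) powr \<delta>\<close>.\<close>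

lemma whitney_energy_lower:
  assumes low: "AE x in L\<Omega>. x \<in> ball z \<rho>2 \<longrightarrow> mat_le (mat (b * infdist x (frontier \<Omega>) powr \<delta>)) (C x)"
    and b: "b > 0" "\<delta> \<ge> 0" "\<kappa> > 0" "r > 0" and sub: "ball x (L * r) \<subseteq> ball z \<rho>2" and f: "f \<in> test_functions \<Omega>"
  defines "W \<equiv> whitney_part \<Omega> \<kappa> L x r"
  shows "integrable (lebesgue_on W) (sq_grad f)"
    "b * (\<kappa> * r) powr \<delta> * integral\<^sup>L (lebesgue_on W) (sq_grad f) \<le>
      integral\<^sup>L (lebesgue_on (\<Omega> \<inter> ball x (L * r))) (energy_density C (grad f))"
proof -
  let ?e = "energy_density C (grad f)"
  have Ws: "W \<in> sets lebesgue" unfolding W_def by (rule whitney_part_sets[OF open_\<Omega>])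
  have W\<Omega>: "W \<subseteq> \<Omega>" and Wb: "W \<subseteq> \<Omega> \<inter> ball x (L * r)" by (auto simp: W_def whitney_part_def)
  have Bs: "\<Omega> \<inter> ball x (L * r) \<in> sets lebesgue" by (intro sets.Int) auto
  have "integrable L\<Omega> (sq_grad f)"
    unfolding sq_grad_def[abs_def] using test_sq_int[OF test_functions_partial[OF f]] by (simp add: sq_int_def)
  then show gi: "integrable (lebesgue_on W) (sq_grad f)"
    by (rule lebesgue_on_integrable_subset[OF _ W\<Omega> Ws sets_\<Omega>])
  have ei: "integrable L\<Omega> ?e" using test_form_fn[OF f] by (simp add: form_fn_def)
  have eB: "integrable (lebesgue_on (\<Omega> \<inter> ball x (L * r))) ?e"
    by (rule lebesgue_on_integrable_subset[OF ei _ Bs sets_\<Omega>]) auto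
  have eW: "integrable (lebesgue_on W) ?e" by (rule lebesgue_on_integrable_subset[OF ei W\<Omega> Ws sets_\<Omega>])
  have nnB: "AE y in lebesgue_on (\<Omega> \<inter> ball x (L * r)). 0 \<le> ?e y"
  proof -
    have "AE y in lebesgue. y \<in> \<Omega> \<longrightarrow> 0 \<le> ?e y" using energy_nonneg[of "\<lambda>k. partial_deriv k f"] by (simp add: AE_restrict_space_iff)
    then have "AE y in lebesgue. y \<in> \<Omega> \<inter> ball x (L * r) \<longrightarrow> 0 \<le> ?e y" by eventually_elim auto
    then show ?thesis using Bs by (subst AE_restrict_space_iff) auto
  qed
  have "AE y in lebesgue. y \<in> \<Omega> \<longrightarrow> (y \<in> ball z \<rho>2 \<longrightarrow> mat_le (mat (b * infdist y (frontier \<Omega>) powr \<delta>)) (C y))"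
    using low by (simp add: AE_restrict_space_iff)
  then have "AE y in lebesgue. y \<in> W \<longrightarrow> b * (\<kappa> * r) powr \<delta> * sq_grad f y \<le> ?e y"
  proof eventually_elim
    case (elim y)
    show ?case
    proof
      assume y: "y \<in> W"
      let ?v = "\<chi> k. partial_deriv k f y"
      have "y \<in> \<Omega>" "y \<in> ball z \<rho>2" "\<kappa> * r \<le> infdist y (frontier \<Omega>)" using y sub by (auto simp: W_def whitney_part_def)
      then have "mat_le (mat (b * infdist y (frontier \<Omega>) powr \<delta>)) (C y)" using elim by blast
      then have "?v \<bullet> (mat (b * infdist y (frontier \<Omega>) powr \<delta>) *v ?v) \<le> ?v \<bullet> (C y *v ?v)"
        unfolding mat_le_def by blast
      then have 1: "b * infdist y (frontier \<Omega>) powr \<delta> * sq_grad f y \<le> ?e y"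
        by (simp add: mat_form_scaled_identity energy_density_mat_form mat_form_inner' sq_grad_def)
      have "(\<kappa> * r) powr \<delta> \<le> infdist y (frontier \<Omega>) powr \<delta>"
        using b \<open>\<kappa> * r \<le> infdist y (frontier \<Omega>)\<close> by (intro powr_mono2) auto
      then have "b * (\<kappa> * r) powr \<delta> * sq_grad f y \<le> b * infdist y (frontier \<Omega>) powr \<delta> * sq_grad f y"
        using b sq_grad_nonneg by (intro mult_right_mono mult_left_mono) auto
      with 1 show "b * (\<kappa> * r) powr \<delta> * sq_grad f y \<le> ?e y" by linarith
    qed
  qed
  then have le: "AE y in lebesgue_on W. b * (\<kappa> * r) powr \<delta> * sq_grad f y \<le> ?e y"
    using Ws by (simp add: AE_restrict_space_iff)
  have "b * (\<kappa> * r) powr \<delta> * integral\<^sup>L (lebesgue_on W) (sq_grad f) = (\<integral>y. b * (\<kappa> * r) powr \<delta> * sq_grad f y \<partial>lebesgue_on W)"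
    by simp
  also have "\<dots> \<le> integral\<^sup>L (lebesgue_on W) ?e" by (rule integral_mono_AE[OF _ eW le]) (use gi in simp)
  also have "\<dots> \<le> integral\<^sup>L (lebesgue_on (\<Omega> \<inter> ball x (L * r))) ?e"
    by (rule lebesgue_on_integral_mono_set[OF eB Wb Ws Bs nnB])
  finally show "b * (\<kappa> * r) powr \<delta> * integral\<^sup>L (lebesgue_on W) (sq_grad f) \<le>
      integral\<^sup>L (lebesgue_on (\<Omega> \<inter> ball x (L * r))) ?e" .
qed

text \<open>The order of choices matters: the starting scale \<open>k1\<close> depends only on
  constants and on the energy bound \<open>E\<close>; then \<open>n\<close> is taken so large that
  \<open>f = u n\<close> is close to the bump function at that scale; finally \<open>m\<close>
  depends on the support of \<open>f\<close>. The resulting bound does not involve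
  \<open>m\<close>.\<close>

lemma form_equality_exponent_bound:
  fixes F :: "(real^'n) set"
  assumes F: "F \<subseteq> frontier \<Omega>" "z \<in> F" "ahlfors_regular s F" "s > 0"
    and low: "AE x in L\<Omega>. x \<in> ball z \<rho>2 \<longrightarrow> mat_le (mat (b * infdist x (frontier \<Omega>) powr \<delta>)) (C x)"
    and b: "b > 0" "\<delta> \<ge> 0" "\<rho>2 > 0"
    and chain: "whitney_chain \<Omega> (F \<inter> ball z \<rho>1) R \<kappa> \<eta> L" and pos: "\<rho>1 > 0" "R > 0" "\<kappa> > 0" "\<eta> > 0" "L > 0"
    and DN: "form_D \<Omega> C = form_N \<Omega> C"
  shows "\<delta> \<ge> s - real CARD('n) + 2"
proof (rule ccontr)
  assume contra: "\<not> \<delta> \<ge> s - real CARD('n) + 2"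
  let ?n = "CARD('n)" and ?D = "real CARD('n)"
  \<comment> \<open>Half of the deficit in the exponent, since drops of the means enter the energy
    squared.\<close>
  define \<epsilon> where "\<epsilon> = (s - ?D + 2 - \<delta>) / 2"
  have \<epsilon>: "\<epsilon> > 0" using contra by (simp add: \<epsilon>_def)
  have frne: "frontier \<Omega> \<noteq> {}" using F by blast
  obtain \<phi> :: "real^'n \<Rightarrow> real" where \<phi>: "smooth_fn \<phi>" "\<And>x. \<phi> x \<ge> 0" "\<phi> z > 0" "\<And>x. \<phi> x \<noteq> 0 \<Longrightarrow> dist z x < 1"
    using smooth_bump_exists[of 1 z] by auto
  have \<phi>c: "continuous_on UNIV \<phi>" using smooth_fn_C_order[OF \<phi>(1), of 0] by simp
  have "bounded {x. \<phi> x \<noteq> 0}" by (rule bounded_subset[of "ball z 1"]) (use \<phi>(4) in auto)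
  from smooth_bounded_support_form_fn[OF \<phi>(1) this] have f\<phi>: "form_fn \<phi> (grad \<phi>)" .
  then have "form_D \<Omega> C \<phi> \<noteq> None" using form_fn_form_N DN by simp
  then obtain u where u: "form_approx \<Omega> (form_0 \<Omega> C) u \<phi>" by (auto simp: form_D_def form_closure_def split: if_splits)
  have ut: "u n \<in> test_functions \<Omega>" for n using u by (auto simp: form_approx_def form_0_dom[symmetric])
  have ulim: "(\<lambda>n. \<integral>x. (u n x - \<phi> x)\<^sup>2 \<partial>L\<Omega>) \<longlonglongrightarrow> 0" using u by (simp add: form_approx_def)
  obtain N0 E where E: "E > 0" "\<And>n. n \<ge> N0 \<Longrightarrow> energy (grad (u n)) \<le> E"
    using form_approx_energy_bounded[OF u] by blast
  define c0 where "c0 = \<phi> z / 2"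
  have c0: "c0 > 0" using \<phi> by (simp add: c0_def)
  have "open {x. c0 < \<phi> x}" by (intro open_Collect_less \<phi>c continuous_intros)
  moreover have "z \<in> {x. c0 < \<phi> x}" using \<phi>(3) by (simp add: c0_def)
  ultimately obtain \<rho>3 where \<rho>3: "\<rho>3 > 0" "ball z \<rho>3 \<subseteq> {x. c0 < \<phi> x}" using open_contains_ball by blast
  \<comment> \<open>For points of \<open>ball z \<rho>4\<close> chains exist, and
    \<open>ball z (2 * \<rho>4)\<close>, which will contain all the cubes, lies where the
    coefficients are bounded below and where the bump function exceeds \<open>c0\<close>.\<close>
  define \<rho>4 where "\<rho>4 = min \<rho>1 (min (\<rho>2/2) (\<rho>3/2))"
  have \<rho>4: "\<rho>4 > 0" "\<rho>4 \<le> \<rho>1" "2 * \<rho>4 \<le> \<rho>2" "2 * \<rho>4 \<le> \<rho>3" using pos b \<rho>3 by (auto simp: \<rho>4_def)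
  obtain \<mu> c where A\<mu>: "ahlfors_bounds \<mu> F z \<rho>4 c s" using ahlfors_regular_bounds[OF F(3,2) \<rho>4(1)] .
  note c = ahlfors_boundsD(2)[OF A\<mu>]
  \<comment> \<open>Halving the scale multiplies its power with exponent \<open>\<epsilon>\<close>
    by \<open>q\<close>, so the weights \<open>q ^ j\<close> of \<open>geometric_step\<close> are
    powers of the scale.\<close>
  define q where "q = 2 powr (- \<epsilon>)"
  have q: "0 < q" "q < 1" using \<epsilon> powr_less_mono[of "-\<epsilon>" 0 2] by (auto simp: q_def)
  \<comment> \<open>The unnormalised averages of the bump function are at least
    \<open>2 * H\<close>; an error of at most \<open>H\<close> is allowed for
    \<open>f\<close>.\<close>
  define H where "H = c0 * 2 ^ ?n / 2"
  have H: "H > 0" using c0 by (simp add: H_def)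
  define A where "A = (1 - q) * (H / 2)"
  have A: "A > 0" using q H by (simp add: A_def)
  define c1 where "c1 = b * \<kappa> powr \<delta> * A\<^sup>2 / L\<^sup>2 * (\<eta> / 4) ^ ?n"
  have c1: "c1 > 0" using b pos A by (simp add: c1_def)
  define r where "r k = R / 2 ^ k" for k :: nat
  have r0: "r k > 0" for k using pos by (simp add: r_def)
  have "(\<lambda>k. R * (1/2) ^ k) \<longlonglongrightarrow> R * 0" by (intro tendsto_intros LIMSEQ_power_zero) auto
  then have rlim: "r \<longlonglongrightarrow> 0" by (simp add: r_def[abs_def] power_one_over)
  have rplim: "(\<lambda>k. r k powr (2 * \<epsilon>)) \<longlonglongrightarrow> 0 powr (2 * \<epsilon>)"
    using \<epsilon> by (intro tendsto_powr'[OF rlim tendsto_const]) (auto intro!: always_eventually less_imp_le r0)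
  define X where "X = c * 5 powr s * (E / (c1 * L powr (- s)))"
  have "(\<lambda>k. X * r k powr (2 * \<epsilon>)) \<longlonglongrightarrow> X * 0 powr (2 * \<epsilon>)" by (intro tendsto_intros rplim)
  then have ev1: "\<forall>\<^sub>F k in sequentially. X * r k powr (2 * \<epsilon>) < inverse c * \<rho>4 powr s"
    using c \<rho>4 by (intro order_tendstoD(2)[of _ 0]) auto
  have "(\<lambda>k. 5 * (L * r k)) \<longlonglongrightarrow> 5 * (L * 0)" by (intro tendsto_intros rlim)
  then have ev2: "\<forall>\<^sub>F k in sequentially. 5 * (L * r k) < 2 * \<rho>4" using \<rho>4 by (intro order_tendstoD(2)[of _ 0]) auto
  \<comment> \<open>The first condition is the contradiction aimed at. The second keeps all balls
    inside \<open>ball z (2 * \<rho>4)\<close> and makes their fivefold enlargements admissible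
    radii for Ahlfors regularity.\<close>
  obtain k1 where k1: "X * r k1 powr (2 * \<epsilon>) < inverse c * \<rho>4 powr s" "5 * (L * r k1) < 2 * \<rho>4"
    using eventually_conj[OF ev1 ev2] by (auto simp: eventually_sequentially)
  have Lr: "L * r k \<le> L * r k1" if "k1 \<le> k" for k
    unfolding r_def using pos that by (intro mult_left_mono divide_left_mono power_increasing) auto
  \<comment> \<open>Only the L2 distance on all of \<open>\<Omega>\<close> enters, so one
    \<open>n\<close> makes the averages at scale \<open>k1\<close> accurate for every
    \<open>x\<close> simultaneously.\<close>
  have "(\<lambda>n. (2 / (\<eta> * r k1)) ^ ?n * (\<integral>x. (u n x - \<phi> x)\<^sup>2 \<partial>L\<Omega>)) \<longlonglongrightarrow> (2 / (\<eta> * r k1)) ^ ?n * 0"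
    by (intro tendsto_intros ulim)
  then have "\<forall>\<^sub>F n in sequentially. (2 / (\<eta> * r k1)) ^ ?n * (\<integral>x. (u n x - \<phi> x)\<^sup>2 \<partial>L\<Omega>) < H\<^sup>2"
    using H by (intro order_tendstoD(2)[of _ 0]) auto
  from eventually_conj[OF this eventually_ge_at_top[of N0]]
  obtain n where n: "n \<ge> N0" "(2 / (\<eta> * r k1)) ^ ?n * (\<integral>x. (u n x - \<phi> x)\<^sup>2 \<partial>L\<Omega>) < H\<^sup>2"
    unfolding eventually_sequentially by blast
  define f where "f = u n"
  have f: "f \<in> test_functions \<Omega>" using ut by (simp add: f_def)
  note fD = test_functionsD[OF f]
  let ?e = "energy_density C (grad f)"
  obtain \<tau> where \<tau>: "\<tau> > 0" "\<And>y. infdist y (frontier \<Omega>) < \<tau> \<Longrightarrow> f y = 0"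
    using test_function_vanishes_near_frontier[OF f open_\<Omega> frne] by blast
  have "(\<lambda>k. L * r k) \<longlonglongrightarrow> L * 0" by (intro tendsto_intros rlim)
  then have "\<forall>\<^sub>F k in sequentially. L * r k < \<tau>" using \<tau> by (intro order_tendstoD(2)[of _ 0]) auto
  \<comment> \<open>At scale \<open>k1 + m\<close> the cubes lie within
    \<open>L * r (k1 + m) < \<tau>\<close> of a frontier point, where \<open>f\<close>
    vanishes.\<close>
  then obtain m where m: "L * r (k1 + m) < \<tau>" by (auto simp: eventually_sequentially) (metis le_add2)
  define c2 where "c2 = c1 * L powr (- s) * r k1 powr (- 2 * \<epsilon>)"
  have c2: "c2 > 0" unfolding c2_def using c1 pos r0[of k1] by (intro mult_pos_pos) auto
  \<comment> \<open>Along the chain from \<open>x\<close> the averages fall from at least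
    \<open>H\<close> in absolute value to 0, so \<open>geometric_step\<close> singles out a scale.
    The constant \<open>c2\<close> depends neither on \<open>x\<close> nor on
    \<open>m\<close>.\<close>
  have step: "\<exists>j<m. c2 * (L * r (k1 + j)) powr s \<le> integral\<^sup>L (lebesgue_on (\<Omega> \<inter> ball x (L * r (k1 + j)))) ?e"
    if x: "x \<in> F \<inter> ball z \<rho>4" for x
  proof -
    have x1: "x \<in> F \<inter> ball z \<rho>1" using x \<rho>4 by auto
    from chain[unfolded whitney_chain_def, rule_format, OF x1]
    obtain P where P: "\<And>k. whitney_step \<Omega> \<kappa> \<eta> L x (r k) (P k) (P (Suc k))" unfolding r_def by blast
    have r2: "r k / 2 = r (Suc k)" for k by (simp add: r_def)
    have Pc: "P k + (\<eta> * r k) *\<^sub>R y \<in> whitney_part \<Omega> \<kappa> L x (r k)" if "y \<in> unit_cube" for k y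
      using P[of k] that unfolding whitney_step_def by blast
    have Pd: "\<bar>cube_avg f (P k) (\<eta> * r k) - cube_avg f (P (Suc k)) (\<eta> * r (Suc k))\<bar> \<le>
          L * r k * sqrt ((4 / (\<eta> * r k)) ^ ?n * integral\<^sup>L (lebesgue_on (whitney_part \<Omega> \<kappa> L x (r k))) (sq_grad f))"
      if "integrable (lebesgue_on (whitney_part \<Omega> \<kappa> L x (r k))) (sq_grad f)" for k
      using P[of k] that fD(4) unfolding whitney_step_def r2 by blast
    have sub: "ball x (L * r k) \<subseteq> ball z (2 * \<rho>4)" if "k1 \<le> k" for k
    proof
      fix y assume "y \<in> ball x (L * r k)"
      then show "y \<in> ball z (2 * \<rho>4)" using dist_triangle[of z y x] x Lr[OF that] k1(2) \<rho>4(1) by auto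
    qed
    define a where "a j = cube_avg f (P (k1 + j)) (\<eta> * r (k1 + j))" for j
    have "H \<le> \<bar>a 0\<bar>"
    proof -
      have in_W: "P k1 + (\<eta> * r k1) *\<^sub>R y \<in> \<Omega>" "P k1 + (\<eta> * r k1) *\<^sub>R y \<in> ball x (L * r k1)" if "y \<in> unit_cube" for y
        using Pc[OF that, of k1] by (auto simp: whitney_part_def)
      have "c0 * 2 ^ ?n \<le> cube_avg \<phi> (P k1) (\<eta> * r k1)"
      proof (rule cube_avg_ge[OF \<phi>c])
        fix y :: "real^'n" assume "y \<in> unit_cube"
        then have "P k1 + (\<eta> * r k1) *\<^sub>R y \<in> ball z (2 * \<rho>4)" using in_W(2) sub[OF order_refl] by blast
        then have "P k1 + (\<eta> * r k1) *\<^sub>R y \<in> ball z \<rho>3" using \<rho>4(4) by auto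
        then show "c0 \<le> \<phi> (P k1 + (\<eta> * r k1) *\<^sub>R y)" using \<rho>3(2) by force
      qed
      moreover have "\<bar>cube_avg f (P k1) (\<eta> * r k1) - cube_avg \<phi> (P k1) (\<eta> * r k1)\<bar> \<le> H"
      proof -
        have "\<bar>cube_avg f (P k1) (\<eta> * r k1) - cube_avg \<phi> (P k1) (\<eta> * r k1)\<bar>
           \<le> sqrt ((2 / (\<eta> * r k1)) ^ ?n * (\<integral>x. (f x - \<phi> x)\<^sup>2 \<partial>L\<Omega>))"
        proof (rule cube_avg_L2_diff[OF fD(5) \<phi>c sets_\<Omega>])
          show "integrable L\<Omega> (\<lambda>x. (f x - \<phi> x)\<^sup>2)"
            using sq_int_diff[OF test_sq_int[OF f]] f\<phi> by (simp add: form_fn_def sq_int_def)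
          show "\<eta> * r k1 > 0" using pos r0 by simp
        qed (rule in_W)
        also have "\<dots> \<le> sqrt (H\<^sup>2)" using n(2) by (intro real_sqrt_le_mono) (simp add: f_def)
        finally show ?thesis using H by simp
      qed
      moreover have "c0 * 2 ^ ?n = 2 * H" "a 0 = cube_avg f (P k1) (\<eta> * r k1)" by (simp_all add: H_def a_def)
      ultimately show ?thesis by linarith
    qed
    moreover have "a m = 0"
    proof -
      have "f (P (k1 + m) + (\<eta> * r (k1 + m)) *\<^sub>R y) = 0" if y: "y \<in> unit_cube" for y
      proof (rule \<tau>(2))
        let ?w = "P (k1 + m) + (\<eta> * r (k1 + m)) *\<^sub>R y"
        have "x \<in> frontier \<Omega>" using x F by blast
        then have "infdist ?w (frontier \<Omega>) \<le> dist ?w x" by (rule infdist_le)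
        also have "\<dots> < L * r (k1 + m)" using Pc[OF y, of "k1 + m"] by (simp add: whitney_part_def dist_commute)
        finally show "infdist ?w (frontier \<Omega>) < \<tau>" using m by linarith
      qed
      then have "cube_avg f (P (k1 + m)) (\<eta> * r (k1 + m)) = integral unit_cube (\<lambda>y::real^'n. 0)"
        unfolding cube_avg_def by (intro integral_cong) auto
      then show ?thesis by (simp add: a_def)
    qed
    ultimately obtain j where j: "j < m" "A * q ^ j < \<bar>a j - a (Suc j)\<bar>"
      using geometric_step[of H a m q] H q unfolding A_def by blast
    define k where "k = k1 + j"
    have kk: "k1 \<le> k" by (simp add: k_def)
    let ?W = "whitney_part \<Omega> \<kappa> L x (r k)"
    let ?S = "integral\<^sup>L (lebesgue_on ?W) (sq_grad f)"
    let ?I = "integral\<^sup>L (lebesgue_on (\<Omega> \<inter> ball x (L * r k))) ?e"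
    have "ball x (L * r k) \<subseteq> ball z \<rho>2" using sub[OF kk] \<rho>4(3) by (meson subset_ball order_trans)
    from whitney_energy_lower[OF low b(1,2) pos(3) r0 this f]
    have gi: "integrable (lebesgue_on ?W) (sq_grad f)" and lo: "b * (\<kappa> * r k) powr \<delta> * ?S \<le> ?I" by auto
    have S0: "?S \<ge> 0" by (intro integral_nonneg_AE) (simp add: sq_grad_nonneg)
    let ?T = "(4 / (\<eta> * r k)) ^ ?n"
    have T0: "?T > 0" using pos r0[of k] by simp
    have "A * q ^ j < L * r k * sqrt (?T * ?S)"
      using j(2) Pd[OF gi] by (simp add: a_def k_def)
    then have "(A * q ^ j)\<^sup>2 \<le> (L * r k * sqrt (?T * ?S))\<^sup>2"
      using A q by (intro power_mono) auto
    then have "A\<^sup>2 * (q ^ j)\<^sup>2 \<le> (L\<^sup>2 * (r k)\<^sup>2 * ?T) * ?S"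
      using S0 T0 by (simp add: power_mult_distrib mult_ac)
    then have S_low: "A\<^sup>2 * (q ^ j)\<^sup>2 / (L\<^sup>2 * (r k)\<^sup>2 * ?T) \<le> ?S"
      using pos r0[of k] T0 by (subst pos_divide_le_eq) (auto simp: mult_ac)
    have qj: "(q ^ j)\<^sup>2 = r k powr (2 * \<epsilon>) * r k1 powr (- 2 * \<epsilon>)"
    proof -
      have "r k = r k1 * 2 powr (- real j)"
        by (simp add: r_def k_def power_add powr_minus powr_realpow divide_inverse)
      then have "r k powr (2 * \<epsilon>) = r k1 powr (2 * \<epsilon>) * (2 powr (- real j)) powr (2 * \<epsilon>)"
        using r0[of k1] by (simp add: powr_mult)
      also have "(2 powr (- real j)) powr (2 * \<epsilon>) = (q ^ j)\<^sup>2"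
        by (simp add: q_def powr_powr powr_realpow[symmetric] powr_power mult_ac power_mult[symmetric])
      finally show ?thesis using r0[of k1] by (simp add: powr_minus field_simps)
    qed
    have "c2 * (L * r k) powr s = b * (\<kappa> * r k) powr \<delta> * (A\<^sup>2 * (q ^ j)\<^sup>2 / (L\<^sup>2 * (r k)\<^sup>2 * ?T))"
    proof -
      have Tn: "1 / ?T = (\<eta> / 4) ^ ?n * r k powr ?D"
        using pos r0[of k] by (simp add: power_divide power_mult_distrib powr_realpow)
      have r2: "1 / (r k)\<^sup>2 = r k powr (-2)" using r0[of k] by (simp add: powr_minus divide_inverse)
      have "b * (\<kappa> * r k) powr \<delta> * (A\<^sup>2 * (q ^ j)\<^sup>2 / (L\<^sup>2 * (r k)\<^sup>2 * ?T))
         = b * (\<kappa> powr \<delta> * r k powr \<delta>) * (A\<^sup>2 * (r k powr (2 * \<epsilon>) * r k1 powr (- 2 * \<epsilon>)) / L\<^sup>2 * (1 / (r k)\<^sup>2) * (1 / ?T))"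
        using pos r0[of k] by (simp add: qj powr_mult)
      also have "\<dots> = c1 * r k1 powr (- 2 * \<epsilon>) * (r k powr \<delta> * r k powr (2 * \<epsilon>) * r k powr (-2) * r k powr ?D)"
        unfolding r2 Tn c1_def by simp
      \<comment> \<open>By choice of \<open>\<epsilon>\<close> the exponents add up to
        \<open>s\<close>, the power that \<open>ahlfors_energy_bound\<close> requires.\<close>
      also have "r k powr \<delta> * r k powr (2 * \<epsilon>) * r k powr (-2) * r k powr ?D = r k powr s"
        by (simp add: powr_add[symmetric] \<epsilon>_def field_simps)
      also have "c1 * r k1 powr (- 2 * \<epsilon>) * r k powr s = c2 * (L * r k) powr s"
        using pos r0[of k] by (simp add: c2_def powr_mult powr_minus)
      finally show ?thesis by simp
    qed
    also have "\<dots> \<le> b * (\<kappa> * r k) powr \<delta> * ?S" using S_low b by (intro mult_left_mono) auto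
    also have "\<dots> \<le> ?I" by (rule lo)
    finally show ?thesis using j(1) by (auto simp: k_def)
  qed
  then have "\<forall>x\<in>F \<inter> ball z \<rho>4. \<exists>j. j < m \<and> c2 * (L * r (k1 + j)) powr s \<le> integral\<^sup>L (lebesgue_on (\<Omega> \<inter> ball x (L * r (k1 + j)))) ?e"
    by blast
  from bchoice[OF this] obtain J where J: "\<And>x. x \<in> F \<inter> ball z \<rho>4 \<Longrightarrow> J x < m"
     "\<And>x. x \<in> F \<inter> ball z \<rho>4 \<Longrightarrow> c2 * (L * r (k1 + J x)) powr s \<le> integral\<^sup>L (lebesgue_on (\<Omega> \<inter> ball x (L * r (k1 + J x)))) ?e"
    by blast
  \<comment> \<open>The radius at \<open>x\<close> belongs to the scale found for \<open>x\<close>;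
    as \<open>J x < m\<close>, the scale \<open>k1 + m\<close> provides the common lower bound
    \<open>rmin\<close>.\<close>
  have "inverse c * \<rho>4 powr s \<le> c * 5 powr s * (E / c2)"
  proof (rule ahlfors_energy_bound[OF A\<mu> F(2) \<rho>4(1) F(4) sets_\<Omega>, where e = ?e and \<rho> = "\<lambda>x. L * r (k1 + J x)" and rmin = "L * r (k1 + m)"])
    show "integrable L\<Omega> ?e" using test_form_fn[OF f] by (simp add: form_fn_def)
    show "AE x in L\<Omega>. 0 \<le> ?e x" by (rule energy_nonneg)
    show "integral\<^sup>L L\<Omega> ?e \<le> E" using E(2)[OF n(1)] by (simp add: f_def)
    show "L * r (k1 + m) > 0" using pos r0 by simp
    show "L * r (k1 + m) \<le> L * r (k1 + J x) \<and> 5 * (L * r (k1 + J x)) < 2 * \<rho>4" if x: "x \<in> F \<inter> ball z \<rho>4" for x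
    proof
      show "L * r (k1 + m) \<le> L * r (k1 + J x)"
        unfolding r_def using pos J(1)[OF x] by (intro mult_left_mono divide_left_mono power_increasing) auto
      show "5 * (L * r (k1 + J x)) < 2 * \<rho>4" using Lr[of "k1 + J x"] k1(2) by linarith
    qed
  qed (use J c2 in auto)
  also have "\<dots> = X * r k1 powr (2 * \<epsilon>)"
    using r0[of k1] by (simp add: X_def c2_def powr_minus field_simps)
  also have "\<dots> < inverse c * \<rho>4 powr s" by (rule k1(1))
  finally show False by simp
qed

end

section \<open>Existence of Whitney chains\<close>

lemma small_power:
  fixes c e B m :: real
  assumes "e > 0" "c > 0" "B > 0" "m > 0"
  obtains \<eta> where "\<eta> > 0" "\<eta> \<le> m" "c * \<eta> powr e < B"
proof
  \<comment> \<open>Half of \<open>B / c\<close> is aimed at, to make the final inequality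
    strict.\<close>
  let ?\<eta> = "min m ((B / (2 * c)) powr (1 / e))"
  show pos: "?\<eta> > 0" using assms by simp
  show "?\<eta> \<le> m" by simp
  have "?\<eta> powr e \<le> ((B / (2 * c)) powr (1 / e)) powr e"
    using assms pos by (intro powr_mono2) auto
  also have "\<dots> = B / (2 * c)" using assms by (simp add: powr_powr)
  finally have "c * ?\<eta> powr e \<le> c * (B / (2 * c))" using assms by (intro mult_left_mono) auto
  also have "\<dots> < B" using assms by simp
  finally show "c * ?\<eta> powr e < B" .
qed

text \<open>Inside \<open>ball z \<rho>\<close> all of \<open>\<Gamma>\<close> belongs to
  \<open>F\<close>, and any point of \<open>\<Gamma>\<close> relevant to the layer is inside because
  \<open>\<rho>/8 + \<rho>/4 + \<rho>/4 < \<rho>\<close>.\<close>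

lemma boundary_layer_volume:
  fixes F \<Gamma> :: "(real^'n) set"
  assumes F: "ahlfors_regular s F" "z \<in> F" and \<Gamma>: "F \<subseteq> \<Gamma>" "\<Gamma> \<inter> ball z \<rho> \<subseteq> F" "\<rho> > 0"
  obtains c where "c > 0" "\<And>x r t. x \<in> F \<inter> ball z (\<rho>/8) \<Longrightarrow> 0 < t \<Longrightarrow> t \<le> r \<Longrightarrow> r \<le> \<rho>/4 \<Longrightarrow>
     measure lebesgue {y. dist x y < r \<and> infdist y \<Gamma> < t} \<le> c * t powr (real CARD('n) - s) * r powr s"
proof -
  obtain c where c: "c > 0" "\<And>x r t. x \<in> F \<Longrightarrow> 0 < t \<Longrightarrow> t \<le> r \<Longrightarrow> dist z x + 2 * r < 2 * \<rho> \<Longrightarrow>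
     measure lebesgue {y. dist x y < r \<and> infdist y F < t} \<le> c * t powr (real CARD('n) - s) * r powr s"
    using ahlfors_volume[OF F, of "2 * \<rho>"] \<Gamma>(3) by auto
  have "measure lebesgue {y. dist x y < r \<and> infdist y \<Gamma> < t} \<le> c * t powr (real CARD('n) - s) * r powr s"
    if x: "x \<in> F \<inter> ball z (\<rho>/8)" and t: "0 < t" "t \<le> r" "r \<le> \<rho>/4" for x r t
  proof -
    have "{y. dist x y < r \<and> infdist y \<Gamma> < t} \<subseteq> {y. dist x y < r \<and> infdist y F < t}"
    proof clarify
      fix y assume y: "dist x y < r" "infdist y \<Gamma> < t"
      have "\<Gamma> \<noteq> {}" using F(2) \<Gamma>(1) by blast
      from infdist_lessE[OF y(2) this] obtain w where w: "w \<in> \<Gamma>" "dist y w < t" .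
      have "dist z w \<le> dist z x + dist x y + dist y w" by (metis add.commute add_left_mono dist_triangle order_trans)
      then have "w \<in> ball z \<rho>" using x y w t by simp
      then have "w \<in> F" using w \<Gamma>(2) by blast
      then show "infdist y F < t" using infdist_le[of w F y] w(2) by linarith
    qed
    then have "measure lebesgue {y. dist x y < r \<and> infdist y \<Gamma> < t} \<le> measure lebesgue {y. dist x y < r \<and> infdist y F < t}"
    proof (rule measure_mono_fmeasurable)
      have op: "open {y. dist x y < r \<and> infdist y H < t}" for H
        by (intro open_Collect_conj open_Collect_less continuous_intros)
      then show "{y. dist x y < r \<and> infdist y \<Gamma> < t} \<in> sets lebesgue" by simp
      show "{y. dist x y < r \<and> infdist y F < t} \<in> lmeasurable"
        by (rule lmeasurable_open[OF bounded_subset[of "ball x r"] op]) auto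
    qed
    also have "\<dots> \<le> c * t powr (real CARD('n) - s) * r powr s"
      using c(2)[of x t r] x t by auto
    finally show ?thesis .
  qed
  with c(1) show ?thesis using that by blast
qed

text \<open>Were all of \<open>ball x r\<close> within \<open>\<kappa> * r\<close> of
  \<open>\<Gamma>\<close>, its volume would be at most
  \<open>c * \<kappa> powr (?D - s) * r ^ CARD('n)\<close>, which is too little for small
  \<open>\<kappa>\<close> because \<open>s < ?D\<close>.\<close>

lemma thin_boundary_porous:
  fixes F \<Gamma> :: "(real^'n) set"
  assumes F: "ahlfors_regular s F" "z \<in> F" and \<Gamma>: "F \<subseteq> \<Gamma>" "\<Gamma> \<inter> ball z \<rho> \<subseteq> F" "\<rho> > 0" and s: "s < real CARD('n)"
  obtains \<kappa> where "0 < \<kappa>" "\<kappa> \<le> 1" "\<And>x r. x \<in> F \<inter> ball z (\<rho>/8) \<Longrightarrow> 0 < r \<Longrightarrow> r \<le> \<rho>/4 \<Longrightarrow> \<exists>p. dist x p \<le> r \<and> \<kappa> * r \<le> infdist p \<Gamma>"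
proof -
  let ?D = "real CARD('n)"
  obtain c where c: "c > 0" "\<And>x r t. x \<in> F \<inter> ball z (\<rho>/8) \<Longrightarrow> 0 < t \<Longrightarrow> t \<le> r \<Longrightarrow> r \<le> \<rho>/4 \<Longrightarrow>
     measure lebesgue {y. dist x y < r \<and> infdist y \<Gamma> < t} \<le> c * t powr (?D - s) * r powr s"
    using boundary_layer_volume[OF F \<Gamma>] by blast
  define \<omega> where "\<omega> = unit_ball_vol ?D"
  have \<omega>: "\<omega> > 0" by (simp add: \<omega>_def)
  obtain \<kappa> where \<kappa>: "\<kappa> > 0" "\<kappa> \<le> 1" "c * \<kappa> powr (?D - s) < \<omega>"
    using small_power[of "?D - s" c \<omega> 1] s c \<omega> by auto
  have "\<exists>p. dist x p \<le> r \<and> \<kappa> * r \<le> infdist p \<Gamma>" if x: "x \<in> F \<inter> ball z (\<rho>/8)" and r: "0 < r" "r \<le> \<rho>/4" for x r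
  proof (rule ccontr)
    assume "\<not> ?thesis"
    then have "infdist y \<Gamma> < \<kappa> * r" if "dist x y < r" for y using that by (meson less_imp_le not_le)
    then have eq: "{y. dist x y < r \<and> infdist y \<Gamma> < \<kappa> * r} = ball x r" by auto
    have "\<kappa> * r > 0" "\<kappa> * r \<le> r" using \<kappa> r by (auto intro: mult_left_le_one_le)
    from c(2)[OF x this r(2)] have "measure lebesgue (ball x r) \<le> c * (\<kappa> * r) powr (?D - s) * r powr s" unfolding eq .
    also have "\<dots> = c * \<kappa> powr (?D - s) * (r powr (?D - s) * r powr s)" using \<kappa> r by (simp add: powr_mult)
    also have "r powr (?D - s) * r powr s = r ^ CARD('n)" using r by (simp add: powr_add[symmetric] powr_realpow)
    also have "c * \<kappa> powr (?D - s) * r ^ CARD('n) < \<omega> * r ^ CARD('n)" using \<kappa>(3) r by (intro mult_strict_right_mono) auto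
    also have "\<omega> * r ^ CARD('n) = measure lebesgue (ball x r)" using r by (simp add: content_ball \<omega>_def)
    finally show False by simp
  qed
  with \<kappa> show ?thesis using that by blast
qed

text \<open>Shifting the segment from \<open>p\<close> to \<open>q\<close> by a vector \<open>y\<close> except near its ends, the shifted
  points come close to \<open>\<Gamma>\<close> only for \<open>y\<close> in a union of \<open>O(1 / \<eta>)\<close> translates of a boundary layer, of
  total volume \<open>O(\<eta> powr (d - s - 1))\<close>. Hence some \<open>y\<close> works as soon as \<open>s < d - 1\<close>.\<close>

lemma thin_boundary_chain:
  fixes F \<Gamma> :: "(real^'n) set"
  assumes F: "ahlfors_regular s F" "z \<in> F" and \<Gamma>: "F \<subseteq> \<Gamma>" "\<Gamma> \<inter> ball z \<rho> \<subseteq> F" "\<rho> > 0"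
    and s: "s < real CARD('n) - 1" and \<kappa>: "0 < \<kappa>" "\<kappa> \<le> 1"
  obtains \<eta> where "\<eta> > 0" "\<And>x r p q. x \<in> F \<inter> ball z (\<rho>/8) \<Longrightarrow> 0 < r \<Longrightarrow> r \<le> \<rho>/16 \<Longrightarrow>
     dist x p \<le> r \<Longrightarrow> dist x q \<le> r \<Longrightarrow> \<kappa> * r \<le> infdist p \<Gamma> \<Longrightarrow> \<kappa> * r \<le> infdist q \<Gamma> \<Longrightarrow>
     chain_near \<Gamma> x r \<eta> 6 p q"
proof -
  let ?n = "CARD('n)" and ?D = "real CARD('n)"
  obtain c where c: "c > 0" "\<And>x r t. x \<in> F \<inter> ball z (\<rho>/8) \<Longrightarrow> 0 < t \<Longrightarrow> t \<le> r \<Longrightarrow> r \<le> \<rho>/4 \<Longrightarrow>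
     measure lebesgue {y. dist x y < r \<and> infdist y \<Gamma> < t} \<le> c * t powr (?D - s) * r powr s"
    using boundary_layer_volume[OF F \<Gamma>] by blast
  define \<omega> where "\<omega> = unit_ball_vol ?D"
  have \<omega>: "\<omega> > 0" by (simp add: \<omega>_def)
  \<comment> \<open>This keeps the bad sets \<open>T i\<close> from covering
    \<open>ball 0 (\<kappa> * r / 2)\<close>: there are at most \<open>14 / \<eta>\<close> of them,
    each of volume at most \<open>c * (\<eta> * r) powr (?D - s) * (4 * r) powr s\<close>.\<close>
  obtain \<eta> where \<eta>: "\<eta> > 0" "\<eta> \<le> \<kappa>/4" "14 * c * 4 powr s * \<eta> powr (?D - s - 1) < \<omega> * (\<kappa>/2) ^ ?n"
  proof (rule small_power[of "?D - s - 1" "14 * c * 4 powr s" "\<omega> * (\<kappa>/2) ^ ?n" "\<kappa>/4"])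
    show "\<omega> * (\<kappa>/2) ^ ?n > 0" using \<omega> \<kappa> by simp
  qed (use s c \<kappa> in auto)
  \<comment> \<open>Steps have length at most \<open>6 * r / N\<close>; this must not exceed the
    \<open>\<eta> * r / 2\<close> allowed by \<open>chain_near\<close>.\<close>
  define N where "N = nat \<lceil>12 / \<eta>\<rceil>"
  have \<eta>1: "\<eta> \<le> 1" using \<eta> \<kappa> by linarith
  have "12 / \<eta> > 0" using \<eta> by simp
  then have N12: "12 / \<eta> \<le> real N" and N13: "real N \<le> 12 / \<eta> + 1" unfolding N_def by linarith+
  have N0: "real N > 0" using N12 \<open>12 / \<eta> > 0\<close> by linarith
  have "1 / \<eta> \<ge> 1" using \<eta> \<eta>1 by simp
  then have N14: "real (Suc N) \<le> 14 / \<eta>" using N13 by simp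
  define K where "K = 8 / \<kappa>"
  have K: "K > 0" using \<kappa> by (simp add: K_def)
  \<comment> \<open>A trapezoid with ramps of length \<open>1 / K = \<kappa> / 8\<close>: the shift
    is only partial where the unshifted point is within \<open>\<kappa> * r / 4\<close> of
    \<open>p\<close> or of \<open>q\<close>, and there the clearance of that endpoint protects the
    shifted point.\<close>
  define \<phi> where "\<phi> u = min 1 (min (K * u) (K * (1 - u)))" for u :: real
  have \<phi>lip: "\<bar>\<phi> u - \<phi> v\<bar> \<le> K * \<bar>u - v\<bar>" for u v
  proof -
    have "\<phi> u - \<phi> v \<le> K * \<bar>u - v\<bar>" for u v
    proof -
      have "K * u - K * v \<le> K * \<bar>u - v\<bar>" "K * v - K * u \<le> K * \<bar>u - v\<bar>" "0 \<le> K * \<bar>u - v\<bar>"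
        using K by (auto simp: right_diff_distrib[symmetric] intro!: mult_left_mono)
      then show ?thesis unfolding \<phi>_def right_diff_distrib by linarith
    qed
    from this[of u v] this[of v u] show ?thesis by (simp add: abs_minus_commute)
  qed
  have \<phi>01: "0 \<le> \<phi> u \<and> \<phi> u \<le> 1" if "0 \<le> u" "u \<le> 1" for u using K that by (simp add: \<phi>_def)
  have main: "chain_near \<Gamma> x r \<eta> 6 p q"
    if x: "x \<in> F \<inter> ball z (\<rho>/8)" and r: "0 < r" "r \<le> \<rho>/16" and pq: "dist x p \<le> r" "dist x q \<le> r" "\<kappa> * r \<le> infdist p \<Gamma>" "\<kappa> * r \<le> infdist q \<Gamma>"
    for x p q :: "real^'n" and r
  proof -
    have dpq: "dist p q \<le> 2 * r" using dist_triangle[of p q x] pq by (simp add: dist_commute)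
    have \<kappa>r: "0 < \<kappa> * r" "\<kappa> * r \<le> r" using \<kappa> r by (auto intro: mult_left_le_one_le)
    have \<eta>r: "0 < \<eta> * r" "\<eta> * r \<le> \<kappa> / 4 * r" using \<eta> r by (auto intro: mult_right_mono)
    define a where "a i = p + (real i / real N) *\<^sub>R (q - p)" for i
    \<comment> \<open>The shifts that bring the \<open>i\<close>-th point of the segment too close
      to \<open>\<Gamma>\<close> while it stays within \<open>4 * r\<close> of \<open>x\<close>,
      which always holds for the shifts considered.\<close>
    define T where "T i = {y. dist x (a i + y) < 4 * r \<and> infdist (a i + y) \<Gamma> < \<eta> * r}" for i
    let ?B = "{y. dist x y < 4 * r \<and> infdist y \<Gamma> < \<eta> * r}"
    have T_meas: "T i \<in> lmeasurable \<and> measure lebesgue (T i) = measure lebesgue ?B" for i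
    proof
      have eq: "T i = (+) (- a i) ` ?B"
      proof
        show "T i \<subseteq> (+) (- a i) ` ?B"
        proof
          fix y assume "y \<in> T i"
          then have "a i + y \<in> ?B" by (simp add: T_def)
          moreover have "y = - a i + (a i + y)" by simp
          ultimately show "y \<in> (+) (- a i) ` ?B" by (rule rev_image_eqI)
        qed
      qed (auto simp: T_def)
      show "measure lebesgue (T i) = measure lebesgue ?B" unfolding eq by (rule measure_translation)
      have "open ?B" by (intro open_Collect_conj open_Collect_less continuous_intros)
      then have "?B \<in> lmeasurable" by (intro lmeasurable_open bounded_subset[of "ball x (4 * r)" ?B]) auto
      then show "T i \<in> lmeasurable" unfolding eq by (rule measurable_translation)
    qed
    have "\<not> ball 0 (\<kappa> * r / 2) \<subseteq> (\<Union>i\<le>N. T i)"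
    proof
      assume sub: "ball 0 (\<kappa> * r / 2) \<subseteq> (\<Union>i\<le>N. T i)"
      have "\<omega> * (\<kappa>/2) ^ ?n * r ^ ?n = measure lebesgue (ball (0::real^'n) (\<kappa> * r / 2))"
        using \<kappa>r by (simp add: content_ball \<omega>_def power_mult_distrib power_divide)
      also have "\<dots> \<le> measure lebesgue (\<Union>i\<le>N. T i)"
        using T_meas by (intro measure_mono_fmeasurable[OF sub] fmeasurable.finite_UN) auto
      also have "\<dots> \<le> (\<Sum>i\<le>N. measure lebesgue (T i))"
        by (rule measure_UNION_le) (use T_meas in auto)
      also have "\<dots> = real (Suc N) * measure lebesgue ?B" using T_meas by simp
      also have "\<dots> \<le> (14 / \<eta>) * (c * (\<eta> * r) powr (?D - s) * (4 * r) powr s)"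
      proof (rule mult_mono[OF N14])
        show "measure lebesgue ?B \<le> c * (\<eta> * r) powr (?D - s) * (4 * r) powr s"
          by (rule c(2)[OF x]) (use \<eta>r \<kappa>r r in auto)
      qed (use \<eta> in auto)
      also have "\<dots> = 14 * c * 4 powr s * (\<eta> powr (?D - s) / \<eta>) * (r powr (?D - s) * r powr s)"
        using \<eta> r by (simp add: powr_mult)
      also have "\<eta> powr (?D - s) / \<eta> = \<eta> powr (?D - s - 1)" using \<eta> by (simp add: powr_diff)
      also have "r powr (?D - s) * r powr s = r ^ ?n" using r by (simp add: powr_add[symmetric] powr_realpow)
      also have "14 * c * 4 powr s * \<eta> powr (?D - s - 1) * r ^ ?n < \<omega> * (\<kappa>/2) ^ ?n * r ^ ?n"
        using \<eta>(3) r by (intro mult_strict_right_mono) auto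
      finally show False by simp
    qed
    then obtain y where "y \<in> ball 0 (\<kappa> * r / 2)" "y \<notin> (\<Union>i\<le>N. T i)" by blast
    then have y: "norm y < \<kappa> * r / 2" "\<And>i. i \<le> N \<Longrightarrow> y \<notin> T i" by auto
    define w where "w i = a i + \<phi> (real i / real N) *\<^sub>R y" for i
    have u01: "0 \<le> real i / real N" "real i / real N \<le> 1" if "i \<le> N" for i using that N0 by auto
    have \<phi>y: "norm (\<phi> (real i / real N) *\<^sub>R y) \<le> \<kappa> * r / 2" if "i \<le> N" for i
    proof -
      have "norm (\<phi> (real i / real N) *\<^sub>R y) \<le> 1 * norm y"
        using \<phi>01[OF u01[OF that]] unfolding norm_scaleR by (intro mult_right_mono) auto
      then show ?thesis using y(1) by linarith
    qed
    have ap: "dist p (a i) \<le> (real i / real N) * (2 * r)" for i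
      using dpq unfolding a_def by (auto simp: dist_norm norm_minus_commute intro!: mult_left_mono divide_right_mono)
    have aq: "dist q (a i) \<le> (1 - real i / real N) * (2 * r)" if "i \<le> N" for i
    proof -
      have "q - a i = (1 - real i / real N) *\<^sub>R (q - p)" by (simp add: a_def algebra_simps)
      then have "dist q (a i) = (1 - real i / real N) * dist p q" using u01[OF that] by (simp add: dist_norm norm_minus_commute)
      then show ?thesis using dpq u01[OF that] by (simp add: mult_left_mono)
    qed
    have wa: "dist (a i) (w i) \<le> \<kappa> * r / 2" if "i \<le> N" for i using \<phi>y[OF that] by (simp add: w_def dist_norm)
    have xa: "dist x (a i) \<le> 3 * r" if "i \<le> N" for i
    proof -
      have "(real i / real N) * (2 * r) \<le> 1 * (2 * r)" using u01[OF that] r by (intro mult_right_mono) auto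
      then show ?thesis using ap[of i] dist_triangle[of x "a i" p] pq by linarith
    qed
    have xw: "dist x (w i) < 4 * r" if "i \<le> N" for i
      using xa[OF that] wa[OF that] dist_triangle[of x "w i" "a i"] \<kappa>r r by linarith
    have small: "u * (2 * r) \<le> \<kappa> * r / 4" if "K * u \<le> 1" for u
    proof -
      have "u \<le> \<kappa> / 8" using that \<kappa> by (simp add: K_def field_simps)
      then have "u * (2 * r) \<le> \<kappa> / 8 * (2 * r)" using r by (intro mult_right_mono) auto
      then show ?thesis by simp
    qed
    have low: "\<eta> * r \<le> infdist (w i) \<Gamma>" if i: "i \<le> N" for i
    proof -
      let ?u = "real i / real N"
      have "\<phi> ?u = 1" if "1 < K * ?u" "1 < K * (1 - ?u)" using that unfolding \<phi>_def by linarith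
      then consider "K * ?u \<le> 1" | "K * (1 - ?u) \<le> 1" | "\<phi> ?u = 1" by (meson not_le)
      then show ?thesis
      proof cases
        \<comment> \<open>The point is within \<open>\<kappa> * r / 4 + \<kappa> * r / 2\<close> of
          \<open>p\<close>, which leaves a clearance of at least
          \<open>\<kappa> * r / 4 \<ge> \<eta> * r\<close>.\<close>
        case 1
        have "infdist p \<Gamma> \<le> infdist (w i) \<Gamma> + dist p (w i)" by (rule infdist_triangle)
        then show ?thesis using small[OF 1] ap[of i] wa[OF i] dist_triangle[of p "w i" "a i"] pq(3) \<eta>r by linarith
      next
        case 2
        have "infdist q \<Gamma> \<le> infdist (w i) \<Gamma> + dist q (w i)" by (rule infdist_triangle)
        then show ?thesis using small[OF 2] aq[OF i] wa[OF i] dist_triangle[of q "w i" "a i"] pq(4) \<eta>r by linarith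
      next
        case 3
        then have "w i = a i + y" by (simp add: w_def)
        then show ?thesis using y(2)[OF i] xw[OF i] by (simp add: T_def)
      qed
    qed
    have step: "dist (w i) (w (Suc i)) \<le> 6 * r / real N" for i
    proof -
      have eq: "w (Suc i) - w i = (1 / real N) *\<^sub>R (q - p) + (\<phi> (real (Suc i) / real N) - \<phi> (real i / real N)) *\<^sub>R y"
        by (simp add: w_def a_def add_divide_distrib algebra_simps)
      have "norm ((1 / real N) *\<^sub>R (q - p)) \<le> 2 * r / real N"
        using dpq N0 by (simp add: dist_norm norm_minus_commute divide_right_mono)
      moreover have "norm ((\<phi> (real (Suc i) / real N) - \<phi> (real i / real N)) *\<^sub>R y) \<le> (K * (1 / real N)) * (\<kappa> * r / 2)"
      proof -
        have "\<bar>real (Suc i) / real N - real i / real N\<bar> = 1 / real N" using N0 by (simp add: diff_divide_distrib[symmetric])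
        then have "\<bar>\<phi> (real (Suc i) / real N) - \<phi> (real i / real N)\<bar> \<le> K * (1 / real N)"
          using \<phi>lip[of "real (Suc i) / real N" "real i / real N"] by simp
        then show ?thesis unfolding norm_scaleR using y(1) K N0 by (intro mult_mono) auto
      qed
      moreover have "(K * (1 / real N)) * (\<kappa> * r / 2) = 4 * r / real N" using \<kappa> by (simp add: K_def)
      ultimately have "norm (w (Suc i) - w i) \<le> 2 * r / real N + 4 * r / real N"
        unfolding eq by (intro norm_triangle_le) linarith
      then show ?thesis by (simp add: dist_norm norm_minus_commute add_divide_distrib[symmetric])
    qed
    have "6 * r / real N \<le> \<eta> * r / 2"
    proof -
      have "12 \<le> \<eta> * real N" using N12 \<eta> by (simp add: field_simps)
      then have "12 * r \<le> \<eta> * real N * r" using r by (intro mult_right_mono) auto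
      then show ?thesis using N0 by (simp add: field_simps)
    qed
    then have "\<forall>i<N. dist (w i) (w (Suc i)) \<le> \<eta> * r / 2" using step order_trans by blast
    moreover have "(\<Sum>i<N. dist (w i) (w (Suc i))) \<le> (\<Sum>i<N. 6 * r / real N)" by (rule sum_mono) (rule step)
    then have "(\<Sum>i<N. dist (w i) (w (Suc i))) \<le> 6 * r" using N0 by simp
    moreover have "w 0 = p" "w N = q" using N0 K by (simp_all add: w_def a_def \<phi>_def)
    moreover have "\<forall>i\<le>N. dist x (w i) \<le> 6 * r \<and> \<eta> * r \<le> infdist (w i) \<Gamma>" using xw low r(1) by force
    ultimately show ?thesis unfolding chain_near_def by blast
  qed
  show ?thesis by (rule that[OF \<eta>(1) main])
qed

text \<open>Porosity yields only points off the frontier, possibly outside \<open>\<Omega>\<close>.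
  But such a thin frontier does not separate: every point off it and near \<open>z\<close> is joined
  by a chain to a point of \<open>\<Omega>\<close>, hence lies in \<open>\<Omega>\<close>
  itself.\<close>

lemma thin_boundary_whitney_chain:
  fixes F \<Omega> :: "(real^'n) set"
  assumes \<Omega>: "open \<Omega>" and F: "ahlfors_regular s F" "z \<in> F"
    and \<Gamma>: "F \<subseteq> frontier \<Omega>" "frontier \<Omega> \<inter> ball z \<rho> \<subseteq> F" "\<rho> > 0" and s: "s < real CARD('n) - 1"
  shows "\<exists>\<rho>1 R \<kappa> \<eta> L. \<rho>1 > 0 \<and> R > 0 \<and> \<kappa> > 0 \<and> \<eta> > 0 \<and> L > 0 \<and> whitney_chain \<Omega> (F \<inter> ball z \<rho>1) R \<kappa> \<eta> L"
proof -
  let ?\<Gamma> = "frontier \<Omega>"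
  have ne: "?\<Gamma> \<noteq> {}" using F \<Gamma> by blast
  have in\<Omega>: "p \<in> \<Omega>" if p: "infdist p ?\<Gamma> > 0" "dist z p \<le> \<rho>/16" for p
  proof -
    have "z \<in> closure \<Omega>" using F \<Gamma> by (auto simp: frontier_def)
    then obtain p0 where p0: "p0 \<in> \<Omega>" "dist p0 z < \<rho>/16" using \<Gamma>(3) closure_approachable[of z \<Omega>] by (meson divide_pos_pos zero_less_numeral)
    \<comment> \<open>That this constant depends on \<open>p\<close> is harmless: it serves only to
      place \<open>p\<close> in \<open>\<Omega>\<close>, at the single scale
      \<open>\<rho>/16\<close>.\<close>
    define \<kappa> where "\<kappa> = min 1 (min (infdist p ?\<Gamma>) (infdist p0 ?\<Gamma>) / (\<rho>/16))"
    have \<kappa>: "0 < \<kappa>" "\<kappa> \<le> 1" using p infdist_frontier_pos[OF \<Omega> p0(1) ne] \<Gamma>(3) by (auto simp: \<kappa>_def)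
    have "\<kappa> \<le> min (infdist p ?\<Gamma>) (infdist p0 ?\<Gamma>) / (\<rho>/16)" by (simp add: \<kappa>_def)
    then have "\<kappa> * (\<rho>/16) \<le> min (infdist p ?\<Gamma>) (infdist p0 ?\<Gamma>)" using \<Gamma>(3) by (subst (asm) pos_le_divide_eq) auto
    then have le: "\<kappa> * (\<rho>/16) \<le> infdist p ?\<Gamma>" "\<kappa> * (\<rho>/16) \<le> infdist p0 ?\<Gamma>" by auto
    obtain \<eta> where \<eta>: "\<eta> > 0" "\<And>x r p q. x \<in> F \<inter> ball z (\<rho>/8) \<Longrightarrow> 0 < r \<Longrightarrow> r \<le> \<rho>/16 \<Longrightarrow>
     dist x p \<le> r \<Longrightarrow> dist x q \<le> r \<Longrightarrow> \<kappa> * r \<le> infdist p ?\<Gamma> \<Longrightarrow> \<kappa> * r \<le> infdist q ?\<Gamma> \<Longrightarrow> chain_near ?\<Gamma> x r \<eta> 6 p q"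
      by (rule thin_boundary_chain[OF F \<Gamma> s \<kappa>]) (rule that)
    have \<rho>16: "\<rho>/16 > 0" using \<Gamma>(3) by simp
    have "chain_near ?\<Gamma> z (\<rho>/16) \<eta> 6 p0 p"
      by (rule \<eta>(2)) (use F \<Gamma>(3) p p0 le in \<open>auto simp: dist_commute less_imp_le\<close>)
    then show ?thesis
    proof (rule chain_near_in_open[OF _ p0(1) \<eta>(1) \<rho>16])
      fix N and w :: "nat \<Rightarrow> real^'n"
      assume w: "w N = p" "\<And>i. i \<le> N \<Longrightarrow> w i \<in> \<Omega> \<and> dist z (w i) \<le> 6 * (\<rho>/16) \<and> \<eta> * (\<rho>/16) \<le> infdist (w i) ?\<Gamma>"
      from w(2)[of N] show "p \<in> \<Omega>" using w(1) by simp
    qed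
  qed
  let ?G = "F \<inter> ball z (\<rho>/32)"
  obtain \<kappa> where \<kappa>: "0 < \<kappa>" "\<kappa> \<le> 1" "\<And>x r. x \<in> F \<inter> ball z (\<rho>/8) \<Longrightarrow> 0 < r \<Longrightarrow> r \<le> \<rho>/4 \<Longrightarrow> \<exists>p. dist x p \<le> r \<and> \<kappa> * r \<le> infdist p ?\<Gamma>"
    by (rule thin_boundary_porous[OF F \<Gamma>]) (use s in \<open>auto intro: that\<close>)
  have "accessible \<Omega> ?G (\<rho>/32) \<kappa>"
    unfolding accessible_def
  proof (intro ballI allI impI)
    fix x r assume x: "x \<in> ?G" and r: "0 < r \<and> r \<le> \<rho>/32"
    obtain p where p: "dist x p \<le> r" "\<kappa> * r \<le> infdist p ?\<Gamma>" using \<kappa>(3)[of x r] x r by auto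
    have "\<kappa> * r > 0" using \<kappa> r by simp
    moreover have "dist z p \<le> \<rho>/16" using dist_triangle[of z p x] x p(1) r by simp
    ultimately have "p \<in> \<Omega>" using p(2) by (intro in\<Omega>) auto
    then show "\<exists>p\<in>\<Omega>. dist x p \<le> r \<and> \<kappa> * r \<le> infdist p ?\<Gamma>" using p by blast
  qed
  moreover have \<kappa>2: "0 < \<kappa>/2" "\<kappa>/2 \<le> 1" using \<kappa> by auto
  obtain \<eta> where \<eta>: "\<eta> > 0" "\<And>x r p q. x \<in> F \<inter> ball z (\<rho>/8) \<Longrightarrow> 0 < r \<Longrightarrow> r \<le> \<rho>/16 \<Longrightarrow>
     dist x p \<le> r \<Longrightarrow> dist x q \<le> r \<Longrightarrow> \<kappa>/2 * r \<le> infdist p ?\<Gamma> \<Longrightarrow> \<kappa>/2 * r \<le> infdist q ?\<Gamma> \<Longrightarrow> chain_near ?\<Gamma> x r \<eta> 6 p q"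
    by (rule thin_boundary_chain[OF F \<Gamma> s \<kappa>2]) (rule that)
  have "linkable \<Omega> ?G (\<rho>/32) (\<kappa>/2) \<eta> 6"
    unfolding linkable_def by (intro ballI allI impI \<eta>(2)) (use \<Gamma>(3) in auto)
  ultimately have "\<exists>\<kappa>' \<eta>' L'. \<kappa>' > 0 \<and> \<eta>' > 0 \<and> L' > 0 \<and> whitney_chain \<Omega> ?G (\<rho>/32) \<kappa>' \<eta>' L'"
    using \<kappa>(1) \<eta>(1) \<Gamma>(3) by (intro whitney_chain_exists[OF \<Omega>, of _ _ \<kappa> \<eta> 6]) auto
  moreover have "\<rho>/32 > 0" using \<Gamma>(3) by simp
  ultimately show ?thesis by blast
qed

section \<open>Chains along the curves of a uniform set\<close>

lemma curve_length_polygon_le: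
  assumes "curve_length \<gamma> \<le> ennreal K" "0 \<le> K" "N > 0"
  shows "(\<Sum>i<N. dist (\<gamma> (real i / real N)) (\<gamma> (real (Suc i) / real N))) \<le> K"
proof -
  let ?ts = "map (\<lambda>i. real i / real N) [0..<Suc N]"
  have s: "sorted ?ts" unfolding sorted_iff_nth_mono
    by (auto simp: nth_append divide_right_mono simp del: upt_Suc)
  have "set ?ts \<subseteq> {0..1}" using assms(3) by (auto simp del: upt_Suc)
  then have ts: "?ts \<in> {ts. sorted ts \<and> set ts \<subseteq> {0..1}}" using s by simp
  have "ennreal (\<Sum>i<N. dist (\<gamma> (real i / real N)) (\<gamma> (real (Suc i) / real N))) =
      (\<Sum>i<length ?ts - 1. ennreal (dist (\<gamma> (?ts ! i)) (\<gamma> (?ts ! Suc i))))"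
    by (subst sum_ennreal[symmetric]) (auto intro!: sum.cong simp del: upt_Suc)
  also have "\<dots> \<le> curve_length \<gamma>" unfolding curve_length_def by (rule SUP_upper[OF ts])
  also have "\<dots> \<le> ennreal K" by (rule assms)
  finally show ?thesis using assms(2) by (simp add: ennreal_le_iff)
qed

lemma dist_le_curve_length:
  assumes "curve_length \<gamma> \<le> ennreal K" "0 \<le> K" "t \<in> {0..1}"
  shows "dist (pathstart \<gamma>) (\<gamma> t) \<le> K"
proof -
  have ts: "[0, t] \<in> {ts. sorted ts \<and> set ts \<subseteq> {0..1}}" using assms(3) by simp
  have "ennreal (dist (pathstart \<gamma>) (\<gamma> t)) = (\<Sum>i<length [0, t] - 1. ennreal (dist (\<gamma> ([0, t] ! i)) (\<gamma> ([0, t] ! Suc i))))"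
    by (simp add: pathstart_def)
  also have "\<dots> \<le> curve_length \<gamma>" unfolding curve_length_def by (rule SUP_upper[OF ts])
  also have "\<dots> \<le> ennreal K" by (rule assms)
  finally show ?thesis using assms(2) by (simp add: ennreal_le_iff)
qed

lemma path_fine_partition:
  assumes "path \<gamma>" "\<epsilon> > 0"
  obtains N where "N > 0" "\<And>i. i < N \<Longrightarrow> dist (\<gamma> (real i / real N)) (\<gamma> (real (Suc i) / real N)) < \<epsilon>"
proof -
  have "uniformly_continuous_on {0..1} \<gamma>" using assms(1) unfolding path_def by (intro compact_uniformly_continuous) auto
  then obtain d where d: "d > 0" "\<And>s t. s \<in> {0..1} \<Longrightarrow> t \<in> {0..1} \<Longrightarrow> dist t s < d \<Longrightarrow> dist (\<gamma> t) (\<gamma> s) < \<epsilon>"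
    using assms(2) unfolding uniformly_continuous_on_def by blast
  obtain N where N: "inverse (real (Suc N)) < d" using reals_Archimedean[OF d(1)] by blast
  show ?thesis
  proof
    show "Suc N > 0" by simp
    fix i assume i: "i < Suc N"
    have "dist (real i / real (Suc N)) (real (Suc i) / real (Suc N)) = inverse (real (Suc N))"
      unfolding dist_real_def by (simp add: diff_divide_distrib[symmetric] inverse_eq_divide del: of_nat_Suc)
    then show "dist (\<gamma> (real i / real (Suc N))) (\<gamma> (real (Suc i) / real (Suc N))) < \<epsilon>"
      using i N by (intro d(2)) auto
  qed
qed

text \<open>Corkscrew points arise on a uniform curve that starts near \<open>x\<close> and ends at
  a fixed distant point \<open>y0\<close>, at distance \<open>r/2\<close> from its start. Chains are
  fine subdivisions of uniform curves: away from the ends the cigar condition gives the clearance,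
  near an end the clearance of that endpoint does.\<close>

lemma uniform_whitney_chain:
  fixes F \<Omega> :: "(real^'n) set"
  assumes \<Omega>: "open \<Omega>" and z: "z \<in> F" "F \<subseteq> frontier \<Omega>" and R0: "R0 > 0" and U: "uniform_in \<Omega> (\<Omega> \<inter> ball z R0)"
  shows "\<exists>\<rho>1 R \<kappa> \<eta> L. \<rho>1 > 0 \<and> R > 0 \<and> \<kappa> > 0 \<and> \<eta> > 0 \<and> L > 0 \<and> whitney_chain \<Omega> (F \<inter> ball z \<rho>1) R \<kappa> \<eta> L"
proof -
  let ?d = "\<lambda>w. infdist w (frontier \<Omega>)"
  obtain \<sigma> where \<sigma>: "\<sigma> \<ge> 1" and U: "\<And>x y. x \<in> \<Omega> \<inter> ball z R0 \<Longrightarrow> y \<in> \<Omega> \<inter> ball z R0 \<Longrightarrow> \<exists>\<gamma>.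
        path \<gamma> \<and> path_image \<gamma> \<subseteq> \<Omega> \<and> pathstart \<gamma> = x \<and> pathfinish \<gamma> = y \<and>
        curve_length \<gamma> \<le> ennreal (\<sigma> * dist x y) \<and>
        (\<forall>w\<in>path_image \<gamma>. ?d w \<ge> inverse \<sigma> * min (dist x w) (dist w y))"
    using U unfolding uniform_in_def by blast
  define i\<sigma> where "i\<sigma> = inverse \<sigma>"
  have i\<sigma>: "0 < i\<sigma>" "i\<sigma> \<le> 1" using \<sigma> by (auto simp: i\<sigma>_def inverse_le_1_iff)
  have cl: "x \<in> closure \<Omega>" if "x \<in> F" for x using that z by (auto simp: frontier_def)
  obtain y0 where y0: "y0 \<in> \<Omega>" "dist y0 z < R0" using cl[OF z(1)] R0 unfolding closure_approachable by blast
  have "z \<notin> \<Omega>" using z \<Omega> by (auto simp: frontier_def interior_open)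
  then have "y0 \<noteq> z" using y0 by blast
  define \<rho> where "\<rho> = min (dist y0 z) R0 / 8"
  \<comment> \<open>The factor 8 keeps the points to be joined inside \<open>ball z R0\<close>, and
    \<open>y0\<close> at distance at least \<open>2 * r\<close> from the start \<open>y\<close> for
    every \<open>r \<le> \<rho>\<close>.\<close>
  have \<rho>: "\<rho> > 0" "8 * \<rho> \<le> R0" "8 * \<rho> \<le> dist y0 z" using R0 \<open>y0 \<noteq> z\<close> by (auto simp: \<rho>_def)
  define \<kappa> where "\<kappa> = i\<sigma> / 2"
  have \<kappa>: "\<kappa> > 0" using i\<sigma> by (simp add: \<kappa>_def)
  have acc: "accessible \<Omega> (F \<inter> ball z \<rho>) \<rho> \<kappa>"
    unfolding accessible_def
  proof (intro ballI allI impI)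
    fix x r assume x: "x \<in> F \<inter> ball z \<rho>" and r: "0 < r \<and> r \<le> \<rho>"
    have zx: "dist z x < \<rho>" using x by simp
    have "r/4 > 0" using r by simp
    then obtain y where y: "y \<in> \<Omega>" "dist y x < r/4" using cl[of x] x unfolding closure_approachable by blast
    have zy: "dist z y < 2 * \<rho>" using dist_triangle[of z y x] zx y r by (simp add: dist_commute)
    then have yb: "y \<in> \<Omega> \<inter> ball z R0" using y \<rho> by auto
    have "dist y0 z \<le> dist y0 y + dist y z" by (rule dist_triangle)
    then have yy0: "dist y y0 \<ge> 2 * r" using zy \<rho> r by (simp add: dist_commute)
    have y0b: "y0 \<in> \<Omega> \<inter> ball z R0" using y0 by (simp add: dist_commute)
    obtain \<gamma> where \<gamma>: "path \<gamma>" "path_image \<gamma> \<subseteq> \<Omega>" "pathstart \<gamma> = y" "pathfinish \<gamma> = y0"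
        "\<And>w. w\<in>path_image \<gamma> \<Longrightarrow> ?d w \<ge> i\<sigma> * min (dist y w) (dist w y0)" using U[OF yb y0b] unfolding i\<sigma>_def by blast
    have "\<exists>t\<ge>0. t \<le> 1 \<and> dist y (\<gamma> t) = r/2"
      by (rule IVT') (use \<gamma> yy0 r in \<open>auto simp: path_def pathstart_def pathfinish_def intro!: continuous_intros\<close>)
    then obtain t where t: "0 \<le> t" "t \<le> 1" "dist y (\<gamma> t) = r/2" by blast
    have wi: "\<gamma> t \<in> path_image \<gamma>" using t by (auto simp: path_image_def)
    have "dist (\<gamma> t) y0 \<ge> r/2" using dist_triangle[of y y0 "\<gamma> t"] t yy0 r by linarith
    then have "i\<sigma> * (r/2) \<le> i\<sigma> * min (dist y (\<gamma> t)) (dist (\<gamma> t) y0)" using t i\<sigma> by (intro mult_left_mono) auto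
    then have "\<kappa> * r \<le> ?d (\<gamma> t)" using \<gamma>(5)[OF wi] by (simp add: \<kappa>_def)
    moreover have "dist x (\<gamma> t) \<le> r" using dist_triangle[of x "\<gamma> t" y] t y r by (simp add: dist_commute)
    ultimately show "\<exists>p\<in>\<Omega>. dist x p \<le> r \<and> \<kappa> * r \<le> ?d p" using wi \<gamma>(2) by blast
  qed
  \<comment> \<open>The factor \<open>i\<sigma>\<close> is the loss in the cigar condition at points
    that are at least \<open>\<kappa>/4 * r\<close> away from both ends.\<close>
  define \<eta> where "\<eta> = i\<sigma> * (\<kappa> / 4)"
  have \<eta>: "\<eta> > 0" using i\<sigma> \<kappa> by (simp add: \<eta>_def)
  have link: "linkable \<Omega> (F \<inter> ball z \<rho>) \<rho> (\<kappa>/2) \<eta> (1 + 2 * \<sigma>)"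
    unfolding linkable_def
  proof (intro ballI allI impI)
    fix x r p q assume x: "x \<in> F \<inter> ball z \<rho>" and a: "0 < r \<and> r \<le> \<rho> \<and> p \<in> \<Omega> \<and> q \<in> \<Omega> \<and> dist x p \<le> r \<and> dist x q \<le> r \<and>
     \<kappa>/2 * r \<le> ?d p \<and> \<kappa>/2 * r \<le> ?d q"
    have zx: "dist z x < \<rho>" using x by simp
    have pb: "p \<in> \<Omega> \<inter> ball z R0" using dist_triangle[of z p x] zx a \<rho> by auto
    have qb: "q \<in> \<Omega> \<inter> ball z R0" using dist_triangle[of z q x] zx a \<rho> by auto
    have "dist p q \<le> 2 * r" using dist_triangle[of p q x] a by (simp add: dist_commute)
    then have len: "\<sigma> * dist p q \<le> 2 * \<sigma> * r" using mult_left_mono[of "dist p q" "2 * r" \<sigma>] \<sigma> by simp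
    obtain \<gamma> where \<gamma>: "path \<gamma>" "path_image \<gamma> \<subseteq> \<Omega>" "pathstart \<gamma> = p" "pathfinish \<gamma> = q" "curve_length \<gamma> \<le> ennreal (\<sigma> * dist p q)"
        "\<And>w. w\<in>path_image \<gamma> \<Longrightarrow> ?d w \<ge> i\<sigma> * min (dist p w) (dist w q)" using U[OF pb qb] unfolding i\<sigma>_def by blast
    have nn: "0 \<le> \<sigma> * dist p q" using \<sigma> by simp
    have low: "\<eta> * r \<le> ?d w" if w: "w \<in> path_image \<gamma>" for w
    proof -
      have "\<eta> * r = i\<sigma> * (\<kappa>/4 * r)" by (simp add: \<eta>_def)
      moreover have "i\<sigma> * (\<kappa>/4 * r) \<le> \<kappa>/4 * r" using i\<sigma> \<kappa> a by (intro mult_left_le_one_le) auto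
      ultimately have 1: "\<eta> * r \<le> \<kappa>/4 * r" by linarith
      have tp: "?d p \<le> ?d w + dist p w" and tq: "?d q \<le> ?d w + dist q w" by (rule infdist_triangle)+
      show ?thesis
      proof (cases "\<kappa>/4 * r \<le> dist p w \<and> \<kappa>/4 * r \<le> dist w q")
        case True
        then have "i\<sigma> * (\<kappa>/4 * r) \<le> i\<sigma> * min (dist p w) (dist w q)" using i\<sigma> by (intro mult_left_mono) auto
        then show ?thesis using \<gamma>(6)[OF w] by (simp add: \<eta>_def)
      next
        case False
        then have "dist p w < \<kappa>/4 * r \<or> dist q w < \<kappa>/4 * r" by (auto simp: dist_commute)
        moreover have "\<kappa>/2 * r = 2 * (\<kappa>/4 * r)" by simp
        ultimately show ?thesis using 1 tp tq a by linarith
      qed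
    qed
    have "\<eta> * r / 2 > 0" using \<eta> a by simp
    from path_fine_partition[OF \<gamma>(1) this]
    obtain N where N: "N > 0" "\<And>i. i < N \<Longrightarrow> dist (\<gamma> (real i / real N)) (\<gamma> (real (Suc i) / real N)) < \<eta> * r / 2" by blast
    define w where "w i = \<gamma> (real i / real N)" for i
    have wi: "w i \<in> path_image \<gamma>" "dist p (w i) \<le> \<sigma> * dist p q" if "i \<le> N" for i
    proof -
      have t: "real i / real N \<in> {0..1}" using that N(1) by simp
      then show "w i \<in> path_image \<gamma>" by (auto simp: w_def path_image_def)
      show "dist p (w i) \<le> \<sigma> * dist p q" using dist_le_curve_length[OF \<gamma>(5) nn t] by (simp add: w_def \<gamma>(3))
    qed
    have "dist x (w i) \<le> (1 + 2 * \<sigma>) * r" if "i \<le> N" for i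
      using dist_triangle[of x "w i" p] wi(2)[OF that] len a by (simp add: distrib_right)
    then have "\<forall>i\<le>N. dist x (w i) \<le> (1 + 2 * \<sigma>) * r \<and> \<eta> * r \<le> ?d (w i)" using wi(1) low by blast
    moreover have "w 0 = p" "w N = q" using N(1) \<gamma>(3,4) by (auto simp: w_def pathstart_def pathfinish_def)
    moreover have "\<forall>i<N. dist (w i) (w (Suc i)) \<le> \<eta> * r / 2" using N(2) by (auto simp: w_def intro: less_imp_le)
    moreover have "(\<Sum>i<N. dist (w i) (w (Suc i))) \<le> \<sigma> * dist p q"
      unfolding w_def by (rule curve_length_polygon_le[OF \<gamma>(5) nn N(1)])
    then have "(\<Sum>i<N. dist (w i) (w (Suc i))) \<le> (1 + 2 * \<sigma>) * r" using len a by (simp add: distrib_right)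
    ultimately show "chain_near (frontier \<Omega>) x r \<eta> (1 + 2 * \<sigma>) p q" unfolding chain_near_def by blast
  qed
  have "1 + 2 * \<sigma> > 0" using \<sigma> by simp
  from whitney_chain_exists[OF \<Omega> acc link \<rho>(1) \<kappa> \<eta> this] \<rho>(1) show ?thesis by blast
qed

section \<open>Equality of the forms\<close>

text \<open>For points of \<open>ball z (\<rho>/2)\<close> the nearest frontier point lies in
  \<open>ball z \<rho>\<close>, hence in \<open>F\<close>. So the hypothesis for the one bounded set
  \<open>F \<inter> ball z \<rho>\<close> covers a full neighbourhood of \<open>z\<close> in
  \<open>\<Omega>\<close>.\<close>

lemma near_part_ball:
  fixes \<Omega> :: "(real^'n) set"
  assumes z: "z \<in> F" "F \<subseteq> frontier \<Omega>" "frontier \<Omega> \<inter> ball z \<rho> \<subseteq> F" and x: "x \<in> \<Omega>" "x \<in> ball z (min (\<rho>/2) r)"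
  shows "x \<in> near_part \<Omega> (F \<inter> ball z \<rho>) r"
proof -
  let ?\<Gamma> = "frontier \<Omega>"
  have xz: "dist z x < \<rho>/2" "dist z x < r" using x by auto
  have z\<Gamma>: "z \<in> ?\<Gamma>" using z by blast
  then have le: "infdist x ?\<Gamma> \<le> dist z x" using infdist_le[of z ?\<Gamma> x] by (simp add: dist_commute)
  obtain y where y: "y \<in> ?\<Gamma>" "infdist x ?\<Gamma> = dist x y" using infdist_attains_inf[OF frontier_closed] z\<Gamma> by blast
  have "dist z y < \<rho>" using dist_triangle[of z y x] y xz le by linarith
  then have yA: "y \<in> F \<inter> ball z \<rho>" using y z by auto
  then have "infdist x (F \<inter> ball z \<rho>) \<le> infdist x ?\<Gamma>" using infdist_le[OF yA, of x] y by simp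
  moreover have "infdist x ?\<Gamma> \<le> infdist x (F \<inter> ball z \<rho>)" using yA z by (intro infdist_mono) auto
  ultimately show ?thesis using x(1) xz le by (simp add: near_part_def)
qed

lemma (in coefficients) form_equality_exponent:
  assumes F: "z \<in> F" "openin (top_of_set (frontier \<Omega>)) F" "ahlfors_regular s F" "0 < s"
    and U: "s < real CARD('n) - 1 \<or> (\<exists>R0>0. uniform_in \<Omega> (\<Omega> \<inter> ball z R0))"
    and \<delta>: "\<delta> \<ge> 0" "b > 0" "r > 0"
    and low: "\<And>A. bounded A \<Longrightarrow> A \<subseteq> F \<Longrightarrow> AE x in L\<Omega>. x \<in> near_part \<Omega> A r \<longrightarrow> mat_le (mat (b * infdist x (frontier \<Omega>) powr \<delta>)) (C x)"
    and DN: "form_D \<Omega> C = form_N \<Omega> C"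
  shows "\<delta> \<ge> critical_exponent TYPE('n) s"
proof -
  have sub: "F \<subseteq> frontier \<Omega>" by (rule openin_imp_subset[OF F(2)])
  obtain \<rho> where "\<rho> > 0" "ball z \<rho> \<inter> frontier \<Omega> \<subseteq> F" using F(1,2) unfolding openin_contains_ball by blast
  then have \<rho>: "\<rho> > 0" "frontier \<Omega> \<inter> ball z \<rho> \<subseteq> F" by auto
  have "\<exists>\<rho>1 R \<kappa> \<eta> L. \<rho>1 > 0 \<and> R > 0 \<and> \<kappa> > 0 \<and> \<eta> > 0 \<and> L > 0 \<and> whitney_chain \<Omega> (F \<inter> ball z \<rho>1) R \<kappa> \<eta> L"
    using U
  proof
    assume "s < real CARD('n) - 1"
    then show ?thesis by (rule thin_boundary_whitney_chain[OF open_\<Omega> F(3,1) sub \<rho>(2,1)])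
  next
    assume "\<exists>R0>0. uniform_in \<Omega> (\<Omega> \<inter> ball z R0)"
    then show ?thesis using uniform_whitney_chain[OF open_\<Omega> F(1) sub] by blast
  qed
  then obtain \<rho>1 R \<kappa> \<eta> L where ch: "\<rho>1 > 0" "R > 0" "\<kappa> > 0" "\<eta> > 0" "L > 0" "whitney_chain \<Omega> (F \<inter> ball z \<rho>1) R \<kappa> \<eta> L" by blast
  have "bounded (F \<inter> ball z \<rho>)" by (rule bounded_subset[OF bounded_ball]) blast
  from low[OF this] have "AE x in L\<Omega>. x \<in> near_part \<Omega> (F \<inter> ball z \<rho>) r \<longrightarrow> mat_le (mat (b * infdist x (frontier \<Omega>) powr \<delta>)) (C x)" by blast
  moreover have "AE x in L\<Omega>. x \<in> \<Omega>" by (rule AE_I2) (simp add: space_restrict_space)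
  ultimately have "AE x in L\<Omega>. x \<in> ball z (min (\<rho>/2) r) \<longrightarrow> mat_le (mat (b * infdist x (frontier \<Omega>) powr \<delta>)) (C x)"
  proof eventually_elim
    case (elim x)
    then show ?case using near_part_ball[OF F(1) sub \<rho>(2), of x r] by blast
  qed
  from form_equality_exponent_bound[OF sub F(1,3,4) this \<delta>(2,1) _ ch(6) ch(1-5) DN]
  show ?thesis using \<rho>(1) \<delta>(3) by (simp add: critical_exponent_def)
qed

theorem theorem4p2:
  fixes \<Omega> \<Gamma> :: "(real^'n) set"
    and m :: nat
    and F :: "nat \<Rightarrow> (real^'n) set"
    and s :: "nat \<Rightarrow> real"
    and C :: "real^'n \<Rightarrow> real^'n^'n"
  assumes "open \<Omega>" "connected \<Omega>" "\<Omega> \<noteq> {}"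
    and "\<Gamma> = frontier \<Omega>"
    and "1 \<le> m"
    and "\<Gamma> = (\<Union>j\<in>{1..m}. closure (F j))"
    and "\<And>j. j \<in> {1..m} \<Longrightarrow> F j \<noteq> {}"
    and "disjoint_family_on F {1..m}"
    and "\<And>j. j \<in> {1..m} \<Longrightarrow> openin (top_of_set \<Gamma>) (F j)"
    and "\<And>j. j \<in> {1..m} \<Longrightarrow> 0 < s j \<and> s j < real CARD('n)"
    and "\<And>j. j \<in> {1..m} \<Longrightarrow> ahlfors_regular (s j) (F j)"
    and "\<And>k l. (\<lambda>x. C x $ k $ l) \<in> Linfty_on \<Omega>"
    and "AE x in lebesgue_on \<Omega>. transpose (C x) = C x"
    and "AE x in lebesgue_on \<Omega>. mat_less 0 (C x)"
    and "\<And>K. compact K \<Longrightarrow> K \<subseteq> \<Omega> \<Longrightarrow> \<exists>c>0. AE x in lebesgue_on K. mat_le (mat c) (C x)"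
  shows
    "((\<forall>j\<in>{1..m}. \<exists>\<delta> b r. \<delta> \<ge> critical_exponent TYPE('n) (s j) \<and> b > 0 \<and> r > 0 \<and>
         (\<forall>A. bounded A \<and> A \<subseteq> F j \<longrightarrow>
            (AE x in lebesgue_on \<Omega>. x \<in> near_part \<Omega> A r \<longrightarrow>
               mat_le 0 (C x) \<and> mat_le (C x) (mat (b * infdist x \<Gamma> powr \<delta>)))))
      \<longrightarrow> form_D \<Omega> C = form_N \<Omega> C)
     \<and>
     ((\<forall>j\<in>{1..m}. s j \<ge> real CARD('n) - 1 \<longrightarrow>
         (\<exists>z\<in>F j. \<exists>R>0. uniform_in \<Omega> (\<Omega> \<inter> ball z R)))
      \<and> form_D \<Omega> C = form_N \<Omega> C
      \<longrightarrow> (\<forall>\<delta>. (\<forall>j\<in>{1..m}. \<delta> j \<ge> 0 \<and> (\<exists>b r. b > 0 \<and> r > 0 \<and>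
             (\<forall>A. bounded A \<and> A \<subseteq> F j \<longrightarrow>
                (AE x in lebesgue_on \<Omega>. x \<in> near_part \<Omega> A r \<longrightarrow>
                   mat_le (mat (b * infdist x \<Gamma> powr \<delta> j)) (C x)))))
           \<longrightarrow> (\<forall>j\<in>{1..m}. \<delta> j \<ge> critical_exponent TYPE('n) (s j))))"
proof -
  interpret coefficients \<Omega> C
    by unfold_locales (fact assms)+
  note \<Gamma> = \<open>\<Gamma> = frontier \<Omega>\<close>
  have part1: "form_D \<Omega> C = form_N \<Omega> C"
    if H: "\<forall>j\<in>{1..m}. \<exists>\<delta> b r. \<delta> \<ge> critical_exponent TYPE('n) (s j) \<and> b > 0 \<and> r > 0 \<and>
         (\<forall>A. bounded A \<and> A \<subseteq> F j \<longrightarrow>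
            (AE x in lebesgue_on \<Omega>. x \<in> near_part \<Omega> A r \<longrightarrow>
               mat_le 0 (C x) \<and> mat_le (C x) (mat (b * infdist x \<Gamma> powr \<delta>))))"
  proof -
    define P where "P j \<delta> b r \<longleftrightarrow> \<delta> \<ge> critical_exponent TYPE('n) (s j) \<and> b > 0 \<and> r > 0 \<and>
         (\<forall>A. bounded A \<and> A \<subseteq> F j \<longrightarrow>
            (AE x in lebesgue_on \<Omega>. x \<in> near_part \<Omega> A r \<longrightarrow>
               mat_le 0 (C x) \<and> mat_le (C x) (mat (b * infdist x \<Gamma> powr \<delta>))))" for j \<delta> b r
    have "\<forall>j\<in>{1..m}. \<exists>\<delta> b r. P j \<delta> b r" using H unfolding P_def .
    then obtain \<delta> b r where "\<forall>j\<in>{1..m}. P j (\<delta> j) (b j) (r j)" by metis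
    note H3 = this[unfolded P_def]
    have "degenerate_coefficients \<Omega> C {1..m} F s \<delta> b r"
    proof unfold_locales
      show "{1..m} \<noteq> {}" using \<open>1 \<le> m\<close> by simp
      show "frontier \<Omega> = (\<Union>j\<in>{1..m}. closure (F j))" using assms(6) unfolding \<Gamma> .
    qed (use assms(7,11) H3 in \<open>auto simp: \<Gamma>\<close>)
    then show ?thesis by (rule degenerate_coefficients.form_D_eq_N)
  qed
  have part2: "\<delta> j \<ge> critical_exponent TYPE('n) (s j)"
    if U: "\<forall>j\<in>{1..m}. s j \<ge> real CARD('n) - 1 \<longrightarrow> (\<exists>z\<in>F j. \<exists>R>0. uniform_in \<Omega> (\<Omega> \<inter> ball z R))"
      and DN: "form_D \<Omega> C = form_N \<Omega> C" and j: "j \<in> {1..m}"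
      and low: "\<forall>j\<in>{1..m}. \<delta> j \<ge> 0 \<and> (\<exists>b r. b > 0 \<and> r > 0 \<and>
             (\<forall>A. bounded A \<and> A \<subseteq> F j \<longrightarrow>
                (AE x in lebesgue_on \<Omega>. x \<in> near_part \<Omega> A r \<longrightarrow>
                   mat_le (mat (b * infdist x \<Gamma> powr \<delta> j)) (C x))))" for \<delta> j
  proof -
    from low j obtain b r where br: "\<delta> j \<ge> 0" "b > 0" "r > 0" and lo: "\<forall>A. bounded A \<and> A \<subseteq> F j \<longrightarrow>
                (AE x in lebesgue_on \<Omega>. x \<in> near_part \<Omega> A r \<longrightarrow>
                   mat_le (mat (b * infdist x \<Gamma> powr \<delta> j)) (C x))" by blast
    \<comment> \<open>If \<open>s j < CARD('n) - 1\<close> any point of \<open>F j\<close> will do;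
      otherwise \<open>U\<close> supplies one.\<close>
    have "\<exists>z\<in>F j. s j < real CARD('n) - 1 \<or> (\<exists>R0>0. uniform_in \<Omega> (\<Omega> \<inter> ball z R0))"
      using U j assms(7)[OF j] by (meson ex_in_conv not_le)
    then obtain z where z: "z \<in> F j" "s j < real CARD('n) - 1 \<or> (\<exists>R0>0. uniform_in \<Omega> (\<Omega> \<inter> ball z R0))" by blast
    have op: "openin (top_of_set (frontier \<Omega>)) (F j)" using assms(9)[OF j] unfolding \<Gamma> .
    have s0: "0 < s j" using assms(10)[OF j] by simp
    show ?thesis
    proof (rule form_equality_exponent[OF z(1) op assms(11)[OF j] s0 z(2) br _ DN])
      fix A assume "bounded A" "A \<subseteq> F j"
      then show "AE x in lebesgue_on \<Omega>. x \<in> near_part \<Omega> A r \<longrightarrow> mat_le (mat (b * infdist x (frontier \<Omega>) powr \<delta> j)) (C x)"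
        using lo unfolding \<Gamma> by blast
    qed
  qed
  show ?thesis using part1 part2 by blast
qed

end
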